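(* Assume conditions $(R)$, $(\Omega_1)$ and $(\Omega_2(\kappa))$ below. Fix an integer $k_0\ge2$ and $\lambda>0$, let $z_0>0$ be defined by $z_0^2=X/\log^{4\kappa+1}X$, and suppose $X$ satisfies \[z_0>\max\{2,e^{A_1A_2}\},\quad r(z_0)<1,\quad \widehat{m_0}(z_0)<\log z_0,\quad \left|\frac{(\kappa+1)r(z_0)}{1-r(z_0)}\right|<1.\] Then the infinite product $\prod_p\left(1-\frac{\omega(p)}{p}\right)\left(1-\frac1p\right)^{-\kappa}$ converges and \[S(\mathfrak{A},\mathfrak{P},\sqrt{X})\le \frac{2^\kappa\Gamma(\kappa+1)X}{\log^\kappa X}\left(1+\frac{m_8(z_0,\lambda)}{\log X}\right)\left(1+\frac{m_9\log\log X}{\log X}\right)^{\kappa}\prod_p\left(1-\frac{\omega(p)}{p}\right)\left(1-\frac1p\right)^{-\kappa},\] where \[m_8(z_0,\lambda)=\frac{2m_5(z_0,\lambda)}{1-(4\kappa+1)\frac{\log\log X}{\log X}}+\frac{2^{-4\kappa}m_2^4}{\Gamma(\kappa+1)e^{\kappa\gamma}}\left(1+\frac{\widehat{m_0}(z_0)}{\log z_0}\right),\qquad m_9=\frac{4\kappa+1}{1-\frac{(4\kappa+1)\log\log X}{\log X}}.\]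
   Context: $p$ always denotes a prime and $\gamma$ the Euler–Mascheroni constant. Sieve setting: $\mathfrak{A}$ is a finite sequence of nonnegative integers, $\mathfrak{P}$ a set of primes, $P(z)=\prod_{p\in\mathfrak P,\,p\le z}p$, and $S(\mathfrak A,\mathfrak P,z)=\#\{a\in\mathfrak A:(a,P(z))=1\}$ (counted with multiplicity). For squarefree $d$, $\mathfrak A_d$ is the subsequence of elements divisible by $d$; $\omega$ is a multiplicative function on squarefree integers, $X>0$, and $\mathcal R_d$ is defined by $\#\mathfrak A_d=\frac{\omega(d)}{d}X+\mathcal R_d$. Constants $\kappa\ge1$, $A_1>1$, $A_2>0$, $L$ are given. Conditions (for squarefree $d$ with all prime factors in $\mathfrak P$, and primes $p$): $(R)$: $|\mathcal R_d|\le\omega(d)$; $(\Omega_1)$: $0\le\omega(p)/p\le 1-1/A_1$; $(\Omega_2(\kappa))$: for all $2\le w<z$, $-L\le\sum_{w\le p<z}\frac{\omega(p)\log p}{p}-\kappa\log\frac zw\le A_2$. Auxiliary quantities: $m_0(w)=\max\left\{\frac{A_2}{\log w}+\frac{A_1A_2}{\log w}\left(\kappa+\frac{A_2}{\log w}\right),\frac{L}{\log w}\right\}+\frac{3\kappa}{2\log^2 w}+\kappa\log\frac{w}{w-1}+\frac{A_1^2A_2}{\log w}\left(\kappa+\frac{A_2}{\log w}\right)\left(\sum_{k=2}^{k_0}\frac{A_1^{k-2}A_2^{k-2}}{k(\log w)^{k-2}}+\frac{A_1^{k_0-1}A_2^{k_0-1}}{(\log w)^{k_0-1}}\left((k_0+1)\left(1-\frac{A_1A_2}{\log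 w}\right)\right)^{-1}\right)$; $\widehat{m_0}(z)=\log z\left(\left(1+\frac{1}{\log^2 z}\right)^{\kappa}(1+m_0(z)e^{m_0(z)})-1\right)$; $m_1(x,d)=A_2\left(\kappa\log 2+\frac{A_2}{\log\sqrt{x/d}}+\frac{A_1A_2}{\log\sqrt{x/d}}\left(\kappa+\frac{A_2}{\log\sqrt{x/d}}\right)\right)$; $m_2=\frac{1}{\log^\kappa 2}\exp\left(\frac{A_2}{\log 2}\left(1+A_1\kappa+\frac{A_1A_2}{\log 2}\right)\right)$; $m_4=2\kappa e+\frac{A_2e}{\log 2}+\log 2$; $m_3(z,\lambda)=1+2m_4^{\kappa}\exp\left(\frac{A_2}{\log 2}\left(1+A_1\kappa+\frac{A_1A_2}{\log 2}\right)+\frac{L}{\log 2}-\lambda+\left(\frac{2\kappa}{\lambda}+\frac{A_2}{\log z}\right)e^{\lambda}\right)$; $r(z)=\frac{A_2+m_1(1,1/2)}{\log z}$; $m_7(z)=\frac{\exp\left(\frac{(\kappa+1)r(z)}{1-r(z)}\right)-1}{\log z}$; $m_6(z)=\frac{r(z)\log z}{1-r(z)}+m_7(z)+\frac{m_7(z)r(z)}{1-r(z)}$; $m_5(z,\lambda)=\min\left\{\log z\left(\frac{m_3(z,\lambda)}{e^{\kappa\gamma}\Gamma(\kappa+1)}\left(1+\frac{\widehat{m_0}(z)}{\log z}\right)-1\right),\ m_6(z)\left(1+\frac{m_6(z)}{\log z}\right)^{-1}\right\}$.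
   Formalization: The formal theorem additionally assumes ω(p)=0 for primes p outside 𝔓 (the usual convention; false without it, e.g. 𝔓 empty) and X≥e (for 1<X<e one has z_0>√X and the bound can fail; for X≤1 the formulas are undefined). *)

theory Defs
  imports "HOL-Analysis.Analysis" "HOL-Computational_Algebra.Squarefree"
begin

section \<open>The sieve setting\<close>

text \<open>
  The finite sequence to be sifted is a list of natural numbers, so that multiplicities count.
  The set \<open>P\<close> is meant to consist of primes.
\<close>

definition sieve_prod :: "nat set \<Rightarrow> real \<Rightarrow> nat" where
  "sieve_prod P z = (\<Prod>p | p \<in> P \<and> real p \<le> z. p)"

definition sifted :: "nat list \<Rightarrow> nat set \<Rightarrow> real \<Rightarrow> nat" where
  "sifted A P z = length (filter (\<lambda>a. coprime a (sieve_prod P z)) A)"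

definition divisible_subseq :: "nat list \<Rightarrow> nat \<Rightarrow> nat list" where
  "divisible_subseq A d = filter (\<lambda>a. d dvd a) A"

definition sieve_remainder :: "nat list \<Rightarrow> (nat \<Rightarrow> real) \<Rightarrow> real \<Rightarrow> nat \<Rightarrow> real" where
  "sieve_remainder A \<omega> X d = real (length (divisible_subseq A d)) - \<omega> d / real d * X"

definition multiplicative_on_squarefree :: "(nat \<Rightarrow> real) \<Rightarrow> bool" where
  "multiplicative_on_squarefree \<omega> \<longleftrightarrow> \<omega> 1 = 1 \<and>
     (\<forall>m n. squarefree m \<and> squarefree n \<and> coprime m n \<longrightarrow> \<omega> (m * n) = \<omega> m * \<omega> n)"

definition cond_R :: "nat list \<Rightarrow> nat set \<Rightarrow> (nat \<Rightarrow> real) \<Rightarrow> real \<Rightarrow> bool" where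
  "cond_R A P \<omega> X \<longleftrightarrow>
     (\<forall>d. squarefree d \<and> prime_factors d \<subseteq> P \<longrightarrow> \<bar>sieve_remainder A \<omega> X d\<bar> \<le> \<omega> d)"

definition cond_Omega1 :: "(nat \<Rightarrow> real) \<Rightarrow> real \<Rightarrow> bool" where
  "cond_Omega1 \<omega> A1 \<longleftrightarrow>
     (\<forall>p. prime p \<longrightarrow> 0 \<le> \<omega> p / real p \<and> \<omega> p / real p \<le> 1 - 1 / A1)"

definition cond_Omega2 :: "(nat \<Rightarrow> real) \<Rightarrow> real \<Rightarrow> real \<Rightarrow> real \<Rightarrow> bool" where
  "cond_Omega2 \<omega> \<kappa> A2 L \<longleftrightarrow>
     (\<forall>w z::real. 2 \<le> w \<and> w < z \<longrightarrow>
        (let D = (\<Sum>p | prime p \<and> w \<le> real p \<and> real p < z. \<omega> p * ln (real p) / real p)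
                 - \<kappa> * ln (z / w)
         in - L \<le> D \<and> D \<le> A2))"

text \<open>
  The product over all primes need only converge conditionally, so it is taken in increasing order
  of the primes: an infinite product over the natural numbers whose factors at non-primes are 1.
\<close>

definition singular_factor :: "(nat \<Rightarrow> real) \<Rightarrow> real \<Rightarrow> nat \<Rightarrow> real" where
  "singular_factor \<omega> \<kappa> n =
     (if prime n then (1 - \<omega> n / real n) * (1 - 1 / real n) powr (- \<kappa>) else 1)"

section \<open>The auxiliary quantities\<close>

definition m0 :: "real \<Rightarrow> real \<Rightarrow> real \<Rightarrow> real \<Rightarrow> nat \<Rightarrow> real \<Rightarrow> real" where
  "m0 \<kappa> A1 A2 L k0 w =
     max (A2 / ln w + A1 * A2 / ln w * (\<kappa> + A2 / ln w)) (L / ln w)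
     + 3 * \<kappa> / (2 * (ln w)\<^sup>2)
     + \<kappa> * ln (w / (w - 1))
     + A1\<^sup>2 * A2 / ln w * (\<kappa> + A2 / ln w) *
       ((\<Sum>k = 2..k0. A1 ^ (k - 2) * A2 ^ (k - 2) / (real k * (ln w) ^ (k - 2)))
        + A1 ^ (k0 - 1) * A2 ^ (k0 - 1) / (ln w) ^ (k0 - 1)
          * inverse ((real k0 + 1) * (1 - A1 * A2 / ln w)))"

definition m0_hat :: "real \<Rightarrow> real \<Rightarrow> real \<Rightarrow> real \<Rightarrow> nat \<Rightarrow> real \<Rightarrow> real" where
  "m0_hat \<kappa> A1 A2 L k0 z =
     ln z * ((1 + 1 / (ln z)\<^sup>2) powr \<kappa>
             * (1 + m0 \<kappa> A1 A2 L k0 z * exp (m0 \<kappa> A1 A2 L k0 z)) - 1)"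

definition m1 :: "real \<Rightarrow> real \<Rightarrow> real \<Rightarrow> real \<Rightarrow> real \<Rightarrow> real" where
  "m1 \<kappa> A1 A2 x d =
     A2 * (\<kappa> * ln 2 + A2 / ln (sqrt (x / d))
           + A1 * A2 / ln (sqrt (x / d)) * (\<kappa> + A2 / ln (sqrt (x / d))))"

definition m2 :: "real \<Rightarrow> real \<Rightarrow> real \<Rightarrow> real" where
  "m2 \<kappa> A1 A2 = 1 / (ln 2) powr \<kappa> * exp (A2 / ln 2 * (1 + A1 * \<kappa> + A1 * A2 / ln 2))"

definition m4 :: "real \<Rightarrow> real \<Rightarrow> real" where
  "m4 \<kappa> A2 = 2 * \<kappa> * exp 1 + A2 * exp 1 / ln 2 + ln 2"

definition m3 :: "real \<Rightarrow> real \<Rightarrow> real \<Rightarrow> real \<Rightarrow> real \<Rightarrow> real \<Rightarrow> real" where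
  "m3 \<kappa> A1 A2 L z lam =
     1 + 2 * (m4 \<kappa> A2) powr \<kappa>
         * exp (A2 / ln 2 * (1 + A1 * \<kappa> + A1 * A2 / ln 2) + L / ln 2 - lam
                + (2 * \<kappa> / lam + A2 / ln z) * exp lam)"

definition r_aux :: "real \<Rightarrow> real \<Rightarrow> real \<Rightarrow> real \<Rightarrow> real" where
  "r_aux \<kappa> A1 A2 z = (A2 + m1 \<kappa> A1 A2 1 (1 / 2)) / ln z"

definition m7 :: "real \<Rightarrow> real \<Rightarrow> real \<Rightarrow> real \<Rightarrow> real" where
  "m7 \<kappa> A1 A2 z = (exp ((\<kappa> + 1) * r_aux \<kappa> A1 A2 z / (1 - r_aux \<kappa> A1 A2 z)) - 1) / ln z"

definition m6 :: "real \<Rightarrow> real \<Rightarrow> real \<Rightarrow> real \<Rightarrow> real" where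
  "m6 \<kappa> A1 A2 z =
     r_aux \<kappa> A1 A2 z * ln z / (1 - r_aux \<kappa> A1 A2 z) + m7 \<kappa> A1 A2 z
     + m7 \<kappa> A1 A2 z * r_aux \<kappa> A1 A2 z / (1 - r_aux \<kappa> A1 A2 z)"

definition m5 :: "real \<Rightarrow> real \<Rightarrow> real \<Rightarrow> real \<Rightarrow> nat \<Rightarrow> real \<Rightarrow> real \<Rightarrow> real" where
  "m5 \<kappa> A1 A2 L k0 z lam =
     min (ln z * (m3 \<kappa> A1 A2 L z lam / (exp (\<kappa> * euler_mascheroni) * Gamma (\<kappa> + 1))
                  * (1 + m0_hat \<kappa> A1 A2 L k0 z / ln z) - 1))
         (m6 \<kappa> A1 A2 z * inverse (1 + m6 \<kappa> A1 A2 z / ln z))"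

definition m8 :: "real \<Rightarrow> real \<Rightarrow> real \<Rightarrow> real \<Rightarrow> nat \<Rightarrow> real \<Rightarrow> real \<Rightarrow> real \<Rightarrow> real" where
  "m8 \<kappa> A1 A2 L k0 X z lam =
     2 * m5 \<kappa> A1 A2 L k0 z lam / (1 - (4 * \<kappa> + 1) * (ln (ln X) / ln X))
     + 2 powr (- 4 * \<kappa>) * (m2 \<kappa> A1 A2) ^ 4 / (Gamma (\<kappa> + 1) * exp (\<kappa> * euler_mascheroni))
       * (1 + m0_hat \<kappa> A1 A2 L k0 z / ln z)"

definition m9 :: "real \<Rightarrow> real \<Rightarrow> real" where
  "m9 \<kappa> X = (4 * \<kappa> + 1) / (1 - (4 * \<kappa> + 1) * ln (ln X) / ln X)"

end

theory Submission
  imports Defs "HOL-Real_Asymp.Real_Asymp"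
begin

text \<open>
  Selberg's sieve bounds the sifted count by \<open>X / G + R\<close>, where \<open>G\<close> sums \<open>\<Prod> g p\<close> over the squarefree
  \<open>d < z0\<close>, and condition \<open>(R)\<close> gives \<open>R \<le> z0\<^sup>2 \<Prod> (1 + 3 \<omega> p / p)\<close>. The first entry of the minimum
  in \<open>m\<^sub>5\<close> comes from Rankin's trick. For the second one, let \<open>T u = \<integral>\<^sub>0\<^sup>u G\<close> (in the logarithmic scale);
  splitting one prime off \<open>d\<close> shows that \<open>T u / (u - \<delta>) powr (\<kappa> + 1)\<close> is nonincreasing whenever
  \<open>V y + b y \<le> \<kappa> y + \<delta>\<close>, where \<open>V\<close> is the Chebyshev sum of \<open>(\<Omega>\<^sub>2)\<close> and \<open>b\<close> a correction, so \<open>T\<close> is bounded below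
  by its limit behaviour, which the Laplace transform (an Euler product) determines. Since a lower
  bound for \<open>V\<close> is needed to return from \<open>T\<close> to \<open>G\<close>, the primes are augmented by many small fictitious ones.

  This yields \<open>X / G \<le> main (1 + K / u + Z \<delta> / u)\<close> with \<open>u = log z0\<close>, \<open>K = r(z0) u\<close> and any admissible
  \<open>\<delta>\<close>, whereas \<open>m\<^sub>5\<close> only leaves room for \<open>K / u\<close>. Either \<open>A2\<close> and \<open>A1 A2\<close> are so small that \<open>\<delta> = 0\<close> is
  admissible, or the bound for \<open>R\<close> is smaller than the \<open>m\<^sub>2\<^sup>4\<close>-term of \<open>m\<^sub>8\<close> by enough to absorb \<open>Z \<delta> / u\<close>.
\<close>

section \<open>Partial summation and the density of the sifting primes\<close>

text \<open>\<open>K\<close> contains no \<open>L\<close>, although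
  \<open>(\<Omega>\<^sub>2)\<close> bounds \<open>V\<close> from below only through
  \<open>L\<close>. Fictitious primes resolve this: they are inserted exactly where \<open>V\<close>
  has fallen behind \<open>\<kappa> y - B\<close>, and as \<open>V\<close> gains at most
  \<open>A2\<close> over its expected increment, the upper bound for \<open>V\<close> survives.
  \<open>L\<close> then only guarantees that finitely many of them suffice.

  The shift \<open>\<delta>\<close> and the lag \<open>B\<close> obey
  \<open>B + \<delta> = K\<close>, so \<open>\<delta> = 0\<close> yields exactly the admissible loss
  \<open>1 + K / u\<close>; a positive \<open>\<delta>\<close> costs extra. The hypothesis on
  \<open>(\<kappa> + 1) r / (1 - r)\<close> amounts to \<open>(\<kappa> + 2) K < u\<close>, the
  range in which the convex loss is bounded by a chord.

  The comparison of that extra loss with the \<open>m2\<close> term involves \<open>A1\<close> and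
  \<open>A2\<close> separately. For fixed \<open>m2\<close>, \<open>K\<close> is largest on the
  formal diagonal \<open>A2 = A1 A2 = s\<close>, which leaves an inequality in
  \<open>\<kappa>\<close> and \<open>s\<close> alone: a cubic in \<open>s\<close> against an
  exponential.

  Euler's constant enters only through one inequality, because \<open>W\<close> has to be bounded by
  the singular product from above only.\<close>

lemma abel_upper:
  fixes \<alpha> :: "nat \<Rightarrow> real" and \<phi> \<Phi> :: "real \<Rightarrow> real" and w A \<kappa> :: real
  assumes S: "\<And>m. w \<le> real m \<Longrightarrow> (\<Sum>n | w \<le> real n \<and> n \<le> m. \<alpha> n) \<le> \<kappa> * (ln m - ln w) + A"
    and anti: "\<And>s t. w \<le> s \<Longrightarrow> s \<le> t \<Longrightarrow> \<phi> t \<le> \<phi> s"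
    and prim: "\<And>s t. w \<le> s \<Longrightarrow> s \<le> t \<Longrightarrow> (ln t - ln s) * \<phi> t \<le> \<Phi> t - \<Phi> s"
    and "0 \<le> A" "0 \<le> \<kappa>" "0 < w" and m: "w \<le> real m" and pos: "0 \<le> \<phi> (real m)"
  shows "(\<Sum>n | w \<le> real n \<and> n \<le> m. \<alpha> n * \<phi> (real n)) \<le> A * \<phi> w + \<kappa> * (\<Phi> (real m) - \<Phi> w)"
proof -
  define S where "S m = (\<Sum>n | w \<le> real n \<and> n \<le> m. \<alpha> n)" for m
  define F where "F m = (\<Sum>n | w \<le> real n \<and> n \<le> m. \<alpha> n * \<phi> (real n))" for m
  define m0 where "m0 = nat \<lceil>w\<rceil>"
  have m0: "w \<le> real n \<longleftrightarrow> m0 \<le> n" for n unfolding m0_def by linarith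
  have set_eq: "{n. w \<le> real n \<and> n \<le> k} = {m0..k}" for k
    unfolding m0 atLeastAtMost_def atLeast_def atMost_def by blast
  have "m0 \<le> m" using m m0 by simp
  \<comment> \<open>The slack \<open>A + \<kappa> (ln m - ln w) - S m\<close>, nonnegative by
    \<open>S\<close>, is carried along multiplied by \<open>\<phi> m\<close>. Since
    \<open>\<phi>\<close> decreases, each step can only lose on the left, so Abel's identity becomes
    an inequality that needs no derivative.\<close>
  then have "F m + (A + \<kappa> * (ln m - ln w) - S m) * \<phi> (real m) \<le> A * \<phi> w + \<kappa> * (\<Phi> (real m) - \<Phi> w)"
  proof (induction m rule: dec_induct)
    case base
    have w: "w \<le> real m0" using m0 by simp
    have "A * \<phi> (real m0) \<le> A * \<phi> w" using assms w by (intro mult_left_mono anti) auto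
    moreover have "\<kappa> * ((ln m0 - ln w) * \<phi> (real m0)) \<le> \<kappa> * (\<Phi> (real m0) - \<Phi> w)"
      using assms w by (intro mult_left_mono prim) auto
    ultimately show ?case unfolding F_def S_def set_eq by (simp add: algebra_simps)
  next
    case (step k)
    have w: "w \<le> real k" using m0 step by simp
    have "F (Suc k) = F k + \<alpha> (Suc k) * \<phi> (real (Suc k))" "S (Suc k) = S k + \<alpha> (Suc k)"
      unfolding F_def S_def set_eq using step by (simp_all add: atLeastAtMostSuc_conv)
    moreover have "(A + \<kappa> * (ln k - ln w) - S k) * \<phi> (real (Suc k)) \<le> (A + \<kappa> * (ln k - ln w) - S k) * \<phi> (real k)"
      using S[OF w] w unfolding S_def by (intro mult_left_mono anti) auto
    moreover have "\<kappa> * ((ln (real (Suc k)) - ln k) * \<phi> (real (Suc k))) \<le> \<kappa> * (\<Phi> (real (Suc k)) - \<Phi> (real k))"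
      using assms w by (intro mult_left_mono prim) auto
    ultimately show ?case using step.IH by (simp only:) (simp add: algebra_simps)
  qed
  moreover have "0 \<le> (A + \<kappa> * (ln m - ln w) - S m) * \<phi> (real m)"
    using S[OF m] pos unfolding S_def by (intro mult_nonneg_nonneg) auto
  ultimately show ?thesis unfolding F_def by linarith
qed

text \<open>Mirror image of \<open>abel_upper\<close>. The upper end is m + 1 because
  \<open>(\<Omega>\<^sub>2)\<close> counts primes strictly below z: z = m + 1 captures all n up to
  m. The induction starts at the empty sum m = 1, where both sides agree.\<close>

lemma abel_lower:
  fixes \<alpha> :: "nat \<Rightarrow> real" and \<phi> \<Phi> :: "real \<Rightarrow> real" and B \<kappa> :: real
  assumes S: "\<And>m. 2 \<le> m \<Longrightarrow> \<kappa> * (ln (real (m + 1)) - ln 2) - B \<le> (\<Sum>n = 2..m. \<alpha> n)"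
    and anti: "\<And>s t. 2 \<le> s \<Longrightarrow> s \<le> t \<Longrightarrow> \<phi> t \<le> \<phi> s"
    and prim: "\<And>s t. 2 \<le> s \<Longrightarrow> s \<le> t \<Longrightarrow> \<Phi> t - \<Phi> s \<le> (ln t - ln s) * \<phi> s"
    and "0 \<le> \<kappa>" and m: "2 \<le> m" and pos: "0 \<le> \<phi> (real (m + 1))"
  shows "\<kappa> * (\<Phi> (real (m + 1)) - \<Phi> 2) - B * \<phi> 2 \<le> (\<Sum>n = 2..m. \<alpha> n * \<phi> (real n))"
proof -
  define S where "S m = (\<Sum>n = 2..m. \<alpha> n)" for m :: nat
  define F where "F m = (\<Sum>n = 2..m. \<alpha> n * \<phi> (real n))" for m :: nat
  define s where "s m = S m - \<kappa> * (ln (real (m + 1)) - ln 2) + B" for m :: nat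
  have "\<kappa> * (\<Phi> (real (m + 1)) - \<Phi> 2) - B * \<phi> 2 \<le> F m - s m * \<phi> (real (m + 1))"
    if "1 \<le> m" for m using that
  proof (induction m rule: dec_induct)
    case base
    show ?case unfolding F_def S_def s_def by simp
  next
    case (step k)
    have "F (Suc k) = F k + \<alpha> (Suc k) * \<phi> (real (Suc k))"
      and Ss: "S (Suc k) = S k + \<alpha> (Suc k)"
      unfolding F_def S_def using step by (simp_all add: atLeastAtMostSuc_conv)
    moreover have "s (Suc k) * \<phi> (real (Suc k + 1)) \<le> s (Suc k) * \<phi> (real (k + 1))"
      using S[of "Suc k"] step unfolding s_def S_def by (intro mult_left_mono anti) auto
    moreover have "s (Suc k) = s k + \<alpha> (Suc k) - \<kappa> * (ln (real (Suc k + 1)) - ln (real (k + 1)))"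
      unfolding s_def Ss by (simp add: algebra_simps)
    moreover have "\<kappa> * (\<Phi> (real (Suc k + 1)) - \<Phi> (real (k + 1))) \<le> \<kappa> * ((ln (real (Suc k + 1)) - ln (real (k + 1))) * \<phi> (real (k + 1)))"
      using assms step by (intro mult_left_mono prim) auto
    ultimately show ?case using step.IH by (simp only:) (simp add: algebra_simps)
  qed
  from this[of m] have "\<kappa> * (\<Phi> (real (m + 1)) - \<Phi> 2) - B * \<phi> 2 \<le> F m - s m * \<phi> (real (m + 1))"
    using m by simp
  moreover have "0 \<le> s m * \<phi> (real (m + 1))"
    using S[OF m] pos unfolding s_def S_def by (intro mult_nonneg_nonneg) auto
  ultimately show ?thesis unfolding F_def by linarith
qed

section \<open>Sums and products over the primes in a half-open interval\<close>

definition primes_in :: "real \<Rightarrow> real \<Rightarrow> nat set" where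
  "primes_in w z = {p. prime p \<and> w \<le> real p \<and> real p < z}"

lemma finite_primes_in [simp]: "finite (primes_in w z)"
proof (rule finite_subset)
  show "primes_in w z \<subseteq> {..nat \<lceil>z\<rceil>}" unfolding primes_in_def by (auto, linarith)
qed simp

lemma primes_in_split: "w \<le> z \<Longrightarrow> v \<le> w \<Longrightarrow> primes_in v z = primes_in v w \<union> primes_in w z \<and> primes_in v w \<inter> primes_in w z = {}"
  unfolding primes_in_def by auto

lemma primes_in_ge2: "p \<in> primes_in w z \<Longrightarrow> 2 \<le> p"
  unfolding primes_in_def using prime_ge_2_nat by auto

text \<open>This bound and the next are ln x \<le> x - 1 for a ratio of logarithms. They are the
  discrete form of d(ln ln t) = d(ln t) / ln t and supply \<open>prim\<close> in the partial
  summations.\<close>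

lemma ln_ln_diff_ge:
  fixes s t :: real assumes "1 < s" "s \<le> t"
  shows "(ln t - ln s) * (1 / ln t) \<le> ln (ln t) - ln (ln s)"
proof -
  have "0 < ln s" "0 < ln t" using assms by auto
  then have "- ln (ln s / ln t) \<ge> - (ln s / ln t - 1)" by (intro le_imp_neg_le ln_le_minus_one) auto
  then show ?thesis using \<open>0 < ln s\<close> \<open>0 < ln t\<close> by (simp add: ln_div field_simps)
qed

lemma ln_ln_diff_le:
  fixes s t :: real assumes "1 < s" "s \<le> t"
  shows "ln (ln t) - ln (ln s) \<le> (ln t - ln s) * (1 / ln s)"
proof -
  have "0 < ln s" "0 < ln t" using assms by auto
  then have "ln (ln t / ln s) \<le> ln t / ln s - 1" by (intro ln_le_minus_one) auto
  then show ?thesis using \<open>0 < ln s\<close> \<open>0 < ln t\<close> by (simp add: ln_div field_simps)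
qed

text \<open>Only the hypotheses on the density are collected here, without the sequence and
  \<open>X\<close>. The same results thus apply to \<open>\<omega> = 1\<close>,
  \<open>\<kappa> = 1\<close>, where \<open>W\<close> is Mertens' product.\<close>

locale sieve_density =
  fixes \<omega> :: "nat \<Rightarrow> real" and \<kappa> A1 A2 L :: real
  assumes kappa: "1 \<le> \<kappa>" and A1: "1 < A1" and A2: "0 < A2"
    and Omega1: "cond_Omega1 \<omega> A1" and Omega2: "cond_Omega2 \<omega> \<kappa> A2 L"
begin

definition h :: "nat \<Rightarrow> real" where "h p = \<omega> p / real p"
definition g :: "nat \<Rightarrow> real" where "g p = h p / (1 - h p)"
definition W :: "real \<Rightarrow> real" where "W z = (\<Prod>p\<in>primes_in 2 z. 1 - h p)"
text \<open>The error term of \<open>sum_g_le\<close>. It equals the first entry of the maximum in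
  \<open>m0\<close>, and \<open>U 2\<close> is the exponent in \<open>m2\<close>.\<close>

definition U :: "real \<Rightarrow> real" where
  "U w = A2 / ln w + A1 * A2 / ln w * (\<kappa> + A2 / ln w)"

lemma h_nonneg: "prime p \<Longrightarrow> 0 \<le> h p"
  and h_le: "prime p \<Longrightarrow> h p \<le> 1 - 1 / A1"
  using Omega1 unfolding cond_Omega1_def h_def by auto

lemma h_less_1: "prime p \<Longrightarrow> h p < 1"
  using h_le[of p] A1 by (smt (verit) zero_less_divide_1_iff)

lemma g_nonneg: "prime p \<Longrightarrow> 0 \<le> g p"
  unfolding g_def using h_nonneg h_less_1 by (simp add: less_imp_le)

lemma one_plus_g: "prime p \<Longrightarrow> 1 + g p = 1 / (1 - h p)"
  unfolding g_def using h_less_1[of p] by (simp add: field_simps)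

lemma g_le: assumes "prime p" shows "g p \<le> A1 * h p"
proof -
  have "1 / A1 \<le> 1 - h p" "0 < 1 / A1" using h_le[OF assms] A1 by auto
  then have "1 / (1 - h p) \<le> 1 / (1 / A1)" by (intro divide_left_mono mult_pos_pos) linarith+
  then have "1 / (1 - h p) \<le> A1" using A1 by simp
  then have "h p * (1 / (1 - h p)) \<le> h p * A1" using h_nonneg[OF assms] by (intro mult_left_mono) auto
  then show ?thesis unfolding g_def by (simp add: mult.commute)
qed

lemma g_eq: "prime p \<Longrightarrow> g p = h p + g p * h p"
  unfolding g_def using h_less_1[of p] by (simp add: field_simps)

lemma Omega2_upper:
  assumes "2 \<le> w" "w < z"
  shows "(\<Sum>p\<in>primes_in w z. h p * ln p) \<le> \<kappa> * (ln z - ln w) + A2"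
  using Omega2 assms unfolding cond_Omega2_def Let_def primes_in_def h_def
  by (force simp: ln_div algebra_simps)

lemma Omega2_lower:
  assumes "2 \<le> w" "w < z"
  shows "\<kappa> * (ln z - ln w) - L \<le> (\<Sum>p\<in>primes_in w z. h p * ln p)"
  using Omega2 assms unfolding cond_Omega2_def Let_def primes_in_def h_def
  by (force simp: ln_div algebra_simps)

lemma sum_primes_in_eq:
  fixes f :: "nat \<Rightarrow> real"
  assumes "real m < z" "z \<le> real m + 1"
  shows "(\<Sum>n | w \<le> real n \<and> n \<le> m. if prime n then f n else 0) = (\<Sum>p\<in>primes_in w z. f p)"
proof -
  have eq: "primes_in w z = {n \<in> {n. w \<le> real n \<and> n \<le> m}. prime n}"
    unfolding primes_in_def using assms by force
  have "finite {n. w \<le> real n \<and> n \<le> m}" by (rule finite_subset[of _ "{..m}"]) auto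
  then show ?thesis unfolding eq by (subst sum.inter_filter) auto
qed

text \<open>The closed range up to m is reached by taking z = m + d in
  \<open>(\<Omega>\<^sub>2)\<close> with d so small that the main term grows by at most e.\<close>

lemma Omega2_upper_closed:
  assumes "2 \<le> w" "w \<le> real m"
  shows "(\<Sum>n | w \<le> real n \<and> n \<le> m. if prime n then h n * ln n else 0) \<le> \<kappa> * (ln m - ln w) + A2"
proof (rule field_le_epsilon)
  fix e :: real assume e: "0 < e"
  define d where "d = min 1 (e / \<kappa>)"
  have d: "0 < d" "d \<le> 1" "\<kappa> * d \<le> e" unfolding d_def using e kappa by (auto simp: min_def field_simps)
  have "(\<Sum>n | w \<le> real n \<and> n \<le> m. if prime n then h n * ln n else 0) \<le> \<kappa> * (ln (m + d) - ln w) + A2"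
    using assms d by (subst sum_primes_in_eq[where z = "m + d"]) (auto intro: Omega2_upper)
  also have "ln (m + d) - ln m \<le> d"
  proof -
    have "ln (m + d) - ln m = ln ((m + d) / m)" using assms d by (simp add: ln_divide_pos)
    also have "(m + d) / m = 1 + d / m" using assms by (simp add: add_divide_distrib)
    also have "ln (1 + d / m) \<le> d / m" using assms d by (intro ln_add_one_self_le_self) auto
    also have "\<dots> \<le> d / 1" using assms d by (intro divide_left_mono) auto
    finally show ?thesis by simp
  qed
  then have "\<kappa> * (ln (m + d) - ln w) \<le> \<kappa> * (ln m - ln w + d)" using kappa by (intro mult_left_mono) auto
  then have "\<kappa> * (ln (m + d) - ln w) + A2 \<le> \<kappa> * (ln m - ln w) + A2 + e" using d by (simp add: algebra_simps)
  finally show "(\<Sum>n | w \<le> real n \<and> n \<le> m. if prime n then h n * ln n else 0) \<le> \<kappa> * (ln m - ln w) + A2 + e" by simp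
qed

text \<open>In the closed range both ends may equal p, so that the main term vanishes and only
  \<open>A2\<close> remains.\<close>

lemma h_ln_le: assumes "prime p" shows "h p * ln p \<le> A2"
proof -
  have "{n. real p \<le> real n \<and> n \<le> p} = {p}" by auto
  then show ?thesis using Omega2_upper_closed[of "real p" p] assms prime_ge_2_nat[OF assms] by simp
qed

lemma sum_weighted_le:
  fixes \<phi> \<Phi> :: "real \<Rightarrow> real"
  assumes "\<And>s t. w \<le> s \<Longrightarrow> s \<le> t \<Longrightarrow> \<phi> t \<le> \<phi> s"
    and prim: "\<And>s t. w \<le> s \<Longrightarrow> s \<le> t \<Longrightarrow> (ln t - ln s) * \<phi> t \<le> \<Phi> t - \<Phi> s"
    and pos: "\<And>t. w \<le> t \<Longrightarrow> 0 \<le> \<phi> t" and w: "2 \<le> w" "w \<le> z"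
  shows "(\<Sum>p\<in>primes_in w z. h p * ln p * \<phi> p) \<le> A2 * \<phi> w + \<kappa> * (\<Phi> z - \<Phi> w)"
proof -
  have mono: "\<Phi> s \<le> \<Phi> t" if "w \<le> s" "s \<le> t" for s t
  proof -
    have "0 \<le> (ln t - ln s) * \<phi> t" using pos[of t] that w by (intro mult_nonneg_nonneg) auto
    then show ?thesis using prim[OF that] by simp
  qed
  \<comment> \<open>The largest integer strictly below z; the primes in [w, z) are those in
    [w, m].\<close>
  define m where "m = nat (\<lceil>z\<rceil> - 1)"
  have m: "real m < z" "z \<le> real m + 1" unfolding m_def using w by linarith+
  show ?thesis
  proof (cases "w \<le> real m")
    case True
    have "(\<Sum>p\<in>primes_in w z. h p * ln p * \<phi> p) = (\<Sum>n | w \<le> real n \<and> n \<le> m. if prime n then h n * ln n * \<phi> n else 0)"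
      using m by (intro sum_primes_in_eq[symmetric])
    also have "\<dots> = (\<Sum>n | w \<le> real n \<and> n \<le> m. (if prime n then h n * ln n else 0) * \<phi> n)"
      by (intro sum.cong) auto
    also have "\<dots> \<le> A2 * \<phi> w + \<kappa> * (\<Phi> (real m) - \<Phi> w)"
      using assms True kappa A2 by (intro abel_upper Omega2_upper_closed) auto
    also have "\<dots> \<le> A2 * \<phi> w + \<kappa> * (\<Phi> z - \<Phi> w)"
      using kappa mono[OF True] m by (intro add_left_mono mult_left_mono) auto
    finally show ?thesis .
  next
    case False
    have "p \<notin> primes_in w z" for p
    proof
      assume "p \<in> primes_in w z"
      then have p: "w \<le> real p" "real p < real (m + 1)" using m by (auto simp: primes_in_def)
      have "p < m + 1" using p(2) by (simp only: of_nat_less_iff)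
      then have "real p \<le> real m" by simp
      with p(1) False show False by linarith
    qed
    then have "primes_in w z = {}" by blast
    then show ?thesis using A2 kappa mono[OF _ w(2)] pos[of w] by auto
  qed
qed

lemma sum_h_le:
  assumes "2 \<le> w" "w \<le> z"
  shows "(\<Sum>p\<in>primes_in w z. h p) \<le> A2 / ln w + \<kappa> * (ln (ln z) - ln (ln w))"
proof -
  have "(\<Sum>p\<in>primes_in w z. h p) = (\<Sum>p\<in>primes_in w z. h p * ln p * (1 / ln p))"
    by (intro sum.cong) (use primes_in_ge2 in force)+
  also have "\<dots> \<le> A2 * (1 / ln w) + \<kappa> * (ln (ln z) - ln (ln w))"
    using assms ln_ln_diff_ge by (intro sum_weighted_le) (auto intro!: divide_left_mono)
  finally show ?thesis by simp
qed

lemma sum_h_over_ln_le: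
  assumes "2 \<le> w" "w \<le> z"
  shows "(\<Sum>p\<in>primes_in w z. h p / ln p) \<le> A2 / (ln w)\<^sup>2 + \<kappa> / ln w"
proof -
  have "(\<Sum>p\<in>primes_in w z. h p / ln p) = (\<Sum>p\<in>primes_in w z. h p * ln p * (1 / (ln p)\<^sup>2))"
    by (intro sum.cong) (use primes_in_ge2 in \<open>force simp: power2_eq_square\<close>)+
  also have "\<dots> \<le> A2 * (1 / (ln w)\<^sup>2) + \<kappa> * (- (1 / ln z) - (- (1 / ln w)))"
  proof (rule sum_weighted_le)
    fix s t assume st: "w \<le> s" "s \<le> t"
    have pos: "0 < ln s" "ln s \<le> ln t" using st assms by auto
    show "1 / (ln t)\<^sup>2 \<le> 1 / (ln s)\<^sup>2" using pos by (intro divide_left_mono power_mono) auto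
    have "(ln t - ln s) * (1 / (ln t)\<^sup>2) \<le> (ln t - ln s) * (1 / (ln s * ln t))"
      using pos by (intro mult_left_mono divide_left_mono) (auto simp: power2_eq_square intro!: mult_right_mono)
    also have "\<dots> = - (1 / ln t) - (- (1 / ln s))" using pos by (simp add: field_simps)
    finally show "(ln t - ln s) * (1 / (ln t)\<^sup>2) \<le> - (1 / ln t) - (- (1 / ln s))" .
  qed (use assms in auto)
  also have "\<dots> \<le> A2 / (ln w)\<^sup>2 + \<kappa> / ln w"
    using assms kappa by (simp add: right_diff_distrib)
  finally show ?thesis .
qed

text \<open>Writing g = h + g h separates the main term from a second-order one: g h \<le> A1 h^2,
  and one factor h is at most A2 / ln p. What remains is the sum of h / ln p, bounded independently
  of z.\<close>

lemma sum_g_le: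
  assumes "2 \<le> w" "w \<le> z"
  shows "(\<Sum>p\<in>primes_in w z. g p) \<le> U w + \<kappa> * (ln (ln z) - ln (ln w))"
proof -
  have "(\<Sum>p\<in>primes_in w z. g p) = (\<Sum>p\<in>primes_in w z. h p) + (\<Sum>p\<in>primes_in w z. g p * h p)"
    unfolding sum.distrib[symmetric] by (intro sum.cong refl g_eq) (auto simp: primes_in_def)
  also have "(\<Sum>p\<in>primes_in w z. g p * h p) \<le> (\<Sum>p\<in>primes_in w z. A1 * A2 * (h p / ln p))"
  proof (intro sum_mono)
    fix p assume "p \<in> primes_in w z"
    then have p: "prime p" "0 < ln (real p)" using primes_in_ge2[of p w z] by (auto simp: primes_in_def)
    have "g p * h p \<le> A1 * h p * h p" using g_le h_nonneg p by (intro mult_right_mono) auto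
    also have "\<dots> \<le> A1 * h p * (A2 / ln p)"
      using h_ln_le[OF p(1)] p A1 h_nonneg by (intro mult_left_mono) (auto simp: field_simps)
    finally show "g p * h p \<le> A1 * A2 * (h p / ln p)" by (simp add: mult_ac)
  qed
  also have "\<dots> \<le> A1 * A2 * (A2 / (ln w)\<^sup>2 + \<kappa> / ln w)"
    unfolding sum_distrib_left[symmetric] using A1 A2 by (intro mult_left_mono sum_h_over_ln_le assms) auto
  also have "\<dots> = A1 * A2 / ln w * (\<kappa> + A2 / ln w)"
    using assms by (simp add: field_simps power2_eq_square)
  finally show ?thesis using sum_h_le[OF assms] unfolding U_def by linarith
qed

lemma W_pos: "0 < W z"
  unfolding W_def by (intro prod_pos) (auto simp: primes_in_def h_less_1)

lemma W_2: "W 2 = 1"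
proof -
  have "primes_in 2 2 = {}" unfolding primes_in_def by auto
  then show ?thesis unfolding W_def by simp
qed

lemma W_le:
  assumes "2 \<le> w" "w \<le> z"
  shows "W w \<le> W z * ((ln z / ln w) powr \<kappa> * exp (U w))"
proof -
  have pos: "0 < ln w" "0 < ln z" using assms by auto
  have W: "W z = W w * (\<Prod>p\<in>primes_in w z. 1 - h p)"
    unfolding W_def using primes_in_split[OF assms(2,1)] by (simp add: prod.union_disjoint)
  have ppos: "0 < (\<Prod>p\<in>primes_in w z. 1 - h p)"
    by (intro prod_pos) (auto simp: primes_in_def h_less_1)
  have "1 / (\<Prod>p\<in>primes_in w z. 1 - h p) = (\<Prod>p\<in>primes_in w z. 1 + g p)"
    unfolding prod_dividef[symmetric, of "\<lambda>_. 1", simplified] by (intro prod.cong refl) (auto simp: primes_in_def one_plus_g)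
  also have "\<dots> \<le> (\<Prod>p\<in>primes_in w z. exp (g p))"
    by (intro prod_mono) (auto simp: primes_in_def g_nonneg add_nonneg_nonneg)
  also have "\<dots> = exp (\<Sum>p\<in>primes_in w z. g p)" by (simp add: exp_sum)
  also have "\<dots> \<le> exp (U w + \<kappa> * (ln (ln z) - ln (ln w)))" using sum_g_le[OF assms] by simp
  also have "\<dots> = (ln z / ln w) powr \<kappa> * exp (U w)"
    using pos by (simp add: powr_def exp_add ln_div mult.commute)
  finally have "1 \<le> (\<Prod>p\<in>primes_in w z. 1 - h p) * ((ln z / ln w) powr \<kappa> * exp (U w))"
    using ppos by (simp add: field_simps)
  then have "W w * 1 \<le> W w * ((\<Prod>p\<in>primes_in w z. 1 - h p) * ((ln z / ln w) powr \<kappa> * exp (U w)))"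
    using W_pos by (intro mult_left_mono) (auto simp: less_imp_le)
  then show ?thesis unfolding W by (simp add: mult_ac)
qed

lemma sum_h_ge:
  assumes "2 \<le> m"
  shows "\<kappa> * (ln (ln (real (m + 1))) - ln (ln 2)) - L / ln 2 \<le> (\<Sum>p\<in>primes_in 2 (real (m + 1)). h p)"
proof -
  have eq: "(\<Sum>p\<in>primes_in 2 (real (k + 1)). f p) = (\<Sum>n = 2..k. if prime n then f n else 0)" for f :: "nat \<Rightarrow> real" and k
  proof -
    have "{n. (2::real) \<le> real n \<and> n \<le> k} = {2..k}" by auto
    then show ?thesis using sum_primes_in_eq[where m = k and z = "real (k + 1)" and w = 2 and f = f] by simp
  qed
  have "\<kappa> * (ln (ln (real (m + 1))) - ln (ln 2)) - L * (1 / ln 2) \<le> (\<Sum>n = 2..m. (if prime n then h n * ln n else 0) * (1 / ln (real n)))"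
  proof (rule abel_lower)
    fix m :: nat assume "2 \<le> m"
    then show "\<kappa> * (ln (real (m + 1)) - ln 2) - L \<le> (\<Sum>n = 2..m. if prime n then h n * ln n else 0)"
      unfolding eq[symmetric] by (intro Omega2_lower) auto
  qed (use assms kappa ln_ln_diff_le in \<open>auto intro!: divide_left_mono\<close>)
  also have "\<dots> = (\<Sum>p\<in>primes_in 2 (real (m + 1)). h p)"
    unfolding eq by (intro sum.cong) auto
  finally show ?thesis by simp
qed

lemma U_tendsto_0: "((\<lambda>n. U (real n)) \<longlongrightarrow> 0) sequentially"
  unfolding U_def by real_asymp

text \<open>By \<open>W_le\<close>, E is almost decreasing: E n \<le> E m + U m for m \<le> n with U
  m tending to 0. It is bounded below through \<open>L\<close>, so it converges, namely to the
  infimum of E + U.\<close>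

lemma W_limit: "\<exists>c>0. (\<lambda>n. W (real n) * ln (real n) powr \<kappa>) \<longlonglongrightarrow> c"
proof -
  define E where "E n = - ln (W (real n)) - \<kappa> * ln (ln (real n))" for n
  have step: "E n \<le> E m + U m" if "2 \<le> m" "m \<le> n" for m n :: nat
  proof -
    have "ln (W m) \<le> ln (W n * ((ln n / ln m) powr \<kappa> * exp (U m)))"
      using that W_le[of m n] W_pos by (intro ln_mono) auto
    also have "\<dots> = ln (W n) + \<kappa> * (ln (ln n) - ln (ln m)) + U m"
      using that W_pos[of n] by (simp add: ln_mult ln_powr ln_div)
    finally show ?thesis unfolding E_def by (simp add: algebra_simps)
  qed
  define c0 where "c0 = - \<kappa> * ln (ln 2) - L / ln 2"
  have lower: "c0 \<le> E n" if "3 \<le> n" for n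
  proof -
    define m where "m = n - 1"
    have n: "n = m + 1" "2 \<le> m" using that unfolding m_def by auto
    have "(\<Sum>p\<in>primes_in 2 (real n). h p) \<le> (\<Sum>p\<in>primes_in 2 (real n). - ln (1 - h p))"
    proof (intro sum_mono)
      fix p assume "p \<in> primes_in 2 (real n)"
      then have "h p < 1" using h_less_1 by (auto simp: primes_in_def)
      then have "ln (1 - h p) \<le> (1 - h p) - 1" by (intro ln_le_minus_one) auto
      then show "h p \<le> - ln (1 - h p)" by simp
    qed
    also have "\<dots> = - ln (W n)" unfolding W_def sum_negf
      by (subst ln_prod) (auto simp: primes_in_def dest: h_less_1)
    finally show ?thesis unfolding E_def c0_def using sum_h_ge[OF n(2)] n by (simp add: algebra_simps)
  qed
  define c where "c = (INF n\<in>{3..}. E n + U n)"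
  have Upos: "0 \<le> U n" if "2 \<le> n" for n :: nat
    unfolding U_def using that A1 A2 kappa by (intro add_nonneg_nonneg mult_nonneg_nonneg divide_nonneg_nonneg) auto
  have bdd: "bdd_below ((\<lambda>n. E n + U n) ` {3..})"
    using lower Upos by (intro bdd_belowI2[of _ c0]) (auto simp: add_increasing2)
  have "E \<longlonglongrightarrow> c"
  proof (rule LIMSEQ_I)
    fix e :: real assume e: "0 < e"
    have "\<exists>x\<in>(\<lambda>n. E n + U n) ` {3..}. x < c + e"
      unfolding c_def using e bdd by (subst cInf_less_iff[symmetric]) auto
    then obtain m where m: "3 \<le> m" "E m + U m < c + e" by auto
    have "\<forall>\<^sub>F n in sequentially. U n < e" using order_tendstoD(2)[OF U_tendsto_0] e by blast
    then obtain N where N: "\<And>n::nat. n \<ge> N \<Longrightarrow> U (real n) < e" by (auto simp: eventually_sequentially)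
    have "norm (E n - c) < e" if "n \<ge> max 3 (max m N)" for n
    proof -
      have "c \<le> E n + U n" unfolding c_def using bdd that by (intro cINF_lower) auto
      moreover have "E n \<le> E m + U m" using step[of m n] m that by auto
      ultimately show ?thesis using N[of n] that m by (auto simp: abs_less_iff)
    qed
    then show "\<exists>no. \<forall>n\<ge>no. norm (E n - c) < e" by blast
  qed
  then have "(\<lambda>n. exp (- E n)) \<longlonglongrightarrow> exp (- c)" by (intro tendsto_intros)
  moreover have "\<forall>\<^sub>F n in sequentially. exp (- E n) = W (real n) * ln (real n) powr \<kappa>"
    using eventually_ge_at_top[of 2]
  proof eventually_elim
    case (elim n)
    then have "0 < ln (real n)" by auto
    then show ?case unfolding E_def powr_def using W_pos[of "real n"] by (simp add: exp_add)
  qed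
  ultimately have "(\<lambda>n. W (real n) * ln (real n) powr \<kappa>) \<longlonglongrightarrow> exp (- c)"
    using tendsto_cong by force
  then show ?thesis by (intro exI[of _ "exp (- c)"]) auto
qed

definition W_lim :: real where "W_lim = lim (\<lambda>n. W (real n) * ln (real n) powr \<kappa>)"

lemma W_lim: "(\<lambda>n. W (real n) * ln (real n) powr \<kappa>) \<longlonglongrightarrow> W_lim" and W_lim_pos: "0 < W_lim"
proof -
  obtain c where "0 < c" "(\<lambda>n. W (real n) * ln (real n) powr \<kappa>) \<longlonglongrightarrow> c" using W_limit by blast
  then show "(\<lambda>n. W (real n) * ln (real n) powr \<kappa>) \<longlonglongrightarrow> W_lim" "0 < W_lim"
    unfolding W_lim_def by (simp_all add: limI)
qed

lemma W_le_lim: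
  assumes "2 \<le> z" shows "W z * ln z powr \<kappa> \<le> exp (U z) * W_lim"
proof -
  have z: "0 < ln z" using assms by auto
  have "\<forall>\<^sub>F n in sequentially. W z * ln z powr \<kappa> \<le> exp (U z) * (W (real n) * ln (real n) powr \<kappa>)"
    using eventually_ge_at_top[of "nat \<lceil>z\<rceil>"]
  proof eventually_elim
    case (elim n)
    then have n: "z \<le> real n" by linarith
    then have "0 < ln (real n)" using assms by auto
    have "W z * ln z powr \<kappa> \<le> W n * ((ln n / ln z) powr \<kappa> * exp (U z)) * ln z powr \<kappa>"
      using W_le[OF assms n] by (intro mult_right_mono) auto
    also have "\<dots> = exp (U z) * (W (real n) * ln (real n) powr \<kappa>)"
      using z \<open>0 < ln (real n)\<close> by (simp add: powr_divide)
    finally show ?case .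
  qed
  moreover have "(\<lambda>n. exp (U z) * (W (real n) * ln (real n) powr \<kappa>)) \<longlonglongrightarrow> exp (U z) * W_lim"
    by (intro tendsto_intros W_lim)
  ultimately show ?thesis
    by (intro tendsto_lowerbound[of "\<lambda>n. exp (U z) * (W (real n) * ln (real n) powr \<kappa>)"]) auto
qed

lemma inverse_W_le:
  assumes "2 \<le> z" shows "1 / W z \<le> m2 \<kappa> A1 A2 * ln z powr \<kappa>"
proof -
  have "1 \<le> W z * ((ln z / ln 2) powr \<kappa> * exp (U 2))" using W_le[of 2 z] assms W_2 by simp
  then have "1 / W z \<le> (ln z / ln 2) powr \<kappa> * exp (U 2)" using W_pos[of z] by (simp add: field_simps)
  also have "U 2 = A2 / ln 2 * (1 + A1 * \<kappa> + A1 * A2 / ln 2)" unfolding U_def by (simp add: field_simps)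
  also have "(ln z / ln 2) powr \<kappa> * exp \<dots> = m2 \<kappa> A1 A2 * ln z powr \<kappa>"
    unfolding m2_def using assms by (simp add: powr_divide)
  finally show ?thesis .
qed

end

section \<open>Mertens' first theorem\<close>

abbreviation primes_le :: "nat \<Rightarrow> nat set" where
  "primes_le n \<equiv> {p. prime p \<and> p \<le> n}"

lemma finite_primes_le: "finite (primes_le n)"
  by (rule finite_subset[of _ "{..n}"]) auto

lemma prod_primes_dvd:
  fixes n :: nat
  assumes "finite S" "\<And>p. p \<in> S \<Longrightarrow> prime p" "\<And>p. p \<in> S \<Longrightarrow> p dvd n"
  shows "\<Prod>S dvd n"
  using assms
proof (induction S rule: finite_induct)
  case (insert p S)
  have "coprime p (\<Prod>S)"
    using insert by (intro prod_coprime_right) (auto intro!: primes_coprime)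
  moreover have "p dvd n" "\<Prod>S dvd n" using insert by auto
  ultimately have "p * \<Prod>S dvd n" by (rule divides_mult[rotated 2])
  then show ?case using insert by simp
qed simp

lemma choose_odd_middle_le: "(2 * m + 1) choose m \<le> 4 ^ m"
proof -
  have "2 * ((2 * m + 1) choose m) = (\<Sum>k\<in>{m, m + 1}. (2 * m + 1) choose k)"
    using binomial_symmetric[of m "2 * m + 1"] by simp
  also have "\<dots> \<le> (\<Sum>k\<le>2 * m + 1. (2 * m + 1) choose k)"
    by (intro sum_mono2) auto
  also have "\<dots> = 2 * 4 ^ m" unfolding choose_row_sum by (simp add: power_mult)
  finally show ?thesis by simp
qed

text \<open>Erdos's induction: for n = 2m + 1 every prime in (m + 1, n] divides the binomial
  coefficient (2m + 1 choose m), which is at most 4^m because it occurs twice in a row of total 2 *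
  4^m.\<close>

lemma primorial_le: "\<Prod>(primes_le n) \<le> 4 ^ n"
proof (induction n rule: less_induct)
  case (less n)
  consider "n < 2" | "n = 2" | "n > 2" "even n" | "n > 2" "odd n" by linarith
  then show ?case
  proof cases
    case 1
    have "\<not> prime p" if "p \<le> n" for p :: nat using prime_ge_2_nat[of p] that 1 by linarith
    then have "primes_le n = {}" by blast
    then show ?thesis by (simp only:) simp
  next
    case 2
    have "p = 2" if "prime p" "p \<le> 2" for p :: nat
      using prime_ge_2_nat[OF that(1)] that(2) by simp
    then have "primes_le 2 = {2}" using two_is_prime_nat by blast
    then show ?thesis using 2 by simp
  next
    case 3
    have "\<not> prime n" using 3 prime_odd_nat by blast
    then have "p \<le> n \<longleftrightarrow> p \<le> n - 1" if "prime p" for p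
      using that 3 by (cases "p = n") auto
    then have "primes_le n = primes_le (n - 1)" by blast
    moreover have "\<Prod>(primes_le (n - 1)) \<le> 4 ^ n"
      by (rule le_trans[OF less power_increasing]) (use 3 in auto)
    ultimately show ?thesis by (simp only:)
  next
    case 4
    obtain m where n: "n = 2 * m + 1" using 4 by (elim oddE)
    with 4 have m: "1 \<le> m" by simp
    define S where "S = {p. prime p \<and> m + 1 < p \<and> p \<le> n}"
    have finS: "finite S" unfolding S_def by (rule finite_subset[of _ "{..n}"]) auto
    have "\<Prod>S dvd (2 * m + 1) choose m"
    proof (rule prod_primes_dvd[OF finS])
      fix p assume p: "p \<in> S"
      then have pr: "prime p" and pm: "m + 1 < p" "p \<le> 2 * m + 1" unfolding S_def n by auto
      have "fact m * fact (m + 1) * ((2 * m + 1) choose m) = (fact (2 * m + 1) :: nat)"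
        using binomial_fact_lemma[of m "2 * m + 1"] by (simp add: algebra_simps)
      moreover have "p dvd fact (2 * m + 1)" using pm prime_dvd_fact_iff[OF pr, of "2 * m + 1"] by blast
      ultimately have "p dvd fact m * fact (m + 1) * ((2 * m + 1) choose m)" by simp
      moreover have "\<not> p dvd fact m" "\<not> p dvd fact (m + 1)" unfolding prime_dvd_fact_iff[OF pr] using pm by simp_all
      ultimately show "p dvd (2 * m + 1) choose m" using pr by (simp add: prime_dvd_mult_iff)
    qed (auto simp: S_def)
    then have "\<Prod>S \<le> (2 * m + 1) choose m" by (intro dvd_imp_le) auto
    then have S: "\<Prod>S \<le> 4 ^ m" using choose_odd_middle_le le_trans by blast
    have "p \<le> n \<longleftrightarrow> p \<le> m + 1 \<or> (m + 1 < p \<and> p \<le> n)" for p unfolding n by linarith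
    then have "primes_le n = primes_le (m + 1) \<union> S" unfolding S_def by blast
    moreover have "\<not> (p \<le> m + 1 \<and> m + 1 < p)" for p by simp
    then have "primes_le (m + 1) \<inter> S = {}" unfolding S_def by blast
    ultimately have "\<Prod>(primes_le n) = \<Prod>(primes_le (m + 1)) * \<Prod>S"
      using prod.union_disjoint[OF finite_primes_le finS, of "m + 1" id] by simp
    also have "\<dots> \<le> 4 ^ (m + 1) * 4 ^ m" using n m by (intro mult_mono less S) auto
    also have "\<dots> = 4 ^ n" unfolding n by (simp add: power_add[symmetric])
    finally show ?thesis .
  qed
qed

lemma theta_le: "(\<Sum>p\<in>primes_le n. ln (real p)) \<le> real n * ln 4"
proof -
  have "(\<Sum>p\<in>primes_le n. ln (real p)) = ln (\<Prod>p\<in>primes_le n. real p)"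
    by (rule ln_prod[symmetric]) (auto simp: finite_primes_le prime_gt_0_nat)
  also have "(\<Prod>p\<in>primes_le n. real p) = real (\<Prod>(primes_le n))" by simp
  also have "ln \<dots> \<le> ln (real (4 ^ n))"
    using primorial_le[of n] by (intro ln_mono) (auto simp: finite_primes_le prime_gt_0_nat of_nat_le_iff simp del: of_nat_power of_nat_prod intro!: prod_pos)
  also have "\<dots> = real n * ln 4" by (simp add: ln_realpow)
  finally show ?thesis .
qed

lemma card_multiples: "0 < d \<Longrightarrow> card {k \<in> {1..n}. d dvd k} = n div d"
proof -
  assume d: "0 < d"
  have "{k \<in> {1..n}. d dvd k} = (\<lambda>i. d * i) ` {1..n div d}"
    using d by (auto simp: dvd_def image_iff less_eq_div_iff_mult_less_eq mult.commute Suc_le_eq)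
  moreover have "inj_on (\<lambda>i. d * i) {1..n div d}" using d by (auto intro: inj_onI)
  ultimately show ?thesis by (simp add: card_image)
qed

text \<open>Only radicals are needed: the product of the primes dividing k is at most n, and summing
  its logarithm over k \<le> n gives the sum of ln p times floor(n/p). Dropping the floor costs
  theta(n) \<le> n ln 4.\<close>

lemma mertens_first_upper:
  assumes "1 \<le> n"
  shows "(\<Sum>p\<in>primes_le n. ln (real p) / real p) \<le> ln n + ln 4"
proof -
  have rad: "(\<Sum>p\<in>{p \<in> primes_le n. p dvd k}. ln (real p)) \<le> ln (real n)" if k: "k \<in> {1..n}" for k
  proof -
    have fin: "finite {p \<in> primes_le n. p dvd k}" using finite_primes_le by simp
    have "\<Prod>{p \<in> primes_le n. p dvd k} dvd k" by (rule prod_primes_dvd[OF fin]) auto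
    then have "\<Prod>{p \<in> primes_le n. p dvd k} \<le> k" using k by (intro dvd_imp_le) auto
    then have "\<Prod>{p \<in> primes_le n. p dvd k} \<le> n" using k by simp
    then have le: "(\<Prod>p\<in>{p \<in> primes_le n. p dvd k}. real p) \<le> real n"
      unfolding of_nat_prod[symmetric] of_nat_le_iff by simp
    have "(\<Sum>p\<in>{p \<in> primes_le n. p dvd k}. ln (real p)) = ln (\<Prod>p\<in>{p \<in> primes_le n. p dvd k}. real p)"
      by (rule ln_prod[symmetric]) (use fin in \<open>auto simp: prime_gt_0_nat\<close>)
    also have "\<dots> \<le> ln (real n)"
      using le fin by (intro ln_mono prod_pos) (auto simp: prime_gt_0_nat)
    finally show ?thesis .
  qed
  have "(\<Sum>p\<in>primes_le n. ln (real p) * real (n div p)) = (\<Sum>p\<in>primes_le n. \<Sum>k\<in>{k \<in> {1..n}. p dvd k}. ln (real p))"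
    by (intro sum.cong refl) (auto simp: card_multiples[symmetric] prime_gt_0_nat mult.commute)
  also have "\<dots> = (\<Sum>k\<in>{1..n}. \<Sum>p\<in>{p \<in> primes_le n. p dvd k}. ln (real p))"
    by (intro sum.swap_restrict finite_primes_le) simp
  also have "\<dots> \<le> (\<Sum>k\<in>{1..n}. ln (real n))" by (intro sum_mono rad)
  finally have 1: "(\<Sum>p\<in>primes_le n. ln (real p) * real (n div p)) \<le> real n * ln n" by simp
  have "real n * (\<Sum>p\<in>primes_le n. ln (real p) / real p) = (\<Sum>p\<in>primes_le n. ln (real p) * (real n / real p))"
    by (simp add: sum_distrib_left mult_ac)
  also have "\<dots> \<le> (\<Sum>p\<in>primes_le n. ln (real p) * (real (n div p) + 1))"
  proof (intro sum_mono mult_left_mono ln_ge_zero)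
    fix p :: nat
    have "real n / real p \<le> of_int \<lfloor>real n / real p\<rfloor> + 1" by linarith
    then show "real n / real p \<le> real (n div p) + 1" by (simp add: floor_divide_of_nat_eq)
  qed (auto simp: Suc_le_eq prime_gt_0_nat)
  also have "\<dots> = (\<Sum>p\<in>primes_le n. ln (real p) * real (n div p)) + (\<Sum>p\<in>primes_le n. ln (real p))"
    by (simp add: distrib_left sum.distrib)
  also have "\<dots> \<le> real n * (ln n + ln 4)" using 1 theta_le[of n] by (simp add: distrib_left)
  finally show ?thesis using assms by simp
qed

lemma sum_ln_ge: "1 \<le> n \<Longrightarrow> real n * ln n - real n \<le> (\<Sum>k = 1..n. ln (real k))"
proof (induction n rule: dec_induct)
  case (step n)
  have "ln (real (Suc n)) - ln (real n) \<le> 1 / real n"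
  proof -
    have "ln (real (Suc n)) - ln (real n) = ln (1 + 1 / real n)"
      using step by (subst ln_divide_pos[symmetric]) (auto simp: field_simps)
    also have "\<dots> \<le> 1 / real n" using step by (intro ln_add_one_self_le_self) auto
    finally show ?thesis .
  qed
  then have "real n * (ln (real (Suc n)) - ln (real n)) \<le> 1" using step by (simp add: field_simps)
  then show ?case using step by (simp add: algebra_simps)
qed simp

lemma sum_multiplicity_le:
  assumes p: "prime p"
  shows "real (\<Sum>k = 1..n. multiplicity p k) \<le> real n / (real p - 1)"
proof -
  have p2: "2 \<le> p" using p prime_ge_2_nat by blast
  have mult: "multiplicity p k = card {j \<in> {1..n}. p ^ j dvd k}" if k: "k \<in> {1..n}" for k
  proof -
    have pk: "p ^ j dvd k \<longleftrightarrow> j \<le> multiplicity p k" for j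
      using k p2 by (intro power_dvd_iff_le_multiplicity) auto
    have "multiplicity p k < p ^ multiplicity p k" using p2 by (intro power_gt_expt) auto
    also have "\<dots> \<le> k" using k by (intro dvd_imp_le multiplicity_dvd) auto
    finally have "multiplicity p k \<le> n" using k by simp
    then have "{j \<in> {1..n}. p ^ j dvd k} = {1..multiplicity p k}" unfolding pk by auto
    then show ?thesis by simp
  qed
  have "(\<Sum>k = 1..n. multiplicity p k) = (\<Sum>k\<in>{1..n}. \<Sum>j\<in>{j \<in> {1..n}. p ^ j dvd k}. 1)"
    by (intro sum.cong refl) (simp add: mult)
  also have "\<dots> = (\<Sum>j\<in>{1..n}. \<Sum>k\<in>{k \<in> {1..n}. p ^ j dvd k}. 1)"
    by (intro sum.swap_restrict) auto
  also have "\<dots> = (\<Sum>j\<in>{1..n}. n div p ^ j)"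
  proof (intro sum.cong refl)
    fix j
    have "0 < p ^ j" using p2 by simp
    then show "(\<Sum>k\<in>{k \<in> {1..n}. p ^ j dvd k}. 1) = n div p ^ j"
      unfolding sum_constant by (simp only: card_multiples) simp
  qed
  finally have "real (\<Sum>k = 1..n. multiplicity p k) = (\<Sum>j\<in>{1..n}. real (n div p ^ j))" by simp
  also have "\<dots> \<le> (\<Sum>j\<in>{1..n}. real n * (1 / real p) ^ j)"
  proof (intro sum_mono)
    fix j
    have "real (n div p ^ j) = of_int \<lfloor>real n / real (p ^ j)\<rfloor>" by (simp only: floor_divide_of_nat_eq of_int_of_nat_eq)
    also have "\<dots> \<le> real n * (1 / real p) ^ j" by (simp add: power_one_over)
    finally show "real (n div p ^ j) \<le> real n * (1 / real p) ^ j" .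
  qed
  also have "\<dots> = real n * (\<Sum>j\<in>{1..n}. (1 / real p) ^ j)" by (simp add: sum_distrib_left)
  also have "(\<Sum>j\<in>{1..n}. (1 / real p) ^ j) \<le> 1 / (real p - 1)"
  proof -
    have "(\<Sum>j\<in>{1..n}. (1 / real p) ^ j) \<le> 1 / (real p - 1) - (1 / real p) ^ n / (real p - 1)"
    proof (induction n)
      case (Suc n)
      have "(1 / real p) ^ Suc n = (1 / real p) ^ n / (real p - 1) - (1 / real p) ^ Suc n / (real p - 1)"
        using p2 by (simp add: divide_simps)
      moreover have "(\<Sum>j\<in>{1..Suc n}. (1 / real p) ^ j) = (\<Sum>j\<in>{1..n}. (1 / real p) ^ j) + (1 / real p) ^ Suc n"
        by simp
      ultimately show ?case using Suc by linarith
    qed simp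
    moreover have "0 \<le> (1 / real p) ^ n / (real p - 1)" using p2 by simp
    ultimately show ?thesis by linarith
  qed
  finally show ?thesis by (simp add: mult_left_mono)
qed

lemma summable_ln_over_square: "summable (\<lambda>k. ln (real k) / (real k * (real k - 1)))"
proof (rule summable_comparison_test_bigo)
  show "summable (\<lambda>n. norm (real n powr (-3/2)))" by (simp add: summable_real_powr_iff)
  show "(\<lambda>k. ln (real k) / (real k * (real k - 1))) \<in> O(\<lambda>n. real n powr (-3/2))" by real_asymp
qed

text \<open>Legendre's formula: n! contains p to a power of at most n / (p - 1). The excess 1 / (p -
  1) - 1 / p = 1 / (p (p - 1)) contributes a convergent series; its sum, plus the 1 from n! \<ge>
  (n/e)^n, is C.\<close>

lemma mertens_first_lower:
  obtains C where "0 \<le> C" "\<And>n. 1 \<le> n \<Longrightarrow> ln (real n) - C \<le> (\<Sum>p\<in>primes_le n. ln (real p) / real p)"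
proof -
  define f where "f k = ln (real k) / (real k * (real k - 1))" for k :: nat
  have f0: "0 \<le> f k" for k unfolding f_def by (cases "k = 0") auto
  define C where "C = suminf f + 1"
  have summ: "summable f" using summable_ln_over_square unfolding f_def .
  have bound: "ln (real n) - C \<le> (\<Sum>p\<in>primes_le n. ln (real p) / real p)" if n: "1 \<le> n" for n
  proof -
    have "real n * ln n - real n \<le> (\<Sum>k = 1..n. ln (real k))" by (rule sum_ln_ge[OF n])
    also have "\<dots> = (\<Sum>k = 1..n. \<Sum>p\<in>primes_le n. real (multiplicity p k) * ln (real p))"
    proof (intro sum.cong refl)
      fix k assume k: "k \<in> {1..n}"
      have sub: "prime_factors k \<subseteq> primes_le n"
        using k by (auto simp: in_prime_factors_iff dest!: dvd_imp_le)
      have "real k = (\<Prod>p\<in>prime_factors k. real p ^ multiplicity p k)"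
        using prime_factorization_nat[of k] k by (metis (no_types, lifting) atLeastAtMost_iff not_one_le_zero of_nat_power of_nat_prod prod.cong zero_less_iff_neq_zero)
      then have "ln (real k) = (\<Sum>p\<in>prime_factors k. ln (real p ^ multiplicity p k))"
        by (simp only:) (rule ln_prod, auto simp: prime_gt_0_nat in_prime_factors_iff)
      also have "\<dots> = (\<Sum>p\<in>prime_factors k. real (multiplicity p k) * ln (real p))"
        by (intro sum.cong refl) (auto simp: ln_realpow prime_gt_0_nat in_prime_factors_iff)
      also have "\<dots> = (\<Sum>p\<in>primes_le n. real (multiplicity p k) * ln (real p))"
        using k sub by (intro sum.mono_neutral_left finite_primes_le) (auto simp: in_prime_factors_iff not_dvd_imp_multiplicity_0)
      finally show "ln (real k) = (\<Sum>p\<in>primes_le n. real (multiplicity p k) * ln (real p))" .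
    qed
    also have "\<dots> = (\<Sum>p\<in>primes_le n. real (\<Sum>k = 1..n. multiplicity p k) * ln (real p))"
      by (subst sum.swap) (simp add: sum_distrib_right)
    also have "\<dots> \<le> (\<Sum>p\<in>primes_le n. real n / (real p - 1) * ln (real p))"
      by (intro sum_mono mult_right_mono sum_multiplicity_le ln_ge_zero) (auto simp: Suc_le_eq prime_gt_0_nat)
    also have "\<dots> = (\<Sum>p\<in>primes_le n. real n * (ln (real p) / real p + f p))"
    proof (intro sum.cong refl)
      fix p assume "p \<in> primes_le n"
      then have "2 \<le> p" using prime_ge_2_nat by auto
      then show "real n / (real p - 1) * ln (real p) = real n * (ln (real p) / real p + f p)"
        unfolding f_def by (simp add: divide_simps) (simp add: algebra_simps)
    qed
    also have "\<dots> = real n * ((\<Sum>p\<in>primes_le n. ln (real p) / real p) + (\<Sum>p\<in>primes_le n. f p))"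
      by (simp only: sum.distrib sum_distrib_left[symmetric])
    finally have "real n * (ln n - 1) \<le> real n * ((\<Sum>p\<in>primes_le n. ln (real p) / real p) + (\<Sum>p\<in>primes_le n. f p))"
      by (simp add: algebra_simps)
    then have "ln n - 1 \<le> (\<Sum>p\<in>primes_le n. ln (real p) / real p) + (\<Sum>p\<in>primes_le n. f p)" using n by simp
    moreover have "(\<Sum>p\<in>primes_le n. f p) \<le> suminf f"
      by (intro sum_le_suminf summ finite_primes_le) (use f0 in auto)
    ultimately show ?thesis unfolding C_def by linarith
  qed
  have "0 \<le> C" unfolding C_def using suminf_nonneg[OF summ] f0 by (simp add: add_nonneg_nonneg)
  then show ?thesis using bound that by blast
qed

text \<open>Mertens' first theorem says that \<open>\<omega> = 1\<close> has density
  \<open>\<kappa> = 1\<close>. Taking a difference of two values of S doubles D; the extra 1 makes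
  the upper constant positive, and \<open>A1 = 2\<close> reflects 1 / p \<le> 1 / 2.\<close>

lemma sieve_density_one: "\<exists>A L. sieve_density (\<lambda>_. 1) 1 2 A L"
proof -
  obtain C where C: "0 \<le> C" "\<And>n. 1 \<le> n \<Longrightarrow> ln (real n) - C \<le> (\<Sum>p\<in>primes_le n. ln (real p) / real p)"
    by (rule mertens_first_lower) blast
  define D where "D = C + ln 4"
  define S where "S z = (\<Sum>p\<in>primes_in 2 z. ln (real p) / real p)" for z
  have S: "\<bar>S z - ln z\<bar> \<le> D" if z: "2 \<le> z" for z
  proof -
    define n where "n = nat (\<lceil>z\<rceil> - 1)"
    have n: "real n < z" "z \<le> real n + 1" "1 \<le> n" unfolding n_def using z by linarith+
    have "primes_in 2 z = primes_le n"
    proof (intro set_eqI iffI)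
      fix p assume "p \<in> primes_in 2 z"
      then have "prime p" "real p < real (n + 1)" using n by (auto simp: primes_in_def)
      then show "p \<in> primes_le n" by (simp only: of_nat_less_iff) simp
    next
      fix p assume "p \<in> primes_le n"
      then have "prime p" "real p \<le> real n" "2 \<le> p" using prime_ge_2_nat by auto
      then show "p \<in> primes_in 2 z" using n unfolding primes_in_def by auto
    qed
    then have eq: "S z = (\<Sum>p\<in>primes_le n. ln (real p) / real p)" unfolding S_def by simp
    have "ln n \<le> ln z" using n by (intro ln_mono) auto
    moreover have "ln z \<le> ln (real n * 2)" using n z by (intro ln_mono) auto
    then have "ln z \<le> ln n + ln 2" using n by (simp add: ln_mult)
    moreover have "ln (4::real) = 2 * ln 2" using ln_realpow[of 2 2] by simp
    moreover have "0 < ln (2::real)" by simp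
    ultimately show ?thesis using mertens_first_upper[of n] C(1) C(2)[of n] n unfolding eq D_def by linarith
  qed
  have "sieve_density (\<lambda>_. 1) 1 2 (2 * D + 1) (2 * D)"
  proof
    show "0 < 2 * D + 1" unfolding D_def using C by (simp add: add_nonneg_pos)
    have "1 / real p \<le> 1 / 2" if "prime p" for p
      using prime_ge_2_nat[OF that] by (intro divide_left_mono) auto
    then show "cond_Omega1 (\<lambda>_. 1) 2" unfolding cond_Omega1_def by simp
    show "cond_Omega2 (\<lambda>_. 1) 1 (2 * D + 1) (2 * D)"
      unfolding cond_Omega2_def Let_def
    proof (intro allI impI)
      fix w z :: real assume wz: "2 \<le> w \<and> w < z"
      have "S z = S w + (\<Sum>p\<in>primes_in w z. ln (real p) / real p)"
        unfolding S_def using primes_in_split[of w z 2] wz by (simp add: sum.union_disjoint)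
      moreover have "ln (z / w) = ln z - ln w" using wz by (simp add: ln_div)
      ultimately show "- (2 * D) \<le> (\<Sum>p | prime p \<and> w \<le> real p \<and> real p < z. 1 * ln (real p) / real p) - 1 * ln (z / w) \<and>
          (\<Sum>p | prime p \<and> w \<le> real p \<and> real p < z. 1 * ln (real p) / real p) - 1 * ln (z / w) \<le> 2 * D + 1"
        using S[of w] S[of z] wz unfolding primes_in_def by (auto simp: abs_le_iff)
    qed
  qed auto
  then show ?thesis by blast
qed

section \<open>Mertens' constant and the singular product\<close>

text \<open>The sieve of Eratosthenes on a finite sum: the multiples of p among the remaining n lie
  in p times the remaining set, so removing them keeps at least the proportion 1 - p^-\<sigma>. In
  the end only n = 1 is left. No infinite product occurs.\<close>

lemma zeta_partial_le_euler:
  fixes \<sigma> :: real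
  assumes "0 < \<sigma>"
  shows "(\<Sum>n = 1..N. real n powr - \<sigma>) * (\<Prod>p\<in>primes_le N. 1 - real p powr - \<sigma>) \<le> 1"
proof -
  define R where "R S = {n \<in> {1..N}. \<forall>p\<in>S. \<not> p dvd n}" for S
  define Z where "Z S = (\<Sum>n\<in>R S. real n powr - \<sigma>)" for S
  have finR: "finite (R S)" for S unfolding R_def by simp
  have step: "Z S * (1 - real p powr - \<sigma>) \<le> Z (insert p S)" if p: "prime p" for p S
  proof -
    have "Z S = (\<Sum>n\<in>R (insert p S). real n powr - \<sigma>) + (\<Sum>n\<in>{n \<in> R S. p dvd n}. real n powr - \<sigma>)"
    proof -
      have "R S = R (insert p S) \<union> {n \<in> R S. p dvd n}" "R (insert p S) \<inter> {n \<in> R S. p dvd n} = {}"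
        unfolding R_def by blast+
      then show ?thesis unfolding Z_def
        using sum.union_disjoint[of "R (insert p S)" "{n \<in> R S. p dvd n}" "\<lambda>n. real n powr - \<sigma>"] finR by simp
    qed
    also have "(\<Sum>n\<in>{n \<in> R S. p dvd n}. real n powr - \<sigma>) \<le> (\<Sum>n\<in>(\<lambda>m. p * m) ` R S. real n powr - \<sigma>)"
    proof (intro sum_mono2)
      show "{n \<in> R S. p dvd n} \<subseteq> (\<lambda>m. p * m) ` R S"
      proof
        fix n assume n: "n \<in> {n \<in> R S. p dvd n}"
        then obtain m where m: "n = p * m" by (auto simp: dvd_def)
        have "0 < m" using n m by (auto simp: R_def intro: gr0I)
        moreover have "m \<le> p * m" using prime_gt_0_nat[OF p] by simp
        moreover have "p * m \<le> N" using n m by (simp add: R_def)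
        ultimately have "m \<in> {1..N}" using le_trans[of m "p * m" N] by auto
        moreover have "\<not> q dvd m" if "q \<in> S" for q
          using n m that dvd_mult[of q m p] by (auto simp: R_def)
        ultimately have "m \<in> R S" by (simp add: R_def)
        then show "n \<in> (\<lambda>m. p * m) ` R S" using m by blast
      qed
    qed (auto simp: finR)
    also have "\<dots> = (\<Sum>m\<in>R S. real (p * m) powr - \<sigma>)"
      by (rule sum.reindex[unfolded o_def]) (use prime_gt_0_nat[OF p] in \<open>auto intro: inj_onI\<close>)
    also have "\<dots> = real p powr - \<sigma> * Z S"
      unfolding Z_def sum_distrib_left by (intro sum.cong refl) (simp add: powr_mult)
    finally show ?thesis by (simp add: Z_def algebra_simps)
  qed
  have le1: "0 \<le> 1 - real p powr - \<sigma>" if "prime p" for p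
  proof -
    have "real p powr - \<sigma> \<le> real p powr 0" using that prime_ge_1_nat[OF that] assms by (intro powr_mono) auto
    then show ?thesis using prime_gt_0_nat[OF that] by simp
  qed
  have "Z {} * (\<Prod>p\<in>S. 1 - real p powr - \<sigma>) \<le> Z S" if "finite S" "\<And>p. p \<in> S \<Longrightarrow> prime p" for S
    using that
  proof (induction S rule: finite_induct)
    case (insert p S)
    have "Z {} * (\<Prod>p\<in>insert p S. 1 - real p powr - \<sigma>) = (Z {} * (\<Prod>p\<in>S. 1 - real p powr - \<sigma>)) * (1 - real p powr - \<sigma>)"
      using insert by simp
    also have "\<dots> \<le> Z S * (1 - real p powr - \<sigma>)"
      using insert by (intro mult_right_mono le1) auto
    also have "\<dots> \<le> Z (insert p S)" using insert by (intro step) auto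
    finally show ?case .
  qed simp
  from this[OF finite_primes_le] have "Z {} * (\<Prod>p\<in>primes_le N. 1 - real p powr - \<sigma>) \<le> Z (primes_le N)"
    by blast
  also have "Z (primes_le N) \<le> (\<Sum>n\<in>{1}. real n powr - \<sigma>)"
    unfolding Z_def
  proof (intro sum_mono2)
    show "R (primes_le N) \<subseteq> {1}"
    proof
      fix n assume n: "n \<in> R (primes_le N)"
      have "n = 1"
      proof (rule ccontr)
        assume "n \<noteq> 1"
        then obtain p where "prime p" "p dvd n" using prime_factor_nat by blast
        moreover have "p \<le> N" using n dvd_imp_le[OF \<open>p dvd n\<close>] by (auto simp: R_def)
        ultimately show False using n unfolding R_def by blast
      qed
      then show "n \<in> {1}" by simp
    qed
  qed auto
  also have "\<dots> = 1" by simp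
  finally have "Z {} * (\<Prod>p\<in>primes_le N. 1 - real p powr - \<sigma>) \<le> 1" .
  moreover have "R {} = {1..N}" unfolding R_def by auto
  ultimately show ?thesis by (simp only: Z_def)
qed

text \<open>Comparison with the integral of x^(-1-s) from 1 to N + 1, one unit interval at a time;
  each increment is the Bernoulli-type bound (1 + 1/n)^-s \<ge> 1 - s/n.\<close>

lemma zeta_partial_ge:
  fixes s :: real
  assumes "0 < s"
  shows "(1 - real (N + 1) powr - s) / s \<le> (\<Sum>n = 1..N. real n powr - (1 + s))"
proof (induction N)
  case (Suc N)
  define n where "n = real (N + 1)"
  have n: "1 \<le> n" unfolding n_def by simp
  have "1 - s / n \<le> 1 - s * ln (1 + 1 / n)"
    using ln_add_one_self_le_self[of "1 / n"] n assms mult_left_mono[of "ln (1 + 1 / n)" "1 / n" s] by simp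
  also have "\<dots> \<le> exp (- (s * ln (1 + 1 / n)))" using exp_ge_add_one_self[of "- (s * ln (1 + 1 / n))"] by simp
  also have "\<dots> = (1 + 1 / n) powr - s" using n by (simp add: powr_def add_pos_pos less_imp_neq[THEN not_sym])
  finally have "n powr - s * (1 - s / n) \<le> n powr - s * (1 + 1 / n) powr - s"
    by (intro mult_left_mono) auto
  also have "\<dots> = (n * (1 + 1 / n)) powr - s" using n by (simp add: powr_mult)
  also have "n * (1 + 1 / n) = n + 1" using n by (simp add: field_simps)
  finally have "n powr - s - (n + 1) powr - s \<le> s * (n powr - s / n)" by (simp add: algebra_simps)
  also have "n powr - s / n = n powr - (1 + s)" using n by (simp add: powr_diff powr_minus field_simps)
  finally have "(n powr - s - (n + 1) powr - s) / s \<le> n powr - (1 + s)" using assms by (simp add: field_simps)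
  moreover have "n + 1 = real (Suc N + 1)" unfolding n_def by simp
  ultimately show ?case using Suc unfolding n_def
    by (simp add: diff_divide_distrib)
qed simp

text \<open>Bernoulli's inequality (1 - x)^y \<le> 1 - y x in logarithmic form, that is, convexity
  of exp between 0 and ln (1 - x). With y = p^-s it detaches the twist from an Euler factor; x may
  be negative, as for x = -g.\<close>

lemma one_minus_mult_ge_powr:
  fixes x y :: real
  assumes "0 \<le> y" "y \<le> 1" "x < 1"
  shows "y * ln (1 - x) \<le> ln (1 - y * x)"
proof -
  have pos: "0 < 1 - y * x"
  proof (cases "x \<le> 0")
    case True
    then have "y * x \<le> 0" using assms by (intro mult_nonneg_nonpos)
    then show ?thesis by simp
  next
    case False
    then have "y * x \<le> 1 * x" using assms by (intro mult_right_mono) auto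
    then show ?thesis using assms by simp
  qed
  have "exp ((1 - y) *\<^sub>R 0 + y *\<^sub>R ln (1 - x)) \<le> (1 - y) * exp 0 + y * exp (ln (1 - x))"
    by (rule convex_onD[OF exp_convex]) (use assms in auto)
  also have "\<dots> = 1 - y * x" using assms by (simp add: algebra_simps)
  finally show ?thesis using pos by (simp add: ln_ge_iff)
qed

text \<open>A finite version of ln \<zeta>(1+s) \<ge> - ln s, to which it tends as N grows.\<close>

lemma sum_neg_ln_euler_ge:
  fixes s :: real
  assumes s: "0 < s" and N: "1 \<le> N"
  shows "ln ((1 - real (N + 1) powr - s) / s) \<le> (\<Sum>p\<in>primes_le N. - ln (1 - real p powr - (1 + s)))"
proof -
  define Q where "Q = (\<Prod>p\<in>primes_le N. 1 - real p powr - (1 + s))"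
  have lt: "0 < 1 - real p powr - (1 + s)" if "prime p" for p
  proof -
    have "real p powr - (1 + s) < real p powr 0" using prime_gt_1_nat[OF that] s by (intro powr_less_mono) auto
    then show ?thesis using prime_gt_0_nat[OF that] by simp
  qed
  have Q: "0 < Q" unfolding Q_def using lt by (intro prod_pos) auto
  have "real (N + 1) powr - s < real (N + 1) powr 0" using s N by (intro powr_less_mono) auto
  then have pos: "0 < (1 - real (N + 1) powr - s) / s" using s by simp
  have "(1 - real (N + 1) powr - s) / s * Q \<le> (\<Sum>n = 1..N. real n powr - (1 + s)) * Q"
    using zeta_partial_ge[OF s] Q by (intro mult_right_mono) auto
  also have "\<dots> \<le> 1" unfolding Q_def using s by (intro zeta_partial_le_euler) auto
  finally have "ln ((1 - real (N + 1) powr - s) / s * Q) \<le> ln 1" using pos Q by (intro ln_mono mult_pos_pos) auto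
  then have "ln ((1 - real (N + 1) powr - s) / s) + ln Q \<le> 0" unfolding ln_mult_pos[OF pos Q] by simp
  moreover have "ln Q = (\<Sum>p\<in>primes_le N. ln (1 - real p powr - (1 + s)))"
    unfolding Q_def by (rule ln_prod[OF finite_primes_le], simp only: mem_Collect_eq) (metis lt less_irrefl)
  ultimately show ?thesis by (simp add: sum_negf)
qed

lemma integral_exp_tail:
  fixes c R :: real
  assumes "0 \<le> c" "c \<le> R"
  shows "((\<lambda>t. if t \<in> {c..R} then exp (- t) else 0) has_integral (exp (- c) - exp (- R))) {0..R}"
proof -
  have "((\<lambda>t. exp (- t)) has_integral (- exp (- R) - (- exp (- c)))) {c..R}"
    by (rule fundamental_theorem_of_calculus[OF assms(2)])
       (auto intro!: derivative_eq_intros simp: has_real_derivative_iff_has_vector_derivative[symmetric])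
  then show ?thesis using assms by (subst has_integral_restrict) auto
qed

text \<open>The logarithm is replaced by \<open>(t\<^sup>\<eta> - 1) / \<eta>\<close>, whose Laplace transform is a value of the Gamma
  function; letting \<open>\<eta> \<rightarrow> 0\<close> produces \<open>\<Gamma>'(1) = -\<gamma>\<close>.\<close>

lemma laplace_log_upper:
  fixes l h :: "'a \<Rightarrow> real" and c D u1 s \<eta> :: real
  assumes J: "finite J" and l: "\<And>p. p \<in> J \<Longrightarrow> 0 \<le> l p" and h: "\<And>p. p \<in> J \<Longrightarrow> 0 \<le> h p"
    and D: "0 \<le> D" and s: "0 < s" and eta: "0 < \<eta>" "0 < u1"
    and small: "\<And>u. 0 \<le> u \<Longrightarrow> u \<le> u1 \<Longrightarrow> (\<Sum>p | p \<in> J \<and> l p \<le> u. h p) \<le> D"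
    and large: "\<And>u. u1 < u \<Longrightarrow> (\<Sum>p | p \<in> J \<and> l p \<le> u. h p) \<le> ln u + c"
    and s_small: "1 / \<eta> \<le> c - ln s"
  shows "(\<Sum>p\<in>J. h p * exp (- (s * l p))) \<le> (Gamma (1 + \<eta>) - 1) / \<eta> + (c - ln s) + D * (s * u1)"
proof -
  \<comment> \<open>For t > s u1 this majorizes the summatory function of h at t / s, since ln t
    \<le> (t^\<eta> - 1) / \<eta>. The hypothesis \<open>s_small\<close> makes it nonnegative, so
    that its integral may be extended from [0, R] to the half-line.\<close>
  define \<beta> where "\<beta> t = (t powr \<eta> - 1) / \<eta> + (c - ln s)" for t
  define M where "M = Max (insert 0 ((\<lambda>p. s * l p) ` J))"
  have beta0: "0 \<le> \<beta> t" if "0 \<le> t" for t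
  proof -
    have "(0 - 1) / \<eta> \<le> (t powr \<eta> - 1) / \<eta>" using eta that by (intro divide_right_mono) auto
    then show ?thesis unfolding \<beta>_def using s_small by simp
  qed
  have lnle: "ln t \<le> (t powr \<eta> - 1) / \<eta>" if "0 < t" for t
  proof -
    have "\<eta> * ln t \<le> t powr \<eta> - 1" using exp_ge_add_one_self[of "\<eta> * ln t"] that unfolding powr_def by (simp add: algebra_simps)
    then show ?thesis using eta by (simp add: field_simps)
  qed
  have Gint: "((\<lambda>t. t powr (1 + \<eta> - 1) / exp t) has_integral Gamma (1 + \<eta>)) {0..}"
    using eta by (intro Gamma_integral_real) auto
  have Gint1: "((\<lambda>t. t powr (1 - 1) / exp t) has_integral Gamma 1) {0::real..}"
    by (intro Gamma_integral_real) auto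
  have "((\<lambda>t. exp (- t)) has_integral Gamma 1) {0::real..}"
  proof (rule has_integral_spike_finite)
    show "finite {0::real}" by simp
    show "exp (- t) = t powr (1 - 1) / exp t" if "t \<in> {0..} - {0}" for t :: real
      using that by (simp add: exp_minus field_simps)
  qed (rule Gint1)
  then have eint: "((\<lambda>t. exp (- t)) has_integral 1) {0::real..}" by simp
  have bint: "((\<lambda>t. exp (- t) * \<beta> t) has_integral ((Gamma (1 + \<eta>) - 1) / \<eta> + (c - ln s))) {0..}"
  proof -
    have "((\<lambda>t. 1 / \<eta> * (t powr (1 + \<eta> - 1) / exp t) + (c - ln s - 1 / \<eta>) * exp (- t)) has_integral
        (1 / \<eta> * Gamma (1 + \<eta>) + (c - ln s - 1 / \<eta>) * 1)) {0..}"
      by (intro has_integral_add has_integral_mult_right Gint eint)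
    moreover have "1 / \<eta> * Gamma (1 + \<eta>) + (c - ln s - 1 / \<eta>) * 1 = (Gamma (1 + \<eta>) - 1) / \<eta> + (c - ln s)"
      by (simp add: diff_divide_distrib)
    ultimately have "((\<lambda>t. 1 / \<eta> * (t powr (1 + \<eta> - 1) / exp t) + (c - ln s - 1 / \<eta>) * exp (- t)) has_integral
        ((Gamma (1 + \<eta>) - 1) / \<eta> + (c - ln s))) {0..}" by (simp only:)
    then show ?thesis
      by (rule has_integral_eq[rotated]) (simp add: \<beta>_def exp_minus divide_inverse algebra_simps)
  qed
  \<comment> \<open>Each exponential is the integral of exp (-t) over t \<ge> s l p, cut off at R.
    Exchanging sum and integral produces the summatory function of h at t / s; the cut-off terms exp
    (-R) vanish at the end.\<close>
  have le: "(\<Sum>p\<in>J. h p * (exp (- (s * l p)) - exp (- R))) \<le> (Gamma (1 + \<eta>) - 1) / \<eta> + (c - ln s) + D * (s * u1)"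
    if R: "max M (s * u1) \<le> R" for R
  proof -
    have su1: "0 < s * u1" using s eta by simp
    have lR: "s * l p \<le> R" if "p \<in> J" for p
      using Max_ge[of "insert 0 ((\<lambda>p. s * l p) ` J)" "s * l p"] that J R unfolding M_def by auto
    have "((\<lambda>t. \<Sum>p\<in>J. h p * (if t \<in> {s * l p..R} then exp (- t) else 0)) has_integral
        (\<Sum>p\<in>J. h p * (exp (- (s * l p)) - exp (- R)))) {0..R}"
      using J l s lR by (intro has_integral_sum has_integral_mult_right integral_exp_tail) auto
    moreover have "((\<lambda>t. exp (- t) * \<beta> t + (if t \<in> {0..s * u1} then D else 0)) has_integral
        (integral {0..R} (\<lambda>t. exp (- t) * \<beta> t) + D * (s * u1))) {0..R}"
    proof (intro has_integral_add)
      show "((\<lambda>t. exp (- t) * \<beta> t) has_integral integral {0..R} (\<lambda>t. exp (- t) * \<beta> t)) {0..R}"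
        by (intro integrable_integral integrable_on_subinterval[OF has_integral_integrable[OF bint]]) auto
      have "((\<lambda>t. D) has_integral (s * u1 - 0) *\<^sub>R D) {0..s * u1}"
        using has_integral_const_real[of D 0 "s * u1"] su1 by simp
      then show "((\<lambda>t. if t \<in> {0..s * u1} then D else 0) has_integral D * (s * u1)) {0..R}"
        using R by (subst has_integral_restrict) (auto simp: mult.commute)
    qed
    ultimately have "(\<Sum>p\<in>J. h p * (exp (- (s * l p)) - exp (- R))) \<le> integral {0..R} (\<lambda>t. exp (- t) * \<beta> t) + D * (s * u1)"
    proof (rule has_integral_le)
      fix t assume t: "t \<in> {0..R}"
      define H where "H = (\<Sum>p | p \<in> J \<and> l p \<le> t / s. h p)"
      have H0: "0 \<le> H" unfolding H_def using h by (intro sum_nonneg) auto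
      have "(\<Sum>p\<in>J. h p * (if t \<in> {s * l p..R} then exp (- t) else 0)) = (\<Sum>p\<in>J. if l p \<le> t / s then h p * exp (- t) else 0)"
        using t s by (intro sum.cong refl) (auto simp: field_simps)
      also have "\<dots> = exp (- t) * H" unfolding H_def sum_distrib_left
        by (subst sum.inter_filter[OF J, symmetric]) (simp add: mult.commute)
      also have "\<dots> \<le> exp (- t) * \<beta> t + (if t \<in> {0..s * u1} then D else 0)"
      proof (cases "t \<le> s * u1")
        case True
        then have "H \<le> D" unfolding H_def using t s by (intro small) (auto simp: field_simps)
        moreover have "exp (- t) * H \<le> 1 * H" using t H0 by (intro mult_right_mono) auto
        moreover have "0 \<le> exp (- t) * \<beta> t" using beta0 t by simp
        ultimately show ?thesis using True t by simp
      next
        case False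
        then have u: "u1 < t / s" using s by (simp add: field_simps)
        have t0: "0 < t" using False su1 by linarith
        have "H \<le> ln (t / s) + c" unfolding H_def by (rule large[OF u])
        also have "\<dots> \<le> \<beta> t" unfolding \<beta>_def using lnle[OF t0] t0 s by (simp add: ln_divide_pos)
        finally show ?thesis using False by simp
      qed
      finally show "(\<Sum>p\<in>J. h p * (if t \<in> {s * l p..R} then exp (- t) else 0)) \<le> exp (- t) * \<beta> t + (if t \<in> {0..s * u1} then D else 0)" .
    qed
    also have "integral {0..R} (\<lambda>t. exp (- t) * \<beta> t) \<le> (Gamma (1 + \<eta>) - 1) / \<eta> + (c - ln s)"
      by (rule has_integral_subset_le[OF _ integrable_integral[OF integrable_on_subinterval[OF has_integral_integrable[OF bint]]] bint])
         (use beta0 in auto)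
    finally show ?thesis by simp
  qed
  have "((\<lambda>R::real. exp (- R)) \<longlongrightarrow> 0) at_top" by real_asymp
  then have "((\<lambda>R. \<Sum>p\<in>J. h p * (exp (- (s * l p)) - exp (- R))) \<longlongrightarrow> (\<Sum>p\<in>J. h p * (exp (- (s * l p)) - 0))) at_top"
    by (intro tendsto_intros)
  then have "(\<Sum>p\<in>J. h p * (exp (- (s * l p)) - 0)) \<le> (Gamma (1 + \<eta>) - 1) / \<eta> + (c - ln s) + D * (s * u1)"
    by (rule tendsto_upperbound) (use le in \<open>auto intro!: eventually_at_top_linorderI[of "max M (s * u1)"]\<close>)
  then show ?thesis by simp
qed

text \<open>If -ln W(z) behaves like ln ln z - ln W_lim, its Laplace transform is about -\<gamma> -
  ln W_lim - ln s, while ln \<zeta>(1+s) \<ge> - ln s. Comparing the two as s tends to 0 gives the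
  inequality. The opposite one is not proved here.\<close>

lemma mertens_constant:
  assumes "sieve_density (\<lambda>_. 1) 1 2 A L"
  shows "sieve_density.W_lim (\<lambda>_. 1) 1 \<le> exp (- euler_mascheroni)"
proof -
  interpret sieve_density "\<lambda>_. 1" 1 2 A L by fact
  define h' where "h' p = - ln (1 - 1 / real p)" for p :: nat
  have hp: "h p = 1 / real p" for p by (simp add: h_def)
  have h'0: "0 \<le> h' p" if "prime p" for p
  proof -
    have "ln (1 - 1 / real p) \<le> ln 1" using prime_gt_1_nat[OF that] by (intro ln_mono) auto
    then show ?thesis unfolding h'_def by simp
  qed
  have lnW: "- ln (W z) = (\<Sum>p\<in>primes_in 2 z. h' p)" for z
  proof -
    have "ln (W z) = (\<Sum>p\<in>primes_in 2 z. ln (1 - h p))"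
      unfolding W_def 
      by (rule ln_prod[OF finite_primes_in]) (auto simp: primes_in_def dest: h_less_1)
    then show ?thesis unfolding h'_def hp by (simp add: sum_negf)
  qed
  have main: "0 \<le> (Gamma (1 + \<eta>) - 1) / \<eta> + (\<epsilon> - ln W_lim)" if eta: "0 < \<eta>" and eps: "0 < \<epsilon>" for \<eta> \<epsilon> :: real
  proof -
    define c where "c = \<epsilon> - ln W_lim"
    have "(\<lambda>n. ln (W (real n) * ln (real n) powr 1)) \<longlonglongrightarrow> ln W_lim"
      using W_lim W_lim_pos by (intro tendsto_ln) auto
    then have "\<forall>\<^sub>F n in sequentially. ln W_lim - \<epsilon> / 2 < ln (W (real n) * ln (real n) powr 1)"
      using eps by (intro order_tendstoD(1)) auto
    then obtain n1 where n1: "\<And>n. n1 \<le> n \<Longrightarrow> ln W_lim - \<epsilon> / 2 < ln (W (real n) * ln (real n) powr 1)"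
      by (auto simp: eventually_sequentially)
    have "((\<lambda>u::real. ln (ln (exp u + 2)) - ln u) \<longlongrightarrow> 0) at_top" by real_asymp
    then have "\<forall>\<^sub>F u in at_top. ln (ln (exp u + 2)) - ln u < \<epsilon> / 2"
      using eps by (intro order_tendstoD(2)) auto
    then obtain u0 where u0: "\<And>u. u0 \<le> u \<Longrightarrow> ln (ln (exp u + 2)) - ln u < \<epsilon> / 2"
      by (auto simp: eventually_at_top_linorder)
    \<comment> \<open>Beyond \<open>u1\<close> both approximations, that of W by its limit and that
      of ln ln (e^u + 2) by ln u, are accurate to \<epsilon>/2. The primes below contribute at most
      D s u1, which tends to 0 with s.\<close>
    define u1 where "u1 = max 1 (max u0 (real n1))"
    have u1: "0 < u1" unfolding u1_def by simp
    define D where "D = (\<Sum>p\<in>primes_in 2 (exp u1 + 1). h' p)"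
    have D0: "0 \<le> D" unfolding D_def by (intro sum_nonneg h'0) (auto simp: primes_in_def)
    have large: "(\<Sum>p | p \<in> primes_le N \<and> ln (real p) \<le> u. h' p) \<le> ln u + c" if u: "u1 < u" for u N
    proof -
      define n where "n = nat (\<lfloor>exp u\<rfloor> + 1)"
      have "real n = of_int \<lfloor>exp u\<rfloor> + 1" unfolding n_def by (simp add: add_nonneg_pos)
      then have n: "exp u < real n" "real n \<le> exp u + 1" by linarith+
      have u': "u0 \<le> u" "real n1 \<le> u" "1 < u" using u unfolding u1_def by auto
      have "u + 1 \<le> exp u" using exp_ge_add_one_self[of u] by linarith
      then have nn1: "n1 \<le> n" and n2: "2 \<le> real n" using u' n by linarith+
      have "(\<Sum>p | p \<in> primes_le N \<and> ln (real p) \<le> u. h' p) \<le> (\<Sum>p\<in>primes_in 2 (real n). h' p)"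
      proof (intro sum_mono2)
        show "{p. p \<in> primes_le N \<and> ln (real p) \<le> u} \<subseteq> primes_in 2 (real n)"
        proof clarify
          fix p assume p: "prime p" "ln (real p) \<le> u"
          have "2 \<le> real p" using prime_ge_2_nat[OF p(1)] by simp
          moreover have "real p \<le> exp u" using p prime_gt_0_nat[OF p(1)] by (metis exp_le_cancel_iff exp_ln of_nat_0_less_iff)
          ultimately show "p \<in> primes_in 2 (real n)" using n p by (auto simp: primes_in_def)
        qed
      qed (rule finite_primes_in, auto simp: primes_in_def h'0)
      also have "\<dots> = - ln (W (real n))" by (rule lnW[symmetric])
      also have "\<dots> \<le> ln (ln (real n)) - ln W_lim + \<epsilon> / 2"
        using n1[OF nn1] W_pos[of "real n"] n2 by (simp add: ln_mult_pos)
      also have "ln (ln (real n)) \<le> ln (ln (exp u + 2))" using n n2 by (intro ln_mono) auto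
      also have "\<dots> \<le> ln u + \<epsilon> / 2" using u0[OF u'(1)] by simp
      finally show ?thesis unfolding c_def by simp
    qed
    have small: "(\<Sum>p | p \<in> primes_le N \<and> ln (real p) \<le> u. h' p) \<le> D" if u: "u \<le> u1" for u N
      unfolding D_def
    proof (intro sum_mono2)
      show "{p. p \<in> primes_le N \<and> ln (real p) \<le> u} \<subseteq> primes_in 2 (exp u1 + 1)"
      proof clarify
        fix p assume p: "prime p" "ln (real p) \<le> u"
        have "2 \<le> real p" using prime_ge_2_nat[OF p(1)] by simp
        moreover have "real p \<le> exp u1" using p u prime_gt_0_nat[OF p(1)]
          by (metis exp_le_cancel_iff exp_ln of_nat_0_less_iff order_trans)
        ultimately show "p \<in> primes_in 2 (exp u1 + 1)" using p by (auto simp: primes_in_def)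
      qed
    qed (rule finite_primes_in, auto simp: primes_in_def h'0)
    have bound: "0 \<le> (Gamma (1 + \<eta>) - 1) / \<eta> + c + D * (s * u1)" if s: "0 < s" "1 / \<eta> \<le> c - ln s" for s
    proof -
      have "ln ((1 - real (N + 1) powr - s) / s) \<le> (Gamma (1 + \<eta>) - 1) / \<eta> + (c - ln s) + D * (s * u1)" if N: "1 \<le> N" for N
      proof -
        have "ln ((1 - real (N + 1) powr - s) / s) \<le> (\<Sum>p\<in>primes_le N. - ln (1 - real p powr - (1 + s)))"
          by (rule sum_neg_ln_euler_ge[OF s(1) N])
        \<comment> \<open>Bernoulli with y = p^-s: each logarithm is at most p^-s times its value at
          s = 0, which is the untwisted weight h'.\<close>
        also have "\<dots> \<le> (\<Sum>p\<in>primes_le N. h' p * exp (- (s * ln (real p))))"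
        proof (intro sum_mono)
          fix p assume "p \<in> primes_le N"
          then have p: "1 < real p" using prime_gt_1_nat by auto
          define y where "y = exp (- (s * ln (real p)))"
          have y: "0 \<le> y" "y \<le> 1" unfolding y_def using p s by auto
          have "real p powr - (1 + s) = y * (1 / real p)"
            unfolding y_def powr_def using p by (simp add: algebra_simps exp_diff exp_minus) (simp add: field_simps exp_minus exp_add)
          moreover have "y * ln (1 - 1 / real p) \<le> ln (1 - y * (1 / real p))"
            using y p by (intro one_minus_mult_ge_powr) auto
          ultimately show "- ln (1 - real p powr - (1 + s)) \<le> h' p * exp (- (s * ln (real p)))"
            unfolding h'_def y_def[symmetric] by (simp add: mult.commute)
        qed
        also have "\<dots> \<le> (Gamma (1 + \<eta>) - 1) / \<eta> + (c - ln s) + D * (s * u1)"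
          using finite_primes_le h'0 D0 s eta u1 small large
          by (intro laplace_log_upper) (auto intro!: ln_ge_zero simp: Suc_le_eq prime_gt_0_nat)
        finally show ?thesis .
      qed
      moreover have "((\<lambda>N. ln ((1 - real (N + 1) powr - s) / s)) \<longlongrightarrow> ln ((1 - 0) / s)) sequentially"
      proof -
        have "((\<lambda>N. real (N + 1) powr - s) \<longlongrightarrow> 0) sequentially" using s by real_asymp
        then show ?thesis using s by (intro tendsto_intros) auto
      qed
      ultimately have "ln ((1 - 0) / s) \<le> (Gamma (1 + \<eta>) - 1) / \<eta> + (c - ln s) + D * (s * u1)"
        by (intro tendsto_upperbound[of "\<lambda>N. ln ((1 - real (N + 1) powr - s) / s)"])
           (auto simp: eventually_sequentially intro!: exI[of _ 1])
      then show ?thesis using s by (simp add: ln_divide_pos)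
    qed
    have "filterlim (\<lambda>s. c - ln s) at_top (at_right (0::real))" by real_asymp
    then have "\<forall>\<^sub>F s in at_right 0. 1 / \<eta> \<le> c - ln s" by (auto simp: filterlim_at_top)
    then have "\<forall>\<^sub>F s in at_right 0. 0 \<le> (Gamma (1 + \<eta>) - 1) / \<eta> + c + D * (s * u1)"
      using eventually_at_right_less[of 0] by eventually_elim (rule bound)
    moreover have "((\<lambda>s. (Gamma (1 + \<eta>) - 1) / \<eta> + c + D * (s * u1)) \<longlongrightarrow> (Gamma (1 + \<eta>) - 1) / \<eta> + c + D * (0 * u1)) (at_right 0)"
      by (intro tendsto_intros)
    ultimately have "0 \<le> (Gamma (1 + \<eta>) - 1) / \<eta> + c + D * (0 * u1)"
      by (intro tendsto_lowerbound[of "\<lambda>s. (Gamma (1 + \<eta>) - 1) / \<eta> + c + D * (s * u1)"]) auto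
    then show ?thesis unfolding c_def by simp
  qed
  have "0 \<le> (Gamma (1 + \<eta>) - 1) / \<eta> - ln W_lim" if "0 < \<eta>" for \<eta> :: real
    by (rule field_le_epsilon) (use main[OF that] in force)
  moreover have "((\<lambda>\<eta>. (Gamma (1 + \<eta>) - 1) / \<eta> - ln W_lim) \<longlongrightarrow> - euler_mascheroni - ln W_lim) (at_right 0)"
  proof -
    have "(Gamma has_field_derivative (Gamma 1 * Digamma 1)) (at (1::real))"
      by (rule has_field_derivative_Gamma) auto
    then have "((\<lambda>\<eta>. (Gamma (1 + \<eta>) - Gamma (1::real)) / \<eta>) \<longlongrightarrow> - euler_mascheroni) (at 0)"
      unfolding DERIV_def by simp
    then have "((\<lambda>\<eta>. (Gamma (1 + \<eta>) - 1) / \<eta>) \<longlongrightarrow> - euler_mascheroni) (at_right (0::real))"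
      by (auto simp: filterlim_at_split)
    then show ?thesis by (intro tendsto_intros)
  qed
  ultimately have "0 \<le> - euler_mascheroni - ln W_lim"
    by (intro tendsto_lowerbound[of "\<lambda>\<eta>. (Gamma (1 + \<eta>) - 1) / \<eta> - ln W_lim"])
       (auto intro: eventually_mono[OF eventually_at_right_less])
  then have "exp (ln W_lim) \<le> exp (- euler_mascheroni)" by simp
  then show ?thesis using W_lim_pos by simp
qed

context sieve_density begin

text \<open>The powers of ln z attached to \<open>W\<close> and to Mertens' product cancel in this
  quotient, so it is the limit of the partial singular products.\<close>

definition P_lim :: real where
  "P_lim = W_lim / sieve_density.W_lim (\<lambda>_. 1) 1 powr \<kappa>"

lemma singular_product:
  shows "convergent_prod (singular_factor \<omega> \<kappa>)" "prodinf (singular_factor \<omega> \<kappa>) = P_lim"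
    "0 < P_lim" "W_lim \<le> P_lim * exp (- (\<kappa> * euler_mascheroni))"
    and singular_partial: "(\<lambda>n. \<Prod>i\<le>n. singular_factor \<omega> \<kappa> i) \<longlonglongrightarrow> P_lim"
proof -
  obtain A L' where one: "sieve_density (\<lambda>_. 1) 1 2 A L'" using sieve_density_one by blast
  interpret one: sieve_density "\<lambda>_. 1" 1 2 A L' by fact
  show pos: "0 < P_lim" unfolding P_lim_def using W_lim_pos one.W_lim_pos by simp
  have "one.W_lim powr \<kappa> \<le> exp (- euler_mascheroni) powr \<kappa>"
    using kappa one.W_lim_pos by (intro powr_mono2 mertens_constant[OF one]) auto
  also have "\<dots> = exp (- (\<kappa> * euler_mascheroni))" by (simp add: powr_def)
  finally have "P_lim * one.W_lim powr \<kappa> \<le> P_lim * exp (- (\<kappa> * euler_mascheroni))"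
    using pos by (intro mult_left_mono) auto
  then show "W_lim \<le> P_lim * exp (- (\<kappa> * euler_mascheroni))"
    unfolding P_lim_def using one.W_lim_pos by simp
  \<comment> \<open>The argument is Suc n because \<open>W\<close> multiplies over primes strictly
    below it.\<close>
  have eq: "(\<Prod>i\<le>n. singular_factor \<omega> \<kappa> i) = W (real (Suc n)) * ln (real (Suc n)) powr \<kappa> / (one.W (real (Suc n)) * ln (real (Suc n)) powr 1) powr \<kappa>"
    if n: "1 \<le> n" for n
  proof -
    have set: "primes_in 2 (real (Suc n)) = {i \<in> {..n}. prime i}"
      unfolding primes_in_def using prime_ge_2_nat by (auto simp: less_Suc_eq_le)
    have "(\<Prod>i\<le>n. singular_factor \<omega> \<kappa> i) = (\<Prod>i\<in>primes_in 2 (real (Suc n)). (1 - h i) * (1 - one.h i) powr - \<kappa>)"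
      unfolding set singular_factor_def h_def one.h_def by (rule prod.inter_filter[symmetric]) simp
    also have "\<dots> = W (real (Suc n)) * (\<Prod>i\<in>primes_in 2 (real (Suc n)). (1 - one.h i) powr - \<kappa>)"
      unfolding W_def by (rule prod.distrib)
    also have "(\<Prod>i\<in>primes_in 2 (real (Suc n)). (1 - one.h i) powr - \<kappa>) = one.W (real (Suc n)) powr - \<kappa>"
      unfolding one.W_def by (rule prod_powr_distrib[symmetric])
    also have "W (real (Suc n)) * one.W (real (Suc n)) powr - \<kappa> = W (real (Suc n)) * ln (real (Suc n)) powr \<kappa> / (one.W (real (Suc n)) * ln (real (Suc n)) powr 1) powr \<kappa>"
    proof -
      have "0 < ln (real (Suc n))" using n by simp
      then show ?thesis using one.W_pos[of "real (Suc n)"] by (simp add: powr_mult powr_minus field_simps)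
    qed
    finally show ?thesis .
  qed
  have "(\<lambda>n. W (real (Suc n)) * ln (real (Suc n)) powr \<kappa> / (one.W (real (Suc n)) * ln (real (Suc n)) powr 1) powr \<kappa>) \<longlonglongrightarrow> P_lim"
    unfolding P_lim_def using W_lim[THEN LIMSEQ_Suc] one.W_lim[THEN LIMSEQ_Suc] one.W_lim_pos
    by (intro tendsto_intros) auto
  then show lim: "(\<lambda>n. \<Prod>i\<le>n. singular_factor \<omega> \<kappa> i) \<longlonglongrightarrow> P_lim"
    by (rule Lim_transform_eventually) (auto simp: eq eventually_sequentially intro!: exI[of _ 1])
  have nz: "singular_factor \<omega> \<kappa> i \<noteq> 0" for i
    unfolding singular_factor_def using h_less_1[of i] prime_gt_1_nat[of i] unfolding h_def by auto
  show conv: "convergent_prod (singular_factor \<omega> \<kappa>)"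
    using convergent_prod_iff_nz_lim[of "singular_factor \<omega> \<kappa>"] nz lim pos by force
  show "prodinf (singular_factor \<omega> \<kappa>) = P_lim"
    using convergent_prod_LIMSEQ[OF conv] lim LIMSEQ_unique by blast
qed

end

section \<open>Sums over squarefree numbers with generalized primes\<close>

text \<open>Logarithms are arbitrary positive reals on an abstract index set, so that elements
  corresponding to no integer can be adjoined. A finite set of indices plays the part of a
  squarefree number.\<close>

locale generalized_primes =
  fixes I :: "'i set" and l g :: "'i \<Rightarrow> real"
  assumes l_pos: "\<And>i. i \<in> I \<Longrightarrow> 0 < l i"
    and g_nonneg: "\<And>i. i \<in> I \<Longrightarrow> 0 \<le> g i"
    and finite_below: "\<And>u. finite {i \<in> I. l i < u}"
begin

definition DD :: "real \<Rightarrow> 'i set set" where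
  "DD u = {D. D \<subseteq> {i \<in> I. l i < u} \<and> sum l D < u}"

definition G :: "real \<Rightarrow> real" where
  "G u = (\<Sum>D\<in>DD u. prod g D)"

definition T :: "real \<Rightarrow> real" where
  "T u = (\<Sum>D\<in>DD u. prod g D * (u - sum l D))"

text \<open>For actual primes, where g = h / (1 - h), this is h p times log p, so \<open>V\<close>
  is the sum controlled by \<open>(\<Omega>\<^sub>2)\<close>.\<close>

definition a :: "'i \<Rightarrow> real" where
  "a i = l i * g i / (1 + g i)"

definition V :: "real \<Rightarrow> real" where
  "V y = (\<Sum>i\<in>{i \<in> I. l i < y}. a i)"

text \<open>Collects the boundary effect at remaining length y: elements that still fit once but not
  twice.\<close>

definition b :: "real \<Rightarrow> real" where
  "b y = (\<Sum>i\<in>{i \<in> I. l i < y \<and> y \<le> 2 * l i}. g i * a i)"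

lemma finite_DD: "finite (DD u)"
  unfolding DD_def using finite_below[of u] by (rule_tac finite_subset[of _ "Pow {i \<in> I. l i < u}"]) auto

lemma DD_finite: "D \<in> DD u \<Longrightarrow> finite D"
  unfolding DD_def using finite_below[of u] finite_subset by blast

lemma DD_subset: "D \<in> DD u \<Longrightarrow> D \<subseteq> I"
  unfolding DD_def by blast

lemma sum_l_nonneg: "D \<subseteq> I \<Longrightarrow> 0 \<le> sum l D"
  by (intro sum_nonneg) (use l_pos in force)

lemma prod_g_nonneg: "D \<subseteq> I \<Longrightarrow> 0 \<le> prod g D"
  by (intro prod_nonneg) (use g_nonneg in force)

lemma a_nonneg: "i \<in> I \<Longrightarrow> 0 \<le> a i"
  unfolding a_def using l_pos[of i] g_nonneg[of i] by auto

lemma DD_iff: "D \<in> DD u \<longleftrightarrow> finite D \<and> D \<subseteq> I \<and> sum l D < u"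
proof
  assume D: "finite D \<and> D \<subseteq> I \<and> sum l D < u"
  have "l i < u" if "i \<in> D" for i
  proof -
    have "l i \<le> sum l D" using D that l_pos by (intro member_le_sum) force+
    then show ?thesis using D by linarith
  qed
  then show "D \<in> DD u" using D unfolding DD_def by blast
next
  assume D: "D \<in> DD u"
  then have "sum l D < u" unfolding DD_def by blast
  then show "finite D \<and> D \<subseteq> I \<and> sum l D < u" using DD_finite[OF D] DD_subset[OF D] by blast
qed

lemma empty_in_DD: "0 < u \<Longrightarrow> {} \<in> DD u"
  by (simp add: DD_iff)

lemma DD_mono: "u \<le> v \<Longrightarrow> DD u \<subseteq> DD v"
  by (auto simp: DD_iff)

lemma G_ge_1: assumes "0 < u" shows "1 \<le> G u"
proof -
  have "(\<Sum>D\<in>{{}}. prod g D) \<le> G u"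
    unfolding G_def using empty_in_DD[OF assms] DD_subset prod_g_nonneg
    by (intro sum_mono2 finite_DD) blast+
  then show ?thesis by simp
qed

lemma T_nonneg: "0 \<le> T u"
  unfolding T_def
  by (intro sum_nonneg mult_nonneg_nonneg) (auto simp: DD_iff prod_g_nonneg)

lemma V_nonneg: "0 \<le> V y"
  unfolding V_def by (intro sum_nonneg) (auto simp: a_nonneg)

text \<open>For c = 1 these are the ways to single out one element i of an admissible set; for c = 2
  there must be room for i a second time.\<close>

definition pairs :: "real \<Rightarrow> real \<Rightarrow> ('i set \<times> 'i) set" where
  "pairs c u = (SIGMA E:DD u. {i \<in> I. i \<notin> E \<and> c * l i + sum l E < u})"

lemma finite_pairs: assumes "1 \<le> c" shows "finite (pairs c u)"
proof -
  have "{i \<in> I. i \<notin> E \<and> c * l i + sum l E < u} \<subseteq> {i \<in> I. l i < u}" if "E \<in> DD u" for E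
  proof clarify
    fix i assume i: "i \<in> I" "c * l i + sum l E < u"
    have "1 * l i \<le> c * l i" using assms l_pos[OF i(1)] by (intro mult_right_mono) auto
    moreover have "0 \<le> sum l E" using DD_subset that sum_l_nonneg by blast
    ultimately show "l i < u" using i by linarith
  qed
  then have "finite {i \<in> I. i \<notin> E \<and> c * l i + sum l E < u}" if "E \<in> DD u" for E
    using that finite_subset[OF _ finite_below[of u]] by meson
  then show ?thesis
    unfolding pairs_def by (intro finite_SigmaI finite_DD)
qed

lemma sum_weighted_l:
  "(\<Sum>D\<in>DD u. prod g D * sum l D) = (\<Sum>(E, i)\<in>pairs 1 u. prod g E * (g i * l i))"
proof -
  have "(\<Sum>D\<in>DD u. prod g D * sum l D) = (\<Sum>(D, i)\<in>(SIGMA D:DD u. D). prod g D * l i)"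
    by (subst sum.Sigma[symmetric]) (auto simp: finite_DD DD_finite sum_distrib_left)
  also have "\<dots> = (\<Sum>(E, i)\<in>pairs 1 u. prod g E * (g i * l i))"
  proof (rule sum.reindex_bij_witness[where i = "\<lambda>(E, i). (insert i E, i)" and j = "\<lambda>(D, i). (D - {i}, i)"], goal_cases)
    case (1 x) then show ?case by (auto simp: pairs_def)
  next
    case (2 x)
    then obtain D i where x: "x = (D, i)" "D \<in> DD u" "i \<in> D" by auto
    have "sum l D = l i + sum l (D - {i})" by (rule sum.remove[OF DD_finite]) (use x in auto)
    moreover have "0 < l i" using x DD_subset l_pos by blast
    ultimately show ?case using x by (auto simp: pairs_def DD_iff)
  next
    case (3 x) then show ?case by (auto simp: pairs_def)
  next
    case (4 x)
    then obtain E i where x: "x = (E, i)" "E \<in> DD u" "i \<notin> E" "i \<in> I" "l i + sum l E < u"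
      by (auto simp: pairs_def)
    then show ?case by (auto simp: DD_iff)
  next
    case (5 x)
    then obtain D i where x: "x = (D, i)" "D \<in> DD u" "i \<in> D" by auto
    have "prod g D = g i * prod g (D - {i})" by (rule prod.remove[OF DD_finite]) (use x in auto)
    then show ?case using x by (simp add: mult_ac)
  qed
  finally show ?thesis .
qed

text \<open>\<open>V (u - sum l E)\<close> runs over all i that fit beside E, including those
  already in E. Removing such an i from E frees its length once, which is why those terms become
  pairs with doubled length and an additional factor g i.\<close>

lemma sum_weighted_V:
  "(\<Sum>E\<in>DD u. prod g E * V (u - sum l E)) =
     (\<Sum>(E, i)\<in>pairs 1 u. prod g E * a i) + (\<Sum>(E, i)\<in>pairs 2 u. prod g E * (g i * a i))"
proof -
  define B where "B = (SIGMA E:DD u. {i \<in> I. i \<in> E \<and> l i + sum l E < u})"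
  have finB: "finite B" unfolding B_def
    by (intro finite_SigmaI finite_DD) (auto intro: finite_subset[OF _ DD_finite])
  have *: "(SIGMA E:DD u. {i \<in> I. l i < u - sum l E}) = pairs 1 u \<union> B"
    by (auto simp: pairs_def B_def)
  have "(\<Sum>E\<in>DD u. prod g E * V (u - sum l E))
      = (\<Sum>(E, i)\<in>(SIGMA E:DD u. {i \<in> I. l i < u - sum l E}). prod g E * a i)"
    by (subst sum.Sigma[symmetric]) (auto simp: finite_DD finite_below V_def sum_distrib_left)
  also have "\<dots> = (\<Sum>(E, i)\<in>pairs 1 u. prod g E * a i) + (\<Sum>(E, i)\<in>B. prod g E * a i)"
    unfolding * by (intro sum.union_disjoint finB finite_pairs) (auto simp: pairs_def B_def)
  also have "(\<Sum>(E, i)\<in>B. prod g E * a i) = (\<Sum>(E, i)\<in>pairs 2 u. prod g E * (g i * a i))"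
  proof (rule sum.reindex_bij_witness[where i = "\<lambda>(E, i). (insert i E, i)" and j = "\<lambda>(D, i). (D - {i}, i)"], goal_cases)
    case (1 x) then show ?case by (auto simp: B_def)
  next
    case (2 x)
    then obtain D i where x: "x = (D, i)" "D \<in> DD u" "i \<in> D" "l i + sum l D < u" by (auto simp: B_def)
    have "sum l D = l i + sum l (D - {i})" by (rule sum.remove[OF DD_finite]) (use x in auto)
    moreover have "0 < l i" using x DD_subset l_pos by blast
    ultimately show ?case using x by (auto simp: pairs_def DD_iff)
  next
    case (3 x) then show ?case by (auto simp: pairs_def)
  next
    case (4 x)
    then obtain E i where x: "x = (E, i)" "E \<in> DD u" "i \<notin> E" "i \<in> I" "2 * l i + sum l E < u"
      by (auto simp: pairs_def)
    then show ?case using l_pos[of i] by (auto simp: DD_iff B_def)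
  next
    case (5 x)
    then obtain D i where x: "x = (D, i)" "D \<in> DD u" "i \<in> D" by (auto simp: B_def)
    have "prod g D = g i * prod g (D - {i})" by (rule prod.remove[OF DD_finite]) (use x in auto)
    then show ?case using x by (simp add: mult_ac)
  qed
  finally show ?thesis .
qed

lemma pairs_antimono: "pairs 2 u \<subseteq> pairs 1 u"
proof -
  have "l i \<le> 2 * l i" if "i \<in> I" for i using l_pos[OF that] by simp
  then show ?thesis unfolding pairs_def by (fastforce intro: le_less_trans)
qed

text \<open>The analogue of Selberg's symmetry \<open>\<Sum> g(d) log d\<close>: splitting off one prime from \<open>d\<close> and
  writing \<open>g log p = a + g a\<close>, the terms with \<open>p | d\<close> telescope except near the boundary.\<close>

lemma sum_weighted_l_split:
  "(\<Sum>D\<in>DD u. prod g D * sum l D) =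
     (\<Sum>E\<in>DD u. prod g E * V (u - sum l E)) + (\<Sum>(E, i)\<in>pairs 1 u - pairs 2 u. prod g E * (g i * a i))"
proof -
  have eq: "g i * l i = a i + g i * a i" if "i \<in> I" for i
  proof -
    have "a i * (1 + g i) = l i * g i" using g_nonneg[OF that] unfolding a_def by simp
    then show ?thesis by (simp add: algebra_simps)
  qed
  have "(\<Sum>(E, i)\<in>pairs 1 u. prod g E * (g i * l i)) =
        (\<Sum>(E, i)\<in>pairs 1 u. prod g E * a i + prod g E * (g i * a i))"
    by (intro sum.cong refl) (auto simp: pairs_def eq distrib_left)
  also have "\<dots> = (\<Sum>(E, i)\<in>pairs 1 u. prod g E * a i) + (\<Sum>(E, i)\<in>pairs 1 u. prod g E * (g i * a i))"
    by (simp add: sum.distrib case_prod_unfold)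
  also have "(\<Sum>(E, i)\<in>pairs 1 u. prod g E * (g i * a i)) =
      (\<Sum>(E, i)\<in>pairs 1 u - pairs 2 u. prod g E * (g i * a i)) + (\<Sum>(E, i)\<in>pairs 2 u. prod g E * (g i * a i))"
    by (intro sum.subset_diff pairs_antimono finite_pairs) simp
  finally show ?thesis unfolding sum_weighted_l sum_weighted_V by simp
qed

lemma sum_weighted_l_ge:
  "(\<Sum>E\<in>DD u. prod g E * V (u - sum l E)) \<le> (\<Sum>D\<in>DD u. prod g D * sum l D)"
proof -
  have "0 \<le> (\<Sum>(E, i)\<in>pairs 1 u - pairs 2 u. prod g E * (g i * a i))"
    by (intro sum_nonneg) (auto simp: pairs_def DD_iff prod_g_nonneg g_nonneg a_nonneg intro!: mult_nonneg_nonneg)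
  then show ?thesis unfolding sum_weighted_l_split by simp
qed

text \<open>The uncancelled pairs satisfy l i < y \<le> 2 l i for y = u - sum l E; allowing i to lie
  in E as well turns their sum into \<open>b y\<close>.\<close>

lemma sum_weighted_l_le:
  "(\<Sum>D\<in>DD u. prod g D * sum l D) \<le> (\<Sum>E\<in>DD u. prod g E * (V (u - sum l E) + b (u - sum l E)))"
proof -
  let ?S = "SIGMA E:DD u. {i \<in> I. l i < u - sum l E \<and> u - sum l E \<le> 2 * l i}"
  have fin: "finite {i \<in> I. l i < y \<and> y \<le> 2 * l i}" for y
    using finite_below[of y] by (rule rev_finite_subset) auto
  have "(\<Sum>(E, i)\<in>pairs 1 u - pairs 2 u. prod g E * (g i * a i)) \<le> (\<Sum>(E, i)\<in>?S. prod g E * (g i * a i))"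
    by (intro sum_mono2 finite_SigmaI finite_DD fin)
       (auto simp: pairs_def DD_iff prod_g_nonneg g_nonneg a_nonneg intro!: mult_nonneg_nonneg)
  also have "\<dots> = (\<Sum>E\<in>DD u. prod g E * b (u - sum l E))"
    by (subst sum.Sigma[symmetric]) (auto simp: finite_DD fin b_def sum_distrib_left)
  finally show ?thesis unfolding sum_weighted_l_split by (simp add: distrib_left sum.distrib)
qed

lemma weighted_l_eq: "(\<Sum>D\<in>DD u. prod g D * sum l D) = u * G u - T u"
proof -
  have "u * G u - T u = (\<Sum>D\<in>DD u. u * prod g D - prod g D * (u - sum l D))"
    unfolding G_def T_def by (simp only: sum_distrib_left sum_subtractf)
  also have "\<dots> = (\<Sum>D\<in>DD u. prod g D * sum l D)"
    by (rule sum.cong[OF refl]) (simp add: right_diff_distrib)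
  finally show ?thesis ..
qed

text \<open>Summing the bound for \<open>V + b\<close> over E against the weights turns y = u - sum
  l E into \<open>T u\<close>. The outcome is the differential inequality (u - \<delta>) T' \<le>
  (\<kappa> + 1) T, as G is the derivative of T.\<close>

lemma T_ge:
  assumes "\<And>y. 0 < y \<Longrightarrow> V y + b y \<le> \<kappa> * y + \<delta>"
  shows "(u - \<delta>) * G u \<le> (\<kappa> + 1) * T u"
proof -
  have "u * G u - T u \<le> (\<Sum>E\<in>DD u. prod g E * (\<kappa> * (u - sum l E) + \<delta>))"
    using sum_weighted_l_le[of u] unfolding weighted_l_eq
    by (rule order_trans) (intro sum_mono mult_left_mono assms, auto simp: DD_iff prod_g_nonneg)
  also have "\<dots> = \<kappa> * T u + \<delta> * G u"
    unfolding G_def T_def sum_distrib_left sum.distrib[symmetric]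
    by (intro sum.cong refl) (simp add: algebra_simps)
  finally show ?thesis by (simp add: algebra_simps)
qed

lemma T_le:
  assumes "\<And>y. 0 < y \<Longrightarrow> \<kappa> * y - B \<le> V y"
  shows "(\<kappa> + 1) * T u \<le> (u + B) * G u"
proof -
  have "\<kappa> * T u - B * G u = (\<Sum>E\<in>DD u. prod g E * (\<kappa> * (u - sum l E) - B))"
    unfolding G_def T_def sum_distrib_left sum_subtractf[symmetric]
    by (intro sum.cong refl) (simp add: algebra_simps)
  also have "\<dots> \<le> u * G u - T u"
    using sum_weighted_l_ge[of u] unfolding weighted_l_eq
    by (rule order_trans[rotated]) (intro sum_mono mult_left_mono assms, auto simp: DD_iff prod_g_nonneg)
  finally show ?thesis by (simp add: algebra_simps)
qed

section \<open>T as a piecewise linear function and its growth\<close>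

lemma T_eq_max:
  assumes "x \<le> v"
  shows "T x = (\<Sum>D\<in>DD v. prod g D * max 0 (x - sum l D))"
proof -
  have "(\<Sum>D\<in>DD v. prod g D * max 0 (x - sum l D)) = (\<Sum>D\<in>DD x. prod g D * max 0 (x - sum l D))"
    using DD_mono[OF assms] by (intro sum.mono_neutral_right finite_DD) (auto simp: DD_iff)
  also have "\<dots> = T x" unfolding T_def by (intro sum.cong) (auto simp: DD_iff)
  finally show ?thesis ..
qed

lemma G_eq_step:
  assumes "x \<le> v"
  shows "G x = (\<Sum>D\<in>DD v. prod g D * (if sum l D < x then 1 else 0))"
proof -
  have "(\<Sum>D\<in>DD v. prod g D * (if sum l D < x then 1 else 0)) = (\<Sum>D\<in>DD x. prod g D * (if sum l D < x then 1 else 0))"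
    using DD_mono[OF assms] by (intro sum.mono_neutral_right finite_DD) (auto simp: DD_iff)
  also have "\<dots> = G x" unfolding G_def by (intro sum.cong) (auto simp: DD_iff)
  finally show ?thesis ..
qed

lemma T_deriv:
  assumes "x < v" "x \<notin> sum l ` DD v"
  shows "(T has_real_derivative G x) (at x)"
proof -
  have D: "((\<lambda>x. max 0 (x - c)) has_real_derivative (if c < x then 1 else 0)) (at x)" if "x \<noteq> c" for c :: real
  proof (cases "c < x")
    case True
    have "((\<lambda>x. x - c) has_real_derivative 1) (at x)" by (auto intro!: derivative_eq_intros)
    then have "((\<lambda>x. max 0 (x - c)) has_real_derivative 1) (at x)"
      by (rule has_field_derivative_transform_within_open[where S = "{c<..}"]) (use True in auto)
    then show ?thesis using True by simp
  next
    case False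
    have "((\<lambda>x. 0) has_real_derivative 0) (at x)" by (auto intro!: derivative_eq_intros)
    then have "((\<lambda>x. max 0 (x - c)) has_real_derivative 0) (at x)"
      by (rule has_field_derivative_transform_within_open[where S = "{..<c}"]) (use False that in auto)
    then show ?thesis using False by simp
  qed
  have "((\<lambda>x. \<Sum>D\<in>DD v. prod g D * max 0 (x - sum l D)) has_real_derivative
        (\<Sum>D\<in>DD v. prod g D * (if sum l D < x then 1 else 0))) (at x)"
    using assms by (intro DERIV_sum DERIV_cmult D) auto
  then show ?thesis
    unfolding G_eq_step[OF less_imp_le[OF assms(1)]]
    by (rule has_field_derivative_transform_within_open[where S = "{..<v}"])
       (use assms in \<open>auto intro!: T_eq_max[symmetric]\<close>)
qed

lemma T_continuous_on: "continuous_on {..v} T"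
proof -
  have "continuous_on {..v} (\<lambda>x. \<Sum>D\<in>DD v. prod g D * max 0 (x - sum l D))"
    by (intro continuous_intros)
  then show ?thesis by (rule continuous_on_eq) (auto intro!: T_eq_max[symmetric])
qed

text \<open>Integrated form of \<open>T_ge\<close>: the derivative of the quotient is (x -
  \<delta>)^(-\<kappa>-2) times (x - \<delta>) G - (\<kappa> + 1) T, which is nonpositive.\<close>

lemma T_growth:
  assumes bound: "\<And>y. 0 < y \<Longrightarrow> V y + b y \<le> \<kappa> * y + \<delta>"
    and "\<delta> < u" "u \<le> v"
  shows "T v / (v - \<delta>) powr (\<kappa> + 1) \<le> T u / (u - \<delta>) powr (\<kappa> + 1)"
proof -
  define F where "F x = T x * (x - \<delta>) powr (- \<kappa> - 1)" for x
  define F' where "F' x = G x * (x - \<delta>) powr (- \<kappa> - 1) + T x * ((- \<kappa> - 1) * (x - \<delta>) powr (- \<kappa> - 2))" for x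
  have deriv: "(F has_real_derivative F' x) (at x)"
    if "x \<in> {u<..<v}" "x \<notin> sum l ` DD v" for x
  proof -
    have "((\<lambda>x. (x - \<delta>) powr (- \<kappa> - 1)) has_real_derivative (- \<kappa> - 1) * (x - \<delta>) powr (- \<kappa> - 1 - 1) * 1) (at x)"
      using that assms(2) by (intro derivative_eq_intros has_real_derivative_powr[THEN DERIV_chain2] refl | simp)+
    moreover have "- \<kappa> - 1 - 1 = - \<kappa> - 2" by simp
    ultimately have "((\<lambda>x. (x - \<delta>) powr (- \<kappa> - 1)) has_real_derivative (- \<kappa> - 1) * (x - \<delta>) powr (- \<kappa> - 2)) (at x)"
      by (simp del: diff_diff_eq)
    from DERIV_mult[OF T_deriv[of x v] this] that show ?thesis
      unfolding F_def[abs_def] F'_def by (simp add: algebra_simps)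
  qed
  have cont: "continuous_on {u..v} F"
    unfolding F_def using assms
    by (intro continuous_intros continuous_on_subset[OF T_continuous_on[of v]]) auto
  \<comment> \<open>T has corners at the finitely many values of \<open>sum l\<close>, so the
    derivative is only required off a finite set.\<close>
  have "(F' has_integral (F v - F u)) {u..v}"
    by (rule fundamental_theorem_of_calculus_interior_strong[where S = "sum l ` DD v"])
       (use deriv cont assms finite_DD in \<open>auto simp: has_real_derivative_iff_has_vector_derivative\<close>)
  moreover have "((\<lambda>x. 0::real) has_integral 0) {u..v}" by simp
  ultimately have "F v - F u \<le> 0"
  proof (rule has_integral_le)
    fix x assume x: "x \<in> {u..v}"
    have "(x - \<delta>) powr (- \<kappa> - 1) = (x - \<delta>) * (x - \<delta>) powr (- \<kappa> - 2)"
    proof -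
      have "1 + (- \<kappa> - 2) = - \<kappa> - 1" by simp
      then show ?thesis using powr_mult_base[of "x - \<delta>" "- \<kappa> - 2"] x assms(2) by (metis atLeastAtMost_iff diff_ge_0_iff_ge dual_order.trans less_imp_le)
    qed
    then have "F' x = (x - \<delta>) powr (- \<kappa> - 2) * ((x - \<delta>) * G x - (\<kappa> + 1) * T x)"
      unfolding F'_def by (simp only:) (simp add: algebra_simps)
    also have "\<dots> \<le> 0"
      using T_ge[OF bound, where u = x] by (intro mult_nonneg_nonpos) auto
    finally show "F' x \<le> 0" .
  qed
  moreover have "F x = T x / (x - \<delta>) powr (\<kappa> + 1)" for x
  proof -
    have "- \<kappa> - 1 = - (\<kappa> + 1)" by simp
    then show ?thesis unfolding F_def using powr_minus_divide[of "x - \<delta>" "\<kappa> + 1"] by simp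
  qed
  ultimately show ?thesis by simp
qed


lemma T_mono: "u \<le> v \<Longrightarrow> T u \<le> T v"
  unfolding T_eq_max[of u v] T_eq_max[OF order_refl, of v]
  by (intro sum_mono mult_left_mono) (auto simp: DD_iff prod_g_nonneg)

lemma sum_Pow_le_T:
  assumes "finite J" "J \<subseteq> I"
  shows "(\<Sum>D\<in>Pow J. prod g D * max 0 (x - sum l D)) \<le> T x"
proof -
  have "(\<Sum>D\<in>Pow J. prod g D * max 0 (x - sum l D)) = (\<Sum>D\<in>Pow J \<inter> DD x. prod g D * max 0 (x - sum l D))"
  proof (intro sum.mono_neutral_right ballI)
    fix D assume D: "D \<in> Pow J - Pow J \<inter> DD x"
    then have "finite D" "D \<subseteq> I" using assms finite_subset[of D J] by auto
    then have "\<not> sum l D < x" using D DD_iff by blast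
    then show "prod g D * max 0 (x - sum l D) = 0" by simp
  qed (use assms in auto)
  also have "\<dots> = (\<Sum>D\<in>Pow J \<inter> DD x. prod g D * (x - sum l D))"
    by (intro sum.cong) (auto simp: DD_iff)
  also have "\<dots> \<le> T x"
    unfolding T_def by (intro sum_mono2 finite_DD) (auto simp: DD_iff prod_g_nonneg intro!: mult_nonneg_nonneg)
  finally show ?thesis .
qed

end

text \<open>Over the whole half-line the integral is exp (-c). Hence e^(-s log d) is the Laplace
  transform of the ramp by which d enters \<open>T\<close>, and an Euler product is the transform of
  T.\<close>

lemma integral_ramp_exp_ge:
  fixes c R :: real
  assumes "0 \<le> c" "c \<le> R"
  shows "exp (- c) - (R + 1) * exp (- R) \<le> integral {0..R} (\<lambda>t. max 0 (t - c) * exp (- t))"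
proof -
  have "((\<lambda>t. (t - c) * exp (- t)) has_integral (- (R - c + 1) * exp (- R) - (- (c - c + 1) * exp (- c)))) {c..R}"
    by (rule fundamental_theorem_of_calculus[OF assms(2)])
       (auto intro!: derivative_eq_intros simp: has_real_derivative_iff_has_vector_derivative[symmetric] algebra_simps)
  then have i1: "((\<lambda>t. max 0 (t - c) * exp (- t)) has_integral (- (R - c + 1) * exp (- R) - (- (c - c + 1) * exp (- c)))) {c..R}"
    by (rule has_integral_eq[rotated]) auto
  have i2: "((\<lambda>t. max 0 (t - c) * exp (- t)) has_integral integral {0..R} (\<lambda>t. max 0 (t - c) * exp (- t))) {0..R}"
    by (intro integrable_integral integrable_continuous_interval continuous_intros)
  have "- (R - c + 1) * exp (- R) - (- (c - c + 1) * exp (- c)) \<le> integral {0..R} (\<lambda>t. max 0 (t - c) * exp (- t))"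
    by (rule has_integral_subset_le[OF _ i1 i2]) (use assms in auto)
  moreover have "(R - c + 1) * exp (- R) \<le> (R + 1) * exp (- R)" using assms by (intro mult_right_mono) auto
  ultimately show ?thesis by (simp add: algebra_simps)
qed

context generalized_primes begin

text \<open>The product is at most s times the Laplace transform of T. Up to u, T is at most T u;
  beyond u, \<open>T_growth\<close> bounds it by a power, whose transform is the Gamma
  factor.\<close>

lemma euler_product_le_T:
  assumes bound: "\<And>y. 0 < y \<Longrightarrow> V y + b y \<le> \<kappa> * y + \<delta>"
    and "0 \<le> \<delta>" "\<delta> < u" "0 < s" "0 \<le> \<kappa>" and J: "finite J" "J \<subseteq> I"
  shows "(\<Prod>i\<in>J. 1 + g i * exp (- (s * l i))) \<le>
           s * T u + T u / (u - \<delta>) powr (\<kappa> + 1) * Gamma (\<kappa> + 2) * s powr (- \<kappa>)"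
proof -
  define c where "c = T u / (u - \<delta>) powr (\<kappa> + 1)"
  define M where "M = Max ((\<lambda>D. s * sum l D) ` Pow J)"
  have fin: "finite (Pow J)" using J by simp
  have c0: "0 \<le> c" unfolding c_def using T_nonneg by simp
  \<comment> \<open>Adding both bounds instead of splitting the integral is harmless: the term from
    \<open>T u\<close> becomes s T u, negligible against s^-\<kappa> as s tends to 0.\<close>
  have Tle: "T x \<le> T u + c * x powr (\<kappa> + 1)" if "0 \<le> x" for x
  proof (cases "x \<le> u")
    case True
    then show ?thesis using T_mono[OF True] c0 by (simp add: add_increasing2)
  next
    case False
    then have "T x / (x - \<delta>) powr (\<kappa> + 1) \<le> c"
      unfolding c_def using assms by (intro T_growth) auto
    then have "T x \<le> c * (x - \<delta>) powr (\<kappa> + 1)"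
      using False assms by (simp add: divide_le_eq split: if_splits)
    also have "\<dots> \<le> c * x powr (\<kappa> + 1)"
      using c0 False assms by (intro mult_left_mono powr_mono2) auto
    finally show ?thesis using T_nonneg[of u] by simp
  qed
  have le: "(\<Sum>D\<in>Pow J. prod g D * (exp (- (s * sum l D)) - (R + 1) * exp (- R)))
          \<le> s * T u + c * s powr (- \<kappa>) * Gamma (\<kappa> + 2)" if R: "R \<ge> M" "0 \<le> R" for R
  proof -
    have RD: "s * sum l D \<le> R" if "D \<in> Pow J" for D
    proof -
      have "s * sum l D \<le> M" unfolding M_def using fin that by (intro Max_ge) blast+
      then show ?thesis using R by simp
    qed
    have int1: "((\<lambda>t::real. exp (- t)) has_integral (- exp (- R) - (- exp (- 0)))) {0..R}"
      by (rule fundamental_theorem_of_calculus[OF R(2)])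
         (auto intro!: derivative_eq_intros simp: has_real_derivative_iff_has_vector_derivative[symmetric])
    have int2: "((\<lambda>t. t powr (\<kappa> + 2 - 1) / exp t) has_integral Gamma (\<kappa> + 2)) {0..}"
      using assms by (intro Gamma_integral_real) auto
    have int2': "(\<lambda>t. t powr (\<kappa> + 2 - 1) / exp t) integrable_on {0..R}"
      by (rule integrable_on_subinterval[OF has_integral_integrable[OF int2]]) auto
    have int2'': "integral {0..R} (\<lambda>t. t powr (\<kappa> + 2 - 1) / exp t) \<le> Gamma (\<kappa> + 2)"
      by (rule has_integral_subset_le[OF _ integrable_integral[OF int2'] int2]) auto
    have "(\<Sum>D\<in>Pow J. prod g D * (exp (- (s * sum l D)) - (R + 1) * exp (- R)))
        \<le> (\<Sum>D\<in>Pow J. prod g D * integral {0..R} (\<lambda>t. max 0 (t - s * sum l D) * exp (- t)))"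
    proof (intro sum_mono mult_left_mono integral_ramp_exp_ge)
      fix D assume D: "D \<in> Pow J"
      then have "D \<subseteq> I" using J by blast
      then show "0 \<le> s * sum l D" "0 \<le> prod g D" using prod_g_nonneg sum_l_nonneg \<open>0 < s\<close> by auto
      show "s * sum l D \<le> R" by (rule RD[OF D])
    qed
    also have "\<dots> = integral {0..R} (\<lambda>t. \<Sum>D\<in>Pow J. prod g D * (max 0 (t - s * sum l D) * exp (- t)))"
      by (subst integral_sum[OF fin])
         (auto intro!: integrable_continuous_interval continuous_intros)
    also have "\<dots> \<le> integral {0..R} (\<lambda>t. s * T u * exp (- t) + c * s powr (- \<kappa>) * (t powr (\<kappa> + 2 - 1) / exp t))"
    proof (rule integral_le)
      show "(\<lambda>t. \<Sum>D\<in>Pow J. prod g D * (max 0 (t - s * sum l D) * exp (- t))) integrable_on {0..R}"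
        by (intro integrable_continuous_interval continuous_intros)
      show "(\<lambda>t. s * T u * exp (- t) + c * s powr (- \<kappa>) * (t powr (\<kappa> + 2 - 1) / exp t)) integrable_on {0..R}"
        by (rule has_integral_integrable[OF has_integral_add[OF has_integral_mult_right[OF int1]
              has_integral_mult_right[OF integrable_integral[OF int2']]]])
      fix t assume t: "t \<in> {0..R}"
      have "max 0 (t - s * sum l D) = s * max 0 (t / s - sum l D)" for D
        using \<open>0 < s\<close> by (simp add: max_def field_simps)
      then have "(\<Sum>D\<in>Pow J. prod g D * (max 0 (t - s * sum l D) * exp (- t)))
          = s * exp (- t) * (\<Sum>D\<in>Pow J. prod g D * max 0 (t / s - sum l D))"
        by (simp add: sum_distrib_left mult_ac)
      also have "\<dots> \<le> s * exp (- t) * (T u + c * (t / s) powr (\<kappa> + 1))"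
        using t \<open>0 < s\<close> J
        by (intro mult_left_mono order_trans[OF sum_Pow_le_T Tle]) auto
      also have "(t / s) powr (\<kappa> + 1) = t powr (\<kappa> + 1) * (s powr (- \<kappa>) / s)"
        using t \<open>0 < s\<close> by (simp add: powr_divide powr_add powr_minus field_simps)
      also have "s * exp (- t) * (T u + c * (t powr (\<kappa> + 1) * (s powr (- \<kappa>) / s)))
          = s * T u * exp (- t) + c * s powr (- \<kappa>) * (t powr (\<kappa> + 1) / exp t)"
        using \<open>0 < s\<close> by (simp add: field_simps exp_minus)
      finally show "(\<Sum>D\<in>Pow J. prod g D * (max 0 (t - s * sum l D) * exp (- t))) \<le>
          s * T u * exp (- t) + c * s powr (- \<kappa>) * (t powr (\<kappa> + 2 - 1) / exp t)"
        by (simp add: add.commute)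
    qed
    also have "\<dots> = s * T u * (1 - exp (- R)) + c * s powr (- \<kappa>) * integral {0..R} (\<lambda>t. t powr (\<kappa> + 2 - 1) / exp t)"
    proof (rule integral_unique, intro has_integral_add has_integral_mult_right)
      show "((\<lambda>t. exp (- t)) has_integral 1 - exp (- R)) {0..R}" using int1 by simp
    qed (use int2' in \<open>auto intro: integrable_integral\<close>)
    also have "\<dots> \<le> s * T u * 1 + c * s powr (- \<kappa>) * Gamma (\<kappa> + 2)"
      using c0 \<open>0 < s\<close> T_nonneg[of u] int2''
      by (intro add_mono mult_left_mono) auto
    finally show ?thesis by simp
  qed
  have "((\<lambda>R::real. (R + 1) * exp (- R)) \<longlongrightarrow> 0) at_top"
    by real_asymp
  then have "((\<lambda>R. \<Sum>D\<in>Pow J. prod g D * (exp (- (s * sum l D)) - (R + 1) * exp (- R)))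
      \<longlongrightarrow> (\<Sum>D\<in>Pow J. prod g D * (exp (- (s * sum l D)) - 0))) at_top"
    by (intro tendsto_intros)
  then have "(\<Sum>D\<in>Pow J. prod g D * (exp (- (s * sum l D)) - 0)) \<le> s * T u + c * s powr (- \<kappa>) * Gamma (\<kappa> + 2)"
    by (rule tendsto_upperbound)
       (use le in \<open>auto intro!: eventually_at_top_linorderI[of "max 0 M"]\<close>)
  moreover have "(\<Prod>i\<in>J. 1 + g i * exp (- (s * l i))) = (\<Sum>D\<in>Pow J. prod g D * exp (- (s * sum l D)))"
  proof -
    have "(\<Prod>i\<in>J. g i * exp (- (s * l i)) + 1) = (\<Sum>D\<in>Pow J. (\<Prod>i\<in>D. g i * exp (- (s * l i))) * (\<Prod>i\<in>J - D. 1))"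
      by (rule prod_add[OF J(1)])
    also have "\<dots> = (\<Sum>D\<in>Pow J. prod g D * exp (- (s * sum l D)))"
      using J by (intro sum.cong refl) (auto simp: prod.distrib exp_sum finite_subset sum_distrib_left sum_negf[symmetric] simp del: sum_negf)
    finally show ?thesis by (simp add: add.commute)
  qed
  ultimately show ?thesis unfolding c_def by (simp add: mult_ac)
qed

text \<open>The lower limit of s^\<kappa> times the Euler product is at least C, phrased with finite
  partial products so that convergence is never an issue.\<close>

definition euler_lower :: "real \<Rightarrow> real \<Rightarrow> bool" where
  "euler_lower \<kappa> C \<longleftrightarrow> (\<forall>c<C. \<forall>\<^sub>F s in at_right 0. \<exists>J. finite J \<and> J \<subseteq> I \<and>
     c \<le> s powr \<kappa> * (\<Prod>i\<in>J. 1 + g i * exp (- (s * l i))))"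

text \<open>After multiplication by s^\<kappa> the contribution of the initial range vanishes as s
  tends to 0, and the bound for T at the single point u remains.\<close>

lemma T_lower:
  assumes bound: "\<And>y. 0 < y \<Longrightarrow> V y + b y \<le> \<kappa> * y + \<delta>"
    and "0 \<le> \<delta>" "\<delta> < u" "0 < \<kappa>" and C: "euler_lower \<kappa> C"
  shows "C * (u - \<delta>) powr (\<kappa> + 1) \<le> Gamma (\<kappa> + 2) * T u"
proof -
  define R where "R = T u / (u - \<delta>) powr (\<kappa> + 1) * Gamma (\<kappa> + 2)"
  have "C \<le> R"
  proof (rule dense_le)
    fix c assume "c < C"
    then have ev: "\<forall>\<^sub>F s in at_right 0. \<exists>J. finite J \<and> J \<subseteq> I \<and>
       c \<le> s powr \<kappa> * (\<Prod>i\<in>J. 1 + g i * exp (- (s * l i)))"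
      using C unfolding euler_lower_def by blast
    have "\<forall>\<^sub>F s in at_right 0. c \<le> s powr \<kappa> * (s * T u) + R"
      using ev eventually_at_right_less[of 0]
    proof eventually_elim
      case (elim s)
      then obtain J where J: "finite J" "J \<subseteq> I" "c \<le> s powr \<kappa> * (\<Prod>i\<in>J. 1 + g i * exp (- (s * l i)))" by blast
      note J(3)
      also have "s powr \<kappa> * (\<Prod>i\<in>J. 1 + g i * exp (- (s * l i))) \<le> s powr \<kappa> * (s * T u + R * s powr (- \<kappa>))"
        unfolding R_def using assms elim J by (intro mult_left_mono euler_product_le_T) auto
      also have "\<dots> = s powr \<kappa> * (s * T u) + R"
        using elim by (simp add: distrib_left powr_minus field_simps)
      finally show ?case .
    qed
    moreover have "((\<lambda>s::real. s powr \<kappa> * (s * T u) + R) \<longlongrightarrow> 0 * (0 * T u) + R) (at_right 0)"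
      using assms by (intro tendsto_intros tendsto_zero_powrI[of _ _ _ \<kappa>]) (auto intro: eventually_at_right_less eventually_mono[OF eventually_at_right_less])
    ultimately show "c \<le> R"
      by (intro tendsto_lowerbound[of "\<lambda>s::real. s powr \<kappa> * (s * T u) + R" R "at_right 0"]) auto
  qed
  then show ?thesis unfolding R_def using assms(3) by (simp add: field_simps)
qed

end

section \<open>Adding fictitious primes\<close>

text \<open>The fictitious primes have logarithms \<open>t j\<close> and weights \<open>w j\<close>. Multiplying \<open>G\<close> and the Euler
  product by the same factor \<open>\<Prod> (1 + w j)\<close>, they leave the ratio that matters unchanged.\<close>

locale augmented_primes = generalized_primes I l g
  for I :: "'i set" and l g :: "'i \<Rightarrow> real" +
  fixes m :: nat and t w :: "nat \<Rightarrow> real"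
  assumes t_pos: "\<And>j. j < m \<Longrightarrow> 0 < t j" and w_nonneg: "\<And>j. j < m \<Longrightarrow> 0 \<le> w j"
begin

lemma below_split:
  "{i \<in> I <+> {..<m}. P (case_sum l t i)} = {i \<in> I. P (l i)} <+> {j. j < m \<and> P (t j)}"
  by auto

sublocale aug: generalized_primes "I <+> {..<m}" "case_sum l t" "case_sum g w"
proof
  show "finite {i \<in> I <+> {..<m}. case_sum l t i < u}" for u
    unfolding below_split[of "\<lambda>x. x < u"] by (intro finite_Plus finite_below) simp
qed (use l_pos g_nonneg t_pos w_nonneg in \<open>auto split: sum.splits\<close>)

lemma aug_V: "aug.V y = V y + (\<Sum>j | j < m \<and> t j < y. t j * w j / (1 + w j))"
proof -
  have fin: "finite {j. j < m \<and> t j < y}" by simp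
  show ?thesis
    unfolding aug.V_def V_def below_split[of "\<lambda>x. x < y"] sum.Plus[OF finite_below fin]
    by (simp add: aug.a_def a_def)
qed

lemma aug_b: "aug.b y \<le> b y + (\<Sum>j<m. w j * (t j * w j / (1 + w j)))"
proof -
  have fin: "finite {j. j < m \<and> t j < y \<and> y \<le> 2 * t j}" by simp
  have fin': "finite {i \<in> I. l i < y \<and> y \<le> 2 * l i}" by (rule finite_subset[OF _ finite_below[of y]]) auto
  have "aug.b y = b y + (\<Sum>j | j < m \<and> t j < y \<and> y \<le> 2 * t j. w j * (t j * w j / (1 + w j)))"
    unfolding aug.b_def b_def below_split[of "\<lambda>x. x < y \<and> y \<le> 2 * x"] sum.Plus[OF fin' fin]
    by (simp add: aug.a_def a_def)
  also have "(\<Sum>j | j < m \<and> t j < y \<and> y \<le> 2 * t j. w j * (t j * w j / (1 + w j))) \<le> (\<Sum>j<m. w j * (t j * w j / (1 + w j)))"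
    by (intro sum_mono2) (auto simp: w_nonneg t_pos less_imp_le)
  finally show ?thesis by simp
qed

lemma prod_one_plus_w_ge: "1 \<le> (\<Prod>j<m. 1 + w j)"
  by (intro prod_ge_1) (auto simp: w_nonneg)

text \<open>An admissible augmented set splits into a genuine and a fictitious part. Ignoring the
  length of the fictitious part only enlarges the sum, which then factors.\<close>

lemma aug_G: "aug.G u \<le> (\<Prod>j<m. 1 + w j) * G u"
proof -
  let ?F = "\<lambda>(D1, D2). D1 <+> D2"
  have nn: "0 \<le> prod g D1 * prod w D2" if "D1 \<in> DD u" "D2 \<subseteq> {..<m}" for D1 D2
  proof -
    have "0 \<le> prod w D2" using that w_nonneg by (intro prod_nonneg) auto
    then show ?thesis using prod_g_nonneg[OF DD_subset[OF that(1)]] by simp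
  qed
  have pr: "prod (case_sum g w) (D1 <+> D2) = prod g D1 * prod w D2"
    if "D1 \<in> DD u" "D2 \<subseteq> {..<m}" for D1 D2
    using DD_finite[OF that(1)] finite_subset[OF that(2)] by (subst prod.Plus) auto
  have "aug.G u \<le> (\<Sum>D\<in>?F ` (DD u \<times> Pow {..<m}). prod (case_sum g w) D)"
    unfolding aug.G_def
  proof (rule sum_mono2)
    show "aug.DD u \<subseteq> ?F ` (DD u \<times> Pow {..<m})"
    proof
      fix D assume D: "D \<in> aug.DD u"
      define D1 D2 where "D1 = Inl -` D" and "D2 = Inr -` D"
      have eq: "D = D1 <+> D2" 
      proof (intro set_eqI)
        show "x \<in> D \<longleftrightarrow> x \<in> D1 <+> D2" for x unfolding D1_def D2_def by (cases x) auto
      qed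
      have fD: "finite D" "D \<subseteq> I <+> {..<m}" "sum (case_sum l t) D < u" using D unfolding aug.DD_iff by auto
      have f12: "finite D1" "finite D2" using fD(1) unfolding eq by auto
      have sub: "D1 \<subseteq> I" "D2 \<subseteq> {..<m}" using fD(2) unfolding D1_def D2_def by auto
      have "sum (case_sum l t) D = sum l D1 + sum t D2" unfolding eq by (subst sum.Plus[OF f12]) simp
      moreover have "0 \<le> sum t D2" using sub t_pos by (intro sum_nonneg) (auto simp: less_imp_le)
      ultimately have "D1 \<in> DD u" using fD f12 sub unfolding DD_iff by simp
      then show "D \<in> ?F ` (DD u \<times> Pow {..<m})" using sub eq by auto
    qed
  qed (use pr nn in \<open>auto simp: finite_DD\<close>)
  also have "\<dots> = (\<Sum>x\<in>DD u \<times> Pow {..<m}. prod (case_sum g w) (?F x))"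
    by (subst sum.reindex) (auto simp: inj_on_def o_def)
  also have "\<dots> = (\<Sum>(D1, D2)\<in>DD u \<times> Pow {..<m}. prod g D1 * prod w D2)"
    by (intro sum.cong refl) (auto simp: pr)
  also have "\<dots> = G u * (\<Sum>D\<in>Pow {..<m}. prod w D)"
    unfolding G_def sum_product sum.cartesian_product by simp
  also have "(\<Sum>D\<in>Pow {..<m}. prod w D) = (\<Prod>j<m. 1 + w j)"
    using prod_add[of "{..<m}" w "\<lambda>_. 1"] by (simp add: add.commute)
  finally show ?thesis by (simp add: mult.commute)
qed

text \<open>The finitely many new factors 1 + w e^(-s t) tend to 1 + w as s tends to 0.\<close>

lemma aug_euler_lower:
  assumes C: "euler_lower \<kappa> C" "0 < C"
  shows "aug.euler_lower \<kappa> (C * (\<Prod>j<m. 1 + w j))"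
  unfolding aug.euler_lower_def
proof (intro allI impI)
  fix c' assume c': "c' < C * (\<Prod>j<m. 1 + w j)"
  define W where "W = (\<Prod>j<m. 1 + w j)"
  have W: "1 \<le> W" unfolding W_def by (rule prod_one_plus_w_ge)
  \<comment> \<open>A positive number strictly between c' / W and C; positivity is used when the
    product with the fictitious factors is compared.\<close>
  define c where "c = max ((c' / W + C) / 2) (C / 2)"
  have cW: "c' / W < C" using c' W unfolding W_def[symmetric] by (simp add: field_simps)
  have c: "0 < c" "c < C" unfolding c_def using C cW by auto
  have half: "x < (x + C) / 2" if "x < C" for x :: real using that by simp
  from half[OF cW] have "c' / W < c" unfolding c_def by (rule less_le_trans) simp
  then have cW': "c' < c * W" using W by (simp add: field_simps)
  have "((\<lambda>s. c * (\<Prod>j<m. 1 + w j * exp (- (s * t j)))) \<longlongrightarrow> c * (\<Prod>j<m. 1 + w j * exp (- (0 * t j)))) (at_right 0)"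
    by (intro tendsto_intros)
  then have "\<forall>\<^sub>F s in at_right 0. c' < c * (\<Prod>j<m. 1 + w j * exp (- (s * t j)))"
    using cW' by (intro order_tendstoD(1)) (auto simp: W_def)
  moreover have "\<forall>\<^sub>F s in at_right 0. \<exists>J. finite J \<and> J \<subseteq> I \<and> c \<le> s powr \<kappa> * (\<Prod>i\<in>J. 1 + g i * exp (- (s * l i)))"
    using C c unfolding euler_lower_def by blast
  ultimately show "\<forall>\<^sub>F s in at_right 0. \<exists>J. finite J \<and> J \<subseteq> I <+> {..<m} \<and>
      c' \<le> s powr \<kappa> * (\<Prod>i\<in>J. 1 + case_sum g w i * exp (- (s * case_sum l t i)))"
  proof eventually_elim
    case (elim s)
    then obtain J where J: "finite J" "J \<subseteq> I" "c \<le> s powr \<kappa> * (\<Prod>i\<in>J. 1 + g i * exp (- (s * l i)))" by blast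
    define Q where "Q = (\<Prod>j<m. 1 + w j * exp (- (s * t j)))"
    have Q: "0 \<le> Q" unfolding Q_def by (intro prod_nonneg) (auto simp: w_nonneg)
    have "c' \<le> c * Q" using elim unfolding Q_def by simp
    also have "\<dots> \<le> s powr \<kappa> * (\<Prod>i\<in>J. 1 + g i * exp (- (s * l i))) * Q"
      using J Q by (intro mult_right_mono) auto
    also have "\<dots> = s powr \<kappa> * (\<Prod>i\<in>J <+> {..<m}. 1 + case_sum g w i * exp (- (s * case_sum l t i)))"
      using J unfolding Q_def by (subst prod.Plus) auto
    finally show ?case using J by (intro exI[of _ "J <+> {..<m}"]) auto
  qed
qed

end

context generalized_primes begin

text \<open>Only finitely many elements lie below y, so V is constant just to the left of y. This
  yields the strict inequality needed to count a fictitious prime below y.\<close>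

lemma V_left_continuous:
  assumes "0 < y" "0 < e"
  obtains x where "0 < x" "x < y" "y - x < e" "V x = V y"
proof -
  define M where "M = Max (insert 0 (insert (y - e) (l ` {i \<in> I. l i < y})))"
  have fin: "finite (insert 0 (insert (y - e) (l ` {i \<in> I. l i < y})))" using finite_below by simp
  have "M \<in> insert 0 (insert (y - e) (l ` {i \<in> I. l i < y}))" unfolding M_def by (rule Max_in[OF fin]) simp
  then have My: "M < y" using assms by auto
  define x where "x = (M + y) / 2"
  have M: "0 \<le> M" "y - e \<le> M" "\<And>i. i \<in> I \<Longrightarrow> l i < y \<Longrightarrow> l i \<le> M"
    unfolding M_def by (rule Max_ge[OF fin], blast)+
  have x: "M < x" "x < y" unfolding x_def using My by auto
  have "{i \<in> I. l i < x} = {i \<in> I. l i < y}" using M(3) x by force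
  then have "V x = V y" unfolding V_def by simp
  then show ?thesis using that[of x] M x by auto
qed

text \<open>F x is the amount by which V x falls short of \<kappa> x - B. A fictitious prime of mass
  \<eta> is placed where F first exceeds each multiple of \<eta>, so that their total N satisfies F
  \<le> N, and N y exceeds some earlier F x by at most \<eta>. Then V + N \<ge> \<kappa> y - B,
  while V y + N y \<le> V y - V x + \<kappa> x - B + \<eta>, which \<open>incr\<close> and
  \<open>AB\<close> bound by \<kappa> y + \<delta> - bm + \<eta>.\<close>

lemma G_lower_eps:
  assumes k: "0 < \<kappa>" and d: "0 \<le> \<delta>" "\<delta> + \<epsilon> < u" "0 < \<epsilon>" and B: "0 < B" and C: "0 < C" "euler_lower \<kappa> C"
    and vb: "\<And>y. 0 < y \<Longrightarrow> V y + b y \<le> \<kappa> * y + \<delta>"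
    and incr: "\<And>x y. 0 < x \<Longrightarrow> x < y \<Longrightarrow> V y - V x \<le> \<kappa> * (y - x) + A"
    and bm: "\<And>y. 0 < y \<Longrightarrow> b y \<le> bm" and AB: "A + bm \<le> B + \<delta>"
    and Lm: "\<And>y. 0 < y \<Longrightarrow> \<kappa> * y - V y \<le> Lm"
  shows "(\<kappa> + 1) * (C * (u - (\<delta> + \<epsilon>)) powr (\<kappa> + 1)) \<le> Gamma (\<kappa> + 2) * ((u + B) * G u)"
proof -
  define Lp where "Lp = max Lm 0"
  \<comment> \<open>\<epsilon> has to pay for the overshoot \<eta> of N and for the b-terms of the
    fictitious primes, which total at most (Lp + 2) * 2\<kappa>/B times \<eta>.\<close>
  define q where "q = 1 + (Lp + 2) * (2 * \<kappa> / B)"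
  have q: "1 \<le> q" unfolding q_def Lp_def using k B by simp
  define \<eta> where "\<eta> = min 1 (min (B / (2 * \<kappa>)) (\<epsilon> / q))"
  have eta: "0 < \<eta>" "\<eta> \<le> 1" "2 * \<eta> \<le> B / \<kappa>" "\<eta> * q \<le> \<epsilon>"
  proof -
    show "0 < \<eta>" "\<eta> \<le> 1" unfolding \<eta>_def using k B d q by auto
    have "\<eta> \<le> B / (2 * \<kappa>)" "\<eta> \<le> \<epsilon> / q" unfolding \<eta>_def by auto
    then show "2 * \<eta> \<le> B / \<kappa>" "\<eta> * q \<le> \<epsilon>" using q k by (auto simp: field_simps)
  qed
  define F where "F x = \<kappa> * x - V x - B" for x
  define J where "J j = {x. 0 < x \<and> real j * \<eta> < F x}" for j :: nat
  \<comment> \<open>F never exceeds Lp, so no level from m on is reached; this keeps the fictitious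
    primes finite in number.\<close>
  define m where "m = nat \<lceil>Lp / \<eta>\<rceil> + 1"
  \<comment> \<open>A level that is never reached gets position 1 and weight 0, hence no effect.
    Otherwise w j solves t w / (1 + w) = \<eta>, that is, the element adds exactly \<eta> to
    V.\<close>
  define t where "t j = (if J j = {} then 1 else Inf (J j))" for j
  define w where "w j = (if J j = {} then 0 else \<eta> / (t j - \<eta>))" for j
  have Jge: "B / \<kappa> \<le> x" if "x \<in> J j" for x j
  proof -
    have "0 \<le> real j * \<eta>" using eta by simp
    then have "0 < F x" using that unfolding J_def by simp
    then have "B < \<kappa> * x" unfolding F_def using V_nonneg[of x] by simp
    then show ?thesis using k by (simp add: field_simps)
  qed
  have bdd: "bdd_below (J j)" for j using Jge by (intro bdd_belowI) auto
  have tge: "B / \<kappa> \<le> t j" if "J j \<noteq> {}" for j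
    unfolding t_def using that Jge by (auto intro!: cInf_greatest)
  have t2: "2 * \<eta> \<le> t j" if "J j \<noteq> {}" for j using tge[OF that] eta by simp
  have tpos: "0 < t j" for j
  proof (cases "J j = {}")
    case True then show ?thesis unfolding t_def by simp
  next
    case False then show ?thesis using t2[OF False] eta by simp
  qed
  have w0: "0 \<le> w j" for j
  proof (cases "J j = {}")
    case True then show ?thesis unfolding w_def by simp
  next
    case False then show ?thesis unfolding w_def using t2[OF False] eta by simp
  qed
  have nj: "t j * w j / (1 + w j) = (if J j = {} then 0 else \<eta>)" for j
  proof (cases "J j = {}")
    case True then show ?thesis unfolding w_def by simp
  next
    case False
    have "0 < t j - \<eta>" using t2[OF False] eta by simp
    then have "1 + w j = t j / (t j - \<eta>)" unfolding w_def using False by (simp add: field_simps)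
    then show ?thesis using False \<open>0 < t j - \<eta>\<close> tpos[of j] unfolding w_def by simp
  qed
  have wle: "w j * (t j * w j / (1 + w j)) \<le> 2 * \<kappa> / B * \<eta> * \<eta>" for j
  proof (cases "J j = {}")
    case True then show ?thesis unfolding nj using k B eta by simp
  next
    case False
    have "B / (2 * \<kappa>) \<le> t j - \<eta>" using tge[OF False] eta by (simp add: field_simps)
    moreover have "0 < B / (2 * \<kappa>)" using B k by simp
    ultimately have "\<eta> / (t j - \<eta>) \<le> \<eta> / (B / (2 * \<kappa>))"
      using eta by (intro divide_left_mono mult_pos_pos) linarith+
    then have "w j \<le> \<eta> / (B / (2 * \<kappa>))" unfolding w_def using False by simp
    then have "w j * \<eta> \<le> \<eta> / (B / (2 * \<kappa>)) * \<eta>" using eta by (intro mult_right_mono) auto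
    then show ?thesis unfolding nj using False by (simp add: mult_ac)
  qed
  interpret augmented_primes I l g m t w
    by unfold_locales (use tpos w0 in auto)
  define N where "N y = (\<Sum>j | j < m \<and> t j < y. t j * w j / (1 + w j))" for y
  have N_eq: "N y = \<eta> * real (card {j. j < m \<and> t j < y \<and> J j \<noteq> {}})" for y
  proof -
    have "N y = (\<Sum>j | j < m \<and> t j < y. if J j \<noteq> {} then \<eta> else 0)"
      unfolding N_def nj by (intro sum.cong) auto
    also have "\<dots> = (\<Sum>j\<in>{j \<in> {j. j < m \<and> t j < y}. J j \<noteq> {}}. \<eta>)"
      by (rule sum.inter_filter[symmetric]) simp
    also have "{j \<in> {j. j < m \<and> t j < y}. J j \<noteq> {}} = {j. j < m \<and> t j < y \<and> J j \<noteq> {}}" by auto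
    finally show ?thesis by simp
  qed
  have mlarge: "Lp \<le> real m * \<eta>" and msmall: "real m * \<eta> \<le> Lp + 2"
  proof -
    have "0 \<le> Lp / \<eta>" unfolding Lp_def using eta by simp
    then have "real m = of_int \<lceil>Lp / \<eta>\<rceil> + 1" unfolding m_def by simp
    then have "Lp / \<eta> \<le> real m" "real m \<le> Lp / \<eta> + 2" by linarith+
    then show "Lp \<le> real m * \<eta>" "real m * \<eta> \<le> Lp + 2" using eta by (auto simp: field_simps)
  qed
  \<comment> \<open>All levels below F y have been passed already at some x < y, by left continuity
    of V; there are at least F y / \<eta> of them.\<close>
  have lower: "F y \<le> N y" if y: "0 < y" for y
  proof (cases "F y \<le> 0")
    case True
    then show ?thesis unfolding N_eq using eta by (simp add: order_trans[OF _ mult_nonneg_nonneg])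
  next
    case False
    define k' where "k' = nat \<lceil>F y / \<eta>\<rceil>"
    have "F y / \<eta> \<le> real k'" unfolding k'_def by (rule real_nat_ceiling_ge)
    then have k': "F y \<le> \<eta> * real k'" using eta by (simp add: field_simps)
    have "{..<k'} \<subseteq> {j. j < m \<and> t j < y \<and> J j \<noteq> {}}"
    proof
      fix j assume "j \<in> {..<k'}"
      then have "real j < F y / \<eta>" unfolding k'_def using False eta by (simp add: less_ceiling_iff zless_nat_eq_int_zless)
      then have j: "real j * \<eta> < F y" using eta by (simp add: field_simps)
      have "F y \<le> Lp" using Lm[OF y] B unfolding F_def Lp_def by simp
      then have "real j * \<eta> < real m * \<eta>" using j mlarge by linarith
      then have jm: "j < m" using eta by simp
      obtain x where x: "0 < x" "x < y" "y - x < (F y - real j * \<eta>) / \<kappa>" "V x = V y"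
        using V_left_continuous[OF y, of "(F y - real j * \<eta>) / \<kappa>"] j k by auto
      have "\<kappa> * (y - x) < F y - real j * \<eta>" using x(3) k by (simp add: field_simps)
      then have "real j * \<eta> < F x" unfolding F_def using x(4) by (simp add: algebra_simps)
      then have xJ: "x \<in> J j" unfolding J_def using x by simp
      then have "t j \<le> x" unfolding t_def using bdd by (auto intro: cInf_lower)
      then show "j \<in> {j. j < m \<and> t j < y \<and> J j \<noteq> {}}" using jm x xJ by auto
    qed
    then have "card {..<k'} \<le> card {j. j < m \<and> t j < y \<and> J j \<noteq> {}}" by (intro card_mono) auto
    then have "\<eta> * real k' \<le> N y" unfolding N_eq using eta by simp
    then show ?thesis using k' by simp
  qed
  \<comment> \<open>The highest level j counted in N y was exceeded by F at some x < y, and at most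
    j + 1 levels are counted.\<close>
  have upper: "\<exists>x. 0 < x \<and> x < y \<and> N y \<le> F x + \<eta>" if Ny: "N y \<noteq> 0" for y
  proof -
    define S where "S = {j. j < m \<and> t j < y \<and> J j \<noteq> {}}"
    have S: "finite S" "S \<noteq> {}" using Ny unfolding N_eq S_def by auto
    define j where "j = Max S"
    have j: "j \<in> S" unfolding j_def using S by (rule Max_in)
    have "S \<subseteq> {..j}" unfolding j_def using S by auto
    then have "card S \<le> j + 1" using card_mono[of "{..j}" S] by simp
    then have "\<eta> * real (card S) \<le> \<eta> * (real j + 1)" using eta by (intro mult_left_mono) auto
    then have N1: "N y \<le> real j * \<eta> + \<eta>" unfolding N_eq S_def by (simp add: algebra_simps)
    have Jj: "J j \<noteq> {}" "t j < y" using j unfolding S_def by auto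
    then have "Inf (J j) < y" unfolding t_def by simp
    then obtain x where "x \<in> J j" "x < y" using cInf_less_iff[OF Jj(1) bdd] by blast
    then show ?thesis using N1 unfolding J_def by force
  qed
  define E where "E = (\<Sum>j<m. w j * (t j * w j / (1 + w j)))"
  have "E \<le> (\<Sum>j<m. 2 * \<kappa> / B * \<eta> * \<eta>)" unfolding E_def by (intro sum_mono wle)
  also have "\<dots> = 2 * \<kappa> / B * \<eta> * (real m * \<eta>)" by simp
  also have "\<dots> \<le> 2 * \<kappa> / B * \<eta> * (Lp + 2)" using k B eta msmall by (intro mult_left_mono) auto
  finally have "E + \<eta> \<le> \<eta> * q" unfolding q_def by (simp add: algebra_simps)
  then have E: "E + \<eta> \<le> \<epsilon>" using eta by linarith
  have E0: "0 \<le> E" unfolding E_def using w0 tpos by (intro sum_nonneg) (auto simp: less_imp_le)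
  have "aug.V y + aug.b y \<le> \<kappa> * y + (\<delta> + \<epsilon>)" if y: "0 < y" for y
  proof -
    have "V y + N y + b y \<le> \<kappa> * y + \<delta> + \<eta>"
    proof (cases "N y = 0")
      case True then show ?thesis using vb[OF y] eta by simp
    next
      case False
      then obtain x where x: "0 < x" "x < y" "N y \<le> F x + \<eta>" using upper by blast
      then show ?thesis using incr[OF x(1,2)] bm[OF y] AB unfolding F_def by (simp add: algebra_simps)
    qed
    then show ?thesis using aug_V[of y] aug_b[of y] E unfolding N_def E_def by linarith
  qed
  note vb' = this
  have lb': "\<kappa> * y - B \<le> aug.V y" if "0 < y" for y
    using lower[OF that] unfolding aug_V N_def[symmetric] F_def by simp
  define W where "W = (\<Prod>j<m. 1 + w j)"
  have W: "0 < W" using prod_one_plus_w_ge unfolding W_def by linarith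
  have "C * W * (u - (\<delta> + \<epsilon>)) powr (\<kappa> + 1) \<le> Gamma (\<kappa> + 2) * aug.T u"
    unfolding W_def using d k vb' C by (intro aug.T_lower aug_euler_lower) auto
  then have "(\<kappa> + 1) * (C * W * (u - (\<delta> + \<epsilon>)) powr (\<kappa> + 1)) \<le> (\<kappa> + 1) * (Gamma (\<kappa> + 2) * aug.T u)"
    using k by (intro mult_left_mono) auto
  also have "\<dots> = Gamma (\<kappa> + 2) * ((\<kappa> + 1) * aug.T u)" by simp
  also have "\<dots> \<le> Gamma (\<kappa> + 2) * ((u + B) * aug.G u)"
    using k lb' by (intro mult_left_mono aug.T_le) (auto intro!: less_imp_le Gamma_real_pos)
  also have "\<dots> \<le> Gamma (\<kappa> + 2) * ((u + B) * (W * G u))"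
    unfolding W_def using k d B by (intro mult_left_mono aug_G) (auto intro!: less_imp_le Gamma_real_pos)
  finally have "W * ((\<kappa> + 1) * (C * (u - (\<delta> + \<epsilon>)) powr (\<kappa> + 1))) \<le> W * (Gamma (\<kappa> + 2) * ((u + B) * G u))"
    by (simp add: mult_ac)
  then show ?thesis using W by simp
qed

theorem G_lower:
  assumes k: "0 < \<kappa>" and d: "0 \<le> \<delta>" "\<delta> < u" and B: "0 < B" and C: "0 < C" "euler_lower \<kappa> C"
    and vb: "\<And>y. 0 < y \<Longrightarrow> V y + b y \<le> \<kappa> * y + \<delta>"
    and incr: "\<And>x y. 0 < x \<Longrightarrow> x < y \<Longrightarrow> V y - V x \<le> \<kappa> * (y - x) + A"
    and bm: "\<And>y. 0 < y \<Longrightarrow> b y \<le> bm" and AB: "A + bm \<le> B + \<delta>"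
    and Lm: "\<And>y. 0 < y \<Longrightarrow> \<kappa> * y - V y \<le> Lm"
  shows "C * (u - \<delta>) powr (\<kappa> + 1) \<le> Gamma (\<kappa> + 1) * ((u + B) * G u)"
proof -
  have "((\<lambda>\<epsilon>. (\<kappa> + 1) * (C * (u - (\<delta> + \<epsilon>)) powr (\<kappa> + 1))) \<longlongrightarrow> (\<kappa> + 1) * (C * (u - (\<delta> + 0)) powr (\<kappa> + 1))) (at_right 0)"
    using d by (intro tendsto_intros) auto
  moreover have "\<forall>\<^sub>F \<epsilon> in at_right 0. (\<kappa> + 1) * (C * (u - (\<delta> + \<epsilon>)) powr (\<kappa> + 1)) \<le> Gamma (\<kappa> + 2) * ((u + B) * G u)"
    using eventually_at_right_real[of 0 "u - \<delta>"] d
    by (auto elim!: eventually_mono intro!: G_lower_eps[OF k d(1) _ _ B C vb incr bm AB Lm])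
  ultimately have "(\<kappa> + 1) * (C * (u - (\<delta> + 0)) powr (\<kappa> + 1)) \<le> Gamma (\<kappa> + 2) * ((u + B) * G u)"
    by (intro tendsto_upperbound[of "\<lambda>\<epsilon>. (\<kappa> + 1) * (C * (u - (\<delta> + \<epsilon>)) powr (\<kappa> + 1))"]) auto
  moreover have "Gamma (\<kappa> + 2) = (\<kappa> + 1) * Gamma (\<kappa> + 1)"
  proof -
    have "\<kappa> + 1 \<notin> \<int>\<^sub>\<le>\<^sub>0" using k nonpos_Ints_nonpos[of "\<kappa> + 1"] by auto
    from Gamma_plus1[OF this] show ?thesis by (simp add: add.assoc)
  qed
  ultimately have "(\<kappa> + 1) * (C * (u - \<delta>) powr (\<kappa> + 1)) \<le> (\<kappa> + 1) * (Gamma (\<kappa> + 1) * ((u + B) * G u))"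
    by (simp add: mult_ac)
  then show ?thesis using k by simp
qed

end

section \<open>Lower bound for the Selberg sum\<close>

text \<open>Abel's theorem in inequality form: partial sums at least a from n1 on, and at least b
  throughout, give a lower bound tending to a as s tends to 0.\<close>

lemma abel_sum_ge:
  fixes x :: "nat \<Rightarrow> real" and s a b :: real
  defines "X \<equiv> \<lambda>n. \<Sum>k = 1..n. x k"
  assumes s: "0 < s" and n1: "1 \<le> n1" "n1 \<le> N"
    and b: "\<And>n. 1 \<le> n \<Longrightarrow> b \<le> X n" and a: "\<And>n. n1 \<le> n \<Longrightarrow> a \<le> X n"
  shows "a * real n1 powr - s + b * (1 - real n1 powr - s) \<le> (\<Sum>k = 1..N. x k * real k powr - s)"
proof -
  define S where "S n = (\<Sum>k = 1..n. x k * real k powr - s)" for n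
  have step: "S (Suc n) - X (Suc n) * real (Suc n) powr - s = S n - X n * real n powr - s + X n * (real n powr - s - real (Suc n) powr - s)" for n
    unfolding S_def X_def by (simp add: algebra_simps)
  have dec: "0 \<le> real n powr - s - real (Suc n) powr - s" if "1 \<le> n" for n
    using that s powr_mono2'[of "- s" "real n" "real (Suc n)"] by simp
  have 1: "b * (1 - real n powr - s) \<le> S n - X n * real n powr - s" if "1 \<le> n" for n
    using that
  proof (induction n rule: dec_induct)
    case base show ?case unfolding S_def X_def by simp
  next
    case (step n)
    have "b * (real n powr - s - real (Suc n) powr - s) \<le> X n * (real n powr - s - real (Suc n) powr - s)"
      using step b dec by (intro mult_right_mono) auto
    then show ?case unfolding \<open>\<And>n. S (Suc n) - _ = _\<close> using step.IH by (simp add: algebra_simps)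
  qed
  have 2: "a * (real n1 powr - s - real n powr - s) + b * (1 - real n1 powr - s) \<le> S n - X n * real n powr - s" if "n1 \<le> n" for n
    using that
  proof (induction n rule: dec_induct)
    case base show ?case using 1[OF n1(1)] by simp
  next
    case (step n)
    have "a * (real n powr - s - real (Suc n) powr - s) \<le> X n * (real n powr - s - real (Suc n) powr - s)"
      using step a dec n1 by (intro mult_right_mono) auto
    then show ?case unfolding \<open>\<And>n. S (Suc n) - _ = _\<close> using step.IH by (simp add: algebra_simps)
  qed
  have "a * real N powr - s \<le> X N * real N powr - s" using a n1 by (intro mult_right_mono) auto
  then show ?thesis using 2[OF n1(2)] unfolding S_def by (simp add: algebra_simps)
qed

lemma prime_ge_2_real: "prime (p :: nat) \<Longrightarrow> 2 \<le> real p"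
  using prime_ge_2_nat[of p] by simp

context sieve_density begin

sublocale gp: generalized_primes "{p. prime p}" "\<lambda>p. ln (real p)" g
proof
  fix p :: nat assume "p \<in> {p. prime p}"
  then have p: "prime p" by simp
  then show "0 < ln (real p)" using prime_gt_1_nat[of p] by simp
  show "0 \<le> g p" using p by (rule g_nonneg)
next
  fix u :: real
  have "{p \<in> {p. prime p}. ln (real p) < u} \<subseteq> primes_in 2 (exp u)"
  proof clarify
    fix p :: nat assume p: "prime p" "ln (real p) < u"
    have "2 \<le> real p" using prime_ge_2_nat[OF p(1)] by simp
    moreover have "exp (ln (real p)) < exp u" using p by simp
    ultimately show "p \<in> primes_in 2 (exp u)" using p by (simp add: primes_in_def)
  qed
  then show "finite {p \<in> {p. prime p}. ln (real p) < u}" using finite_subset finite_primes_in by blast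
qed

section \<open>V and b for the actual primes\<close>

lemma ln_less_iff_exp: "prime p \<Longrightarrow> ln (real p) < u \<longleftrightarrow> real p < exp u"
  using prime_gt_0_nat[of p] by (metis exp_less_cancel_iff exp_ln of_nat_0_less_iff)

lemma gp_a: "prime p \<Longrightarrow> gp.a p = h p * ln p"
proof -
  assume p: "prime p"
  have "0 < 1 - h p" using h_less_1[OF p] by simp
  then have "g p / (1 + g p) = h p" unfolding one_plus_g[OF p] by (simp add: g_def)
  then show ?thesis unfolding gp.a_def by (metis mult.commute times_divide_eq_right)
qed

lemma gp_V: "gp.V y = (\<Sum>p\<in>primes_in 2 (exp y). h p * ln p)"
proof -
  have "{p \<in> {p. prime p}. ln (real p) < y} = primes_in 2 (exp y)"
    unfolding primes_in_def mem_Collect_eq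
    by (intro Collect_cong) (metis ln_less_iff_exp prime_ge_2_real)
  then show ?thesis unfolding gp.V_def by (intro sum.cong) (auto simp: primes_in_def gp_a)
qed

lemma gp_V_small: "y \<le> ln 2 \<Longrightarrow> gp.V y = 0"
proof -
  assume "y \<le> ln 2"
  then have "exp y \<le> 2" by (metis exp_le_cancel_iff exp_ln zero_less_numeral)
  then have "primes_in 2 (exp y) = {}" by (auto simp: primes_in_def)
  then show ?thesis unfolding gp_V by simp
qed

lemma exp_ge_2: "ln 2 \<le> y \<Longrightarrow> 2 \<le> exp (y::real)"
  by (metis exp_le_cancel_iff exp_ln zero_less_numeral)

lemma gp_V_diff:
  assumes "ln 2 \<le> x" "x < y"
  shows "gp.V y - gp.V x = (\<Sum>p\<in>primes_in (exp x) (exp y). h p * ln p)"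
  unfolding gp_V using primes_in_split[of "exp x" "exp y" 2] exp_ge_2[OF assms(1)] assms
  by (simp add: sum.union_disjoint)

lemma gp_V_incr:
  assumes "0 < x" "x < y"
  shows "gp.V y - gp.V x \<le> \<kappa> * (y - x) + A2"
proof -
  consider "ln 2 \<le> x" | "x < ln 2" "ln 2 < y" | "y \<le> ln 2" by linarith
  then show ?thesis
  proof cases
    case 1
    then show ?thesis using gp_V_diff[OF 1 assms(2)] Omega2_upper[of "exp x" "exp y"] exp_ge_2[OF 1] assms by simp
  next
    case 2
    have "gp.V y \<le> \<kappa> * (y - ln 2) + A2"
      using Omega2_upper[of 2 "exp y"] exp_less_mono[OF 2(2)] unfolding gp_V by simp
    moreover have "\<kappa> * (y - ln 2) \<le> \<kappa> * (y - x)" using 2 kappa by (intro mult_left_mono) auto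
    ultimately show ?thesis using gp_V_small[of x] 2 by simp
  next
    case 3
    then show ?thesis using gp_V_small[of x] gp_V_small[of y] assms kappa A2 by simp
  qed
qed

lemma gp_V_le: "ln 2 < y \<Longrightarrow> gp.V y \<le> \<kappa> * (y - ln 2) + A2"
  using Omega2_upper[of 2 "exp y"] exp_less_mono[of "ln 2" y] unfolding gp_V by simp

lemma gp_V_ge: "0 < y \<Longrightarrow> \<kappa> * y - gp.V y \<le> \<kappa> * ln 2 + max L 0"
proof (cases "y \<le> ln 2")
  case True
  then have "\<kappa> * y \<le> \<kappa> * ln 2" using kappa by (intro mult_left_mono) auto
  then show ?thesis using gp_V_small[OF True] by simp
next
  case False
  then have "\<kappa> * (y - ln 2) - L \<le> gp.V y"
    using Omega2_lower[of 2 "exp y"] exp_less_mono[of "ln 2" y] unfolding gp_V by simp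
  then show ?thesis by (simp add: algebra_simps)
qed

text \<open>The quantity \<open>m\<^sub>1\<close> as a function of \<open>y = log (x/d)\<close>.\<close>

definition m1_log :: "real \<Rightarrow> real" where
  "m1_log y = A2 * (\<kappa> * ln 2 + 2 * A2 / y + A1 * (2 * A2 / y) * (\<kappa> + 2 * A2 / y))"

text \<open>\<open>K\<close> is \<open>r(z) log z\<close>, which does not depend on \<open>z\<close>.\<close>

definition K :: real where "K = A2 + m1_log (ln 2)"

lemma m1_log_antimono: "0 < x \<Longrightarrow> x \<le> y \<Longrightarrow> m1_log y \<le> m1_log x"
proof -
  assume a: "0 < x" "x \<le> y"
  then have 1: "2 * A2 / y \<le> 2 * A2 / x" using A2 by (intro divide_left_mono) auto
  have 0: "0 \<le> 2 * A2 / y" using a A2 by simp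
  have "A1 * (2 * A2 / y) * (\<kappa> + 2 * A2 / y) \<le> A1 * (2 * A2 / x) * (\<kappa> + 2 * A2 / x)"
  proof (rule mult_mono)
    show "A1 * (2 * A2 / y) \<le> A1 * (2 * A2 / x)" using 1 A1 by (intro mult_left_mono) auto
    have "0 \<le> 2 * A2 / x" using 0 1 by linarith
    then show "0 \<le> A1 * (2 * A2 / x)" using A1 by (intro mult_nonneg_nonneg) auto
  qed (use 0 1 kappa in linarith)+
  then show ?thesis unfolding m1_log_def using 1 A2 kappa by (intro mult_left_mono add_mono) auto
qed

lemma gp_b_set:
  "{p \<in> {p. prime p}. ln (real p) < y \<and> y \<le> 2 * ln (real p)} = primes_in (max 2 (exp (y / 2))) (exp y)"
proof -
  have "y \<le> 2 * ln (real p) \<longleftrightarrow> exp (y / 2) \<le> real p" if "prime p" for p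
  proof -
    have "y / 2 \<le> ln (real p) \<longleftrightarrow> exp (y / 2) \<le> real p" using prime_gt_0_nat[OF that]
      by (metis exp_le_cancel_iff exp_ln of_nat_0_less_iff)
    then show ?thesis by auto
  qed
  then show ?thesis unfolding primes_in_def max.bounded_iff mem_Collect_eq
    by (intro Collect_cong) (metis ln_less_iff_exp prime_ge_2_real)
qed

text \<open>Here p runs over e^(y/2) \<le> p < e^y, where each h p log p is at most A2 and the sum
  of g is at most U + \<kappa> ln 2, because log p varies by a factor of at most 2.\<close>

lemma gp_b_le: assumes "ln 2 \<le> y" shows "gp.b y \<le> m1_log y"
proof -
  define w where "w = max 2 (exp (y / 2))"
  have y0: "0 < y" using assms by (smt (verit) ln_gt_zero)
  have w: "2 \<le> w" "w \<le> exp y" "y / 2 \<le> ln w" "0 < ln w"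
    using assms exp_ge_2[OF assms] y0 ln_mono[of "exp (y / 2)" w] unfolding w_def by auto
  have "gp.b y = (\<Sum>p\<in>primes_in w (exp y). g p * gp.a p)"
    unfolding gp.b_def gp_b_set w_def ..
  also have "\<dots> \<le> (\<Sum>p\<in>primes_in w (exp y). g p * A2)"
    by (intro sum_mono mult_left_mono) (auto simp: primes_in_def gp_a h_ln_le g_nonneg)
  also have "\<dots> = A2 * (\<Sum>p\<in>primes_in w (exp y). g p)" by (simp add: sum_distrib_left mult.commute)
  also have "\<dots> \<le> A2 * (U w + \<kappa> * (ln (ln (exp y)) - ln (ln w)))"
    using A2 w by (intro mult_left_mono sum_g_le) auto
  also have "\<dots> \<le> m1_log y"
  proof -
    have "ln y - ln (ln w) \<le> ln 2"
    proof -
      have "ln (y / 2) \<le> ln (ln w)" using w y0 by (intro ln_mono) auto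
      then show ?thesis using y0 by (simp add: ln_divide_pos)
    qed
    then have "\<kappa> * (ln (ln (exp y)) - ln (ln w)) \<le> \<kappa> * ln 2" using kappa by (intro mult_left_mono) auto
    moreover have "U w \<le> 2 * A2 / y + A1 * (2 * A2 / y) * (\<kappa> + 2 * A2 / y)"
    proof -
      have le: "A2 / ln w \<le> 2 * A2 / y"
        using divide_left_mono[of "y / 2" "ln w" A2] w A2 y0 by (simp add: mult_ac)
      have "U w = A2 / ln w + A1 * (A2 / ln w) * (\<kappa> + A2 / ln w)" unfolding U_def by simp
      also have "\<dots> \<le> 2 * A2 / y + A1 * (2 * A2 / y) * (\<kappa> + 2 * A2 / y)"
        using le w A1 A2 kappa y0 by (intro add_mono mult_mono mult_left_mono) auto
      finally show ?thesis .
    qed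
    ultimately show ?thesis unfolding m1_log_def using A2 by (intro mult_left_mono) auto
  qed
  finally show ?thesis .
qed

lemma gp_b_small: "y < ln 2 \<Longrightarrow> gp.b y = 0"
proof -
  assume "y < ln 2"
  then have "exp y < 2" by (metis exp_less_cancel_iff exp_ln zero_less_numeral)
  then have "primes_in (max 2 (exp (y / 2))) (exp y) = {}" by (auto simp: primes_in_def)
  then show ?thesis unfolding gp.b_def gp_b_set by simp
qed

lemma m1_log_nonneg: "0 < y \<Longrightarrow> 0 \<le> m1_log y"
  unfolding m1_log_def using A1 A2 kappa by (intro mult_nonneg_nonneg add_nonneg_nonneg) auto

lemma gp_b_le': "0 < y \<Longrightarrow> gp.b y \<le> m1_log (ln 2)"
  using gp_b_le[of y] gp_b_small[of y] m1_log_antimono[of "ln 2" y] m1_log_nonneg[of "ln 2"]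
  by (cases "y < ln 2") auto

text \<open>For x = 1 and d = 1/2 the logarithm of the square root in \<open>m1\<close> is (ln 2) /
  2, which is \<open>m1_log\<close> at the logarithm of the smallest prime.\<close>

lemma r_aux_eq: "r_aux \<kappa> A1 A2 z = K / ln z"
proof -
  have e: "ln (sqrt (1 / (1 / 2))) = ln (2::real) / 2" by (simp add: ln_sqrt)
  have "m1 \<kappa> A1 A2 1 (1 / 2) = m1_log (ln 2)" unfolding m1_def e m1_log_def by (simp add: mult_ac)
  then show ?thesis unfolding r_aux_def K_def by simp
qed

text \<open>Bernoulli bounds the logarithm of each twisted factor below by p^-s times that of the
  singular factor's inverse, plus \<kappa> times a factor of \<zeta>(1+s). The first part tends to
  -ln P_lim by Abel's theorem, and \<zeta>(1+s) \<ge> 1/s absorbs s^\<kappa>.\<close>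

lemma gp_euler_lower: "gp.euler_lower \<kappa> (1 / P_lim)"
  unfolding gp.euler_lower_def
proof (intro allI impI)
  fix c0 :: real assume c0: "c0 < 1 / P_lim"
  \<comment> \<open>A positive replacement for c0, still below 1 / P_lim, so that logarithms can be
    taken.\<close>
  define c where "c = max c0 (1 / P_lim / 2)"
  have "0 < q \<Longrightarrow> c0 < q \<Longrightarrow> 0 < max c0 (q / 2) \<and> max c0 (q / 2) < q" for q by auto
  from this[of "1 / P_lim"] have c: "0 < c" "c < 1 / P_lim" "c0 \<le> c"
    unfolding c_def using c0 singular_product(3) by simp_all
  define x where "x n = (if prime n then - ln (singular_factor \<omega> \<kappa> n) else 0)" for n
  define X where "X n = (\<Sum>k = 1..n. x k)" for n
  have sf_pos: "0 < singular_factor \<omega> \<kappa> n" for n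
    unfolding singular_factor_def using h_less_1[of n] prime_gt_1_nat[of n] unfolding h_def by auto
  have X: "X n = - ln (\<Prod>i\<le>n. singular_factor \<omega> \<kappa> i)" for n
  proof -
    have "ln (\<Prod>i\<le>n. singular_factor \<omega> \<kappa> i) = (\<Sum>i\<le>n. ln (singular_factor \<omega> \<kappa> i))"
      by (rule ln_prod) (use sf_pos less_irrefl in \<open>metis finite_atMost\<close>)+
    also have "\<dots> = (\<Sum>i\<le>n. - x i)" unfolding x_def singular_factor_def by (intro sum.cong) auto
    also have "\<dots> = - (\<Sum>i\<le>n. x i)" by (rule sum_negf)
    also have "(\<Sum>i\<le>n. x i) = X n" unfolding X_def
      by (rule sum.mono_neutral_right) (auto simp: x_def Suc_le_eq intro: gr0I)
    finally show ?thesis by simp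
  qed
  have Xlim: "X \<longlonglongrightarrow> - ln P_lim"
    unfolding X[abs_def] using singular_partial singular_product(3) by (intro tendsto_intros) auto
  \<comment> \<open>Three of the four quarters are spent: on the limit of X, on the weights n^-s,
    and on truncating the zeta sum at N.\<close>
  define \<epsilon> where "\<epsilon> = (- ln P_lim - ln c) / 4"
  have eps: "0 < \<epsilon>"
  proof -
    have "ln c < ln (1 / P_lim)" using c singular_product(3) by (intro ln_less_cancel_iff[THEN iffD2]) auto
    then show ?thesis unfolding \<epsilon>_def using singular_product(3) by (simp add: ln_divide_pos)
  qed
  define a where "a = - ln P_lim - \<epsilon>"
  have "\<forall>\<^sub>F n in sequentially. a < X n" using Xlim eps unfolding a_def by (intro order_tendstoD(1)) auto
  then obtain n0 where n0: "\<And>n. n0 \<le> n \<Longrightarrow> a < X n" by (auto simp: eventually_sequentially)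
  define n1 where "n1 = max 1 n0"
  have n1: "1 \<le> n1" "\<And>n. n1 \<le> n \<Longrightarrow> a \<le> X n" unfolding n1_def using n0 by (auto intro: less_imp_le)
  have "Bseq X" using Xlim convergentI convergent_imp_Bseq by blast
  then obtain B where B: "\<forall>n. norm (X n) \<le> B" by (rule BseqE) blast
  define b where "b = - B"
  have b: "b \<le> X n" for n using spec[OF B, of n] unfolding b_def by auto
  have "((\<lambda>s. a * real n1 powr - s + b * (1 - real n1 powr - s)) \<longlongrightarrow> a * real n1 powr - 0 + b * (1 - real n1 powr - 0)) (at_right 0)"
    using n1 by (intro tendsto_intros) auto
  then have "\<forall>\<^sub>F s in at_right 0. a - \<epsilon> < a * real n1 powr - s + b * (1 - real n1 powr - s)"
    using n1 eps by (intro order_tendstoD(1)) auto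
  then show "\<forall>\<^sub>F s in at_right 0. \<exists>J. finite J \<and> J \<subseteq> {p. prime p} \<and>
      c0 \<le> s powr \<kappa> * (\<Prod>i\<in>J. 1 + g i * exp (- (s * ln (real i))))"
    using eventually_at_right_less[of 0]
  proof eventually_elim
    case (elim s)
    have s: "0 < s" using elim by simp
    have "((\<lambda>N. \<kappa> * ln (1 - real (N + 1) powr - s)) \<longlongrightarrow> \<kappa> * ln (1 - 0)) sequentially"
    proof -
      have "((\<lambda>N. real (N + 1) powr - s) \<longlongrightarrow> 0) sequentially" using s by real_asymp
      then show ?thesis by (intro tendsto_intros) auto
    qed
    then have "\<forall>\<^sub>F N in sequentially. - \<epsilon> < \<kappa> * ln (1 - real (N + 1) powr - s)"
      using eps by (intro order_tendstoD(1)) auto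
    then have "\<forall>\<^sub>F N in sequentially. - \<epsilon> < \<kappa> * ln (1 - real (N + 1) powr - s) \<and> n1 \<le> N"
      using eventually_ge_at_top by (rule eventually_conj)
    \<comment> \<open>N may depend on s, since \<open>euler_lower\<close> asks for a finite set
      separately for each s.\<close>
    then obtain N where N: "- \<epsilon> < \<kappa> * ln (1 - real (N + 1) powr - s)" "n1 \<le> N"
      by (auto simp: eventually_sequentially)
    define J where "J = primes_le N"
    define y where "y p = exp (- (s * ln (real p)))" for p :: nat
    have y: "0 \<le> y p" "y p \<le> 1" "y p = real p powr - s" if "p \<in> J" for p
    proof -
      have "1 < real p" using that prime_gt_1_nat[of p] unfolding J_def by simp
      then show "0 \<le> y p" "y p \<le> 1" "y p = real p powr - s"
        using s unfolding y_def powr_def by auto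
    qed
    \<comment> \<open>Bernoulli is applied twice, to 1 + g with x = -g and to 1 - 1/p; both errors
      have the favourable sign.\<close>
    have termwise: "y p * x p + \<kappa> * (- ln (1 - real p powr - (1 + s))) \<le> ln (1 + g p * y p)" if p: "p \<in> J" for p
    proof -
      have pr: "prime p" using p unfolding J_def by simp
      then have p1: "1 < real p" using prime_gt_1_nat by simp
      have "ln (singular_factor \<omega> \<kappa> p) = ln (1 - h p) - \<kappa> * ln (1 - 1 / real p)"
        unfolding singular_factor_def h_def[symmetric] using pr h_less_1[OF pr] p1
        by (simp add: ln_mult_pos ln_powr)
      moreover have "ln (1 + g p) = - ln (1 - h p)"
        unfolding one_plus_g[OF pr] using h_less_1[OF pr] by (simp add: ln_divide_pos)
      ultimately have xp: "x p = ln (1 + g p) + \<kappa> * ln (1 - 1 / real p)" unfolding x_def using pr by simp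
      have "y p * ln (1 - (- g p)) \<le> ln (1 - y p * (- g p))"
        using y[OF p] g_nonneg[OF pr] by (intro one_minus_mult_ge_powr) auto
      moreover have "real p powr - (1 + s) = y p * (1 / real p)"
        unfolding y(3)[OF p] using p1 by (simp add: powr_diff powr_minus field_simps)
      moreover have "y p * ln (1 - 1 / real p) \<le> ln (1 - y p * (1 / real p))"
        using y[OF p] p1 by (intro one_minus_mult_ge_powr) auto
      then have "\<kappa> * (y p * ln (1 - 1 / real p)) \<le> \<kappa> * ln (1 - y p * (1 / real p))" using kappa by (intro mult_left_mono) auto
      ultimately show ?thesis unfolding xp by (simp add: algebra_simps)
    qed
    have "a - \<epsilon> \<le> (\<Sum>k = 1..N. x k * real k powr - s)"
      using abel_sum_ge[OF s n1(1) N(2), where x = x and a = a and b = b] b n1(2) elim unfolding X_def by force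
    also have "\<dots> = (\<Sum>p\<in>J. y p * x p)"
    proof -
      have "(\<Sum>k = 1..N. x k * real k powr - s) = (\<Sum>k\<in>J. x k * real k powr - s)"
        unfolding J_def by (rule sum.mono_neutral_right) (auto simp: x_def Suc_le_eq prime_gt_0_nat)
      also have "\<dots> = (\<Sum>p\<in>J. y p * x p)" by (intro sum.cong refl) (simp add: y(3))
      finally show ?thesis .
    qed
    finally have 1: "a - \<epsilon> \<le> (\<Sum>p\<in>J. y p * x p)" .
    have Ns: "real (N + 1) powr - s < 1"
      using powr_less_mono[of "- s" 0 "real (N + 1)"] s N(2) n1(1) by simp
    have 2: "\<kappa> * ln (1 - real (N + 1) powr - s) - \<kappa> * ln s \<le> (\<Sum>p\<in>J. \<kappa> * (- ln (1 - real p powr - (1 + s))))"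
    proof -
      have "\<kappa> * ln ((1 - real (N + 1) powr - s) / s) \<le> \<kappa> * (\<Sum>p\<in>J. - ln (1 - real p powr - (1 + s)))"
        unfolding J_def using kappa N n1 s by (intro mult_left_mono sum_neg_ln_euler_ge) auto
      then show ?thesis using Ns s by (simp add: ln_divide_pos sum_distrib_left right_diff_distrib)
    qed
    have ypos: "0 < 1 + g p * y p" if "p \<in> J" for p
      using g_nonneg[of p] y(1)[OF that] that unfolding J_def by (simp add: add_pos_nonneg)
    have "a - \<epsilon> - \<epsilon> - \<kappa> * ln s \<le> (\<Sum>p\<in>J. y p * x p + \<kappa> * (- ln (1 - real p powr - (1 + s))))"
      unfolding sum.distrib using 1 2 N(1) by linarith
    also have "\<dots> \<le> (\<Sum>p\<in>J. ln (1 + g p * y p))" by (intro sum_mono termwise)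
    also have "\<dots> = ln (\<Prod>p\<in>J. 1 + g p * y p)"
      by (rule ln_prod[symmetric]) (use ypos finite_primes_le in \<open>auto simp: J_def less_imp_neq[THEN not_sym]\<close>)
    finally have "ln c \<le> \<kappa> * ln s + ln (\<Prod>p\<in>J. 1 + g p * y p)" using eps unfolding a_def \<epsilon>_def by (simp add: field_simps)
    also have "\<dots> = ln (s powr \<kappa> * (\<Prod>p\<in>J. 1 + g p * y p))"
      using s ypos by (subst ln_mult_pos) (auto simp: ln_powr intro!: prod_pos)
    finally have "c \<le> s powr \<kappa> * (\<Prod>p\<in>J. 1 + g p * y p)"
      using c s ypos by (subst (asm) ln_le_cancel_iff) (auto intro!: prod_pos mult_pos_pos)
    then show ?case using c finite_primes_le unfolding J_def y_def by (intro exI[of _ "primes_le N"]) auto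
  qed
qed

lemma K_pos: "0 < K" unfolding K_def using A2 m1_log_nonneg[of "ln 2"] by simp

text \<open>\<open>G_lower\<close> with B = K - \<delta>: the two upward deviations, A2 from
  \<open>V\<close> and \<open>m1_log (ln 2)\<close> from \<open>b\<close>, add up to exactly K = B +
  \<delta>.\<close>

theorem G_lower_main:
  assumes d: "0 \<le> \<delta>" "\<delta> < K" "\<delta> < u" and vb: "\<And>y. 0 < y \<Longrightarrow> gp.V y + gp.b y \<le> \<kappa> * y + \<delta>"
  shows "(u - \<delta>) powr (\<kappa> + 1) \<le> P_lim * (Gamma (\<kappa> + 1) * ((u + (K - \<delta>)) * gp.G u))"
proof -
  have "1 / P_lim * (u - \<delta>) powr (\<kappa> + 1) \<le> Gamma (\<kappa> + 1) * ((u + (K - \<delta>)) * gp.G u)"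
    by (rule gp.G_lower[where A = A2 and bm = "m1_log (ln 2)" and Lm = "\<kappa> * ln 2 + max L 0"])
       (use d kappa singular_product(3) gp_euler_lower vb gp_V_incr gp_b_le' gp_V_ge in \<open>auto simp: K_def\<close>)
  then show ?thesis using singular_product(3) by (simp add: field_simps)
qed

end

section \<open>Selberg's sieve\<close>

text \<open>Removing L from every D leaves the expansion of a product of factors -1 + 1 over K - L.
  This is Moebius cancellation for squarefree divisors.\<close>

lemma sum_alternating_interval:
  assumes "finite K" "L \<subseteq> K"
  shows "(\<Sum>D | L \<subseteq> D \<and> D \<subseteq> K. (- 1) ^ card D) = (if L = K then (- 1) ^ card L else (0::real))"
proof -
  have fin: "finite L" "finite (K - L)" using assms finite_subset by auto
  have "(\<Sum>D | L \<subseteq> D \<and> D \<subseteq> K. (- 1) ^ card D) = (\<Sum>D\<in>Pow (K - L). (- 1::real) ^ (card L + card D))"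
    by (rule sum.reindex_bij_witness[where i = "\<lambda>D. L \<union> D" and j = "\<lambda>D. D - L"])
       (use assms fin in \<open>auto simp: card_Diff_subset card_mono finite_subset[OF _ assms(1)]\<close>)
  also have "\<dots> = (- 1) ^ card L * (\<Sum>D\<in>Pow (K - L). (\<Prod>x\<in>D. - 1) * (\<Prod>x\<in>K - L - D. 1))"
    by (simp add: power_add sum_distrib_left)
  also have "(\<Sum>D\<in>Pow (K - L). (\<Prod>x\<in>D. - 1) * (\<Prod>x\<in>K - L - D. 1)) = (\<Prod>x\<in>K - L. - 1 + (1::real))"
    by (rule prod_add[OF fin(2), symmetric])
  also have "\<dots> = (if L = K then 1 else 0)" using assms fin(2) by (auto simp: card_eq_0_iff)
  finally show ?thesis by simp
qed

locale selberg_weights =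
  fixes Q :: "'p set" and h :: "'p \<Rightarrow> real" and DD :: "'p set set"
  assumes finite_Q: "finite Q" and h: "\<And>p. p \<in> Q \<Longrightarrow> 0 < h p \<and> h p < 1"
    and DD_Q: "DD \<subseteq> Pow Q" and down: "\<And>D E. D \<in> DD \<Longrightarrow> E \<subseteq> D \<Longrightarrow> E \<in> DD"
    and empty_DD: "{} \<in> DD"
begin

definition g where "g p = h p / (1 - h p)"
definition G where "G = (\<Sum>K\<in>DD. prod g K)"
text \<open>Selberg's optimal weights. The form is that of a Moebius inversion:
  \<open>lam_transform\<close> recovers from them the minimizing values of the diagonal
  variables.\<close>

definition lam where
  "lam D = (- 1) ^ card D / prod h D * (\<Sum>K | K \<in> DD \<and> D \<subseteq> K. prod g K) / G"

lemma finite_DD: "finite DD" using DD_Q finite_Q finite_subset by blast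
lemma fin: "D \<in> DD \<Longrightarrow> finite D" using DD_Q finite_Q finite_subset by blast

lemma g_pos: "p \<in> Q \<Longrightarrow> 0 < g p" unfolding g_def using h by simp
lemma prod_g_pos: "D \<subseteq> Q \<Longrightarrow> 0 < prod g D" by (intro prod_pos) (use g_pos in auto)
lemma prod_h_pos: "D \<subseteq> Q \<Longrightarrow> 0 < prod h D" by (intro prod_pos) (use h in auto)
lemma sub: "D \<in> DD \<Longrightarrow> D \<subseteq> Q" using DD_Q by blast

lemma G_pos: "0 < G"
  unfolding G_def using finite_DD empty_DD prod_g_pos[OF sub]
  by (intro sum_pos) auto

lemma lam_empty: "lam {} = 1"
  unfolding lam_def using G_pos by (simp add: G_def)

lemma lam_transform:
  assumes L: "L \<in> DD"
  shows "(\<Sum>D\<in>DD. if L \<subseteq> D then lam D * prod h D else 0) = (- 1) ^ card L * prod g L / G"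
proof -
  have "(\<Sum>D\<in>DD. if L \<subseteq> D then lam D * prod h D else 0) =
      (\<Sum>D\<in>DD. \<Sum>K\<in>DD. if L \<subseteq> D \<and> D \<subseteq> K then (- 1) ^ card D * prod g K / G else 0)"
  proof (intro sum.cong refl)
    fix D assume D: "D \<in> DD"
    have "lam D * prod h D = (\<Sum>K | K \<in> DD \<and> D \<subseteq> K. (- 1) ^ card D * prod g K / G)"
    proof -
      have "lam D * prod h D = (- 1) ^ card D * (\<Sum>K | K \<in> DD \<and> D \<subseteq> K. prod g K) / G"
        unfolding lam_def using prod_h_pos[OF sub[OF D]] by simp
      then show ?thesis by (simp add: sum_distrib_left sum_divide_distrib)
    qed
    also have "\<dots> = (\<Sum>K\<in>DD. if D \<subseteq> K then (- 1) ^ card D * prod g K / G else 0)"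
      by (rule sum.inter_filter[OF finite_DD])
    finally show "(if L \<subseteq> D then lam D * prod h D else 0) =
        (\<Sum>K\<in>DD. if L \<subseteq> D \<and> D \<subseteq> K then (- 1) ^ card D * prod g K / G else 0)" by simp
  qed
  also have "\<dots> = (\<Sum>K\<in>DD. \<Sum>D\<in>DD. if L \<subseteq> D \<and> D \<subseteq> K then (- 1) ^ card D * prod g K / G else 0)"
    by (rule sum.swap)
  also have "\<dots> = (\<Sum>K\<in>DD. if L = K then (- 1) ^ card L * prod g K / G else 0)"
  proof (intro sum.cong refl)
    fix K assume K: "K \<in> DD"
    have "(\<Sum>D\<in>DD. if L \<subseteq> D \<and> D \<subseteq> K then (- 1) ^ card D * prod g K / G else 0)
        = (\<Sum>D | D \<in> DD \<and> L \<subseteq> D \<and> D \<subseteq> K. (- 1) ^ card D * prod g K / G)"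
      by (rule sum.inter_filter[OF finite_DD, symmetric])
    also have "{D. D \<in> DD \<and> L \<subseteq> D \<and> D \<subseteq> K} = {D. L \<subseteq> D \<and> D \<subseteq> K}" using down[OF K] by auto
    also have "(\<Sum>D\<in>{D. L \<subseteq> D \<and> D \<subseteq> K}. (- 1) ^ card D * prod g K / G)
        = (\<Sum>D | L \<subseteq> D \<and> D \<subseteq> K. (- 1) ^ card D) * prod g K / G"
      by (simp add: sum_distrib_right sum_divide_distrib)
    also have "\<dots> = (if L = K then (- 1) ^ card L * prod g K / G else 0)"
    proof (cases "L \<subseteq> K")
      case True
      then show ?thesis by (subst sum_alternating_interval[OF fin[OF K]]) auto
    next
      case False
      then have "{D. L \<subseteq> D \<and> D \<subseteq> K} = {}" "L \<noteq> K" by auto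
      then show ?thesis by (simp only:) simp
    qed
    finally show "(\<Sum>D\<in>DD. if L \<subseteq> D \<and> D \<subseteq> K then (- 1) ^ card D * prod g K / G else 0)
        = (if L = K then (- 1) ^ card L * prod g K / G else 0)" .
  qed
  also have "\<dots> = (- 1) ^ card L * prod g L / G" using L finite_DD by simp
  finally show ?thesis .
qed

text \<open>Since 1/h = 1/g + 1, the factor 1/h of the intersection expands into a sum of 1/g over
  its subsets. This diagonalizes the form into squares of the sums evaluated by
  \<open>lam_transform\<close>.\<close>

lemma quadratic_form: "(\<Sum>D1\<in>DD. \<Sum>D2\<in>DD. lam D1 * lam D2 * prod h (D1 \<union> D2)) = 1 / G"
proof -
  define y where "y L D = (if L \<subseteq> D then lam D * prod h D else 0)" for L D
  have eq: "lam D1 * lam D2 * prod h (D1 \<union> D2) = (\<Sum>L\<in>DD. (\<Prod>p\<in>L. 1 / g p) * (y L D1 * y L D2))"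
    if D: "D1 \<in> DD" "D2 \<in> DD" for D1 D2
  proof -
    have f: "finite D1" "finite D2" using fin D by auto
    have I: "D1 \<inter> D2 \<in> DD" using down[OF D(1)] by blast
    have "prod h (D1 \<union> D2) * prod h (D1 \<inter> D2) = prod h D1 * prod h D2"
      by (rule prod.union_inter[OF f])
    then have u: "prod h (D1 \<union> D2) = prod h D1 * prod h D2 * (1 / prod h (D1 \<inter> D2))"
      using prod_h_pos[OF sub[OF I]] by (simp add: field_simps)
    have i: "1 / prod h (D1 \<inter> D2) = (\<Sum>L\<in>Pow (D1 \<inter> D2). \<Prod>p\<in>L. 1 / g p)"
    proof -
      have "1 / prod h (D1 \<inter> D2) = (\<Prod>p\<in>D1 \<inter> D2. 1 / g p + 1)"
        unfolding prod_dividef[of "\<lambda>_. 1", simplified, symmetric]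
      proof (intro prod.cong refl)
        fix p assume "p \<in> D1 \<inter> D2"
        then have "0 < h p" "h p < 1" using h sub[OF D(1)] by auto
        then show "1 / h p = 1 / g p + 1" unfolding g_def by (simp add: field_simps)
      qed
      also have "\<dots> = (\<Sum>L\<in>Pow (D1 \<inter> D2). (\<Prod>p\<in>L. 1 / g p) * (\<Prod>p\<in>D1 \<inter> D2 - L. 1))"
        using f by (intro prod_add) auto
      finally show ?thesis by simp
    qed
    have j: "(\<Sum>L\<in>Pow (D1 \<inter> D2). \<Prod>p\<in>L. 1 / g p) = (\<Sum>L\<in>DD. if L \<subseteq> D1 \<inter> D2 then \<Prod>p\<in>L. 1 / g p else 0)"
    proof -
      have "Pow (D1 \<inter> D2) = {L \<in> DD. L \<subseteq> D1 \<inter> D2}" using down[OF I] by auto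
      then show ?thesis by (simp only: sum.inter_filter[OF finite_DD])
    qed
    show ?thesis unfolding u i j y_def
      by (simp add: sum_distrib_left mult_ac if_distrib cong: if_cong) (intro sum.cong, auto)
  qed
  have "(\<Sum>D1\<in>DD. \<Sum>D2\<in>DD. lam D1 * lam D2 * prod h (D1 \<union> D2))
      = (\<Sum>D1\<in>DD. \<Sum>D2\<in>DD. \<Sum>L\<in>DD. (\<Prod>p\<in>L. 1 / g p) * (y L D1 * y L D2))"
    by (intro sum.cong refl eq)
  also have "\<dots> = (\<Sum>D1\<in>DD. \<Sum>L\<in>DD. \<Sum>D2\<in>DD. (\<Prod>p\<in>L. 1 / g p) * (y L D1 * y L D2))"
    by (intro sum.cong refl sum.swap)
  also have "\<dots> = (\<Sum>L\<in>DD. \<Sum>D1\<in>DD. \<Sum>D2\<in>DD. (\<Prod>p\<in>L. 1 / g p) * (y L D1 * y L D2))"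
    by (rule sum.swap)
  also have "\<dots> = (\<Sum>L\<in>DD. (\<Prod>p\<in>L. 1 / g p) * ((\<Sum>D\<in>DD. y L D) * (\<Sum>D\<in>DD. y L D)))"
    unfolding sum_product by (simp only: sum_distrib_left)
  also have "\<dots> = (\<Sum>L\<in>DD. prod g L / G\<^sup>2)"
  proof (intro sum.cong refl)
    fix L assume L: "L \<in> DD"
    have "(\<Prod>p\<in>L. 1 / g p) = 1 / prod g L" by (simp add: prod_dividef)
    moreover have "(\<Sum>D\<in>DD. y L D) = (- 1) ^ card L * prod g L / G"
      unfolding y_def by (rule lam_transform[OF L])
    moreover have "((- 1) ^ card L * (- 1) ^ card L :: real) = 1" by (simp add: power_mult_distrib[symmetric])
    ultimately show "(\<Prod>p\<in>L. 1 / g p) * ((\<Sum>D\<in>DD. y L D) * (\<Sum>D\<in>DD. y L D)) = prod g L / G\<^sup>2"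
      using prod_g_pos[OF sub[OF L]] by (simp add: field_simps power2_eq_square)
  qed
  also have "\<dots> = 1 / G" using G_pos by (simp add: sum_divide_distrib[symmetric] G_def[symmetric] power2_eq_square)
  finally show ?thesis .
qed

text \<open>Y consists of the complements of D in the members of DD that contain D. Every union of a
  subset of D with a member of Y lies in DD, so G is at least the product of 1 + g over D times the
  sum over Y, and 1 + g = g / h is the normalization in \<open>lam\<close>.\<close>

lemma abs_lam_le_1:
  assumes D: "D \<in> DD" shows "\<bar>lam D\<bar> \<le> 1"
proof -
  define Y where "Y = {K. K \<inter> D = {} \<and> K \<union> D \<in> DD}"
  have DQ: "D \<subseteq> Q" and fD: "finite D" using sub fin D by auto
  have YD: "K \<in> DD" if "K \<in> Y" for K using that down unfolding Y_def by blast
  have finY: "finite Y" using YD finite_DD by (meson finite_subset subsetI)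
  have 1: "(\<Sum>K | K \<in> DD \<and> D \<subseteq> K. prod g K) = prod g D * (\<Sum>K\<in>Y. prod g K)"
    unfolding sum_distrib_left
  proof (rule sum.reindex_bij_witness[where i = "\<lambda>K. K \<union> D" and j = "\<lambda>K. K - D"])
    fix K assume K: "K \<in> {K. K \<in> DD \<and> D \<subseteq> K}"
    show "K - D \<in> Y" using K unfolding Y_def by (auto simp: Un_absorb2)
    show "K - D \<union> D = K" using K by auto
    show "prod g D * prod g (K - D) = prod g K"
      using K fin by (metis (no_types, lifting) mem_Collect_eq mult.commute prod.subset_diff)
  next
    fix K assume "K \<in> Y"
    then show "K \<union> D \<in> {K. K \<in> DD \<and> D \<subseteq> K}" "K \<union> D - D = K" unfolding Y_def by auto
  qed
  have "(\<Sum>L\<in>Pow D. prod g L) * (\<Sum>K\<in>Y. prod g K) = (\<Sum>(L, K)\<in>Pow D \<times> Y. prod g (L \<union> K))"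
    unfolding sum_product sum.cartesian_product
  proof (intro sum.cong refl)
    fix x assume "x \<in> Pow D \<times> Y"
    then obtain L K where x: "x = (L, K)" "L \<subseteq> D" "K \<in> Y" by auto
    have "L \<inter> K = {}" "finite L" "finite K" using x fD YD fin finite_subset unfolding Y_def by blast+
    then show "(case x of (x, y) \<Rightarrow> prod g x * prod g y) = (case x of (L, K) \<Rightarrow> prod g (L \<union> K))"
      using x by (simp add: prod.union_disjoint)
  qed
  also have "\<dots> = (\<Sum>K\<in>(\<lambda>(L, K). L \<union> K) ` (Pow D \<times> Y). prod g K)"
  proof (subst sum.reindex)
    show "inj_on (\<lambda>(L, K). L \<union> K) (Pow D \<times> Y)"
    proof (rule inj_onI)
      fix x x' assume a: "x \<in> Pow D \<times> Y" "x' \<in> Pow D \<times> Y"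
        "(case x of (L, K) \<Rightarrow> L \<union> K) = (case x' of (L, K) \<Rightarrow> L \<union> K)"
      obtain L K L' K' where x: "x = (L, K)" "x' = (L', K')" by fastforce
      have "L = (L \<union> K) \<inter> D" "K = (L \<union> K) - D" "L' = (L' \<union> K') \<inter> D" "K' = (L' \<union> K') - D"
        using a x unfolding Y_def by auto
      then show "x = x'" using a(3) x by auto
    qed
  qed (auto simp: o_def case_prod_unfold)
  also have "\<dots> \<le> G" unfolding G_def
  proof (rule sum_mono2[OF finite_DD])
    show "(\<lambda>(L, K). L \<union> K) ` (Pow D \<times> Y) \<subseteq> DD"
    proof clarify
      fix L K assume "L \<subseteq> D" "K \<in> Y"
      then show "L \<union> K \<in> DD" unfolding Y_def by (auto intro!: down[of "K \<union> D"])
    qed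
  qed (use prod_g_pos[OF sub] in \<open>auto simp: less_imp_le\<close>)
  finally have 2: "(\<Sum>L\<in>Pow D. prod g L) * (\<Sum>K\<in>Y. prod g K) \<le> G" .
  have "(\<Sum>L\<in>Pow D. prod g L) = prod g D / prod h D"
  proof -
    have "(\<Sum>L\<in>Pow D. prod g L) = (\<Sum>L\<in>Pow D. prod g L * (\<Prod>p\<in>D - L. 1))" by simp
    also have "\<dots> = (\<Prod>p\<in>D. g p + 1)" by (rule prod_add[OF fD, symmetric])
    also have "\<dots> = (\<Prod>p\<in>D. g p / h p)"
    proof (intro prod.cong refl)
      fix p assume "p \<in> D"
      then have "0 < h p" "h p < 1" using h DQ by auto
      then show "g p + 1 = g p / h p" unfolding g_def by (simp add: field_simps)
    qed
    finally show ?thesis by (simp add: prod_dividef)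
  qed
  with 2 have le: "prod g D * (\<Sum>K\<in>Y. prod g K) / prod h D \<le> G" by simp
  have nn: "0 \<le> prod g D * (\<Sum>K\<in>Y. prod g K) / prod h D"
    using prod_g_pos[OF DQ] prod_h_pos[OF DQ] prod_g_pos[OF sub[OF YD]] by (simp add: sum_nonneg less_imp_le)
  have "lam D = (- 1) ^ card D * (prod g D * (\<Sum>K\<in>Y. prod g K) / prod h D / G)"
    unfolding lam_def 1 by simp
  then have "\<bar>lam D\<bar> = prod g D * (\<Sum>K\<in>Y. prod g K) / prod h D / G"
    using nn G_pos by (simp only: abs_mult power_abs abs_minus_cancel abs_one power_one mult_1 abs_of_nonneg divide_nonneg_pos)
  also have "\<dots> \<le> 1" using le G_pos by (simp only: divide_le_eq_1_pos)
  finally show ?thesis .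
qed

end

text \<open>A prime of the union lies in the first set only, in the second only, or in both; hence
  the 3.\<close>

lemma sum_Pow_union_le:
  fixes h :: "'p \<Rightarrow> real"
  assumes "finite Q"
  shows "(\<Sum>D\<in>Pow Q. \<Sum>E\<in>Pow Q. prod h (D \<union> E)) = (\<Prod>p\<in>Q. 1 + 3 * h p)"
  using assms
proof (induction Q rule: finite_induct)
  case (insert p Q)
  have split: "(\<Sum>D\<in>Pow (insert p Q). f D) = (\<Sum>D\<in>Pow Q. f D) + (\<Sum>D\<in>Pow Q. f (insert p D))" for f :: "'p set \<Rightarrow> real"
  proof -
    have "inj_on (insert p) (Pow Q)" using insert by (auto simp: inj_on_def)
    moreover have "Pow Q \<inter> insert p ` Pow Q = {}" using insert by auto
    ultimately show ?thesis unfolding Pow_insert using insert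
      by (subst sum.union_disjoint) (auto simp: sum.reindex o_def)
  qed
  have pr: "prod h (insert p D) = h p * prod h D" if "D \<subseteq> Q" for D
    using that insert finite_subset by (subst prod.insert) auto
  have "(\<Sum>D\<in>Pow (insert p Q). \<Sum>E\<in>Pow (insert p Q). prod h (D \<union> E))
      = (\<Sum>D\<in>Pow Q. \<Sum>E\<in>Pow Q. prod h (D \<union> E)) + 3 * (h p * (\<Sum>D\<in>Pow Q. \<Sum>E\<in>Pow Q. prod h (D \<union> E)))"
    unfolding split by (simp add: pr sum.distrib sum_distrib_left[symmetric])
  then show ?case using insert by (simp add: algebra_simps)
qed simp

section \<open>From sets of primes to squarefree numbers\<close>

lemma prod_mult_squarefree:
  assumes mult: "multiplicative_on_squarefree \<omega>" and "finite D" "\<And>p. p \<in> D \<Longrightarrow> prime p"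
  shows "\<omega> (\<Prod>D) = prod \<omega> D \<and> squarefree (\<Prod>D) \<and> prime_factors (\<Prod>D) = D"
  using assms(2,3)
proof (induction D rule: finite_induct)
  case empty
  then show ?case using mult by (simp add: multiplicative_on_squarefree_def)
next
  case (insert p D)
  have p: "prime p" and IH: "\<omega> (\<Prod>D) = prod \<omega> D" "squarefree (\<Prod>D)" "prime_factors (\<Prod>D) = D" using insert by auto
  have nz: "\<Prod>D \<noteq> 0" by (metis insert.hyps(1) insert.prems insert_iff not_prime_0 prod_zero_iff)
  have cop: "coprime p (\<Prod>D)" using insert by (intro prod_coprime_right) (auto intro!: primes_coprime)
  have sp: "squarefree p" using p by (rule squarefree_prime)
  have "\<omega> (p * \<Prod>D) = \<omega> p * \<omega> (\<Prod>D)"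
    using mult cop sp IH unfolding multiplicative_on_squarefree_def by blast
  moreover have "squarefree (p * \<Prod>D)" using cop sp IH by (intro squarefree_mult_coprime)
  moreover have "prime_factors (p * \<Prod>D) = insert p D"
    using nz p IH by (subst prime_factors_product) (auto simp: prime_factorization_prime)
  ultimately show ?case using insert IH by simp
qed

lemma sum_list_sum_swap:
  fixes f :: "'b \<Rightarrow> 'a \<Rightarrow> real"
  shows "(\<Sum>a\<leftarrow>A. \<Sum>x\<in>S. f x a) = (\<Sum>x\<in>S. \<Sum>a\<leftarrow>A. f x a)"
  by (induction A) (auto simp: sum.distrib)

lemma sum_list_of_bool: "(\<Sum>a\<leftarrow>A. of_bool (P a) :: real) = real (length (filter P A))"
  by (induction A) auto

theorem selberg_upper_bound:
  fixes \<omega> :: "nat \<Rightarrow> real" and y X zz :: real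
  assumes mult: "multiplicative_on_squarefree \<omega>" and R: "cond_R A P \<omega> X"
    and P: "P \<subseteq> {p. prime p}" and Q: "Q \<subseteq> {p \<in> P. real p \<le> zz}"
    and h: "\<And>p. p \<in> Q \<Longrightarrow> 0 < \<omega> p / real p \<and> \<omega> p / real p < 1" and y: "1 < y"
  defines "GG \<equiv> (\<Sum>D | D \<subseteq> Q \<and> real (\<Prod>D) < y. \<Prod>p\<in>D. \<omega> p / real p / (1 - \<omega> p / real p))"
  shows "real (sifted A P zz) \<le> X / GG + y\<^sup>2 * (\<Prod>p\<in>Q. 1 + 3 * (\<omega> p / real p))"
proof -
  define hh where "hh p = \<omega> p / real p" for p
  define DD where "DD = {D. D \<subseteq> Q \<and> real (\<Prod>D) < y}"
  define PP where "PP = {p \<in> P. real p \<le> zz}"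
  have finPP: "finite PP" unfolding PP_def
    by (rule finite_subset[of _ "{..nat \<lfloor>zz\<rfloor>}"]) (auto simp: le_nat_floor)
  have finQ: "finite Q" using Q finPP finite_subset unfolding PP_def by blast
  have prime: "prime p" if "p \<in> Q" for p using that Q P by auto
  have finD: "finite D" if "D \<subseteq> Q" for D using that finQ finite_subset by blast
  have prodpos: "0 < \<Prod>D" if "D \<subseteq> Q" for D
    using that prime prime_gt_0_nat by (intro prod_pos) auto
  interpret selberg_weights Q hh DD
  proof
    show "D \<in> DD \<Longrightarrow> E \<subseteq> D \<Longrightarrow> E \<in> DD" for D E
    proof -
      assume a: "D \<in> DD" "E \<subseteq> D"
      then have "\<Prod>E dvd \<Prod>D" using finD by (intro prod_dvd_prod_subset) (auto simp: DD_def)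
      then have "\<Prod>E \<le> \<Prod>D" using prodpos a by (intro dvd_imp_le) (auto simp: DD_def)
      then have "real (\<Prod>E) \<le> real (\<Prod>D)" by (simp only: of_nat_le_iff)
      then show "E \<in> DD" using a unfolding DD_def by force
    qed
  qed (use finQ h y in \<open>auto simp: DD_def hh_def\<close>)
  have G_eq: "G = GG"
    unfolding GG_def G_def by (simp add: DD_def g_def hh_def)
  have hprod: "\<omega> (\<Prod>D) / real (\<Prod>D) = prod hh D" "squarefree (\<Prod>D)" "prime_factors (\<Prod>D) = D" if "D \<subseteq> Q" for D
    using prod_mult_squarefree[OF mult finD[OF that]] that prime by (auto simp: hh_def prod_dividef)
  have dvd_union: "\<Prod>(D \<union> E) dvd a \<longleftrightarrow> \<Prod>D dvd a \<and> \<Prod>E dvd a" if "D \<subseteq> Q" "E \<subseteq> Q" for D E a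
  proof
    assume "\<Prod>(D \<union> E) dvd a"
    moreover have "\<Prod>D dvd \<Prod>(D \<union> E)" "\<Prod>E dvd \<Prod>(D \<union> E)"
      using that finD by (auto intro!: prod_dvd_prod_subset)
    ultimately show "\<Prod>D dvd a \<and> \<Prod>E dvd a" using dvd_trans by blast
  next
    assume a: "\<Prod>D dvd a \<and> \<Prod>E dvd a"
    have "\<Prod>(D \<union> E) = \<Prod>D * \<Prod>(E - D)"
      using finD[OF that(1)] finD[OF that(2)] prod.union_disjoint[of D "E - D" "\<lambda>x. x"] by auto
    moreover have "coprime (\<Prod>D) (\<Prod>(E - D))"
      using that prime by (intro prod_coprime_left prod_coprime_right primes_coprime) auto
    moreover have "\<Prod>(E - D) dvd a" using a prod_dvd_prod_subset[of E "E - D" "\<lambda>x. x"] finD[OF that(2)] dvd_trans by blast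
    ultimately show "\<Prod>(D \<union> E) dvd a" using a by (simp add: divides_mult)
  qed
  define d where "d D a = (of_bool (\<Prod>D dvd a) :: real)" for D :: "nat set" and a :: nat
  have "real (sifted A P zz) = (\<Sum>a\<leftarrow>A. of_bool (coprime a (sieve_prod P zz)))"
    unfolding sifted_def by (rule sum_list_of_bool[symmetric])
  also have "\<dots> \<le> (\<Sum>a\<leftarrow>A. (\<Sum>D\<in>DD. lam D * d D a)\<^sup>2)"
  proof (rule sum_list_mono)
    fix a
    show "of_bool (coprime a (sieve_prod P zz)) \<le> (\<Sum>D\<in>DD. lam D * d D a)\<^sup>2"
    proof (cases "coprime a (sieve_prod P zz)")
      case True
      have "d D a = 0" if D: "D \<in> DD" "D \<noteq> {}" for D
      proof -
        obtain p where p: "p \<in> D" using D by blast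
        have DQ: "D \<subseteq> Q" using D by (auto simp: DD_def)
        have "p \<in> PP" using p DQ Q unfolding PP_def by auto
        then have "p dvd sieve_prod P zz" unfolding sieve_prod_def PP_def[symmetric] using finPP by (intro dvd_prodI) auto
        moreover have "p dvd \<Prod>D" using p finD[OF DQ] by (intro dvd_prodI) auto
        moreover have "\<not> p dvd 1" using prime p DQ by (metis not_prime_1 nat_dvd_1_iff_1 subsetD)
        ultimately have "\<not> \<Prod>D dvd a" using True by (meson coprime_common_divisor dvd_trans)
        then show ?thesis unfolding d_def by simp
      qed
      then have "(\<Sum>D\<in>DD. lam D * d D a) = (\<Sum>D\<in>{{}}. lam D * d D a)"
        using finite_DD empty_DD by (intro sum.mono_neutral_right) auto
      then show ?thesis by (simp add: lam_empty d_def)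
    qed simp
  qed
  also have "\<dots> = (\<Sum>a\<leftarrow>A. \<Sum>D1\<in>DD. \<Sum>D2\<in>DD. lam D1 * lam D2 * d (D1 \<union> D2) a)"
  proof (intro arg_cong[where f = sum_list] map_cong refl)
    fix a
    have "d D1 a * d D2 a = d (D1 \<union> D2) a" if "D1 \<in> DD" "D2 \<in> DD" for D1 D2
      using dvd_union[of D1 D2] that unfolding d_def DD_def by auto
    then show "(\<Sum>D\<in>DD. lam D * d D a)\<^sup>2 = (\<Sum>D1\<in>DD. \<Sum>D2\<in>DD. lam D1 * lam D2 * d (D1 \<union> D2) a)"
      unfolding power2_eq_square sum_product by (intro sum.cong refl) (simp add: mult_ac)
  qed
  also have "\<dots> = (\<Sum>D1\<in>DD. \<Sum>D2\<in>DD. lam D1 * lam D2 * real (length (divisible_subseq A (\<Prod>(D1 \<union> D2)))))"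
    unfolding sum_list_sum_swap divisible_subseq_def sum_list_of_bool[symmetric] d_def
    by (simp add: sum_list_const_mult)
  also have "\<dots> \<le> (\<Sum>D1\<in>DD. \<Sum>D2\<in>DD. X * (lam D1 * lam D2 * prod hh (D1 \<union> D2)) + y\<^sup>2 * prod hh (D1 \<union> D2))"
  proof (intro sum_mono)
    fix D1 D2 assume D: "D1 \<in> DD" "D2 \<in> DD"
    define E where "E = D1 \<union> D2"
    have E: "E \<subseteq> Q" using D unfolding E_def DD_def by auto
    define rem where "rem = sieve_remainder A \<omega> X (\<Prod>E)"
    have len: "real (length (divisible_subseq A (\<Prod>E))) = prod hh E * X + rem"
      unfolding rem_def sieve_remainder_def hprod(1)[OF E, symmetric] by simp
    have "prime_factors (\<Prod>E) \<subseteq> P" unfolding hprod(3)[OF E] using E Q by auto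
    then have "\<bar>rem\<bar> \<le> \<omega> (\<Prod>E)" using R hprod(2)[OF E] unfolding cond_R_def rem_def by blast
    also have "\<omega> (\<Prod>E) = real (\<Prod>E) * prod hh E" unfolding hprod(1)[OF E, symmetric] using prodpos[OF E] by (simp del: of_nat_prod)
    \<comment> \<open>The factor d in \<omega>(d) = d h(d) is replaced by y^2, since d divides a
      product of two numbers below y. What is left is multiplicative, so the double sum becomes a
      product over primes.\<close>
    also have "\<dots> \<le> y\<^sup>2 * prod hh E"
    proof (intro mult_right_mono)
      have D12: "D1 \<subseteq> Q" "D2 \<subseteq> Q" "real (\<Prod>D1) < y" "real (\<Prod>D2) < y" using D unfolding DD_def by auto
      have "\<Prod>E dvd \<Prod>D1 * \<Prod>D2" unfolding E_def using dvd_union[OF D12(1,2)] by simp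
      then have "\<Prod>E \<le> \<Prod>D1 * \<Prod>D2" using prodpos D12 by (intro dvd_imp_le) auto
      then have "real (\<Prod>E) \<le> real (\<Prod>D1) * real (\<Prod>D2)" by (metis of_nat_le_iff of_nat_mult)
      also have "\<dots> \<le> y * y" using D12 y by (intro mult_mono) (auto intro!: prod_nonneg)
      finally show "real (\<Prod>E) \<le> y\<^sup>2" by (simp add: power2_eq_square)
      show "0 \<le> prod hh E" using prod_h_pos[OF E] by simp
    qed
    finally have rem: "\<bar>rem\<bar> \<le> y\<^sup>2 * prod hh E" .
    have "\<bar>lam D1 * lam D2\<bar> \<le> 1" unfolding abs_mult using abs_lam_le_1 D by (intro mult_le_one) auto
    then have "\<bar>lam D1 * lam D2 * rem\<bar> \<le> 1 * \<bar>rem\<bar>" unfolding abs_mult[of _ rem] by (intro mult_right_mono) auto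
    then have "lam D1 * lam D2 * rem \<le> y\<^sup>2 * prod hh E" using rem by linarith
    then show "lam D1 * lam D2 * real (length (divisible_subseq A (\<Prod>(D1 \<union> D2))))
        \<le> X * (lam D1 * lam D2 * prod hh (D1 \<union> D2)) + y\<^sup>2 * prod hh (D1 \<union> D2)"
      unfolding E_def[symmetric] len by (simp add: algebra_simps)
  qed
  also have "\<dots> = X * (1 / G) + y\<^sup>2 * (\<Sum>D1\<in>DD. \<Sum>D2\<in>DD. prod hh (D1 \<union> D2))"
    unfolding quadratic_form[symmetric] by (simp add: sum.distrib sum_distrib_left)
  also have "(\<Sum>D1\<in>DD. \<Sum>D2\<in>DD. prod hh (D1 \<union> D2)) \<le> (\<Prod>p\<in>Q. 1 + 3 * hh p)"
  proof -
    have nn: "0 \<le> prod hh (D \<union> E)" if "D \<subseteq> Q" "E \<subseteq> Q" for D E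
      using prod_h_pos[of "D \<union> E"] that by simp
    have "(\<Sum>D1\<in>DD. \<Sum>D2\<in>DD. prod hh (D1 \<union> D2)) \<le> (\<Sum>D1\<in>DD. \<Sum>D2\<in>Pow Q. prod hh (D1 \<union> D2))"
      using finQ DD_Q nn by (intro sum_mono sum_mono2) auto
    also have "\<dots> \<le> (\<Sum>D1\<in>Pow Q. \<Sum>D2\<in>Pow Q. prod hh (D1 \<union> D2))"
      using finQ DD_Q nn by (intro sum_mono2 sum_nonneg) auto
    finally show ?thesis unfolding sum_Pow_union_le[OF finQ] .
  qed
  finally show ?thesis unfolding G_eq by (simp add: hh_def mult_left_mono)
qed

section \<open>Numerical estimates\<close>

lemma ln_2_bounds: "6931 / 10000 \<le> ln (2::real)" "ln (2::real) \<le> 69318 / 100000"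
  using ln_approx_bounds[of 2 4] by (simp_all add: eval_nat_numeral)

lemma ln_4_eq: "ln (4::real) = 2 * ln 2"
  using ln_mult_pos[of 2 "2::real"] by simp

lemma ln_8_eq: "ln (8::real) = 3 * ln 2"
  using ln_mult_pos[of 2 "4::real"] ln_4_eq by simp

lemma ln_11_ge: "2397 / 1000 \<le> ln (11::real)"
proof -
  have "ln (11::real) = 3 * ln 2 + ln (11 / 8)" using ln_mult_pos[of 8 "11 / 8"] ln_8_eq by simp
  moreover have "3178 / 10000 \<le> ln (11 / 8 :: real)"
    using ln_approx_bounds[of "11 / 8" 2] by (simp add: eval_nat_numeral)
  ultimately show ?thesis using ln_2_bounds by simp
qed

lemma ln_7_ge: "193 / 100 \<le> ln (7::real)"
proof -
  note ln_8_eq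
  moreover have "ln (8 / 7 :: real) \<le> 8 / 7 - 1" by (rule ln_le_minus_one) simp
  ultimately show ?thesis using ln_2_bounds by (simp add: ln_divide_pos)
qed

lemma ln_5_ge: "158 / 100 \<le> ln (5::real)"
proof -
  note ln_4_eq
  moreover have "ln (4 / 5 :: real) \<le> 4 / 5 - 1" by (rule ln_le_minus_one) simp
  ultimately show ?thesis using ln_2_bounds by (simp add: ln_divide_pos)
qed

lemma ln_5_le: "ln (5::real) \<le> 160945 / 100000"
proof -
  have "ln (5::real) = 2 * ln 2 + ln (5 / 4)" using ln_mult_pos[of 4 "5 / 4"] ln_4_eq by simp
  moreover have "ln (5 / 4 :: real) \<le> 22315 / 100000"
    using ln_approx_bounds[of "5 / 4" 2] by (simp add: eval_nat_numeral)
  moreover have "ln (2::real) \<le> 693148 / 1000000"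
    using ln_approx_bounds[of 2 5] by (simp add: eval_nat_numeral)
  ultimately show ?thesis by simp
qed

lemma ln_3_ge_1: "1 \<le> ln (3::real)"
  using exp_le by (subst ln_ge_iff) auto

lemma exp_1_bounds: "271828 / 100000 \<le> exp (1::real)" "exp (1::real) \<le> 271829 / 100000"
proof -
  have "\<bar>exp 1 - 5837465777 / 2147483648\<bar> \<le> (1 / 4294967296 :: real)" using e_approx_32 by simp
  from abs_le_D1[OF this] abs_le_D2[OF this] show "271828 / 100000 \<le> exp (1::real)" "exp (1::real) \<le> 271829 / 100000"
    by linarith+
qed

text \<open>3.44 = 3 + 4 * 0.11. The bound is just good enough for 28 \<le> 9/10 * 31.112 in
  \<open>large_s_bound_small_kappa\<close>.\<close>

lemma exp_344_ge: "31112 / 1000 \<le> exp (344 / 100 :: real)"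
proof -
  have "1 + 11 / 100 + (11 / 100)\<^sup>2 / 2 \<le> exp (11 / 100 :: real)" by (rule exp_lower_Taylor_quadratic) simp
  then have "(1 + 11 / 100 + (11 / 100)\<^sup>2 / 2) ^ 4 \<le> exp (11 / 100 :: real) ^ 4" by (intro power_mono) auto
  moreover have "(271828 / 100000) ^ 3 \<le> exp (1::real) ^ 3" using exp_1_bounds by (intro power_mono) auto
  ultimately have "(271828 / 100000) ^ 3 * (1 + 11 / 100 + (11 / 100)\<^sup>2 / 2) ^ 4 \<le> exp (1::real) ^ 3 * exp (11 / 100) ^ 4"
    by (intro mult_mono) auto
  also have "\<dots> = exp (344 / 100)" by (simp add: exp_of_nat_mult[symmetric] exp_add[symmetric])
  finally have "(271828 / 100000) ^ 3 * (1 + 11 / 100 + (11 / 100)\<^sup>2 / 2) ^ 4 \<le> exp (344 / 100 :: real)" .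
  moreover have "31112 / 1000 \<le> (271828 / 100000) ^ 3 * (1 + 11 / 100 + (11 / 100)\<^sup>2 / 2 :: real) ^ 4"
    by (simp add: power_divide)
  ultimately show ?thesis by linarith
qed

text \<open>Log-convexity interpolates between the two neighbouring factorials, n! \<le> n^n handles
  the integers, and the tangent of ln recovers x ln x.\<close>

lemma Gamma_plus1_le_powr:
  fixes x :: real assumes "1 \<le> x" shows "Gamma (x + 1) \<le> exp (x * ln x)"
proof -
  define n where "n = nat \<lfloor>x\<rfloor>"
  define \<theta> where "\<theta> = x - real n"
  have n: "1 \<le> n" "real n \<le> x" "x < real n + 1" unfolding n_def using assms by linarith+
  have \<theta>: "0 \<le> \<theta>" "\<theta> \<le> 1" unfolding \<theta>_def using n by auto
  have "(ln \<circ> Gamma) ((1 - \<theta>) *\<^sub>R real (n + 1) + \<theta> *\<^sub>R real (n + 2)) \<le> (1 - \<theta>) * (ln \<circ> Gamma) (real (n + 1)) + \<theta> * (ln \<circ> Gamma) (real (n + 2))"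
    by (rule convex_onD[OF log_convex_Gamma_real]) (use \<theta> in auto)
  moreover have "(1 - \<theta>) *\<^sub>R real (n + 1) + \<theta> *\<^sub>R real (n + 2) = x + 1" unfolding \<theta>_def by (simp add: algebra_simps)
  moreover have "Gamma (real (n + 1)) = fact n" "Gamma (real (n + 2)) = fact (n + 1)"
    using Gamma_fact[of n, where 'a = real] Gamma_fact[of "n + 1", where 'a = real] by (simp_all add: add.commute)
  ultimately have "ln (Gamma (x + 1)) \<le> (1 - \<theta>) * ln (fact n) + \<theta> * ln (fact (n + 1))" by simp
  also have "ln (fact (n + 1) :: real) = ln (real (n + 1)) + ln (fact n)" by (simp add: ln_mult)
  also have "(1 - \<theta>) * ln (fact n) + \<theta> * (ln (real (n + 1)) + ln (fact n)) = ln (fact n) + \<theta> * ln (real (n + 1))"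
    by (simp add: algebra_simps)
  also have "ln (fact n :: real) \<le> real n * ln (real n)"
  proof -
    have "fact n \<le> (of_nat (n ^ n) :: real)" by (rule fact_le_power)
    then have "ln (fact n :: real) \<le> ln (real n ^ n)" by (intro ln_mono) auto
    then show ?thesis using n by (simp add: ln_realpow)
  qed
  also have "ln (real (n + 1)) \<le> ln (real n) + 1"
  proof -
    have "ln (real (n + 1) / real n) \<le> real (n + 1) / real n - 1" using n by (intro ln_le_minus_one) auto
    also have "\<dots> \<le> 1" using n by (simp add: field_simps)
    finally show ?thesis using n by (simp add: ln_divide_pos)
  qed
  then have "real n * ln (real n) + \<theta> * ln (real (n + 1)) \<le> real n * ln (real n) + \<theta> * (ln (real n) + 1)"
    using \<theta> by (intro add_left_mono mult_left_mono) auto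
  also have "\<dots> = x * ln (real n) + \<theta>" unfolding \<theta>_def by (simp add: algebra_simps)
  also have "\<dots> \<le> x * ln x"
  proof -
    have "ln (real n / x) \<le> real n / x - 1" using n by (intro ln_le_minus_one) auto
    then have "ln (real n) - ln x \<le> real n / x - 1" using n by (simp add: ln_divide_pos)
    then have "x * (ln (real n) - ln x) \<le> x * (real n / x - 1)" using n by (intro mult_left_mono) auto
    also have "\<dots> = - \<theta>" using n unfolding \<theta>_def by (simp add: field_simps)
    finally show ?thesis by (simp add: algebra_simps)
  qed
  finally have "ln (Gamma (x + 1)) \<le> x * ln x" by simp
  moreover have "0 < Gamma (x + 1)" using assms by (intro Gamma_real_pos) auto
  ultimately show ?thesis by (metis exp_le_cancel_iff exp_ln)
qed

text \<open>This combination, times \<kappa>, is the exponent of (2 ln 2)^(4\<kappa>)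
  e^(\<gamma>\<kappa>), the denominator of \<open>M\<close> apart from Gamma.\<close>

lemma euler_constant_bound: "4 * ln (2 * ln 2) + euler_mascheroni \<le> (1898 / 1000 :: real)"
proof -
  have "ln (2 * ln 2) \<le> ln (138636 / 100000 :: real)" using ln_2_bounds by (intro ln_mono) auto
  moreover have "ln (138636 / 100000 :: real) \<le> 32675 / 100000"
    using ln_approx_bounds[of "138636 / 100000" 2] by (simp add: eval_nat_numeral)
  ultimately show ?thesis using euler_mascheroni_less_13_over_22 by linarith
qed

text \<open>The upper bound for \<open>K\<close> in terms of the solution \<open>s\<close> of \<open>(\<kappa> + 1) s + s\<^sup>2 / log 2 = log 2 \<cdot> log (m\<^sub>2 log\<^sup>\<kappa> 2)\<close>.\<close>

definition K_bound :: "real \<Rightarrow> real \<Rightarrow> real" where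
  "K_bound \<kappa> s = s * (1 + \<kappa> * ln 2) + 2 / ln 2 * s\<^sup>2 * (\<kappa> + 1 + 2 / ln 2 * s)"

text \<open>The slope of the chord, over \<open>0 \<le> \<delta> \<le> u / (\<kappa> + 2)\<close>, of the convex function of \<open>\<delta>\<close> that bounds \<open>1 / G\<close>.\<close>

definition chord_slope :: "real \<Rightarrow> real" where
  "chord_slope \<kappa> = (1 + 1 / (\<kappa> + 1)) powr (\<kappa> + 1) * (\<kappa> + 2) - \<kappa> - 3"

lemma chord_slope_le: assumes "1 \<le> \<kappa>" shows "chord_slope \<kappa> \<le> 17183 / 10000 * \<kappa> + 24368 / 10000"
proof -
  have "(\<kappa> + 1) * ln (1 + 1 / (\<kappa> + 1)) \<le> (\<kappa> + 1) * (1 / (\<kappa> + 1))"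
    using assms by (intro mult_left_mono ln_add_one_self_le_self) auto
  then have "(1 + 1 / (\<kappa> + 1)) powr (\<kappa> + 1) \<le> exp 1" using assms unfolding powr_def by (simp add: add_pos_pos)
  then have "(1 + 1 / (\<kappa> + 1)) powr (\<kappa> + 1) * (\<kappa> + 2) \<le> 271829 / 100000 * (\<kappa> + 2)"
    using assms exp_1_bounds by (intro mult_right_mono) auto
  then show ?thesis unfolding chord_slope_def using assms by simp
qed

text \<open>For exponents x \<le> 3, (1 + 1/x)^x \<le> (4/3)^3, sharper than the bound e used in
  \<open>chord_slope_le\<close>; it serves the case \<kappa> \<le> 2.\<close>

lemma chord_slope_le_small: assumes "1 \<le> \<kappa>" "\<kappa> \<le> 2" shows "chord_slope \<kappa> \<le> 13704 / 10000 * \<kappa> + 17408 / 10000"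
proof -
  define x where "x = \<kappa> + 1"
  have x: "2 \<le> x" "x \<le> 3" unfolding x_def using assms by auto
  have "x / 3 * ln (1 + 1 / x) \<le> ln (1 + 1 / 3)"
  proof -
    have "exp ((1 - x / 3) *\<^sub>R 0 + (x / 3) *\<^sub>R ln (1 + 1 / x)) \<le> (1 - x / 3) * exp 0 + (x / 3) * exp (ln (1 + 1 / x))"
      by (rule convex_onD[OF exp_convex]) (use x in auto)
    also have "\<dots> = 1 + 1 / 3" using x by (simp add: field_simps add_pos_pos)
    finally have "exp (x / 3 * ln (1 + 1 / x)) \<le> 1 + 1 / 3" by simp
    then show ?thesis by (subst ln_ge_iff) auto
  qed
  then have "x * ln (1 + 1 / x) \<le> 3 * ln (4 / 3)" by simp
  then have "(1 + 1 / x) powr x \<le> exp (3 * ln (4 / 3))" using x unfolding powr_def by (simp add: add_pos_pos)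
  also have "\<dots> = (4 / 3) ^ 3" by (subst exp_of_nat_mult[of 3, simplified]) simp
  finally have "(1 + 1 / x) powr x * (\<kappa> + 2) \<le> 64 / 27 * (\<kappa> + 2)"
    using assms by (intro mult_right_mono) (auto simp: power3_eq_cube)
  then show ?thesis unfolding chord_slope_def x_def[symmetric] using assms by simp
qed

lemma chord_slope_nonneg: assumes "1 \<le> \<kappa>" shows "0 \<le> chord_slope \<kappa>"
proof -
  have "1 + (\<kappa> + 1) * (1 / (\<kappa> + 1)) \<le> (1 + 1 / (\<kappa> + 1)) powr (\<kappa> + 1)"
  proof -
    have "exp ((1 - 1 / (\<kappa> + 1)) *\<^sub>R 0 + (1 / (\<kappa> + 1)) *\<^sub>R ln 2) \<le> (1 - 1 / (\<kappa> + 1)) * exp 0 + (1 / (\<kappa> + 1)) * exp (ln 2)"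
      by (rule convex_onD[OF exp_convex]) (use assms in auto)
    then have "exp (1 / (\<kappa> + 1) * ln 2) \<le> 1 + 1 / (\<kappa> + 1)" by simp
    then have "exp (1 / (\<kappa> + 1) * ln 2) powr (\<kappa> + 1) \<le> (1 + 1 / (\<kappa> + 1)) powr (\<kappa> + 1)"
      using assms by (intro powr_mono2) auto
    moreover have "exp (1 / (\<kappa> + 1) * ln 2) powr (\<kappa> + 1) = 2" using assms by (simp add: powr_def)
    ultimately show ?thesis using assms by simp
  qed
  then have "2 * (\<kappa> + 2) \<le> (1 + 1 / (\<kappa> + 1)) powr (\<kappa> + 1) * (\<kappa> + 2)"
    using assms by (intro mult_right_mono) auto
  then show ?thesis unfolding chord_slope_def using assms by simp
qed

text \<open>A cubic in s with nonnegative coefficients and no constant term grows by at most the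
  cube of the ratio.\<close>

lemma K_bound_scale:
  assumes "0 < s0" "s0 \<le> s" "0 \<le> \<kappa>" shows "K_bound \<kappa> s \<le> K_bound \<kappa> s0 * (s / s0) ^ 3"
proof -
  define r where "r = s / s0"
  have r: "1 \<le> r" "s = s0 * r" unfolding r_def using assms by auto
  have r23: "r \<le> r ^ 3" "r ^ 2 \<le> r ^ 3" using r power_increasing[of 1 3 r] power_increasing[of 2 3 r] by auto
  define c where "c = 2 / ln (2::real)"
  have c: "0 \<le> c" unfolding c_def by simp
  have "K_bound \<kappa> s = s0 * (1 + \<kappa> * ln 2) * r + c * s0\<^sup>2 * (\<kappa> + 1) * r\<^sup>2 + c * s0\<^sup>2 * (c * s0) * r ^ 3"
    unfolding K_bound_def c_def[symmetric] r(2) by (simp add: algebra_simps power2_eq_square power3_eq_cube)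
  also have "\<dots> \<le> s0 * (1 + \<kappa> * ln 2) * r ^ 3 + c * s0\<^sup>2 * (\<kappa> + 1) * r ^ 3 + c * s0\<^sup>2 * (c * s0) * r ^ 3"
    using r23 assms c by (intro add_mono mult_left_mono mult_nonneg_nonneg add_nonneg_nonneg) auto
  also have "\<dots> = K_bound \<kappa> s0 * r ^ 3" unfolding K_bound_def c_def[symmetric] by (simp add: algebra_simps)
  finally show ?thesis unfolding r_def .
qed

text \<open>Growth in \<open>s\<close> is cubic on the left and exponential on the right, so only the smallest \<open>s\<close> matters.\<close>

lemma large_s_bound_from_min:
  assumes k: "1 \<le> \<kappa>" and s: "0 < s0" "s0 \<le> s" and big: "3 \<le> 577 / 100 * ((\<kappa> + 1) * s0)"
    and X0: "X0 \<le> 577 / 100 * ((\<kappa> + 1) * s0 + s0\<^sup>2 / ln 2) - 1898 / 1000 * \<kappa> - \<kappa> * ln \<kappa>"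
    and R0: "chord_slope \<kappa> * (5 / 2 * (K_bound \<kappa> s0 - \<kappa> * ln 2) + (4 * \<kappa> + 63 / 100)) \<le> 9 / 10 * exp X0"
  shows "chord_slope \<kappa> * (5 / 2 * (K_bound \<kappa> s - \<kappa> * ln 2) + (4 * \<kappa> + 63 / 100))
       \<le> 9 / 10 * exp (4 / ln 2 * ((\<kappa> + 1) * s + s\<^sup>2 / ln 2) - 1898 / 1000 * \<kappa> - \<kappa> * ln \<kappa>)"
proof -
  define r where "r = s / s0"
  have r: "1 \<le> r" unfolding r_def using s by auto
  have r3: "1 \<le> r ^ 3" using r by simp
  \<comment> \<open>The part independent of s is nonnegative, so it too may be multiplied by
    r^3.\<close>
  have c: "0 \<le> 4 * \<kappa> + 63 / 100 - 5 / 2 * (\<kappa> * ln 2)"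
  proof -
    have "\<kappa> * ln 2 \<le> \<kappa> * 1" using k ln_2_bounds by (intro mult_left_mono) auto
    then show ?thesis using k by linarith
  qed
  have "5 / 2 * (K_bound \<kappa> s - \<kappa> * ln 2) + (4 * \<kappa> + 63 / 100) = 5 / 2 * K_bound \<kappa> s + (4 * \<kappa> + 63 / 100 - 5 / 2 * (\<kappa> * ln 2))"
    by simp
  also have "\<dots> \<le> 5 / 2 * (K_bound \<kappa> s0 * r ^ 3) + (4 * \<kappa> + 63 / 100 - 5 / 2 * (\<kappa> * ln 2)) * r ^ 3"
    using K_bound_scale[OF s, of \<kappa>] k mult_left_mono[OF r3 c] unfolding r_def[symmetric] by simp
  also have "\<dots> = (5 / 2 * (K_bound \<kappa> s0 - \<kappa> * ln 2) + (4 * \<kappa> + 63 / 100)) * r ^ 3"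
    by (simp add: algebra_simps)
  finally have "chord_slope \<kappa> * (5 / 2 * (K_bound \<kappa> s - \<kappa> * ln 2) + (4 * \<kappa> + 63 / 100)) \<le>
      chord_slope \<kappa> * (5 / 2 * (K_bound \<kappa> s0 - \<kappa> * ln 2) + (4 * \<kappa> + 63 / 100)) * r ^ 3"
    using chord_slope_nonneg[OF k] by (simp add: mult_left_mono mult.assoc)
  also have "\<dots> \<le> 9 / 10 * exp X0 * r ^ 3" using R0 order_trans[OF zero_le_one r3] by (intro mult_right_mono)
  \<comment> \<open>Here r^3 \<le> e^(3 (r - 1)), and \<open>big\<close> says that the linear part
    of the exponent increases by at least 3 (r - 1). The factor 5.77 is a lower bound for 4 / ln
    2.\<close>
  also have "\<dots> \<le> 9 / 10 * exp X0 * exp (3 * (r - 1))"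
  proof -
    have "r \<le> exp (r - 1)" using exp_ge_add_one_self[of "r - 1"] by simp
    then have "r ^ 3 \<le> exp (r - 1) ^ 3" using r by (intro power_mono) auto
    also have "\<dots> = exp (3 * (r - 1))" by (subst exp_of_nat_mult[of 3, simplified]) simp
    finally show ?thesis by simp
  qed
  also have "\<dots> = 9 / 10 * exp (X0 + 3 * (r - 1))" by (simp add: exp_add)
  also have "X0 + 3 * (r - 1) \<le> 4 / ln 2 * ((\<kappa> + 1) * s + s\<^sup>2 / ln 2) - 1898 / 1000 * \<kappa> - \<kappa> * ln \<kappa>"
  proof -
    have "3 * (r - 1) \<le> 577 / 100 * ((\<kappa> + 1) * s0) * (r - 1)" using big r by (intro mult_right_mono) auto
    also have "\<dots> = 577 / 100 * ((\<kappa> + 1) * s - (\<kappa> + 1) * s0)" unfolding r_def using s by (simp add: field_simps)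
    finally have 1: "3 * (r - 1) \<le> 577 / 100 * ((\<kappa> + 1) * s - (\<kappa> + 1) * s0)" .
    have 2: "s0\<^sup>2 / ln 2 \<le> s\<^sup>2 / ln 2" using s by (intro divide_right_mono power_mono) auto
    have "577 / 100 \<le> 4 / ln (2::real)" using ln_2_bounds by (simp add: field_simps)
    then have "577 / 100 * ((\<kappa> + 1) * s + s\<^sup>2 / ln 2) \<le> 4 / ln 2 * ((\<kappa> + 1) * s + s\<^sup>2 / ln 2)"
      using k s by (intro mult_right_mono add_nonneg_nonneg) auto
    then show ?thesis using X0 1 2 by (simp add: algebra_simps)
  qed
  finally show ?thesis by simp
qed

section \<open>The numerical comparison at the threshold value of s\<close>

lemma inverse_ln_2_bounds: "14426 / 10000 \<le> 1 / ln (2::real)" "1 / ln (2::real) \<le> 14429 / 10000"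
  using ln_2_bounds by (simp_all add: field_simps)

lemma ln_le_tangent: "0 < x \<Longrightarrow> 0 < c \<Longrightarrow> ln x \<le> x / c + ln c - 1" for x c :: real
  using ln_le_minus_one[of "x / c"] by (simp add: ln_divide_pos)

text \<open>3.44 lies just below the value of the right side at \<kappa> = 1, and the slope 2 fits
  the use of \<kappa>^2 \<le> e^(2 (\<kappa> - 1)). The logarithm is replaced by its tangent at 1
  (for \<kappa> \<le> 2) or at 4; after clearing (\<kappa> + 2)^2 a polynomial in t remains, whose
  few negative coefficients are absorbed by the bounded range of t.\<close>

lemma large_s_exponent_ge:
  fixes \<kappa> :: real assumes "1 \<le> \<kappa>" "\<kappa> \<le> 8"
  shows "344 / 100 + 2 * (\<kappa> - 1) \<le> 577 / 100 * ((\<kappa> + 1) * (11 / 10 * \<kappa> / (\<kappa> + 2)) + (11 / 10 * \<kappa> / (\<kappa> + 2))\<^sup>2 / ln 2) - 1898 / 1000 * \<kappa> - \<kappa> * ln \<kappa>"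
proof -
  have pos: "0 < \<kappa> + 2" using assms by simp
  have "14426 / 10000 * (11 / 10 * \<kappa> / (\<kappa> + 2))\<^sup>2 \<le> 1 / ln 2 * (11 / 10 * \<kappa> / (\<kappa> + 2))\<^sup>2"
    using inverse_ln_2_bounds by (intro mult_right_mono) auto
  then have sq: "14426 / 10000 * (11 / 10 * \<kappa> / (\<kappa> + 2))\<^sup>2 \<le> (11 / 10 * \<kappa> / (\<kappa> + 2))\<^sup>2 / ln 2" by simp
  have e: "((\<kappa> + 1) * (11 / 10 * \<kappa> / (\<kappa> + 2)) + 14426 / 10000 * (11 / 10 * \<kappa> / (\<kappa> + 2))\<^sup>2) * (\<kappa> + 2)\<^sup>2
      = 11 / 10 * \<kappa> * (\<kappa> + 1) * (\<kappa> + 2) + 14426 / 10000 * (121 / 100) * \<kappa>\<^sup>2"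
  proof -
    define a where "a = 11 / 10 * \<kappa> / (\<kappa> + 2)"
    have a: "a * (\<kappa> + 2) = 11 / 10 * \<kappa>" unfolding a_def using pos by (metis less_irrefl nonzero_divide_eq_eq)
    have "((\<kappa> + 1) * a + 14426 / 10000 * a\<^sup>2) * (\<kappa> + 2)\<^sup>2 = (\<kappa> + 1) * (a * (\<kappa> + 2)) * (\<kappa> + 2) + 14426 / 10000 * (a * (\<kappa> + 2))\<^sup>2"
      by (simp add: algebra_simps power2_eq_square)
    also have "\<dots> = 11 / 10 * \<kappa> * (\<kappa> + 1) * (\<kappa> + 2) + 14426 / 10000 * (121 / 100) * \<kappa>\<^sup>2"
      unfolding a by (simp add: algebra_simps power2_eq_square)
    finally show ?thesis unfolding a_def .
  qed
  have "344 / 100 + 2 * (\<kappa> - 1) + 1898 / 1000 * \<kappa> + \<kappa> * ln \<kappa> \<le> 577 / 100 * ((\<kappa> + 1) * (11 / 10 * \<kappa> / (\<kappa> + 2)) + 14426 / 10000 * (11 / 10 * \<kappa> / (\<kappa> + 2))\<^sup>2)"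
  proof (cases "\<kappa> \<le> 2")
    case True
    define t where "t = \<kappa> - 1"
    have t: "0 \<le> t" "t \<le> 1" "\<kappa> = 1 + t" unfolding t_def using assms True by auto
    have "\<kappa> * ln \<kappa> \<le> \<kappa> * (\<kappa> - 1)" using assms by (intro mult_left_mono ln_le_minus_one) auto
    moreover have "(344 / 100 + 2 * (\<kappa> - 1) + 1898 / 1000 * \<kappa> + \<kappa> * (\<kappa> - 1)) * (\<kappa> + 2)\<^sup>2
        \<le> 577 / 100 * (11 / 10 * \<kappa> * (\<kappa> + 1) * (\<kappa> + 2) + 14426 / 10000 * (121 / 100) * \<kappa>\<^sup>2)"
    proof -
      have "t ^ 2 \<ge> 0" "t ^ 3 \<le> t" "t ^ 4 \<le> t" using t power_le_one[of t 2] power_le_one[of t 3]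
          mult_left_mono[of "t ^ 2" 1 t] mult_left_mono[of "t ^ 3" 1 t] by (auto simp: power2_eq_square power3_eq_cube power4_eq_xxxx)
      moreover have "577 / 100 * (11 / 10 * \<kappa> * (\<kappa> + 1) * (\<kappa> + 2) + 14426 / 10000 * (121 / 100) * \<kappa>\<^sup>2) - (344 / 100 + 2 * (\<kappa> - 1) + 1898 / 1000 * \<kappa> + \<kappa> * (\<kappa> - 1)) * (\<kappa> + 2)\<^sup>2 = 5590021 / 50000000 + (346265021 / 25000000) * t + (221390021 / 50000000) * t ^ 2 + (- 4551 / 1000) * t ^ 3 + (-1 / 1) * t ^ 4"
        unfolding t(3) by (simp add: field_simps eval_nat_numeral)
      ultimately show ?thesis using t(1) by linarith
    qed
    ultimately show ?thesis using e pos
      by (smt (verit) mult_le_cancel_right mult.assoc zero_less_power)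
  next
    case False
    define t where "t = \<kappa> - 2"
    have t: "0 \<le> t" "t \<le> 6" "\<kappa> = 2 + t" unfolding t_def using assms False by auto
    have "ln \<kappa> \<le> \<kappa> / 4 + ln 4 - 1" using assms by (intro ln_le_tangent) auto
    moreover note ln_4_eq
    ultimately have "ln \<kappa> \<le> \<kappa> / 4 + 38636 / 100000" using ln_2_bounds by simp
    then have "\<kappa> * ln \<kappa> \<le> \<kappa> * (\<kappa> / 4 + 38636 / 100000)" using assms by (intro mult_left_mono) auto
    moreover have "(344 / 100 + 2 * (\<kappa> - 1) + 1898 / 1000 * \<kappa> + \<kappa> * (\<kappa> / 4 + 38636 / 100000)) * (\<kappa> + 2)\<^sup>2
        \<le> 577 / 100 * (11 / 10 * \<kappa> * (\<kappa> + 1) * (\<kappa> + 2) + 14426 / 10000 * (121 / 100) * \<kappa>\<^sup>2)"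
    proof -
      have "t ^ 2 \<le> 6 * t" "t ^ 3 \<le> 6 * t ^ 2" "t ^ 4 \<le> 36 * t ^ 2" "0 \<le> t ^ 2"
        using t mult_mono[of t 6 t t] mult_right_mono[of t 6 "t ^ 2"] mult_right_mono[of "t * t" 36 "t ^ 2"] mult_mono[of t 6 t 6]
        by (auto simp: power2_eq_square power3_eq_cube power4_eq_xxxx)
      moreover have "577 / 100 * (11 / 10 * \<kappa> * (\<kappa> + 1) * (\<kappa> + 2) + 14426 / 10000 * (121 / 100) * \<kappa>\<^sup>2) - (344 / 100 + 2 * (\<kappa> - 1) + 1898 / 1000 * \<kappa> + \<kappa> * (\<kappa> / 4 + 38636 / 100000)) * (\<kappa> + 2)\<^sup>2 = 205946021 / 12500000 + (408621021 / 12500000) * t + (495560021 / 50000000) * t ^ 2 + (-11717 / 12500) * t ^ 3 + (-1 / 4) * t ^ 4"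
        unfolding t(3) by (simp add: field_simps eval_nat_numeral)
      ultimately show ?thesis using t(1) by linarith
    qed
    ultimately show ?thesis using e pos
      by (smt (verit) mult_le_cancel_right mult.assoc zero_less_power)
  qed
  moreover have "577 / 100 * ((\<kappa> + 1) * (11 / 10 * \<kappa> / (\<kappa> + 2)) + 14426 / 10000 * (11 / 10 * \<kappa> / (\<kappa> + 2))\<^sup>2)
      \<le> 577 / 100 * ((\<kappa> + 1) * (11 / 10 * \<kappa> / (\<kappa> + 2)) + (11 / 10 * \<kappa> / (\<kappa> + 2))\<^sup>2 / ln 2)"
    by (intro mult_left_mono add_left_mono sq) simp
  ultimately show ?thesis by linarith
qed

lemma K_bound_nonneg: "0 \<le> \<kappa> \<Longrightarrow> 0 \<le> s \<Longrightarrow> 0 \<le> K_bound \<kappa> s"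
  unfolding K_bound_def by (intro add_nonneg_nonneg mult_nonneg_nonneg) auto

lemma K_bound_le:
  assumes "0 \<le> \<kappa>" "0 \<le> s" "s \<le> s'"
  shows "K_bound \<kappa> s \<le> s' * (1 + 6932 / 10000 * \<kappa>) + 28862 / 10000 * s'\<^sup>2 * (\<kappa> + 1 + 28862 / 10000 * s')"
proof -
  have c: "2 / ln (2::real) \<le> 28862 / 10000" "0 \<le> 2 / ln (2::real)" using inverse_ln_2_bounds by simp_all
  have l: "\<kappa> * ln 2 \<le> 6932 / 10000 * \<kappa>"
    using mult_left_mono[of "ln 2" "6932 / 10000" \<kappa>] ln_2_bounds assms by simp
  have "s * (1 + \<kappa> * ln 2) \<le> s' * (1 + 6932 / 10000 * \<kappa>)"
    using assms l by (intro mult_mono) auto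
  moreover have "2 / ln 2 * s\<^sup>2 \<le> 28862 / 10000 * s'\<^sup>2" using assms c by (intro mult_mono power_mono) auto
  moreover have "2 / ln 2 * s \<le> 28862 / 10000 * s'" using assms c by (intro mult_mono) auto
  ultimately show ?thesis unfolding K_bound_def using assms c
    by (intro add_mono mult_mono[of "2 / ln 2 * s\<^sup>2"]) (auto intro!: mult_nonneg_nonneg add_nonneg_nonneg)
qed

lemma inner_nonneg:
  assumes "1 \<le> \<kappa>" "0 \<le> s" shows "0 \<le> 5 / 2 * (K_bound \<kappa> s - \<kappa> * ln 2) + (4 * \<kappa> + 63 / 100)"
proof -
  define v where "v = \<kappa> * ln 2"
  have "\<kappa> * ln 2 \<le> \<kappa> * 1" using assms ln_2_bounds by (intro mult_left_mono) auto
  then have "v \<le> \<kappa>" unfolding v_def by simp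
  moreover have "0 \<le> K_bound \<kappa> s" using assms by (intro K_bound_nonneg) auto
  ultimately show ?thesis unfolding v_def[symmetric] using assms by argo
qed

text \<open>Since s (\<kappa> + 2) is a multiple of \<kappa>, multiplication by (\<kappa> + 2)^3
  makes everything polynomial in \<kappa>. Shifted to t = \<kappa> - 1 or t = \<kappa> - 2, all
  coefficients of the difference are positive.\<close>

lemma large_s_bound_small_kappa:
  fixes \<kappa> :: real assumes "1 \<le> \<kappa>" "\<kappa> \<le> 8"
  defines "s \<equiv> 11 / 10 * \<kappa> / (\<kappa> + 2)"
  shows "chord_slope \<kappa> * (5 / 2 * (K_bound \<kappa> s - \<kappa> * ln 2) + (4 * \<kappa> + 63 / 100)) \<le> 9 / 10 * exp (344 / 100 + 2 * (\<kappa> - 1))"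
proof -
  have pos: "0 < \<kappa> + 2" "0 < (\<kappa> + 2) ^ 3" using assms by auto
  have sk: "s * (\<kappa> + 2) = 11 / 10 * \<kappa>" unfolding s_def using pos(1) by (metis less_irrefl nonzero_divide_eq_eq)
  have s0: "0 \<le> s" unfolding s_def using assms by simp
  define N where "N = 11 / 10 * \<kappa> * (1 + 6932 / 10000 * \<kappa>) * (\<kappa> + 2)\<^sup>2
      + 28862 / 10000 * (121 / 100) * \<kappa>\<^sup>2 * ((\<kappa> + 1) * (\<kappa> + 2) + 3175 / 1000 * \<kappa>)"
  have "K_bound \<kappa> s * (\<kappa> + 2) ^ 3 \<le> (s * (1 + 6932 / 10000 * \<kappa>) + 28862 / 10000 * s\<^sup>2 * (\<kappa> + 1 + 28862 / 10000 * s)) * (\<kappa> + 2) ^ 3"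
    using K_bound_le[of \<kappa> s s] assms s0 pos by (intro mult_right_mono) auto
  also have "\<dots> = s * (\<kappa> + 2) * (1 + 6932 / 10000 * \<kappa>) * (\<kappa> + 2)\<^sup>2
      + 28862 / 10000 * (s * (\<kappa> + 2))\<^sup>2 * ((\<kappa> + 1) * (\<kappa> + 2) + 28862 / 10000 * (s * (\<kappa> + 2)))"
    by (simp add: field_simps eval_nat_numeral)
  also have "\<dots> \<le> N"
  proof -
    have "28862 / 10000 * (11 / 10 * \<kappa>) \<le> 3175 / 1000 * \<kappa>" using assms by simp
    then have "28862 / 10000 * (11 / 10 * \<kappa>)\<^sup>2 * ((\<kappa> + 1) * (\<kappa> + 2) + 28862 / 10000 * (11 / 10 * \<kappa>))
        \<le> 28862 / 10000 * (11 / 10 * \<kappa>)\<^sup>2 * ((\<kappa> + 1) * (\<kappa> + 2) + 3175 / 1000 * \<kappa>)"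
      by (intro mult_left_mono add_left_mono) auto
    also have "(11 / 10 * \<kappa>)\<^sup>2 = 121 / 100 * \<kappa>\<^sup>2" by (simp add: power2_eq_square)
    finally show ?thesis unfolding N_def sk by (simp add: mult.assoc power_divide power_mult_distrib)
  qed
  finally have N: "K_bound \<kappa> s * (\<kappa> + 2) ^ 3 \<le> N" .
  define I where "I = 5 / 2 * (K_bound \<kappa> s - \<kappa> * ln 2) + (4 * \<kappa> + 63 / 100)"
  have I0: "0 \<le> I" unfolding I_def by (rule inner_nonneg[OF assms(1) s0])
  have I: "I * (\<kappa> + 2) ^ 3 \<le> 5 / 2 * N + (63 / 100 + 4 * \<kappa> - 17325 / 10000 * \<kappa>) * (\<kappa> + 2) ^ 3"
  proof -
    have "6931 / 10000 * \<kappa> \<le> \<kappa> * ln 2" using mult_left_mono[of "6931 / 10000" "ln 2" \<kappa>] ln_2_bounds assms by simp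
    moreover define v where "v = \<kappa> * ln 2"
    ultimately have "I \<le> 5 / 2 * K_bound \<kappa> s + (63 / 100 + 4 * \<kappa> - 17325 / 10000 * \<kappa>)"
      unfolding I_def v_def[symmetric] using assms(1) by argo
    then have "I * (\<kappa> + 2) ^ 3 \<le> (5 / 2 * K_bound \<kappa> s + (63 / 100 + 4 * \<kappa> - 17325 / 10000 * \<kappa>)) * (\<kappa> + 2) ^ 3"
      using pos by (intro mult_right_mono) auto
    also have "\<dots> = 5 / 2 * (K_bound \<kappa> s * (\<kappa> + 2) ^ 3) + (63 / 100 + 4 * \<kappa> - 17325 / 10000 * \<kappa>) * (\<kappa> + 2) ^ 3"
      by (simp add: algebra_simps)
    finally show ?thesis using N by linarith
  qed
  \<comment> \<open>The monomial 28 \<kappa>^2 separates the sides: it dominates the polynomial on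
    the left, and 28 \<le> 9/10 * e^3.44 together with \<kappa> \<le> e^(\<kappa>-1) keeps it below
    the exponential.\<close>
  have main: "chord_slope \<kappa> * I * (\<kappa> + 2) ^ 3 \<le> 28 * \<kappa>\<^sup>2 * (\<kappa> + 2) ^ 3"
  proof (cases "\<kappa> \<le> 2")
    case True
    define t where "t = \<kappa> - 1"
    have t: "0 \<le> t" "\<kappa> = 1 + t" unfolding t_def using assms by auto
    have "chord_slope \<kappa> * (I * (\<kappa> + 2) ^ 3) \<le> (13704 / 10000 * \<kappa> + 17408 / 10000) * (I * (\<kappa> + 2) ^ 3)"
      using chord_slope_le_small[OF assms(1) True] I0 pos by (intro mult_right_mono) auto
    also have "\<dots> \<le> (13704 / 10000 * \<kappa> + 17408 / 10000) * (5 / 2 * N + (63 / 100 + 4 * \<kappa> - 17325 / 10000 * \<kappa>) * (\<kappa> + 2) ^ 3)"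
      using I assms by (intro mult_left_mono) auto
    also have "\<dots> \<le> 28 * \<kappa>\<^sup>2 * (\<kappa> + 2) ^ 3"
    proof -
      have "0 \<le> t ^ 2" "0 \<le> t ^ 3" "0 \<le> t ^ 4" "0 \<le> t ^ 5" using t by auto
      moreover have "28 * \<kappa>\<^sup>2 * (\<kappa> + 2) ^ 3 - (13704 / 10000 * \<kappa> + 17408 / 10000) * (5 / 2 * N + (63 / 100 + 4 * \<kappa> - 17325 / 10000 * \<kappa>) * (\<kappa> + 2) ^ 3) = (1330012494887 / 10000000000) + (56853337189 / 100000000) * t + (3549115398989 / 5000000000) * t ^ 2 + (905638359271 / 2500000000) * t ^ 3 + (895063521399 / 10000000000) * t ^ 4 + (2578899457 / 250000000) * t ^ 5"
        unfolding N_def t(2) by (simp add: field_simps eval_nat_numeral)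
      ultimately show ?thesis using t(1) by linarith
    qed
    finally show ?thesis by (simp add: mult.assoc)
  next
    case False
    define t where "t = \<kappa> - 2"
    have t: "0 \<le> t" "\<kappa> = 2 + t" unfolding t_def using False by auto
    have "chord_slope \<kappa> * (I * (\<kappa> + 2) ^ 3) \<le> (17183 / 10000 * \<kappa> + 24368 / 10000) * (I * (\<kappa> + 2) ^ 3)"
      using chord_slope_le[OF assms(1)] I0 pos by (intro mult_right_mono) auto
    also have "\<dots> \<le> (17183 / 10000 * \<kappa> + 24368 / 10000) * (5 / 2 * N + (63 / 100 + 4 * \<kappa> - 17325 / 10000 * \<kappa>) * (\<kappa> + 2) ^ 3)"
      using I assms by (intro mult_left_mono) auto
    also have "\<dots> \<le> 28 * \<kappa>\<^sup>2 * (\<kappa> + 2) ^ 3"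
    proof -
      have "0 \<le> t ^ 2" "0 \<le> t ^ 3" "0 \<le> t ^ 4" "0 \<le> t ^ 5" using t by auto
      moreover have "28 * \<kappa>\<^sup>2 * (\<kappa> + 2) ^ 3 - (17183 / 10000 * \<kappa> + 24368 / 10000) * (5 / 2 * N + (63 / 100 + 4 * \<kappa> - 17325 / 10000 * \<kappa>) * (\<kappa> + 2) ^ 3) = (1145808080561 / 5000000000) + (1907099995773 / 2500000000) * t + (1358107731031 / 2000000000) * t ^ 2 + (2754725214137 / 10000000000) * t ^ 3 + (4791184591729 / 80000000000) * t ^ 4 + (11652206287 / 2000000000) * t ^ 5"
        unfolding N_def t(2) by (simp add: field_simps eval_nat_numeral)
      ultimately show ?thesis using t(1) by linarith
    qed
    finally show ?thesis by (simp add: mult.assoc)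
  qed
  then have "chord_slope \<kappa> * I \<le> 28 * \<kappa>\<^sup>2" using pos by simp
  also have "\<dots> \<le> 9 / 10 * (31112 / 1000) * exp (\<kappa> - 1) ^ 2"
  proof -
    have "\<kappa> \<le> exp (\<kappa> - 1)" using exp_ge_add_one_self[of "\<kappa> - 1"] by simp
    then have "\<kappa>\<^sup>2 \<le> exp (\<kappa> - 1) ^ 2" using assms by (intro power_mono) auto
    then show ?thesis using zero_le_power2[of "exp (\<kappa> - 1)"] by linarith
  qed
  also have "\<dots> \<le> 9 / 10 * exp (344 / 100) * exp (\<kappa> - 1) ^ 2"
    using exp_344_ge by (intro mult_right_mono mult_left_mono) auto
  also have "\<dots> = 9 / 10 * exp (344 / 100 + 2 * (\<kappa> - 1))"
  proof -
    have "exp (\<kappa> - 1) ^ 2 = exp (2 * (\<kappa> - 1))" by (rule exp_double[symmetric])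
    then show ?thesis by (simp only: exp_add mult.assoc)
  qed
  finally show ?thesis unfolding I_def .
qed

text \<open>The threshold between the two regimes; the constants are tuned so that the estimates on both sides of it hold.\<close>

definition s_min :: "real \<Rightarrow> real" where
  "s_min \<kappa> = (if \<kappa> \<le> 8 then 11 / 10 * \<kappa> / (\<kappa> + 2) else 36 / 100 * ln \<kappa>)"

lemma ln_large_bounds:
  fixes \<kappa> :: real
  assumes "8 \<le> \<kappa>" shows "2079 / 1000 \<le> ln \<kappa>" "ln \<kappa> \<le> 26 / 100 * \<kappa>"
proof -
  have "ln 8 \<le> ln \<kappa>" using assms by (intro ln_mono) auto
  then show "2079 / 1000 \<le> ln \<kappa>" using ln_8_eq ln_2_bounds by linarith
  have "ln \<kappa> \<le> \<kappa> / 8 + ln 8 - 1" using assms by (intro ln_le_tangent) auto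
  then show "ln \<kappa> \<le> 26 / 100 * \<kappa>" using ln_8_eq ln_2_bounds assms by linarith
qed

text \<open>With s about ln \<kappa> the exponent gains a multiple of \<kappa> ln \<kappa>, enough
  to pay for Gamma and leave 4 ln \<kappa>. The left side is at most quartic in \<kappa> because s
  \<le> 0.36 * 0.26 \<kappa>.\<close>

lemma large_s_bound_large_kappa:
  assumes k: "8 \<le> \<kappa>"
  defines "s \<equiv> 36 / 100 * ln \<kappa>"
  shows "4 * ln \<kappa> \<le> 577 / 100 * ((\<kappa> + 1) * s + s\<^sup>2 / ln 2) - 1898 / 1000 * \<kappa> - \<kappa> * ln \<kappa>"
    and "chord_slope \<kappa> * (5 / 2 * (K_bound \<kappa> s - \<kappa> * ln 2) + (4 * \<kappa> + 63 / 100)) \<le> 9 / 10 * exp (4 * ln \<kappa>)"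
proof -
  define x where "x = ln \<kappa>"
  have x: "2079 / 1000 \<le> x" "x \<le> 26 / 100 * \<kappa>" unfolding x_def using ln_large_bounds[OF k] by auto
  have s: "0 \<le> s" "s \<le> 936 / 10000 * \<kappa>" unfolding s_def x_def[symmetric] using x by auto
  have "1 \<le> 1 / ln (2::real)" using inverse_ln_2_bounds by linarith
  then have "1 * s\<^sup>2 \<le> 1 / ln 2 * s\<^sup>2" by (intro mult_right_mono) auto
  then have 1: "s\<^sup>2 \<le> s\<^sup>2 / ln 2" by simp
  \<comment> \<open>The coefficient 2.0772 is 5.77 * 0.36. This product of nonnegative factors makes
    the claim linear in \<kappa>, x, \<kappa> x and x^2.\<close>
  have "0 \<le> (\<kappa> - 8) * (20772 / 10000 * x - x - 1898 / 1000)" using k x by (intro mult_nonneg_nonneg) auto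
  moreover have "2079 / 1000 * x \<le> x * x" using x by (intro mult_right_mono) auto
  moreover have "s\<^sup>2 = 1296 / 10000 * (x * x)" unfolding s_def x_def by (simp add: power2_eq_square)
  moreover have "577 / 100 * ((\<kappa> + 1) * s) = 20772 / 10000 * (\<kappa> * x) + 20772 / 10000 * x" unfolding s_def x_def by (simp add: field_simps)
  moreover have "577 / 100 * ((\<kappa> + 1) * s + s\<^sup>2 / ln 2) = 577 / 100 * ((\<kappa> + 1) * s) + 577 / 100 * (s\<^sup>2 / ln 2)" by (rule distrib_left)
  moreover have "(\<kappa> - 8) * (20772 / 10000 * x - x - 1898 / 1000) = 10772 / 10000 * (\<kappa> * x) - 1898 / 1000 * \<kappa> - 86176 / 10000 * x + 15184 / 1000"
    by (simp add: field_simps)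
  ultimately show "4 * ln \<kappa> \<le> 577 / 100 * ((\<kappa> + 1) * s + s\<^sup>2 / ln 2) - 1898 / 1000 * \<kappa> - \<kappa> * ln \<kappa>"
    using 1 x unfolding x_def[symmetric] by linarith
  define I where "I = 5 / 2 * (K_bound \<kappa> s - \<kappa> * ln 2) + (4 * \<kappa> + 63 / 100)"
  have I0: "0 \<le> I" unfolding I_def using k s by (intro inner_nonneg) auto
  define s' where "s' = 936 / 10000 * \<kappa>"
  have "6931 / 10000 * \<kappa> \<le> \<kappa> * ln 2" using mult_left_mono[of "6931 / 10000" "ln 2" \<kappa>] ln_2_bounds k by simp
  then have I: "I \<le> 5 / 2 * (s' * (1 + 6932 / 10000 * \<kappa>) + 28862 / 10000 * s'\<^sup>2 * (\<kappa> + 1 + 28862 / 10000 * s') - 6931 / 10000 * \<kappa>) + (4 * \<kappa> + 63 / 100)"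
  proof -
    define v where "v = \<kappa> * ln 2"
    have "K_bound \<kappa> s \<le> s' * (1 + 6932 / 10000 * \<kappa>) + 28862 / 10000 * s'\<^sup>2 * (\<kappa> + 1 + 28862 / 10000 * s')"
      using k s unfolding s'_def by (intro K_bound_le) auto
    then show ?thesis using \<open>6931 / 10000 * \<kappa> \<le> \<kappa> * ln 2\<close> unfolding I_def v_def[symmetric] by argo
  qed
  have "chord_slope \<kappa> * I \<le> (17183 / 10000 * \<kappa> + 24368 / 10000) * I"
    using chord_slope_le k I0 by (intro mult_right_mono) auto
  also have "\<dots> \<le> (17183 / 10000 * \<kappa> + 24368 / 10000) *
     (5 / 2 * (s' * (1 + 6932 / 10000 * \<kappa>) + 28862 / 10000 * s'\<^sup>2 * (\<kappa> + 1 + 28862 / 10000 * s') - 6931 / 10000 * \<kappa>) + (4 * \<kappa> + 63 / 100))"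
    using I k by (intro mult_left_mono) auto
  also have "\<dots> \<le> 9 / 10 * \<kappa> ^ 4"
  proof -
    define t where "t = \<kappa> - 8"
    have t: "0 \<le> t" "\<kappa> = 8 + t" unfolding t_def using k by auto
    have "0 \<le> t ^ 2" "0 \<le> t ^ 3" "0 \<le> t ^ 4" using t by auto
    moreover have "9 / 10 * \<kappa> ^ 4 - (17183 / 10000 * \<kappa> + 24368 / 10000) * (5 / 2 * (s' * (1 + 6932 / 10000 * \<kappa>) + 28862 / 10000 * s'\<^sup>2 * (\<kappa> + 1 + 28862 / 10000 * s') - 6931 / 10000 * \<kappa>) + (4 * \<kappa> + 63 / 100)) = (116997636079100419353 / 47683715820312500) + (208126352596667685411 / 152587890625000000) * t + (1671032030014694623929 / 6103515625000000000) * t ^ 2 + (145276442634768014799 / 6103515625000000000) * t ^ 3 + (148834797666705650781 / 195312500000000000000) * t ^ 4"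
      unfolding s'_def t(2) by (simp add: field_simps eval_nat_numeral)
    ultimately show ?thesis using t(1) by linarith
  qed
  also have "\<kappa> ^ 4 = exp (4 * ln \<kappa>)"
    using k exp_of_nat_mult[of 4 "ln \<kappa>"] by simp
  finally show "chord_slope \<kappa> * (5 / 2 * (K_bound \<kappa> s - \<kappa> * ln 2) + (4 * \<kappa> + 63 / 100)) \<le> 9 / 10 * exp (4 * ln \<kappa>)"
    unfolding I_def by simp
qed

lemma large_s_bound:
  assumes k: "1 \<le> \<kappa>" and s: "s_min \<kappa> \<le> s"
  shows "chord_slope \<kappa> * (5 / 2 * (K_bound \<kappa> s - \<kappa> * ln 2) + (4 * \<kappa> + 63 / 100))
       \<le> 9 / 10 * exp (4 / ln 2 * ((\<kappa> + 1) * s + s\<^sup>2 / ln 2) - 1898 / 1000 * \<kappa> - \<kappa> * ln \<kappa>)"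
proof (cases "\<kappa> \<le> 8")
  case True
  have sm: "s_min \<kappa> = 11 / 10 * \<kappa> / (\<kappa> + 2)" unfolding s_min_def using True by simp
  show ?thesis
  proof (rule large_s_bound_from_min[OF k _ s])
    show "0 < s_min \<kappa>" unfolding sm using k by simp
    have "3 * (\<kappa> + 2) \<le> 577 / 100 * ((\<kappa> + 1) * (11 / 10 * \<kappa>))"
    proof -
      have "0 \<le> (\<kappa> - 1) * (\<kappa> - 1)" by simp
      then show ?thesis using k by (simp add: algebra_simps)
    qed
    then show "3 \<le> 577 / 100 * ((\<kappa> + 1) * s_min \<kappa>)" unfolding sm using k by (simp add: field_simps)
  qed (use large_s_exponent_ge[OF k True] large_s_bound_small_kappa[OF k True] in \<open>simp_all only: sm\<close>)
next
  case False
  then have k8: "8 \<le> \<kappa>" by simp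
  have sm: "s_min \<kappa> = 36 / 100 * ln \<kappa>" unfolding s_min_def using False by simp
  show ?thesis
  proof (rule large_s_bound_from_min[OF k _ s])
    show "0 < s_min \<kappa>" unfolding sm using ln_large_bounds[OF k8] by simp
    have "9 * (36 / 100 * (2079 / 1000)) \<le> (\<kappa> + 1) * s_min \<kappa>"
      unfolding sm using ln_large_bounds[OF k8] k8 by (intro mult_mono) auto
    then show "3 \<le> 577 / 100 * ((\<kappa> + 1) * s_min \<kappa>)" by simp
  qed (use large_s_bound_large_kappa[OF k8] in \<open>simp_all only: sm\<close>)
qed

text \<open>Written as (1 - \<delta>/u)^-\<kappa> + (K/u) (1 - \<delta>/u)^(-\<kappa>-1), the left
  side is convex in \<delta>. \<open>\<tau>\<close> is the position of \<delta> in
  [0, u/(\<kappa>+2)], and \<open>x0\<close> bounds both \<delta>/u and K/u.\<close>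

lemma chord_bound:
  fixes K u \<delta> \<kappa> :: real
  assumes k: "1 \<le> \<kappa>" and K: "0 < K" "0 \<le> \<delta>" "\<delta> \<le> K" and u: "(\<kappa> + 2) * K \<le> u"
  shows "(1 + (K - \<delta>) / u) * (1 - \<delta> / u) powr - (\<kappa> + 1) \<le> 1 + K / u + chord_slope \<kappa> * \<delta> / u"
proof -
  have u0: "0 < u" using k K u by (smt (verit) mult_pos_pos)
  define x0 where "x0 = 1 / (\<kappa> + 2)"
  define q where "q = (1 + 1 / (\<kappa> + 1)) powr (\<kappa> + 1)"
  define \<tau> where "\<tau> = (\<kappa> + 2) * \<delta> / u"
  have "(\<kappa> + 2) * \<delta> \<le> (\<kappa> + 2) * K" using k K by (intro mult_left_mono) auto
  then have "(\<kappa> + 2) * \<delta> \<le> u" using u by linarith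
  then have \<tau>: "0 \<le> \<tau>" "\<tau> \<le> 1" unfolding \<tau>_def using u0 k K by (auto simp: divide_le_eq_1)
  have x0: "0 < x0" "x0 < 1" unfolding x0_def using k by auto
  have tx: "\<tau> * x0 = \<delta> / u" unfolding \<tau>_def x0_def using k by simp
  have Kx: "K / u \<le> x0" unfolding x0_def using u u0 k by (simp add: field_simps)
  have d1: "0 < 1 - \<delta> / u" using tx \<tau> x0 by (smt (verit) mult_left_le_one_le)
  have inv: "1 - x0 = 1 / (1 + 1 / (\<kappa> + 1))" unfolding x0_def using k by (simp add: field_simps)
  have pw: "(1 - \<delta> / u) powr - r \<le> 1 + \<tau> * ((1 - x0) powr - r - 1)" if r: "0 \<le> r" for r
  proof -
    have "\<tau> * ln (1 - x0) \<le> ln (1 - \<delta> / u)"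
    proof -
      have "exp ((1 - \<tau>) *\<^sub>R 0 + \<tau> *\<^sub>R ln (1 - x0)) \<le> (1 - \<tau>) * exp 0 + \<tau> * exp (ln (1 - x0))"
        by (rule convex_onD[OF exp_convex]) (use \<tau> in auto)
      also have "\<dots> = 1 - \<delta> / u" using x0 unfolding tx[symmetric] by (simp add: algebra_simps)
      finally show ?thesis using d1 by (simp add: ln_ge_iff)
    qed
    then have "r * (\<tau> * ln (1 - x0)) \<le> r * ln (1 - \<delta> / u)" using r by (rule mult_left_mono)
    then have "(1 - \<delta> / u) powr - r \<le> exp ((1 - \<tau>) *\<^sub>R 0 + \<tau> *\<^sub>R (- (r * ln (1 - x0))))"
      using d1 by (simp add: powr_def mult_ac)
    also have "\<dots> \<le> (1 - \<tau>) * exp 0 + \<tau> * exp (- (r * ln (1 - x0)))"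
      by (rule convex_onD[OF exp_convex]) (use \<tau> in auto)
    also have "\<dots> = 1 + \<tau> * ((1 - x0) powr - r - 1)" using x0 by (simp add: powr_def algebra_simps)
    finally show ?thesis .
  qed
  have q: "(1 - x0) powr - (\<kappa> + 1) = q"
    unfolding inv q_def using k by (simp add: powr_divide powr_minus_divide add_pos_pos del: minus_add_distrib)
  have q': "(1 - x0) powr - \<kappa> = q * (1 - x0)"
    unfolding q[symmetric] using x0 powr_mult_base[of "1 - x0" "- (\<kappa> + 1)"] by (simp add: mult.commute)
  have q1: "1 \<le> q" unfolding q_def using k by (intro ge_one_powr_ge_zero) auto
  have "(1 + (K - \<delta>) / u) * (1 - \<delta> / u) powr - (\<kappa> + 1)
      = (1 - \<delta> / u) * (1 - \<delta> / u) powr - (\<kappa> + 1) + K / u * (1 - \<delta> / u) powr - (\<kappa> + 1)"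
    by (simp add: diff_divide_distrib algebra_simps)
  also have "(1 - \<delta> / u) * (1 - \<delta> / u) powr - (\<kappa> + 1) = (1 - \<delta> / u) powr - \<kappa>"
    using d1 powr_mult_base[of "1 - \<delta> / u" "- (\<kappa> + 1)"] by simp
  also have "(1 - \<delta> / u) powr - \<kappa> + K / u * (1 - \<delta> / u) powr - (\<kappa> + 1)
      \<le> (1 + \<tau> * (q * (1 - x0) - 1)) + K / u * (1 + \<tau> * (q - 1))"
    using pw[of \<kappa>] pw[of "\<kappa> + 1"] k K u0 unfolding q q' by (intro add_mono mult_left_mono) auto
  also have "\<dots> = 1 + K / u + \<tau> * (q * (1 - x0) - 1) + K / u * (\<tau> * (q - 1))" by (simp add: algebra_simps)
  also have "K / u * (\<tau> * (q - 1)) \<le> x0 * (\<tau> * (q - 1))" using Kx \<tau> q1 by (intro mult_right_mono) auto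
  also have "1 + K / u + \<tau> * (q * (1 - x0) - 1) + x0 * (\<tau> * (q - 1)) = 1 + K / u + \<tau> * (q - 1 - x0)"
    by (simp add: algebra_simps)
  also have "\<tau> * (q - 1 - x0) = chord_slope \<kappa> * \<delta> / u"
  proof -
    have "(\<kappa> + 2) * (q - 1 - x0) = chord_slope \<kappa>" unfolding chord_slope_def q_def[symmetric] x0_def using k by (simp add: field_simps)
    then show ?thesis unfolding \<tau>_def by (simp add: mult_ac)
  qed
  finally show ?thesis by simp
qed

text \<open>With l = log X and u = log z0, it converts a loss measured in 1/u into one measured in
  1/l, the scale of the \<open>m2\<close> term.\<close>

lemma log_X_bound:
  fixes l u \<kappa> K \<delta> :: real
  assumes k: "1 \<le> \<kappa>" and l: "0 < l" "l = 2 * u + (4 * \<kappa> + 1) * ln l"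
    and K: "0 \<le> \<delta>" "\<delta> \<le> K" and u: "(\<kappa> + 2) * K \<le> u"
  shows "\<delta> * l \<le> u * (5 / 2 * \<delta> + (4 * \<kappa> + 63 / 100))"
proof -
  \<comment> \<open>The tangent at c turns (4\<kappa> + 1) ln l into l/5 plus a constant, hence the
    5/2 in front of u. The second tangent, at 25, is taken at the value of c for \<kappa> =
    1.\<close>
  define c where "c = 5 * (4 * \<kappa> + 1)"
  have c: "0 < c" unfolding c_def using k by simp
  have "ln l \<le> l / c + ln c - 1" by (rule ln_le_tangent[OF l(1) c])
  then have "(4 * \<kappa> + 1) * ln l \<le> (4 * \<kappa> + 1) * (l / c + ln c - 1)" using k by (intro mult_left_mono) auto
  also have "\<dots> = l / 5 + (4 * \<kappa> + 1) * (ln c - 1)" unfolding c_def using k by (simp add: field_simps)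
  finally have 1: "l \<le> 5 / 2 * u + 5 / 4 * ((4 * \<kappa> + 1) * (ln c - 1))" using l(2) by linarith
  have "ln c \<le> c / 25 + ln 25 - 1" by (rule ln_le_tangent[OF c]) simp
  moreover have "ln (25::real) = 2 * ln 5" using ln_mult_pos[of 5 "5::real"] by simp
  ultimately have "ln c - 1 \<le> 8 / 10 * \<kappa> + 14189 / 10000" using ln_5_le k c_def by argo
  then have "5 / 4 * ((4 * \<kappa> + 1) * (ln c - 1)) \<le> 5 / 4 * ((4 * \<kappa> + 1) * (8 / 10 * \<kappa> + 14189 / 10000))"
    using k by (intro mult_left_mono) auto
  also have "\<dots> \<le> (\<kappa> + 2) * (4 * \<kappa> + 63 / 100)" using k by (simp add: field_simps)
  finally have "l \<le> 5 / 2 * u + (\<kappa> + 2) * (4 * \<kappa> + 63 / 100)" using 1 by linarith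
  then have "\<delta> * l \<le> \<delta> * (5 / 2 * u + (\<kappa> + 2) * (4 * \<kappa> + 63 / 100))" using K by (intro mult_left_mono) auto
  also have "\<dots> = u * (5 / 2 * \<delta>) + ((\<kappa> + 2) * \<delta>) * (4 * \<kappa> + 63 / 100)" by (simp add: algebra_simps)
  also have "((\<kappa> + 2) * \<delta>) * (4 * \<kappa> + 63 / 100) \<le> u * (4 * \<kappa> + 63 / 100)"
  proof (rule mult_right_mono)
    have "(\<kappa> + 2) * \<delta> \<le> (\<kappa> + 2) * K" using k K by (intro mult_left_mono) auto
    then show "(\<kappa> + 2) * \<delta> \<le> u" using u by linarith
  qed (use k in auto)
  finally show ?thesis by (simp add: distrib_left)
qed

text \<open>With a = A2 and b = A1 A2, e determines \<open>m2\<close> and the left side of the last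
  claim is \<open>K\<close>. In terms of e it reads a (1 + \<kappa> ln 2) + 2 c a e + 2 c^2 a (a b),
  where c = 1 / ln 2, so it increases with a and a b. Along fixed e both are largest on the diagonal
  a = b = s.\<close>

lemma exists_common_parameter:
  fixes \<kappa> a b :: real
  assumes k: "1 \<le> \<kappa>" and ab: "0 < a" "a \<le> b"
  defines "e \<equiv> a + \<kappa> * b + a * b / ln 2"
  obtains s where "a \<le> s" "(\<kappa> + 1) * s + s\<^sup>2 / ln 2 = e"
    "a * (1 + \<kappa> * ln 2 + 2 / ln 2 * a + 2 / ln 2 * b * (\<kappa> + 2 / ln 2 * a)) \<le> K_bound \<kappa> s"
proof -
  define c where "c = 1 / ln (2::real)"
  have c: "0 < c" unfolding c_def by simp
  have e: "e = a + \<kappa> * b + c * (a * b)" unfolding e_def c_def by simp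
  define D where "D = sqrt ((\<kappa> + 1)\<^sup>2 + 4 * c * e)"
  have e0: "0 < e" unfolding e using k ab c by (intro add_pos_pos mult_pos_pos) auto
  have D2: "D\<^sup>2 = (\<kappa> + 1)\<^sup>2 + 4 * c * e" unfolding D_def using c e0 by simp
  define s where "s = (D - (\<kappa> + 1)) / (2 * c)"
  have "D = 2 * c * s + (\<kappa> + 1)" unfolding s_def using c by simp
  then have "4 * c * ((\<kappa> + 1) * s + c * s\<^sup>2) = 4 * c * e" using D2 by (simp add: power2_eq_square algebra_simps)
  then have se: "(\<kappa> + 1) * s + c * s\<^sup>2 = e" using c by simp
  have "\<kappa> + 1 \<le> D" unfolding D_def using c e0 k by (intro real_le_rsqrt) auto
  then have s0: "0 \<le> s" unfolding s_def using c by simp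
  have as: "a \<le> s"
  proof (rule ccontr)
    assume "\<not> a \<le> s"
    then have lt: "s < a" by simp
    have "(\<kappa> + 1) * s < (\<kappa> + 1) * a" using lt k by (intro mult_strict_left_mono) auto
    moreover have "c * s\<^sup>2 \<le> c * a\<^sup>2" using lt s0 c by (intro mult_left_mono power_mono) auto
    moreover have "\<kappa> * a \<le> \<kappa> * b" "c * (a * a) \<le> c * (a * b)" using ab k c by (auto intro!: mult_left_mono)
    ultimately show False using se e by (simp add: power2_eq_square algebra_simps)
  qed
  have abs2: "a * b \<le> s\<^sup>2"
  proof -
    have ks: "a \<le> \<kappa> * s" using as k s0 mult_right_mono[of 1 \<kappa> s] by simp
    have "0 \<le> (s - a) * (\<kappa> * s - a)" using as ks by (intro mult_nonneg_nonneg) auto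
    moreover have "b * (\<kappa> + c * a) = (\<kappa> + 1) * s + c * s\<^sup>2 - a" using se e by (simp add: algebra_simps)
    then have "a * b * (\<kappa> + c * a) = a * ((\<kappa> + 1) * s + c * s\<^sup>2 - a)" by (simp add: mult.assoc)
    ultimately have "a * b * (\<kappa> + c * a) \<le> s\<^sup>2 * (\<kappa> + c * a)" by (simp add: power2_eq_square algebra_simps)
    then show ?thesis using k c ab by (simp add: add_pos_pos)
  qed
  have "a * (1 + \<kappa> * ln 2 + 2 * c * a + 2 * c * b * (\<kappa> + 2 * c * a)) = a * (1 + \<kappa> * ln 2) + 2 * c * a * e + 2 * c * a * (c * (a * b))"
    unfolding e by (simp add: algebra_simps)
  also have "\<dots> \<le> s * (1 + \<kappa> * ln 2) + 2 * c * s * e + 2 * c * s * (c * s\<^sup>2)"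
    using as abs2 c k e0 ab s0 by (intro add_mono mult_mono mult_right_mono mult_left_mono) auto
  also have "\<dots> = s * (1 + \<kappa> * ln 2) + 2 * c * s\<^sup>2 * (\<kappa> + 1 + 2 * c * s)"
    unfolding se[symmetric] by (simp add: power2_eq_square algebra_simps)
  finally show ?thesis using that[OF as] se unfolding K_bound_def c_def by simp
qed

text \<open>Throughout this regime s \<ge> 0.36, so the bracket is at least 0.36 + 0.186 and the
  exponent at least 2.36, where e^-2.36 < 1/10.\<close>

lemma remainder_saving:
  assumes k: "1 \<le> \<kappa>" and s: "s_min \<kappa> \<le> s" and a: "a \<le> s"
  shows "9 / 10 \<le> 1 - exp (- (3 / ln 2 * ((\<kappa> + 1) * s + s\<^sup>2 / ln 2 - a)))"
proof -
  have sm: "36 / 100 \<le> s_min \<kappa>"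
  proof (cases "\<kappa> \<le> 8")
    case True then show ?thesis unfolding s_min_def using k by (simp add: field_simps)
  next
    case False then show ?thesis unfolding s_min_def using ln_large_bounds[of \<kappa>] by simp
  qed
  then have s36: "36 / 100 \<le> s" using s by simp
  have 1: "1 * s \<le> \<kappa> * s" using k s36 by (intro mult_right_mono) auto
  have "14426 / 10000 * (36 / 100)\<^sup>2 \<le> 1 / ln 2 * s\<^sup>2"
    using inverse_ln_2_bounds s36 by (intro mult_mono power_mono) auto
  moreover have "1 / ln 2 * s\<^sup>2 = s\<^sup>2 / ln 2" "(36 / 100 :: real)\<^sup>2 = 1296 / 10000" by (simp_all add: power2_eq_square)
  ultimately have "186 / 1000 \<le> s\<^sup>2 / ln 2" by linarith
  moreover have "(\<kappa> + 1) * s = \<kappa> * s + s" by (simp add: algebra_simps)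
  ultimately have "546 / 1000 \<le> (\<kappa> + 1) * s + s\<^sup>2 / ln 2 - a" using 1 s36 a by linarith
  moreover have "4327 / 1000 \<le> 3 / ln (2::real)" using inverse_ln_2_bounds by simp
  ultimately have "4327 / 1000 * (546 / 1000) \<le> 3 / ln 2 * ((\<kappa> + 1) * s + s\<^sup>2 / ln 2 - a)" by (intro mult_mono) auto
  then have "exp (- (3 / ln 2 * ((\<kappa> + 1) * s + s\<^sup>2 / ln 2 - a))) \<le> exp (- (236 / 100))"
    unfolding exp_le_cancel_iff by linarith
  also have "\<dots> \<le> 1 / 10"
  proof -
    have "1 + 36 / 100 + (36 / 100)\<^sup>2 / 2 \<le> exp (36 / 100 :: real)" by (rule exp_lower_Taylor_quadratic) simp
    moreover have "(271828 / 100000)\<^sup>2 \<le> (exp (1::real))\<^sup>2" using exp_1_bounds by (intro power_mono) auto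
    ultimately have "(271828 / 100000)\<^sup>2 * (1 + 36 / 100 + (36 / 100)\<^sup>2 / 2) \<le> (exp (1::real))\<^sup>2 * exp (36 / 100)"
      by (intro mult_mono) auto
    also have "\<dots> = exp (236 / 100)" by (simp add: exp_double[symmetric] exp_add[symmetric])
    finally have "10 \<le> exp (236 / 100 :: real)" by (simp add: power2_eq_square)
    then show ?thesis by (simp add: exp_minus field_simps)
  qed
  finally show ?thesis by simp
qed

section \<open>Rankin's trick\<close>

context sieve_density begin

text \<open>The interval [7/2, 5) contains no prime, so the lower half of
  \<open>(\<Omega>\<^sub>2)\<close> forces \<open>L\<close> to exceed a nonnegative
  quantity.\<close>

lemma L_nonneg: "0 \<le> L"
proof -
  have "{p. prime p \<and> 7 / 2 \<le> real p \<and> real p < 5} = {}"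
  proof -
    have "\<not> prime p" if "7 / 2 \<le> real p" "real p < 5" for p :: nat
    proof -
      have "p = 4" using that by linarith
      then show ?thesis using primes_dvd_imp_eq[of 2 "4 :: nat"] by auto
    qed
    then show ?thesis by blast
  qed
  then have "primes_in (7 / 2) 5 = {}" unfolding primes_in_def .
  then have "\<kappa> * (ln 5 - ln (7 / 2)) - L \<le> 0" using Omega2_lower[of "7 / 2" 5] by simp
  moreover have "0 \<le> \<kappa> * (ln 5 - ln (7 / 2))" using kappa by (intro mult_nonneg_nonneg) auto
  ultimately show ?thesis by linarith
qed

lemma U_nonneg: "1 < w \<Longrightarrow> 0 \<le> U w"
  unfolding U_def using A1 A2 kappa by (intro add_nonneg_nonneg mult_nonneg_nonneg divide_nonneg_nonneg) auto

lemma U_antimono: "1 < v \<Longrightarrow> v \<le> w \<Longrightarrow> U w \<le> U v"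
proof -
  assume a: "1 < v" "v \<le> w"
  then have 1: "A2 / ln w \<le> A2 / ln v" "0 < ln v" "0 < ln w" using A2 by (auto intro!: divide_left_mono)
  have "A1 * (A2 / ln w) * (\<kappa> + A2 / ln w) \<le> A1 * (A2 / ln v) * (\<kappa> + A2 / ln v)"
    using 1 A1 A2 kappa by (intro mult_mono mult_left_mono add_left_mono mult_nonneg_nonneg add_nonneg_nonneg) auto
  then show ?thesis unfolding U_def using 1 by simp
qed

lemma U_2_eq: "U 2 = A2 / ln 2 * (1 + A1 * \<kappa> + A1 * A2 / ln 2)"
  unfolding U_def by (simp add: field_simps)

lemma inverse_W_le_powr: "2 \<le> z \<Longrightarrow> 1 / W z \<le> (ln z / ln 2) powr \<kappa> * exp (U 2)"
  using W_le[of 2 z] W_2 W_pos[of z] by (simp add: field_simps)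

lemma m4_ge_1: "1 \<le> m4 \<kappa> A2"
proof -
  have "1 * 1 \<le> 2 * \<kappa> * exp 1" using kappa by (intro mult_mono) auto
  then show ?thesis unfolding m4_def using A2 by (smt (verit) divide_nonneg_nonneg exp_ge_zero ln_ge_zero mult_nonneg_nonneg)
qed

text \<open>Rankin's trick, with \<open>y = exp v\<close>: the subsets of the primes below \<open>y\<close> with product at least
  \<open>exp u\<close> contribute at most half of the full product over these primes.\<close>

lemma inverse_W_le_2_G:
  assumes v: "ln 2 < v" and u: "u = m4 \<kappa> A2 * v"
  shows "1 / W (exp v) \<le> 2 * gp.G u"
proof -
  define S where "S = primes_in 2 (exp v)"
  have v0: "0 < v" using v by (smt (verit) ln_gt_zero)
  have S: "finite S" "\<And>p. p \<in> S \<Longrightarrow> prime p" "\<And>p. p \<in> S \<Longrightarrow> ln (real p) \<le> v"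
  proof -
    show "finite S" unfolding S_def by simp
    show "prime p" if "p \<in> S" for p using that unfolding S_def primes_in_def by simp
    show "ln (real p) \<le> v" if "p \<in> S" for p
      using that ln_less_iff_exp[of p v] unfolding S_def primes_in_def by auto
  qed
  have SI: "D \<subseteq> {p. prime p}" if "D \<subseteq> S" for D using that S(2) by blast
  define w where "w D = (\<Sum>p\<in>D. ln (real p))" for D :: "nat set"
  define x where "x p = exp (ln (real p) / v)" for p :: nat
  have W: "1 / W (exp v) = (\<Prod>p\<in>S. 1 + g p)"
    unfolding W_def S_def[symmetric] prod_dividef[symmetric, of "\<lambda>_. 1", simplified]
    using S(2) by (intro prod.cong refl) (simp add: one_plus_g)
  have all: "(\<Prod>p\<in>S. 1 + f p) = (\<Sum>D\<in>Pow S. prod f D)" for f :: "nat \<Rightarrow> real"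
    using S(1) prod_add[of S "\<lambda>_. 1" f]
    by (subst prod_add[of S f "\<lambda>_. 1", simplified add.commute]) (auto intro!: sum.cong)
  have "(\<Sum>D\<in>Pow S. prod g D) = (\<Sum>D\<in>{D \<in> Pow S. w D < u}. prod g D) + (\<Sum>D\<in>{D \<in> Pow S. \<not> w D < u}. prod g D)"
  proof -
    define F where "F = Pow S"
    have "finite F" unfolding F_def using S(1) by simp
    moreover have "F = {D \<in> F. w D < u} \<union> {D \<in> F. \<not> w D < u}" by blast
    ultimately have "sum (prod g) F = sum (prod g) {D \<in> F. w D < u} + sum (prod g) {D \<in> F. \<not> w D < u}"
      by (subst sum.union_disjoint[symmetric]) (auto intro!: arg_cong2[where f = sum])
    then show ?thesis unfolding F_def .
  qed
  also have "(\<Sum>D\<in>{D \<in> Pow S. w D < u}. prod g D) \<le> gp.G u"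
    unfolding gp.G_def
  proof (rule sum_mono2)
    show "{D \<in> Pow S. w D < u} \<subseteq> gp.DD u"
    proof (clarify, unfold gp.DD_iff, intro conjI)
      fix D assume D: "D \<subseteq> S" "w D < u"
      show "finite D" using D S(1) finite_subset by blast
      show "D \<subseteq> {p. prime p}" by (rule SI[OF D(1)])
      show "(\<Sum>p\<in>D. ln (real p)) < u" using D unfolding w_def by simp
    qed
  qed (auto simp: gp.finite_DD intro!: gp.prod_g_nonneg gp.DD_subset)
  also have "(\<Sum>D\<in>{D \<in> Pow S. \<not> w D < u}. prod g D) \<le> (\<Sum>D\<in>Pow S. prod g D * exp ((w D - u) / v))"
  proof -
    have "(\<Sum>D\<in>{D \<in> Pow S. \<not> w D < u}. prod g D) \<le> (\<Sum>D\<in>{D \<in> Pow S. \<not> w D < u}. prod g D * exp ((w D - u) / v))"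
    proof (rule sum_mono)
      fix D assume D: "D \<in> {D \<in> Pow S. \<not> w D < u}"
      then have "1 \<le> exp ((w D - u) / v)" using v0 by simp
      then show "prod g D \<le> prod g D * exp ((w D - u) / v)"
        using gp.prod_g_nonneg[OF SI, of D] D mult_left_mono[of 1 "exp ((w D - u) / v)" "prod g D"] by auto
    qed
    also have "\<dots> \<le> (\<Sum>D\<in>Pow S. prod g D * exp ((w D - u) / v))"
      using S(1) SI by (intro sum_mono2) (auto intro!: mult_nonneg_nonneg gp.prod_g_nonneg)
    finally show ?thesis .
  qed
  also have "\<dots> = exp (- m4 \<kappa> A2) * (\<Sum>D\<in>Pow S. \<Prod>p\<in>D. g p * x p)"
    unfolding sum_distrib_left
  proof (intro sum.cong refl)
    fix D assume "D \<in> Pow S"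
    then have "finite D" using S(1) finite_subset by blast
    then have "(\<Prod>p\<in>D. x p) = exp (w D / v)" unfolding x_def w_def by (simp add: exp_sum sum_divide_distrib)
    moreover have "(w D - u) / v = - m4 \<kappa> A2 + w D / v" unfolding u using v0 by (simp add: field_simps)
    then have "exp ((w D - u) / v) = exp (- m4 \<kappa> A2) * exp (w D / v)" by (simp only: exp_add)
    ultimately show "prod g D * exp ((w D - u) / v) = exp (- m4 \<kappa> A2) * (\<Prod>p\<in>D. g p * x p)"
      by (simp add: prod.distrib)
  qed
  also have "(\<Sum>D\<in>Pow S. \<Prod>p\<in>D. g p * x p) = (\<Prod>p\<in>S. 1 + g p * x p)" by (rule all[symmetric])
  also have "exp (- m4 \<kappa> A2) * (\<Prod>p\<in>S. 1 + g p * x p) \<le> 1 / 2 * (\<Prod>p\<in>S. 1 + g p)"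
  proof -
    have "(\<Prod>p\<in>S. 1 + g p * x p) \<le> (\<Prod>p\<in>S. (1 + g p) * exp (h p * ((exp 1 - 1) * (ln (real p) / v))))"
    proof (rule prod_mono, intro conjI)
      fix p assume p: "p \<in> S"
      note pr = S(2)[OF p]
      show "0 \<le> 1 + g p * x p" unfolding x_def using g_nonneg[OF pr] by simp
      have t: "0 \<le> ln (real p) / v" "ln (real p) / v \<le> 1"
        using S(3)[OF p] v0 prime_ge_2_real[OF pr] by auto
      have "exp ((1 - ln (real p) / v) *\<^sub>R 0 + (ln (real p) / v) *\<^sub>R 1) \<le> (1 - ln (real p) / v) * exp 0 + ln (real p) / v * exp 1"
        by (rule convex_onD[OF exp_convex]) (use t in auto)
      moreover define \<tau> where "\<tau> = ln (real p) / v"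
      ultimately have xp: "x p - 1 \<le> (exp 1 - 1) * (ln (real p) / v)"
        unfolding x_def \<tau>_def[symmetric] by (simp add: algebra_simps)
      \<comment> \<open>Taking out 1 + g leaves h instead of g in the perturbation, so the resulting
        sum is exactly \<open>V\<close>, and \<open>(\<Omega>\<^sub>2)\<close> applies without a
        factor A1.\<close>
      have "1 + g p * x p = (1 + g p) * (1 + h p * (x p - 1))"
        using g_eq[OF pr] by (simp add: algebra_simps)
      also have "\<dots> \<le> (1 + g p) * exp (h p * ((exp 1 - 1) * (ln (real p) / v)))"
      proof (rule mult_left_mono)
        have "h p * (x p - 1) \<le> h p * ((exp 1 - 1) * (ln (real p) / v))"
          using h_nonneg[OF pr] xp by (intro mult_left_mono)
        then show "1 + h p * (x p - 1) \<le> exp (h p * ((exp 1 - 1) * (ln (real p) / v)))"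
          using exp_ge_add_one_self[of "h p * ((exp 1 - 1) * (ln (real p) / v))"] by linarith
      qed (use g_nonneg[OF pr] in simp)
      finally show "1 + g p * x p \<le> (1 + g p) * exp (h p * ((exp 1 - 1) * (ln (real p) / v)))" .
    qed
    also have "\<dots> = (\<Prod>p\<in>S. 1 + g p) * exp ((exp 1 - 1) / v * gp.V v)"
      unfolding prod.distrib exp_sum[OF S(1), symmetric] gp_V S_def[symmetric] sum_distrib_left by (simp add: mult_ac)
    also have "\<dots> \<le> (\<Prod>p\<in>S. 1 + g p) * exp (m4 \<kappa> A2 - ln 2)"
    proof (rule mult_left_mono)
      have "\<kappa> * (v - ln 2) \<le> \<kappa> * v" using kappa by (intro mult_left_mono) auto
      then have V: "gp.V v \<le> \<kappa> * v + A2" using gp_V_le[OF v] by linarith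
      have "(exp 1 - 1) / v * gp.V v \<le> (exp 1 - 1) / v * (\<kappa> * v + A2)"
        using V v0 by (intro mult_left_mono) auto
      also have "\<dots> = (exp 1 - 1) * (\<kappa> + A2 / v)" using v0 by (simp add: field_simps)
      also have "\<dots> \<le> exp 1 * (\<kappa> + A2 / ln 2)"
        using v v0 A2 kappa by (intro mult_mono add_left_mono divide_left_mono) auto
      also have "\<dots> \<le> m4 \<kappa> A2 - ln 2" unfolding m4_def using kappa by (simp add: algebra_simps)
      finally show "exp ((exp 1 - 1) / v * gp.V v) \<le> exp (m4 \<kappa> A2 - ln 2)" by simp
    qed (use S(2) g_nonneg in \<open>auto intro!: prod_nonneg add_nonneg_nonneg\<close>)
    finally have "exp (- m4 \<kappa> A2) * (\<Prod>p\<in>S. 1 + g p * x p) \<le> exp (- m4 \<kappa> A2) * ((\<Prod>p\<in>S. 1 + g p) * exp (m4 \<kappa> A2 - ln 2))"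
      by (intro mult_left_mono) auto
    also have "\<dots> = 1 / 2 * (\<Prod>p\<in>S. 1 + g p)" by (simp add: exp_diff exp_minus field_simps)
    finally show ?thesis .
  qed
  finally show ?thesis unfolding W all[of g] by simp
qed

text \<open>The preceding lemma is used at v = ln z / m4. Moving W from e^v to z costs m4^\<kappa>
  e^(U 2) by \<open>W_le\<close>; if v \<le> ln 2, the same cost already covers 1 / W z, as G \<ge>
  1.\<close>

lemma inverse_W_le_G:
  assumes z: "2 \<le> z"
  shows "1 / W z \<le> 2 * m4 \<kappa> A2 powr \<kappa> * exp (U 2) * gp.G (ln z)"
proof -
  define m where "m = m4 \<kappa> A2"
  have m: "1 \<le> m" unfolding m_def by (rule m4_ge_1)
  have G: "1 \<le> gp.G (ln z)" using z by (intro gp.G_ge_1) auto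
  show ?thesis
  proof (cases "ln z / m \<le> ln 2")
    case True
    then have "(ln z / ln 2) powr \<kappa> \<le> m powr \<kappa>"
      using z m kappa by (intro powr_mono2) (auto simp: field_simps)
    then have "1 / W z \<le> m powr \<kappa> * exp (U 2)"
      using inverse_W_le_powr[OF z] by (smt (verit) exp_ge_zero mult_right_mono)
    also have "\<dots> * 1 \<le> (2 * m powr \<kappa> * exp (U 2)) * gp.G (ln z)" using G by (intro mult_mono) auto
    finally show ?thesis unfolding m_def by simp
  next
    case False
    define v where "v = ln z / m"
    have v: "ln 2 < v" using False unfolding v_def by simp
    have uv: "ln z = m * v" unfolding v_def using m by simp
    have lz: "0 < ln z" using z by auto
    have "v \<le> ln z" unfolding v_def using m lz by (simp add: divide_le_eq)
    then have vz: "exp v \<le> z" "2 \<le> exp v" using z v by (auto simp: ln_ge_iff[symmetric] exp_ge_2)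
    have "1 / W z \<le> (ln z / v) powr \<kappa> * exp (U (exp v)) * (1 / W (exp v))"
      using W_le[OF vz(2,1)] W_pos[of z] W_pos[of "exp v"] by (simp add: field_simps)
    also have "\<dots> \<le> m powr \<kappa> * exp (U 2) * (2 * gp.G (ln z))"
    proof (intro mult_mono)
      show "(ln z / v) powr \<kappa> \<le> m powr \<kappa>" using uv v by (simp add: less_imp_le)
      show "exp (U (exp v)) \<le> exp (U 2)" using U_antimono[of 2 "exp v"] vz by simp
      show "1 / W (exp v) \<le> 2 * gp.G (ln z)" using v uv unfolding m_def by (intro inverse_W_le_2_G) auto
    qed (use W_pos[of "exp v"] in auto)
    finally show ?thesis unfolding m_def by (simp add: mult_ac)
  qed
qed

text \<open>The part of the exponent in \<open>m3\<close> beyond \<open>U 2\<close> is nonnegative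
  for every positive lam: lam^2 \<le> 2 e^lam gives lam \<le> (2\<kappa>/lam) e^lam, and the other
  terms are nonnegative.\<close>

lemma inverse_W_le_m3:
  assumes z: "2 \<le> z" and lam: "0 < lam"
  shows "1 / W z \<le> m3 \<kappa> A1 A2 L z lam * gp.G (ln z)"
proof -
  have lz: "0 < ln z" using z by auto
  have "1 + lam + lam\<^sup>2 / 2 \<le> exp lam" using lam by (intro exp_lower_Taylor_quadratic) auto
  then have "lam * lam \<le> 2 * exp lam" using lam by (simp add: power2_eq_square)
  moreover have "2 * exp lam \<le> 2 * \<kappa> * exp lam" using kappa by simp
  ultimately have "lam * lam \<le> 2 * \<kappa> * exp lam" by linarith
  then have "lam \<le> 2 * \<kappa> * exp lam / lam" using lam by (simp add: field_simps)
  moreover have "0 \<le> A2 / ln z * exp lam" using A2 lz by (intro mult_nonneg_nonneg) auto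
  moreover have "0 \<le> L / ln 2" using L_nonneg by simp
  ultimately have "0 \<le> L / ln 2 - lam + (2 * \<kappa> / lam + A2 / ln z) * exp lam" by (simp add: algebra_simps)
  then have "exp (U 2) \<le> exp (U 2 + L / ln 2 - lam + (2 * \<kappa> / lam + A2 / ln z) * exp lam)" by simp
  then have "2 * m4 \<kappa> A2 powr \<kappa> * exp (U 2) \<le> 2 * m4 \<kappa> A2 powr \<kappa> * exp (U 2 + L / ln 2 - lam + (2 * \<kappa> / lam + A2 / ln z) * exp lam)"
    by (intro mult_left_mono) auto
  also have "\<dots> \<le> m3 \<kappa> A1 A2 L z lam" unfolding m3_def U_2_eq by simp
  finally have "2 * m4 \<kappa> A2 powr \<kappa> * exp (U 2) * gp.G (ln z) \<le> m3 \<kappa> A1 A2 L z lam * gp.G (ln z)"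
    using gp.G_ge_1[OF lz] by (intro mult_right_mono) auto
  then show ?thesis using inverse_W_le_G[OF z] by linarith
qed

end

section \<open>The two regimes for the shift\<close>

lemma card_le_of_primes_in:
  assumes "1 \<le> Y" shows "real (card (primes_in 2 Y)) \<le> Y - 1"
proof -
  have "primes_in 2 Y \<subseteq> {2..<nat \<lceil>Y\<rceil>}"
    unfolding primes_in_def using prime_ge_2_nat by (auto simp: less_ceiling_iff zless_nat_eq_int_zless)
  then have "card (primes_in 2 Y) \<le> nat \<lceil>Y\<rceil> - 2" by (metis card_atLeastLessThan card_mono finite_atLeastLessThan)
  then have "real (card (primes_in 2 Y)) \<le> real (nat \<lceil>Y\<rceil> - 2)" by simp
  also have "\<dots> \<le> Y - 1" using assms by linarith
  finally show ?thesis .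
qed

lemma card_primes_in_le_length:
  assumes "\<And>p. prime p \<Longrightarrow> real p < Y \<Longrightarrow> p \<in> set xs" shows "card (primes_in 2 Y) \<le> length xs"
proof -
  have "primes_in 2 Y \<subseteq> set xs" unfolding primes_in_def using assms by blast
  then have "card (primes_in 2 Y) \<le> card (set xs)" by (intro card_mono) auto
  then show ?thesis using card_length le_trans by blast
qed

lemma prime_less_11: assumes "prime (p::nat)" "p < 11" shows "p \<in> {2, 3, 5, 7}"
proof -
  have "p \<notin> {4, 6, 8, 9, 10}"
  proof
    assume "p \<in> {4, 6, 8, 9, 10}"
    then have "2 dvd p \<and> p \<noteq> 2 \<or> 3 dvd p \<and> p \<noteq> 3" by auto
    moreover have "prime (3 :: nat)" by (simp add: prime_nat_numeral_eq)
    ultimately show False using assms primes_dvd_imp_eq[of 2 p] primes_dvd_imp_eq[of 3 p] by auto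
  qed
  moreover have "2 \<le> p" using prime_ge_2_nat[OF assms(1)] .
  ultimately show ?thesis using assms(2) by auto
qed

context sieve_density begin

text \<open>\<open>m\<^sub>2\<close> depends on \<open>A1\<close> and \<open>A2\<close> only through this quantity, which also bounds every \<open>(\<kappa> + 1) g p log p\<close>.\<close>

definition m2_exponent :: real where "m2_exponent = A2 + \<kappa> * (A1 * A2) + A2 * (A1 * A2) / ln 2"

lemma m2_exponent_pos: "0 < m2_exponent"
  unfolding m2_exponent_def using A1 A2 kappa by (intro add_pos_nonneg mult_nonneg_nonneg divide_nonneg_nonneg) auto

lemma gp_V_plus_b_le: "gp.V y + gp.b y \<le> (\<Sum>p\<in>primes_in 2 (exp y). g p * ln (real p))"
proof -
  have "gp.b y = (\<Sum>p\<in>primes_in (max 2 (exp (y / 2))) (exp y). g p * gp.a p)"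
    unfolding gp.b_def gp_b_set ..
  also have "\<dots> \<le> (\<Sum>p\<in>primes_in 2 (exp y). g p * gp.a p)"
    by (intro sum_mono2 finite_primes_in) (auto simp: primes_in_def gp.a_nonneg g_nonneg)
  finally have "gp.V y + gp.b y \<le> (\<Sum>p\<in>primes_in 2 (exp y). h p * ln (real p) + g p * gp.a p)"
    unfolding gp_V sum.distrib by simp
  also have "\<dots> = (\<Sum>p\<in>primes_in 2 (exp y). g p * ln (real p))"
  proof (intro sum.cong refl)
    fix p assume "p \<in> primes_in 2 (exp y)"
    then have p: "prime p" unfolding primes_in_def by simp
    show "h p * ln (real p) + g p * gp.a p = g p * ln (real p)"
      unfolding gp_a[OF p] using arg_cong[OF g_eq[OF p], of "\<lambda>t. t * ln (real p)"] by (simp add: algebra_simps)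
  qed
  finally show ?thesis .
qed

text \<open>g log p is at most A1 A2 by \<open>(\<Omega>\<^sub>1)\<close>, and at most A2 + A1 A2^2
  / ln 2 by g = h + g h. Adding the second bound to \<kappa> times the first gives
  \<open>m2_exponent\<close>.\<close>

lemma g_ln_le: assumes p: "prime p" shows "g p * ln (real p) \<le> m2_exponent / (\<kappa> + 1)"
proof -
  have lp: "ln 2 \<le> ln (real p)" "0 < ln (real p)" using prime_ge_2_real[OF p] by auto
  have hl: "0 \<le> h p * ln (real p)" using h_nonneg[OF p] lp by simp
  have 1: "g p * ln (real p) \<le> A1 * A2"
  proof -
    have "g p * ln (real p) \<le> A1 * h p * ln (real p)" using g_le[OF p] lp by (intro mult_right_mono) auto
    also have "\<dots> \<le> A1 * A2" using h_ln_le[OF p] A1 by (simp add: mult.assoc)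
    finally show ?thesis .
  qed
  then have "g p \<le> A1 * A2 / ln (real p)" using lp by (simp add: field_simps)
  also have "\<dots> \<le> A1 * A2 / ln 2" using lp A1 A2 by (intro divide_left_mono) auto
  finally have "g p * (h p * ln (real p)) \<le> A1 * A2 / ln 2 * A2"
    using h_ln_le[OF p] g_nonneg[OF p] hl A1 A2 by (intro mult_mono) auto
  moreover have "g p * ln (real p) = h p * ln (real p) + g p * (h p * ln (real p))"
    using arg_cong[OF g_eq[OF p], of "\<lambda>t. t * ln (real p)"] by (simp add: algebra_simps)
  ultimately have "g p * ln (real p) \<le> A2 + A1 * A2 / ln 2 * A2" using h_ln_le[OF p] by linarith
  moreover have "\<kappa> * (g p * ln (real p)) \<le> \<kappa> * (A1 * A2)" using 1 kappa by (intro mult_left_mono) auto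
  ultimately have "(\<kappa> + 1) * (g p * ln (real p)) \<le> m2_exponent" unfolding m2_exponent_def by (simp add: algebra_simps)
  then show ?thesis using kappa by (simp add: field_simps)
qed

lemma gp_V_plus_b_le_card: "gp.V y + gp.b y \<le> real (card (primes_in 2 (exp y))) * (m2_exponent / (\<kappa> + 1))"
proof -
  have "(\<Sum>p\<in>primes_in 2 (exp y). g p * ln (real p)) \<le> (\<Sum>p\<in>primes_in 2 (exp y). m2_exponent / (\<kappa> + 1))"
    by (intro sum_mono g_ln_le) (simp add: primes_in_def)
  then show ?thesis using gp_V_plus_b_le[of y] by simp
qed

text \<open>Below w each prime is charged A2; from w on the increment bound takes over. The
  condition w \<ge> 4 makes 2 / ln w \<le> 1 / ln 2, so that the bound for b fits under
  \<open>m2_exponent\<close>.\<close>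

lemma gp_V_plus_b_le_beyond:
  assumes w: "4 \<le> w" and y: "ln w < y" and n: "real (card (primes_in 2 w)) \<le> n"
  shows "gp.V y + gp.b y \<le> \<kappa> * y + A2 * (1 + n + \<kappa> * ln 2 + 2 / ln w * m2_exponent) - \<kappa> * ln w"
proof -
  have lw: "0 < ln w" "2 * ln 2 \<le> ln w" using w ln_mono[of 4 w] ln_4_eq by auto
  have "gp.V (ln w) = (\<Sum>p\<in>primes_in 2 w. h p * ln (real p))" unfolding gp_V using w by simp
  also have "\<dots> \<le> (\<Sum>p\<in>primes_in 2 w. A2)" by (intro sum_mono h_ln_le) (simp add: primes_in_def)
  also have "\<dots> \<le> n * A2" using n A2 by simp
  finally have "gp.V y \<le> n * A2 + \<kappa> * (y - ln w) + A2" using gp_V_incr[OF lw(1) y] by linarith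
  moreover have "gp.b y \<le> A2 * (\<kappa> * ln 2 + 2 / ln w * m2_exponent)"
  proof -
    have "gp.b y \<le> m1_log y" using y lw by (intro gp_b_le) auto
    also have "\<dots> \<le> m1_log (ln w)" using y lw by (intro m1_log_antimono) auto
    also have "\<dots> = A2 * (\<kappa> * ln 2 + 2 / ln w * (A2 + A1 * A2 * (\<kappa> + 2 / ln w * A2)))"
    proof -
      define c where "c = 2 / ln w"
      have "2 * A2 / ln w = c * A2" unfolding c_def by simp
      then show ?thesis unfolding m1_log_def c_def[symmetric] by (simp add: algebra_simps)
    qed
    also have "\<dots> \<le> A2 * (\<kappa> * ln 2 + 2 / ln w * (A2 + A1 * A2 * (\<kappa> + 1 / ln 2 * A2)))"
    proof -
      have "2 / ln w \<le> 1 / ln 2" using lw by (simp add: field_simps)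
      then have "2 / ln w * A2 \<le> 1 / ln 2 * A2" using A2 by (intro mult_right_mono) auto
      then show ?thesis using A1 A2 lw by (intro mult_left_mono add_left_mono) auto
    qed
    also have "A2 + A1 * A2 * (\<kappa> + 1 / ln 2 * A2) = m2_exponent" unfolding m2_exponent_def by (simp add: algebra_simps)
    finally show ?thesis .
  qed
  ultimately show ?thesis by (simp add: algebra_simps)
qed

text \<open>V + b vanishes up to ln 2 and each further prime adds at most 0.4638 \<kappa>. The line
  \<kappa> y stays above this staircase at 2, 3, 5 and 7, the tightest spots being ln 2 and ln 7;
  beyond 11 the density condition suffices.\<close>

lemma V_plus_b_le_small_kappa:
  assumes s: "A2 \<le> s" "(\<kappa> + 1) * s + s\<^sup>2 / ln 2 = m2_exponent" "s \<le> 11 / 10 * \<kappa> / (\<kappa> + 2)" and y: "0 < y"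
  shows "gp.V y + gp.b y \<le> \<kappa> * y"
proof -
  define t where "t = 11 / 10 * \<kappa> / (\<kappa> + 2)"
  have t: "t * (\<kappa> + 2) = 11 / 10 * \<kappa>" "0 \<le> t" unfolding t_def using kappa by (auto simp: field_simps)
  have s0: "0 \<le> s" using s A2 by linarith
  have e: "m2_exponent \<le> (\<kappa> + 1) * t + 14429 / 10000 * t\<^sup>2"
  proof -
    have "s\<^sup>2 * (1 / ln 2) \<le> t\<^sup>2 * (14429 / 10000)"
      using s s0 inverse_ln_2_bounds unfolding t_def by (intro mult_mono power_mono) auto
    moreover have "s\<^sup>2 * (1 / ln 2) = s\<^sup>2 / ln 2" by simp
    moreover have "(\<kappa> + 1) * s \<le> (\<kappa> + 1) * t" using s kappa unfolding t_def by (intro mult_left_mono) auto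
    ultimately show ?thesis unfolding s(2)[symmetric] by linarith
  qed
  define c where "c = m2_exponent / (\<kappa> + 1)"
  \<comment> \<open>The constant is the mass each prime may carry: slightly above the value at
    \<kappa> = 1, where the difference polynomial is nearly 0, and small enough that four primes
    stay below 1.93 \<le> ln 7.\<close>
  have c: "c \<le> 4638 / 10000 * \<kappa>"
  proof -
    have "m2_exponent * (\<kappa> + 2)\<^sup>2 \<le> ((\<kappa> + 1) * t + 14429 / 10000 * t\<^sup>2) * (\<kappa> + 2)\<^sup>2" using e by (intro mult_right_mono) auto
    also have "\<dots> = (\<kappa> + 1) * (t * (\<kappa> + 2)) * (\<kappa> + 2) + 14429 / 10000 * (t * (\<kappa> + 2))\<^sup>2"
      by (simp add: algebra_simps power2_eq_square)
    also have "\<dots> \<le> 4638 / 10000 * \<kappa> * (\<kappa> + 1) * (\<kappa> + 2)\<^sup>2"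
    proof -
      define x where "x = \<kappa> - 1"
      have x: "0 \<le> x" "\<kappa> = 1 + x" unfolding x_def using kappa by auto
      have "0 \<le> x ^ 2" "0 \<le> x ^ 3" "0 \<le> x ^ 4" using x by auto
      moreover have "4638 / 10000 * \<kappa> * (\<kappa> + 1) * (\<kappa> + 2)\<^sup>2 - ((\<kappa> + 1) * (11 / 10 * \<kappa>) * (\<kappa> + 2) + 14429 / 10000 * (11 / 10 * \<kappa>)\<^sup>2) = (2491 / 1000000) + (1248191 / 500000) * x + (5104291 / 1000000) * x ^ 2 + (15371 / 5000) * x ^ 3 + (2319 / 5000) * x ^ 4"
        unfolding x(2) by (simp add: field_simps eval_nat_numeral)
      ultimately show ?thesis unfolding t using x(1) by linarith
    qed
    finally have "m2_exponent \<le> 4638 / 10000 * \<kappa> * (\<kappa> + 1)" using kappa by (simp add: mult_le_cancel_right)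
    then show ?thesis unfolding c_def using kappa by (simp add: field_simps)
  qed
  have c0: "0 \<le> c" unfolding c_def using m2_exponent_pos kappa by simp
  have few: "gp.V y + gp.b y \<le> \<kappa> * y"
    if "card (primes_in 2 (exp y)) \<le> n" "real n * (4638 / 10000) \<le> q" "q \<le> y" for n and q :: real
  proof -
    have "gp.V y + gp.b y \<le> real (card (primes_in 2 (exp y))) * c" using gp_V_plus_b_le_card unfolding c_def .
    also have "\<dots> \<le> real n * (4638 / 10000 * \<kappa>)" using that(1) c c0 by (intro mult_mono) auto
    also have "\<dots> = real n * (4638 / 10000) * \<kappa>" by simp
    also have "\<dots> \<le> y * \<kappa>" using that(2,3) kappa by (intro mult_right_mono) auto
    finally show ?thesis by (simp add: mult.commute)
  qed
  have less: "exp y \<le> w" if "y \<le> ln w" "0 < w" for w using that by (simp add: ln_ge_iff)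
  have mem: "p \<in> {2, 3, 5, 7} \<and> real p < w" if "prime p" "real p < exp y" "y \<le> ln w" "0 < w" "w \<le> 11" for p :: nat and w :: real
  proof -
    have "real p < w" using less[OF that(3,4)] that(2) by linarith
    then show ?thesis using prime_less_11[OF that(1)] that(5) by simp
  qed
  consider "y \<le> ln 2" | "ln 2 < y" "y \<le> ln 3" | "ln 3 < y" "y \<le> ln 5" | "ln 5 < y" "y \<le> ln 7"
    | "ln 7 < y" "y \<le> ln 11" | "ln 11 < y" by linarith
  then show ?thesis
  proof cases
    case 1
    have "card (primes_in 2 (exp y)) \<le> length ([] :: nat list)"
    proof (rule card_primes_in_le_length)
      fix p :: nat assume "prime p" "real p < exp y"
      then show "p \<in> set []" using less[OF 1] prime_ge_2_real[of p] by simp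
    qed
    then show ?thesis using y by (intro few[of 0 0]) auto
  next
    case 2
    have "card (primes_in 2 (exp y)) \<le> length [2 :: nat]"
    proof (rule card_primes_in_le_length)
      fix p :: nat assume "prime p" "real p < exp y"
      then show "p \<in> set [2]" using mem[of p 3] 2 by auto
    qed
    then show ?thesis using 2 ln_2_bounds by (intro few[of 1 "ln 2"]) auto
  next
    case 3
    have "card (primes_in 2 (exp y)) \<le> length [2, 3 :: nat]"
    proof (rule card_primes_in_le_length)
      fix p :: nat assume "prime p" "real p < exp y"
      then show "p \<in> set [2, 3]" using mem[of p 5] 3 by auto
    qed
    then show ?thesis using 3 ln_3_ge_1 by (intro few[of 2 "ln 3"]) auto
  next
    case 4
    have "card (primes_in 2 (exp y)) \<le> length [2, 3, 5 :: nat]"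
    proof (rule card_primes_in_le_length)
      fix p :: nat assume "prime p" "real p < exp y"
      then show "p \<in> set [2, 3, 5]" using mem[of p 7] 4 by auto
    qed
    then show ?thesis using 4 ln_5_ge by (intro few[of 3 "ln 5"]) auto
  next
    case 5
    have "card (primes_in 2 (exp y)) \<le> length [2, 3, 5, 7 :: nat]"
    proof (rule card_primes_in_le_length)
      fix p :: nat assume "prime p" "real p < exp y"
      then show "p \<in> set [2, 3, 5, 7]" using mem[of p 11] 5 by auto
    qed
    then show ?thesis using 5 ln_7_ge by (intro few[of 4 "ln 7"]) auto
  next
    case 6
    have "card (primes_in 2 11) \<le> length [2, 3, 5, 7 :: nat]"
    proof (rule card_primes_in_le_length)
      fix p :: nat assume "prime p" "real p < 11"
      then show "p \<in> set [2, 3, 5, 7]" using prime_less_11[of p] by simp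
    qed
    then have "gp.V y + gp.b y \<le> \<kappa> * y + A2 * (1 + 4 + \<kappa> * ln 2 + 2 / ln 11 * m2_exponent) - \<kappa> * ln 11"
      using 6 by (intro gp_V_plus_b_le_beyond) auto
    moreover have "A2 * (1 + 4 + \<kappa> * ln 2 + 2 / ln 11 * m2_exponent)
        \<le> t * (5 + 69318 / 100000 * \<kappa> + 8344 / 10000 * ((\<kappa> + 1) * t + 14429 / 10000 * t\<^sup>2))"
    proof (rule mult_mono)
      show "A2 \<le> t" using s unfolding t_def by linarith
      have "2 / ln (11::real) \<le> 8344 / 10000" using ln_11_ge by (simp add: field_simps)
      then have "2 / ln 11 * m2_exponent \<le> 8344 / 10000 * ((\<kappa> + 1) * t + 14429 / 10000 * t\<^sup>2)"
        using e m2_exponent_pos by (intro mult_mono) auto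
      moreover have "\<kappa> * ln 2 \<le> \<kappa> * (69318 / 100000)" using kappa ln_2_bounds by (intro mult_left_mono) auto
      ultimately show "1 + 4 + \<kappa> * ln 2 + 2 / ln 11 * m2_exponent \<le> 5 + 69318 / 100000 * \<kappa> + 8344 / 10000 * ((\<kappa> + 1) * t + 14429 / 10000 * t\<^sup>2)"
        by linarith
    qed (use t kappa m2_exponent_pos in auto)
    moreover have "\<dots> \<le> 2397 / 1000 * \<kappa>"
    proof -
      have "(t * (5 + 69318 / 100000 * \<kappa> + 8344 / 10000 * ((\<kappa> + 1) * t + 14429 / 10000 * t\<^sup>2))) * (\<kappa> + 2) ^ 3
        = t * (\<kappa> + 2) * ((5 + 69318 / 100000 * \<kappa>) * (\<kappa> + 2)\<^sup>2
            + 8344 / 10000 * ((\<kappa> + 1) * (t * (\<kappa> + 2)) * (\<kappa> + 2) + 14429 / 10000 * (t * (\<kappa> + 2))\<^sup>2))"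
        by (simp add: field_simps eval_nat_numeral)
      also have "\<dots> = 11 / 10 * \<kappa> * ((5 + 69318 / 100000 * \<kappa>) * (\<kappa> + 2)\<^sup>2
            + 8344 / 10000 * ((\<kappa> + 1) * (11 / 10 * \<kappa>) * (\<kappa> + 2) + 14429 / 10000 * (11 / 10 * \<kappa>)\<^sup>2))"
        unfolding t ..
      also have "\<dots> \<le> 2397 / 1000 * \<kappa> * (\<kappa> + 2) ^ 3"
      proof -
        define x where "x = \<kappa> - 1"
        have x: "0 \<le> x" "\<kappa> = 1 + x" unfolding x_def using kappa by auto
        have "0 \<le> x ^ 2" "0 \<le> x ^ 3" "0 \<le> x ^ 4" using x by auto
        moreover have "2397 / 1000 * \<kappa> * (\<kappa> + 2) ^ 3 - 11 / 10 * \<kappa> * ((5 + 69318 / 100000 * \<kappa>) * (\<kappa> + 2)\<^sup>2 + 8344 / 10000 * ((\<kappa> + 1) * (11 / 10 * \<kappa>) * (\<kappa> + 2) + 14429 / 10000 * (11 / 10 * \<kappa>)\<^sup>2)) = (8703861043 / 12500000000) + (83338058129 / 12500000000) * x + (113075508129 / 12500000000) * x ^ 2 + (46252286043 / 12500000000) * x ^ 3 + (312439 / 500000) * x ^ 4"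
          unfolding x(2) by (simp add: field_simps eval_nat_numeral)
        ultimately show ?thesis using x(1) by linarith
      qed
      finally show ?thesis by (rule mult_right_le_imp_le) (use kappa in auto)
    qed
    moreover have "\<kappa> * (2397 / 1000) \<le> \<kappa> * ln 11" using kappa ln_11_ge by (intro mult_left_mono) auto
    ultimately show ?thesis by linarith
  qed
qed

text \<open>Up to y = ln \<kappa> there are at most e^y - 1 primes, each of mass at most ln
  \<kappa>, and convexity of exp gives (e^y - 1) ln \<kappa> \<le> (\<kappa> - 1) y. Beyond, the
  gain \<kappa> ln \<kappa> outweighs all constants.\<close>

lemma V_plus_b_le_large_kappa:
  assumes k8: "8 \<le> \<kappa>" and s: "A2 \<le> s" "(\<kappa> + 1) * s + s\<^sup>2 / ln 2 = m2_exponent" "s \<le> 36 / 100 * ln \<kappa>" and y: "0 < y"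
  shows "gp.V y + gp.b y \<le> \<kappa> * y"
proof -
  define x where "x = ln \<kappa>"
  have x: "0 < x" "x \<le> 26 / 100 * \<kappa>" "s \<le> 36 / 100 * x" using ln_large_bounds[OF k8] s unfolding x_def by auto
  have s0: "0 \<le> s" using s A2 by linarith
  have e: "m2_exponent \<le> 41 / 100 * x * (\<kappa> + 1)"
  proof -
    have "(\<kappa> + 1) * s \<le> (\<kappa> + 1) * (36 / 100 * x)" using x kappa by (intro mult_left_mono) auto
    moreover have "s\<^sup>2 * (1 / ln 2) \<le> (36 / 100 * x)\<^sup>2 * (14429 / 10000)"
      using x s0 inverse_ln_2_bounds by (intro mult_mono power_mono) auto
    moreover have "(36 / 100 * x)\<^sup>2 * (14429 / 10000) = 1296 * 14429 / 10000 / 10000 * (x * x)" by (simp add: power2_eq_square)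
    moreover have "x * x \<le> x * (26 / 100 * (\<kappa> + 1))" using x by (intro mult_left_mono) auto
    ultimately have "m2_exponent \<le> (\<kappa> + 1) * (36 / 100 * x) + 1296 * 14429 / 10000 / 10000 * (x * (26 / 100 * (\<kappa> + 1)))"
      unfolding s(2)[symmetric] by simp
    also have "\<dots> \<le> 41 / 100 * x * (\<kappa> + 1)"
    proof -
      have "0 \<le> x * (\<kappa> + 1)" using x kappa by simp
      moreover have "(\<kappa> + 1) * (36 / 100 * x) = 36 / 100 * (x * (\<kappa> + 1))"
        "x * (26 / 100 * (\<kappa> + 1)) = 26 / 100 * (x * (\<kappa> + 1))" "41 / 100 * x * (\<kappa> + 1) = 41 / 100 * (x * (\<kappa> + 1))"
        by simp_all
      ultimately show ?thesis by linarith
    qed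
    finally show ?thesis .
  qed
  then have c: "m2_exponent / (\<kappa> + 1) \<le> x" using x kappa by (simp add: field_simps) (use mult_pos_pos[of x "\<kappa> + 1"] in \<open>simp add: algebra_simps\<close>)
  show ?thesis
  proof (cases "y \<le> x")
    case True
    define Y where "Y = exp y"
    have Y: "1 < Y" "Y \<le> \<kappa>" unfolding Y_def using y True k8 unfolding x_def by (auto simp: ln_ge_iff)
    \<comment> \<open>The position of e^y between 1 and \<kappa>, for the chord of exp over
      [0, ln \<kappa>].\<close>
    define \<theta> where "\<theta> = (Y - 1) / (\<kappa> - 1)"
    have th: "0 \<le> \<theta>" "\<theta> \<le> 1" unfolding \<theta>_def using Y k8 by auto
    have "exp ((1 - \<theta>) *\<^sub>R 0 + \<theta> *\<^sub>R x) \<le> (1 - \<theta>) * exp 0 + \<theta> * exp x"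
      by (rule convex_onD[OF exp_convex]) (use th in auto)
    also have "\<dots> = 1 + \<theta> * (\<kappa> - 1)" unfolding x_def using k8 by (simp add: algebra_simps)
    also have "\<dots> = exp y" unfolding \<theta>_def Y_def using k8 by simp
    finally have "\<theta> * x \<le> y" by simp
    then have "(Y - 1) * x \<le> y * (\<kappa> - 1)" unfolding \<theta>_def using k8 by (simp add: field_simps)
    then have 1: "(Y - 1) * x \<le> \<kappa> * y" using y by (simp add: algebra_simps)
    have "gp.V y + gp.b y \<le> real (card (primes_in 2 Y)) * (m2_exponent / (\<kappa> + 1))" unfolding Y_def by (rule gp_V_plus_b_le_card)
    also have "\<dots> \<le> (Y - 1) * x" using card_le_of_primes_in[of Y] Y c m2_exponent_pos kappa by (intro mult_mono) auto
    finally show ?thesis using 1 by linarith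
  next
    case False
    then have "gp.V y + gp.b y \<le> \<kappa> * y + A2 * (1 + (\<kappa> - 1) + \<kappa> * ln 2 + 2 / ln \<kappa> * m2_exponent) - \<kappa> * ln \<kappa>"
      using k8 card_le_of_primes_in[of \<kappa>] unfolding x_def by (intro gp_V_plus_b_le_beyond) auto
    moreover have "A2 * (1 + (\<kappa> - 1) + \<kappa> * ln 2 + 2 / ln \<kappa> * m2_exponent) \<le> (36 / 100 * x) * (\<kappa> + 69318 / 100000 * \<kappa> + 82 / 100 * (\<kappa> + 1))"
    proof (rule mult_mono)
      have "2 / ln \<kappa> * m2_exponent \<le> 2 / x * (41 / 100 * x * (\<kappa> + 1))" unfolding x_def[symmetric] using e x by (intro mult_left_mono) auto
      also have "\<dots> = 82 / 100 * (\<kappa> + 1)" using x by simp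
      finally have "2 / ln \<kappa> * m2_exponent \<le> 82 / 100 * (\<kappa> + 1)" .
      moreover have "\<kappa> * ln 2 \<le> \<kappa> * (69318 / 100000)" using kappa ln_2_bounds by (intro mult_left_mono) auto
      ultimately show "1 + (\<kappa> - 1) + \<kappa> * ln 2 + 2 / ln \<kappa> * m2_exponent \<le> \<kappa> + 69318 / 100000 * \<kappa> + 82 / 100 * (\<kappa> + 1)" by linarith
    qed (use s x kappa m2_exponent_pos in \<open>auto simp: x_def\<close>)
    moreover have "\<dots> \<le> x * \<kappa>"
    proof -
      have "36 / 100 * (\<kappa> + 69318 / 100000 * \<kappa> + 82 / 100 * (\<kappa> + 1)) \<le> \<kappa>"
        using k8 by (simp add: field_simps)
      then have "x * (36 / 100 * (\<kappa> + 69318 / 100000 * \<kappa> + 82 / 100 * (\<kappa> + 1))) \<le> x * \<kappa>" using x by (intro mult_left_mono) auto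
      then show ?thesis by (simp add: mult_ac)
    qed
    moreover have "x * \<kappa> = \<kappa> * ln \<kappa>" unfolding x_def by simp
    ultimately show ?thesis by linarith
  qed
qed

lemma V_plus_b_le:
  assumes "A2 \<le> s" "(\<kappa> + 1) * s + s\<^sup>2 / ln 2 = m2_exponent" "s \<le> s_min \<kappa>" "0 < y"
  shows "gp.V y + gp.b y \<le> \<kappa> * y"
  using V_plus_b_le_small_kappa[of s y] V_plus_b_le_large_kappa[of s y] assms
  unfolding s_min_def by (cases "\<kappa> \<le> 8") auto

text \<open>The second summand of \<open>m\<^sub>8\<close>, without its last factor.\<close>

definition M :: real where
  "M = 2 powr (- 4 * \<kappa>) * m2 \<kappa> A1 A2 ^ 4 / (Gamma (\<kappa> + 1) * exp (\<kappa> * euler_mascheroni))"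

lemma m2_eq: "m2 \<kappa> A1 A2 = exp (m2_exponent / ln 2) / ln 2 powr \<kappa>"
  unfolding m2_def m2_exponent_def by (simp add: field_simps)

lemma M_pos: "0 < M"
  unfolding M_def m2_eq using kappa by (auto intro!: divide_pos_pos mult_pos_pos Gamma_real_pos)

text \<open>Gamma is at most \<kappa>^\<kappa>, and the powers of ln 2 hidden in \<open>m2^4\<close>
  join 2^(-4\<kappa>) to form (2 ln 2)^(-4\<kappa>).\<close>

lemma M_ge: "exp (4 / ln 2 * m2_exponent - 1898 / 1000 * \<kappa> - \<kappa> * ln \<kappa>) \<le> M"
proof -
  have G: "0 < Gamma (\<kappa> + 1)" using kappa by (intro Gamma_real_pos) auto
  have "Gamma (\<kappa> + 1) * exp (\<kappa> * euler_mascheroni) * exp (4 * \<kappa> * ln (2 * ln 2))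
      = Gamma (\<kappa> + 1) * exp (\<kappa> * (4 * ln (2 * ln 2) + euler_mascheroni))"
    by (simp add: exp_add[symmetric] algebra_simps)
  also have "\<dots> \<le> exp (\<kappa> * ln \<kappa>) * exp (\<kappa> * (1898 / 1000))"
  proof (rule mult_mono)
    show "exp (\<kappa> * (4 * ln (2 * ln 2) + euler_mascheroni)) \<le> exp (\<kappa> * (1898 / 1000))"
      unfolding exp_le_cancel_iff using kappa euler_constant_bound by (intro mult_left_mono) auto
  qed (use Gamma_plus1_le_powr[OF kappa] in auto)
  finally have le: "Gamma (\<kappa> + 1) * exp (\<kappa> * euler_mascheroni) * exp (4 * \<kappa> * ln (2 * ln 2)) \<le> exp (1898 / 1000 * \<kappa> + \<kappa> * ln \<kappa>)"
    by (simp add: exp_add mult_ac)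
  have num: "2 powr (- 4 * \<kappa>) * m2 \<kappa> A1 A2 ^ 4 = exp (4 / ln 2 * m2_exponent) / exp (4 * \<kappa> * ln (2 * ln 2))"
  proof -
    have "2 powr (- 4 * \<kappa>) * m2 \<kappa> A1 A2 ^ 4 = exp (- 4 * \<kappa> * ln 2) * exp (m2_exponent / ln 2 - \<kappa> * ln (ln 2)) ^ 4"
      unfolding m2_eq powr_def by (simp add: exp_diff)
    also have "\<dots> = exp (4 / ln 2 * m2_exponent - 4 * \<kappa> * (ln 2 + ln (ln 2)))"
      by (simp add: exp_of_nat_mult[symmetric] exp_add[symmetric] algebra_simps)
    finally show ?thesis by (simp add: exp_diff ln_mult_pos)
  qed
  have "M = exp (4 / ln 2 * m2_exponent) / (Gamma (\<kappa> + 1) * exp (\<kappa> * euler_mascheroni) * exp (4 * \<kappa> * ln (2 * ln 2)))"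
    unfolding M_def num by (simp add: mult_ac)
  moreover have "exp (4 / ln 2 * m2_exponent) / exp (1898 / 1000 * \<kappa> + \<kappa> * ln \<kappa>)
      \<le> exp (4 / ln 2 * m2_exponent) / (Gamma (\<kappa> + 1) * exp (\<kappa> * euler_mascheroni) * exp (4 * \<kappa> * ln (2 * ln 2)))"
    using le G by (intro divide_left_mono) auto
  moreover have "4 / ln 2 * m2_exponent - 1898 / 1000 * \<kappa> - \<kappa> * ln \<kappa> = 4 / ln 2 * m2_exponent - (1898 / 1000 * \<kappa> + \<kappa> * ln \<kappa>)" by simp
  ultimately show ?thesis by (simp only: exp_diff)
qed

lemma G_lower_delta:
  assumes d: "0 \<le> \<delta>" "\<delta> < K" and u: "(\<kappa> + 2) * K \<le> u"
    and vb: "\<And>y. 0 < y \<Longrightarrow> gp.V y + gp.b y \<le> \<kappa> * y + \<delta>"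
  shows "1 / gp.G u \<le> P_lim * Gamma (\<kappa> + 1) / u powr \<kappa> * (1 + K / u + chord_slope \<kappa> * \<delta> / u)"
proof -
  have "1 * K < (\<kappa> + 2) * K" using kappa K_pos by (intro mult_strict_right_mono) auto
  then have Ku: "K < u" using u by simp
  then have u0: "0 < u" "\<delta> < u" using K_pos d by auto
  have G: "0 < gp.G u" using gp.G_ge_1[OF u0(1)] by linarith
  have C: "0 < P_lim * Gamma (\<kappa> + 1)" using singular_product(3) kappa by (intro mult_pos_pos Gamma_real_pos) auto
  have q: "(u - \<delta>) powr (\<kappa> + 1) \<le> P_lim * Gamma (\<kappa> + 1) * (u + (K - \<delta>)) * gp.G u"
    using G_lower_main[OF d u0(2) vb] by (simp add: mult_ac)
  have "1 / gp.G u \<le> P_lim * Gamma (\<kappa> + 1) * (u + (K - \<delta>)) / (u - \<delta>) powr (\<kappa> + 1)"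
    using q G u0 by (simp add: field_simps)
  also have "(u - \<delta>) powr (\<kappa> + 1) = u powr (\<kappa> + 1) * (1 - \<delta> / u) powr (\<kappa> + 1)"
  proof -
    have "u - \<delta> = u * (1 - \<delta> / u)" using u0 by (simp add: field_simps)
    moreover have "0 \<le> 1 - \<delta> / u" using u0 by simp
    ultimately show ?thesis using u0 by (simp only: powr_mult)
  qed
  also have "u powr (\<kappa> + 1) = u * u powr \<kappa>" using u0 powr_mult_base[of u \<kappa>] by (simp add: add.commute)
  also have "P_lim * Gamma (\<kappa> + 1) * (u + (K - \<delta>)) / (u * u powr \<kappa> * (1 - \<delta> / u) powr (\<kappa> + 1))
     = P_lim * Gamma (\<kappa> + 1) / u powr \<kappa> * ((1 + (K - \<delta>) / u) * (1 - \<delta> / u) powr - (\<kappa> + 1))"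
  proof -
    have "(1 - \<delta> / u) powr - (\<kappa> + 1) = 1 / (1 - \<delta> / u) powr (\<kappa> + 1)" by (rule powr_minus_divide)
    moreover have "u + (K - \<delta>) = u * (1 + (K - \<delta>) / u)" using u0 by (simp add: field_simps)
    ultimately show ?thesis using u0 by (simp only: mult.assoc) (simp add: mult_ac)
  qed
  also have "\<dots> \<le> P_lim * Gamma (\<kappa> + 1) / u powr \<kappa> * (1 + K / u + chord_slope \<kappa> * \<delta> / u)"
    using C d u K_pos kappa by (intro mult_left_mono chord_bound) auto
  finally show ?thesis .
qed

text \<open>A positive \<delta> is paid for by the part of \<open>M\<close> that the sieve remainder
  leaves over. For s below \<open>s_min\<close>, or for K \<le> \<kappa> ln 2, \<delta> = 0 is
  admissible and nothing has to be paid.\<close>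

lemma G_lower_saving:
  assumes u: "(\<kappa> + 2) * K \<le> u" and l: "0 < l" "l = 2 * u + (4 * \<kappa> + 1) * ln l"
  shows "1 / gp.G u \<le> P_lim * Gamma (\<kappa> + 1) / u powr \<kappa> * (1 + K / u + M * (1 - exp (- (3 / ln 2 * (m2_exponent - A2)))) / l)"
proof -
  have u0: "0 < u" using u K_pos kappa by (smt (verit) mult_pos_pos)
  have C: "0 < P_lim * Gamma (\<kappa> + 1)" using singular_product(3) kappa by (intro mult_pos_pos Gamma_real_pos) auto
  have eA: "A2 \<le> m2_exponent" unfolding m2_exponent_def using A1 A2 kappa by simp
  define S where "S = 1 - exp (- (3 / ln 2 * (m2_exponent - A2)))"
  have S0: "0 \<le> S" unfolding S_def using eA by simp
  have "A2 \<le> A1 * A2" using A1 A2 by simp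
  then obtain s where s: "A2 \<le> s" "(\<kappa> + 1) * s + s\<^sup>2 / ln 2 = m2_exponent"
    "A2 * (1 + \<kappa> * ln 2 + 2 / ln 2 * A2 + 2 / ln 2 * (A1 * A2) * (\<kappa> + 2 / ln 2 * A2)) \<le> K_bound \<kappa> s"
    using exists_common_parameter[OF kappa A2, of "A1 * A2"] unfolding m2_exponent_def by metis
  have KK: "K \<le> K_bound \<kappa> s" using s(3) unfolding K_def m1_log_def by (simp add: algebra_simps)
  have reduce: ?thesis if d: "0 \<le> \<delta>" "\<delta> < K" "\<And>y. 0 < y \<Longrightarrow> gp.V y + gp.b y \<le> \<kappa> * y + \<delta>"
    and Z: "chord_slope \<kappa> * \<delta> / u \<le> M * S / l" for \<delta>
  proof -
    have "1 / gp.G u \<le> P_lim * Gamma (\<kappa> + 1) / u powr \<kappa> * (1 + K / u + chord_slope \<kappa> * \<delta> / u)"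
      by (rule G_lower_delta[OF d(1,2) u d(3)])
    also have "\<dots> \<le> P_lim * Gamma (\<kappa> + 1) / u powr \<kappa> * (1 + K / u + M * S / l)"
      using C Z by (intro mult_left_mono add_left_mono) auto
    finally show ?thesis unfolding S_def .
  qed
  have zero: ?thesis if "\<And>y. 0 < y \<Longrightarrow> gp.V y + gp.b y \<le> \<kappa> * y"
    using that K_pos M_pos S0 l by (intro reduce[of 0]) auto
  show ?thesis
  proof (cases "s \<le> s_min \<kappa>")
    case True
    then show ?thesis using zero V_plus_b_le s by blast
  next
    case False
    have small: "gp.V y + gp.b y \<le> 0" if "y \<le> ln 2" for y
    proof -
      have "exp y \<le> 2" using that by (simp add: ln_ge_iff)
      then have "primes_in 2 (exp y) = {}" unfolding primes_in_def by auto
      then show ?thesis using gp_V_plus_b_le[of y] by simp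
    qed
    have vb: "gp.V y + gp.b y \<le> \<kappa> * y + (K - \<kappa> * ln 2)" if "ln 2 < y" for y
      using gp_V_le[OF that] gp_b_le'[of y] that unfolding K_def by (smt (verit) ln_gt_zero right_diff_distrib)
    show ?thesis
    proof (cases "K \<le> \<kappa> * ln 2")
      case True
      show ?thesis
      proof (rule zero)
        fix y :: real assume y: "0 < y"
        have "0 \<le> \<kappa> * y" using kappa y by simp
        then show "gp.V y + gp.b y \<le> \<kappa> * y" using small[of y] vb[of y] True by (cases "y \<le> ln 2") auto
      qed
    next
      case K: False
      \<comment> \<open>No prime lies below 2, so V y \<le> \<kappa> (y - ln 2) + A2 for y > ln 2.
        This reduces the obvious shift K by \<kappa> ln 2.\<close>
      define \<delta> where "\<delta> = K - \<kappa> * ln 2"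
      have d: "0 \<le> \<delta>" "\<delta> < K" unfolding \<delta>_def using K kappa by auto
      have "\<delta> * l \<le> u * (5 / 2 * \<delta> + (4 * \<kappa> + 63 / 100))"
        using d by (intro log_X_bound[OF kappa l d(1) _ u]) auto
      also have "\<dots> \<le> u * (5 / 2 * (K_bound \<kappa> s - \<kappa> * ln 2) + (4 * \<kappa> + 63 / 100))"
        using KK u0 unfolding \<delta>_def by (intro mult_left_mono) auto
      finally have "chord_slope \<kappa> * (\<delta> * l) \<le> chord_slope \<kappa> * (u * (5 / 2 * (K_bound \<kappa> s - \<kappa> * ln 2) + (4 * \<kappa> + 63 / 100)))"
        using chord_slope_nonneg[OF kappa] by (rule mult_left_mono)
      also have "\<dots> = u * (chord_slope \<kappa> * (5 / 2 * (K_bound \<kappa> s - \<kappa> * ln 2) + (4 * \<kappa> + 63 / 100)))" by (simp add: mult_ac)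
      also have "\<dots> \<le> u * (9 / 10 * exp (4 / ln 2 * m2_exponent - 1898 / 1000 * \<kappa> - \<kappa> * ln \<kappa>))"
        using large_s_bound[OF kappa, of s] False u0 unfolding s(2) by (intro mult_left_mono) auto
      also have "\<dots> \<le> u * (S * M)"
      proof (intro mult_left_mono mult_mono)
        show "9 / 10 \<le> S" using remainder_saving[OF kappa, of s A2] False s unfolding S_def s(2) by auto
      qed (use M_ge S0 u0 in auto)
      finally have "chord_slope \<kappa> * \<delta> / u \<le> M * S / l" using u0 l by (simp add: field_simps)
      then show ?thesis
      proof (rule reduce[OF d, rotated])
        fix y :: real assume y: "0 < y"
        have "0 \<le> \<kappa> * y" using kappa y by simp
        then show "gp.V y + gp.b y \<le> \<kappa> * y + \<delta>" using small[of y] vb[of y] d unfolding \<delta>_def by (cases "y \<le> ln 2") auto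
      qed
    qed
  qed
qed

end

section \<open>The sieve bound\<close>

context sieve_density begin

section \<open>Expressing the sieve bound through the auxiliary quantities\<close>

lemma G_eq_sum_prod_less:
  assumes z: "0 < z"
  defines "Q \<equiv> {p \<in> primes_in 2 z. 0 < \<omega> p}"
  shows "gp.G (ln z) = (\<Sum>D | D \<subseteq> Q \<and> real (\<Prod>D) < z. \<Prod>p\<in>D. \<omega> p / real p / (1 - \<omega> p / real p))"
proof -
  have Q: "finite Q" "\<And>p. p \<in> Q \<Longrightarrow> prime p"
    using finite_subset[of Q "primes_in 2 z"] unfolding Q_def by (simp, simp add: primes_in_def)
  have less: "(\<Sum>p\<in>D. ln (real p)) < ln z \<longleftrightarrow> real (\<Prod>D) < z" if D: "D \<subseteq> Q" for D
  proof -
    have pos: "0 < real p" if "p \<in> D" for p using that D Q(2) prime_gt_0_nat by (metis of_nat_0_less_iff subsetD)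
    have "finite D" using D Q(1) finite_subset by blast
    then have "(\<Sum>p\<in>D. ln (real p)) = ln (\<Prod>p\<in>D. real p)"
      using pos by (intro ln_prod[symmetric]) (auto simp: less_imp_neq[THEN not_sym])
    also have "(\<Prod>p\<in>D. real p) = real (\<Prod>D)" by simp
    finally have "(\<Sum>p\<in>D. ln (real p)) = ln (real (\<Prod>D))" .
    moreover have "0 < (\<Prod>p\<in>D. real p)" using pos by (intro prod_pos) auto
    ultimately show ?thesis using z by simp
  qed
  have "gp.G (ln z) = (\<Sum>D | D \<in> gp.DD (ln z) \<and> D \<subseteq> Q. prod g D)"
    unfolding gp.G_def
  proof (rule sum.mono_neutral_right)
    show "\<forall>D\<in>gp.DD (ln z) - {D. D \<in> gp.DD (ln z) \<and> D \<subseteq> Q}. prod g D = 0"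
    proof
      fix D assume D: "D \<in> gp.DD (ln z) - {D. D \<in> gp.DD (ln z) \<and> D \<subseteq> Q}"
      then obtain p where p: "p \<in> D" "p \<notin> Q" by blast
      have "p \<in> {p \<in> {p. prime p}. ln (real p) < ln z}" using D p unfolding gp.DD_def by blast
      then have pr: "prime p" "ln (real p) < ln z" by auto
      then have "real p < z" using z prime_gt_0_nat[OF pr(1)] by simp
      then have "p \<in> primes_in 2 z" using pr prime_ge_2_real unfolding primes_in_def by simp
      then have "\<not> 0 < \<omega> p" using p(2) unfolding Q_def by simp
      then have "h p \<le> 0" unfolding h_def by (intro divide_nonpos_nonneg) auto
      then have "g p = 0" using h_nonneg[OF pr(1)] unfolding g_def by simp
      then show "prod g D = 0" using p(1) D gp.DD_finite by (intro prod_zero) auto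
    qed
  qed (auto simp: gp.finite_DD)
  also have "{D. D \<in> gp.DD (ln z) \<and> D \<subseteq> Q} = {D. D \<subseteq> Q \<and> real (\<Prod>D) < z}"
  proof (intro Collect_cong iffI)
    fix D assume D: "D \<in> gp.DD (ln z) \<and> D \<subseteq> Q"
    then show "D \<subseteq> Q \<and> real (\<Prod>D) < z" using less[of D] unfolding gp.DD_iff by blast
  next
    fix D assume D: "D \<subseteq> Q \<and> real (\<Prod>D) < z"
    then show "D \<in> gp.DD (ln z) \<and> D \<subseteq> Q" using less[of D] Q finite_subset[of D Q] unfolding gp.DD_iff by blast
  qed
  finally show ?thesis unfolding g_def h_def .
qed

lemma sifted_le:
  assumes P: "P \<subseteq> {p. prime p}" and mult: "multiplicative_on_squarefree \<omega>"
    and supp: "\<And>p. prime p \<Longrightarrow> p \<notin> P \<Longrightarrow> \<omega> p = 0" and R: "cond_R A P \<omega> X"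
    and z: "2 \<le> z" "z \<le> zz"
  shows "real (sifted A P zz) \<le> X / gp.G (ln z) + z\<^sup>2 * exp (3 * (A2 / ln 2 + \<kappa> * (ln (ln z) - ln (ln 2))))"
proof -
  define Q where "Q = {p \<in> primes_in 2 z. 0 < \<omega> p}"
  have Qs: "Q \<subseteq> primes_in 2 z" unfolding Q_def by blast
  have "Q \<subseteq> {p \<in> P. real p \<le> zz}"
  proof
    fix p assume "p \<in> Q"
    then show "p \<in> {p \<in> P. real p \<le> zz}" using supp[of p] z unfolding Q_def primes_in_def by force
  qed
  moreover have "0 < \<omega> p / real p \<and> \<omega> p / real p < 1" if "p \<in> Q" for p
    using that h_less_1[of p] prime_gt_0_nat[of p] unfolding Q_def primes_in_def h_def by auto
  ultimately have "real (sifted A P zz) \<le> X / gp.G (ln z) + z\<^sup>2 * (\<Prod>p\<in>Q. 1 + 3 * (\<omega> p / real p))"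
    using selberg_upper_bound[OF mult R P, of Q zz z] G_eq_sum_prod_less[of z] z unfolding Q_def by simp
  also have "(\<Prod>p\<in>Q. 1 + 3 * (\<omega> p / real p)) \<le> exp (3 * (A2 / ln 2 + \<kappa> * (ln (ln z) - ln (ln 2))))"
  proof -
    have hn: "0 \<le> h p" if "p \<in> primes_in 2 z" for p using that h_nonneg unfolding primes_in_def by simp
    have "(\<Prod>p\<in>Q. 1 + 3 * h p) \<le> (\<Prod>p\<in>Q. exp (3 * h p))"
      using hn Qs by (intro prod_mono) (auto intro!: add_nonneg_nonneg)
    also have "\<dots> = exp (\<Sum>p\<in>Q. 3 * h p)" using finite_subset[OF Qs] by (simp add: exp_sum)
    also have "(\<Sum>p\<in>Q. 3 * h p) \<le> (\<Sum>p\<in>primes_in 2 z. 3 * h p)" using hn Qs by (intro sum_mono2) auto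
    also have "\<dots> \<le> 3 * (A2 / ln 2 + \<kappa> * (ln (ln z) - ln (ln 2)))"
      unfolding sum_distrib_left[symmetric] using z by (intro mult_left_mono sum_h_le) auto
    finally show ?thesis unfolding h_def by simp
  qed
  finally show ?thesis by (simp add: mult_left_mono)
qed

text \<open>All further terms of \<open>m0\<close> are nonnegative; for the last of them this uses z
  > e^(A1 A2), which makes 1 - A1 A2 / ln z positive.\<close>

lemma U_le_m0:
  assumes z: "2 < z" "exp (A1 * A2) < z"
  shows "U z \<le> m0 \<kappa> A1 A2 L k0 z"
proof -
  have lz: "0 < ln z" "A1 * A2 < ln z" using z ln_less_cancel_iff[of "exp (A1 * A2)" z] by auto
  have "0 \<le> 3 * \<kappa> / (2 * (ln z)\<^sup>2)" using kappa by simp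
  moreover have "0 \<le> \<kappa> * ln (z / (z - 1))" using kappa z by (intro mult_nonneg_nonneg ln_ge_zero) (auto simp: field_simps)
  moreover have "0 \<le> A1\<^sup>2 * A2 / ln z * (\<kappa> + A2 / ln z) *
       ((\<Sum>k = 2..k0. A1 ^ (k - 2) * A2 ^ (k - 2) / (real k * (ln z) ^ (k - 2)))
        + A1 ^ (k0 - 1) * A2 ^ (k0 - 1) / (ln z) ^ (k0 - 1)
          * inverse ((real k0 + 1) * (1 - A1 * A2 / ln z)))"
    using A1 A2 kappa lz
    by (intro mult_nonneg_nonneg add_nonneg_nonneg divide_nonneg_nonneg sum_nonneg inverse_nonnegative_iff_nonnegative[THEN iffD2]) auto
  ultimately show ?thesis unfolding m0_def U_def by linarith
qed

text \<open>e^m \<le> 1 + m e^m is (1 - m) e^m \<le> 1; the power of 1 + 1/(ln z)^2 in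
  \<open>m0_hat\<close> is at least 1.\<close>

lemma exp_U_le:
  assumes z: "2 < z" "exp (A1 * A2) < z"
  shows "exp (U z) \<le> 1 + m0_hat \<kappa> A1 A2 L k0 z / ln z"
proof -
  define m where "m = m0 \<kappa> A1 A2 L k0 z"
  have lz: "0 < ln z" using z by auto
  have Um: "U z \<le> m" unfolding m_def by (rule U_le_m0[OF z])
  have m: "0 \<le> m" using Um U_nonneg[of z] z by linarith
  have "1 - m \<le> exp (- m)" using exp_ge_add_one_self[of "- m"] by simp
  then have "(1 - m) * exp m \<le> exp (- m) * exp m" by (intro mult_right_mono) auto
  also have "\<dots> = 1" by (simp add: exp_minus)
  finally have "exp m \<le> 1 + m * exp m" by (simp add: algebra_simps)
  also have "\<dots> = 1 * (1 + m * exp m)" by simp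
  also have "\<dots> \<le> (1 + 1 / (ln z)\<^sup>2) powr \<kappa> * (1 + m * exp m)"
    using m kappa by (intro mult_right_mono ge_one_powr_ge_zero) auto
  also have "\<dots> = 1 + m0_hat \<kappa> A1 A2 L k0 z / ln z" unfolding m0_hat_def m_def using lz by simp
  finally show ?thesis using Um by (smt (verit) exp_le_cancel_iff)
qed

lemma W_le_P_lim:
  assumes z: "2 \<le> z" and c: "exp (U z) \<le> c"
  shows "W z * ln z powr \<kappa> \<le> c * P_lim / exp (\<kappa> * euler_mascheroni)"
proof -
  have "W z * ln z powr \<kappa> \<le> exp (U z) * W_lim" by (rule W_le_lim[OF z])
  also have "\<dots> \<le> c * (P_lim * exp (- (\<kappa> * euler_mascheroni)))"
    using c singular_product(4) W_lim_pos order_trans[OF exp_ge_zero c] by (intro mult_mono) auto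
  finally show ?thesis by (simp add: exp_minus divide_inverse mult_ac)
qed

text \<open>Bounding the product over 1 + 3 h yields u^(3\<kappa>) m2^3 E. A fourth m2 comes with
  the singular product from \<open>Wz\<close>, and (u/l)^(4\<kappa>) \<le> 2^(-4\<kappa>) accounts
  for the power of 2. This is the shape of the second term of \<open>m8\<close>.\<close>

lemma remainder_le:
  assumes z: "2 \<le> z" and c: "exp (U z) \<le> c" and l: "0 < l" "2 * ln z \<le> l" and z2: "z\<^sup>2 = X / l powr (4 * \<kappa> + 1)"
    and X: "0 < X"
  shows "z\<^sup>2 * exp (3 * (A2 / ln 2 + \<kappa> * (ln (ln z) - ln (ln 2))))
    \<le> P_lim * Gamma (\<kappa> + 1) * X / ln z powr \<kappa> * (M * c * exp (- (3 / ln 2 * (m2_exponent - A2))) / l)"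
proof -
  define u where "u = ln z"
  define m where "m = m2 \<kappa> A1 A2"
  define E where "E = exp (- (3 / ln 2 * (m2_exponent - A2)))"
  have u: "0 < u" unfolding u_def using z by auto
  have m: "0 < m" unfolding m_def m2_eq by simp
  have G: "0 < Gamma (\<kappa> + 1)" using kappa by (intro Gamma_real_pos) auto
  \<comment> \<open>An upper and a lower estimate of W are played against each other, so that the
    singular product can be inserted into a remainder that does not contain it.\<close>
  have Wz: "1 \<le> m * c * P_lim / exp (\<kappa> * euler_mascheroni)"
  proof -
    have "1 \<le> m * (W z * u powr \<kappa>)" using inverse_W_le[OF z] W_pos[of z] unfolding m_def u_def by (simp add: field_simps)
    also have "\<dots> \<le> m * (c * P_lim / exp (\<kappa> * euler_mascheroni))"
      using W_le_P_lim[OF z c] m unfolding u_def by (intro mult_left_mono) auto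
    finally show ?thesis by simp
  qed
  have ul: "(u / l) powr (4 * \<kappa>) \<le> 2 powr (- 4 * \<kappa>)"
  proof -
    have "(u / l) powr (4 * \<kappa>) \<le> (1 / 2) powr (4 * \<kappa>)" using u l kappa unfolding u_def by (intro powr_mono2) (auto simp: field_simps)
    also have "\<dots> = 2 powr (- 4 * \<kappa>)" by (simp add: powr_divide powr_minus_divide)
    finally show ?thesis .
  qed
  have ex: "exp (3 * (A2 / ln 2 + \<kappa> * (ln u - ln (ln 2)))) = u powr (3 * \<kappa>) * (m ^ 3 * E)"
  proof -
    have "m = exp (m2_exponent / ln 2 - \<kappa> * ln (ln 2))" unfolding m_def m2_eq powr_def by (simp add: exp_diff)
    then have "m ^ 3 = exp (3 * (m2_exponent / ln 2 - \<kappa> * ln (ln 2)))" by (simp add: exp_of_nat_mult[symmetric])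
    moreover have "u powr (3 * \<kappa>) = exp (3 * \<kappa> * ln u)" using u by (simp add: powr_def)
    moreover have "3 * \<kappa> * ln u + (3 * (m2_exponent / ln 2 - \<kappa> * ln (ln 2)) + - (3 / ln 2 * (m2_exponent - A2))) = 3 * (A2 / ln 2 + \<kappa> * (ln u - ln (ln 2)))"
      by (simp add: algebra_simps diff_divide_distrib)
    ultimately show ?thesis unfolding E_def by (simp only: exp_add[symmetric])
  qed
  have "l powr (4 * \<kappa> + 1) = l powr (4 * \<kappa>) * l" using l by (simp add: powr_add)
  then have "z\<^sup>2 * exp (3 * (A2 / ln 2 + \<kappa> * (ln u - ln (ln 2)))) = X * (m ^ 3 * E) / l * (u powr (3 * \<kappa>) / l powr (4 * \<kappa>))"
    unfolding z2 ex by (simp add: mult_ac)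
  also have "u powr (3 * \<kappa>) / l powr (4 * \<kappa>) = (u / l) powr (4 * \<kappa>) / u powr \<kappa>"
  proof -
    have "u powr (4 * \<kappa>) = u powr (3 * \<kappa>) * u powr \<kappa>" using powr_add[of u "3 * \<kappa>" \<kappa>] by (simp add: algebra_simps)
    then show ?thesis using u l by (simp add: powr_divide)
  qed
  also have "X * (m ^ 3 * E) / l * ((u / l) powr (4 * \<kappa>) / u powr \<kappa>) \<le> X * (m ^ 3 * E) / l * (2 powr (- 4 * \<kappa>) / u powr \<kappa>)"
    using ul X m l unfolding E_def by (intro mult_left_mono divide_right_mono) auto
  also have "\<dots> = X * (m ^ 3 * E) / l * (2 powr (- 4 * \<kappa>) / u powr \<kappa>) * 1" by simp
  also have "\<dots> \<le> X * (m ^ 3 * E) / l * (2 powr (- 4 * \<kappa>) / u powr \<kappa>) * (m * c * P_lim / exp (\<kappa> * euler_mascheroni))"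
    using Wz X m l unfolding E_def by (intro mult_left_mono) auto
  also have "\<dots> = P_lim * Gamma (\<kappa> + 1) * X / u powr \<kappa> * (M * c * E / l)"
    unfolding M_def m_def[symmetric] using G by (simp add: power4_eq_xxxx power3_eq_cube mult_ac)
  finally show ?thesis unfolding u_def E_def .
qed

text \<open>The map m to m / (1 + m/u) is increasing and takes r u / (1 - r) to r u = K;
  \<open>m6\<close> is at least r u / (1 - r), since \<open>m7\<close> is nonnegative.\<close>

lemma K_le_m6:
  assumes z: "1 < z" and K: "K < ln z"
  shows "K \<le> m6 \<kappa> A1 A2 z * inverse (1 + m6 \<kappa> A1 A2 z / ln z)"
proof -
  define u where "u = ln z"
  have u: "0 < u" unfolding u_def using z by simp
  define r where "r = K / u"
  have r: "0 < r" "r < 1" "r_aux \<kappa> A1 A2 z = r" unfolding r_def u_def r_aux_eq using K K_pos z by auto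
  define m where "m = m6 \<kappa> A1 A2 z"
  have m7: "0 \<le> m7 \<kappa> A1 A2 z" unfolding m7_def r(3) u_def[symmetric] using r u kappa by simp
  then have "r * u / (1 - r) \<le> m" unfolding m_def m6_def r(3) u_def[symmetric] using r by simp
  then have "r * u \<le> m * (1 - r)" using r by (simp add: field_simps)
  then have 1: "r * (u + m) \<le> m" by (simp add: algebra_simps)
  have m0: "0 \<le> m" using \<open>r * u / (1 - r) \<le> m\<close> r u by (smt (verit) divide_nonneg_nonneg mult_nonneg_nonneg)
  have "u + m \<noteq> 0" using u m0 by simp
  then have "r * (u + m) * (u / (u + m)) = r * u" by simp
  then have "K = r * (u + m) * (u / (u + m))" unfolding r_def using u by simp
  also have "\<dots> \<le> m * (u / (u + m))" using 1 u m0 by (intro mult_right_mono) auto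
  also have "\<dots> = m * inverse (1 + m / u)" using u m0 by (simp add: field_simps)
  finally show ?thesis unfolding m_def u_def .
qed

theorem sifted_upper_bound:
  fixes X lam z0 :: real and k0 :: nat and A :: "nat list" and P :: "nat set"
  assumes P: "P \<subseteq> {p. prime p}" and mult: "multiplicative_on_squarefree \<omega>"
    and supp: "\<And>p. prime p \<Longrightarrow> p \<notin> P \<Longrightarrow> \<omega> p = 0" and R: "cond_R A P \<omega> X"
    and X: "exp 1 \<le> X" and lam: "0 < lam" and z2: "z0\<^sup>2 = X / ln X powr (4 * \<kappa> + 1)"
    and z: "2 < z0" "exp (A1 * A2) < z0" and K: "(\<kappa> + 2) * K < ln z0"
  shows "real (sifted A P (sqrt X)) \<le>
      2 powr \<kappa> * Gamma (\<kappa> + 1) * X / (ln X) powr \<kappa>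
      * (1 + m8 \<kappa> A1 A2 L k0 X z0 lam / ln X)
      * (1 + m9 \<kappa> X * ln (ln X) / ln X) powr \<kappa> * P_lim"
proof -
  define l where "l = ln X"
  define u where "u = ln z0"
  define c where "c = 1 + m0_hat \<kappa> A1 A2 L k0 z0 / ln z0"
  define m where "m = m5 \<kappa> A1 A2 L k0 z0 lam"
  have X0: "0 < X" using X exp_gt_zero[of "1 :: real"] by linarith
  have l: "1 \<le> l" unfolding l_def using X X0 by (simp add: ln_ge_iff)
  have u: "0 < u" unfolding u_def using z by auto
  have lu: "l = 2 * u + (4 * \<kappa> + 1) * ln l"
  proof -
    have "2 * u = ln (z0\<^sup>2)" unfolding u_def using z by (simp add: ln_realpow)
    also have "\<dots> = l - (4 * \<kappa> + 1) * ln l" unfolding z2 l_def[symmetric] using X0 l by (subst ln_divide_pos) (auto simp: ln_powr l_def)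
    finally show ?thesis by linarith
  qed
  have lnl: "0 \<le> (4 * \<kappa> + 1) * ln l" using l kappa by simp
  then have ul: "2 * u \<le> l" using lu by linarith
  have zX: "z0 \<le> sqrt X"
  proof (rule real_le_rsqrt)
    have "1 \<le> l powr (4 * \<kappa> + 1)" using l kappa by (intro ge_one_powr_ge_zero) auto
    then show "z0\<^sup>2 \<le> X" unfolding z2 l_def[symmetric] using X0 by (simp add: divide_le_eq)
  qed
  have c: "exp (U z0) \<le> c" unfolding c_def by (rule exp_U_le[OF z])
  then have c1: "1 \<le> c" using U_nonneg[of z0] z by (smt (verit) one_le_exp_iff)
  define E where "E = exp (- (3 / ln 2 * (m2_exponent - A2)))"
  have E: "0 \<le> E" "E \<le> 1" unfolding E_def m2_exponent_def using A1 A2 kappa by auto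
  define C where "C = P_lim * Gamma (\<kappa> + 1) * X / u powr \<kappa>"
  have C: "0 < C" unfolding C_def using singular_product(3) kappa X0 u by (intro divide_pos_pos mult_pos_pos Gamma_real_pos) auto
  have G: "1 \<le> gp.G u" by (rule gp.G_ge_1[OF u])
  have "real (sifted A P (sqrt X)) \<le> X / gp.G u + z0\<^sup>2 * exp (3 * (A2 / ln 2 + \<kappa> * (ln (ln z0) - ln (ln 2))))"
    unfolding u_def using z zX by (intro sifted_le[OF P mult supp R]) auto
  also have "z0\<^sup>2 * exp (3 * (A2 / ln 2 + \<kappa> * (ln (ln z0) - ln (ln 2)))) \<le> C * (M * c * E / l)"
    unfolding C_def E_def u_def using z c l ul X0 by (intro remainder_le z2[folded l_def]) (auto simp: u_def)
  finally have sieve: "real (sifted A P (sqrt X)) \<le> X / gp.G u + C * (M * c * E / l)" by simp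
  have main: "real (sifted A P (sqrt X)) \<le> C * (1 + m / u + M * c / l)"
  proof -
    consider (i) "m = u * (m3 \<kappa> A1 A2 L z0 lam / (exp (\<kappa> * euler_mascheroni) * Gamma (\<kappa> + 1)) * c - 1)"
      | (ii) "m = m6 \<kappa> A1 A2 z0 * inverse (1 + m6 \<kappa> A1 A2 z0 / ln z0)"
      unfolding m_def m5_def c_def u_def min_def by metis
    then show ?thesis
    proof cases
      case i
      have "X / gp.G u \<le> X * (m3 \<kappa> A1 A2 L z0 lam * W z0)"
      proof -
        have "1 / gp.G u \<le> m3 \<kappa> A1 A2 L z0 lam * W z0"
          using inverse_W_le_m3[OF _ lam, of z0] z W_pos[of z0] G unfolding u_def by (simp add: field_simps)
        then show ?thesis using X0 mult_left_mono[of "1 / gp.G u" "m3 \<kappa> A1 A2 L z0 lam * W z0" X] by simp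
      qed
      also have "\<dots> \<le> X * (m3 \<kappa> A1 A2 L z0 lam * (c * P_lim / exp (\<kappa> * euler_mascheroni) / u powr \<kappa>))"
      proof (intro mult_left_mono)
        show "W z0 \<le> c * P_lim / exp (\<kappa> * euler_mascheroni) / u powr \<kappa>"
          using W_le_P_lim[OF _ c] z u unfolding u_def by (simp add: le_divide_eq mult_ac)
        show "0 \<le> m3 \<kappa> A1 A2 L z0 lam" unfolding m3_def by simp
      qed (use X0 in simp)
      also have "\<dots> = C * (1 + m / u)"
      proof -
        have "0 < Gamma (\<kappa> + 1)" using kappa by (intro Gamma_real_pos) auto
        then have "Gamma (\<kappa> + 1) \<noteq> 0" by (rule less_imp_neq[THEN not_sym])
        then show ?thesis unfolding C_def i using u by (simp del: Gamma_eq_zero_iff add: mult_ac)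
      qed
      finally have "X / gp.G u \<le> C * (1 + m / u)" .
      moreover have "C * (M * c * E / l) \<le> C * (M * c / l)"
        using C M_pos c1 E l mult_left_le[of E "M * c"] by (intro mult_left_mono divide_right_mono) auto
      ultimately show ?thesis using sieve by (simp add: distrib_left)
    next
      case ii
      have "X / gp.G u = X * (1 / gp.G u)" by simp
      also have "\<dots> \<le> X * (P_lim * Gamma (\<kappa> + 1) / u powr \<kappa> * (1 + K / u + M * (1 - E) / l))"
        unfolding E_def using X0 K l lu by (intro mult_left_mono G_lower_saving) (auto simp: u_def)
      also have "\<dots> = C * (1 + K / u + M * (1 - E) / l)" unfolding C_def by simp
      also have "\<dots> \<le> C * (1 + m / u + M * c * (1 - E) / l)"
      proof (intro mult_left_mono add_mono divide_right_mono)
        have "1 * K < (\<kappa> + 2) * K" using kappa K_pos by (intro mult_strict_right_mono) auto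
        then show "K \<le> m" unfolding ii using K z by (intro K_le_m6) auto
        have "M * 1 \<le> M * c" using c1 M_pos by (intro mult_left_mono) auto
        then show "M * (1 - E) \<le> M * c * (1 - E)" using E by (intro mult_right_mono) auto
      qed (use C u l in auto)
      finally have "real (sifted A P (sqrt X)) \<le> C * (1 + m / u + M * c * (1 - E) / l) + C * (M * c * E / l)"
        using sieve by linarith
      also have "\<dots> = C * (1 + m / u + M * c / l)" by (simp add: algebra_simps diff_divide_distrib)
      finally show ?thesis .
    qed
  qed
  \<comment> \<open>Since l - (4\<kappa> + 1) ln l = 2 u, one has 1 - t = 2u / l. So the factor with
    \<open>m9\<close> is (l / (2u))^\<kappa>, which trades u^-\<kappa> for 2^\<kappa> l^-\<kappa>,
    and 2 \<open>m5\<close> / (1 - t) divided by l is \<open>m5\<close> / u.\<close>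
  define t where "t = (4 * \<kappa> + 1) * (ln l / l)"
  have t: "1 - t = 2 * u / l" unfolding t_def using lu l by (simp add: field_simps)
  have "m8 \<kappa> A1 A2 L k0 X z0 lam = 2 * m / (1 - t) + M * c"
    unfolding m8_def m_def t_def l_def M_def c_def ..
  then have e8: "m8 \<kappa> A1 A2 L k0 X z0 lam / l = m / u + M * c / l"
    unfolding t using u l by (simp add: add_divide_distrib)
  have "m9 \<kappa> X * ln l / l = t / (1 - t)" unfolding m9_def l_def[symmetric] t_def by simp
  moreover have "0 < 1 - t" unfolding t using u l by simp
  then have "1 + t / (1 - t) = 1 / (1 - t)" by (simp add: field_simps)
  ultimately have "1 + m9 \<kappa> X * ln l / l = l / (2 * u)" using t by simp
  then have "2 powr \<kappa> * Gamma (\<kappa> + 1) * X / l powr \<kappa> * (1 + m8 \<kappa> A1 A2 L k0 X z0 lam / l) * (1 + m9 \<kappa> X * ln l / l) powr \<kappa> * P_lim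
      = C * (1 + m / u + M * c / l)"
    unfolding e8 C_def using u l by (simp add: powr_divide powr_mult mult_ac add.assoc)
  then show ?thesis using main unfolding l_def by simp
qed

end

theorem theorem2p9:
  fixes A :: "nat list" and P :: "nat set" and \<omega> :: "nat \<Rightarrow> real"
    and X \<kappa> A1 A2 L lam z0 :: real and k0 :: nat
  assumes "P \<subseteq> {p. prime p}"
    and "multiplicative_on_squarefree \<omega>"
    and "\<And>p. prime p \<Longrightarrow> p \<notin> P \<Longrightarrow> \<omega> p = 0"
    and "\<kappa> \<ge> 1" and "A1 > 1" and "A2 > 0"
    and "X \<ge> exp 1"
    and "cond_R A P \<omega> X"
    and "cond_Omega1 \<omega> A1"
    and "cond_Omega2 \<omega> \<kappa> A2 L"
    and "k0 \<ge> 2" and "lam > 0"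
    and "z0 > 0" and "z0\<^sup>2 = X / (ln X) powr (4 * \<kappa> + 1)"
    and "z0 > max 2 (exp (A1 * A2))"
    and "r_aux \<kappa> A1 A2 z0 < 1"
    and "m0_hat \<kappa> A1 A2 L k0 z0 < ln z0"
    and "\<bar>(\<kappa> + 1) * r_aux \<kappa> A1 A2 z0 / (1 - r_aux \<kappa> A1 A2 z0)\<bar> < 1"
  shows "convergent_prod (singular_factor \<omega> \<kappa>) \<and>
    real (sifted A P (sqrt X)) \<le>
      2 powr \<kappa> * Gamma (\<kappa> + 1) * X / (ln X) powr \<kappa>
      * (1 + m8 \<kappa> A1 A2 L k0 X z0 lam / ln X)
      * (1 + m9 \<kappa> X * ln (ln X) / ln X) powr \<kappa>
      * prodinf (singular_factor \<omega> \<kappa>)"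
proof -
  interpret sieve_density \<omega> \<kappa> A1 A2 L using assms(4,5,6,9,10) by unfold_locales
  define r where "r = r_aux \<kappa> A1 A2 z0"
  have z: "2 < z0" "exp (A1 * A2) < z0" using assms(15) by auto
  have lz: "0 < ln z0" using z by auto
  have r: "r < 1" "(\<kappa> + 1) * r / (1 - r) < 1" using assms(16,18) unfolding r_def by auto
  \<comment> \<open>Rearranged, this is (\<kappa> + 2) r < 1, that is, (\<kappa> + 2) K < ln
    z0.\<close>
  then have "(\<kappa> + 1) * r < 1 - r" by (simp add: divide_less_eq)
  then have "(\<kappa> + 2) * r < 1" by (simp add: algebra_simps)
  then have "(\<kappa> + 2) * K < ln z0" unfolding r_def r_aux_eq using lz by (simp add: divide_less_eq)
  then have "real (sifted A P (sqrt X)) \<le>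
      2 powr \<kappa> * Gamma (\<kappa> + 1) * X / (ln X) powr \<kappa>
      * (1 + m8 \<kappa> A1 A2 L k0 X z0 lam / ln X)
      * (1 + m9 \<kappa> X * ln (ln X) / ln X) powr \<kappa> * P_lim"
    using assms z by (intro sifted_upper_bound) auto
  then show ?thesis using singular_product by simp
qed

end
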